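(* Let $N\ge0$ be an integer and let $\theta=\arg\nu$. (i) Suppose $\frac{\pi}{4}<|\theta|<\pi$. Let $\varphi^\ast,\varphi^{\ast\ast},\varphi^{\ast\ast\ast}$ be the unique solutions in the interval $I_\theta$ of $$(2N+7)\cos(3\varphi^\ast-2\theta)=(2N-5)\cos(\varphi^\ast-2\theta),$$ $$(2N+9)\cos(3\varphi^{\ast\ast}-2\theta)=(2N-3)\cos(\varphi^{\ast\ast}-2\theta),$$ $$(2N+11)\cos(3\varphi^{\ast\ast\ast}-2\theta)=(2N-1)\cos(\varphi^{\ast\ast\ast}-2\theta).$$ Then $$\left|R_N^{(Y)}(\nu)\right|\le\frac{|\csc(2(\theta-\varphi^\ast))|}{\cos^{\frac{2N+1}{3}}\varphi^\ast}\frac{b_N(\nu)}{2\pi}+\frac{|\csc(2(\theta-\varphi^{\ast\ast\ast}))|}{\cos^{\frac{2N+5}{3}}\varphi^{\ast\ast\ast}}\frac{b_{N+2}(\nu)}{2\pi}\quad\text{if }N\equiv0\bmod3;$$ $$\left|R_N^{(Y)}(\nu)\right|\le\frac{|\csc(2(\theta-\varphi^{\ast\ast}))|}{\cos^{\frac{2N+3}{3}}\varphi^{\ast\ast}}\frac{b_{N+1}(\nu)}{2\pi}\quad\text{if }N\equiv1\bmod3;$$ $$\left|R_N^{(Y)}(\nu)\right|\le\frac{|\csc(2(\theta-\varphi^\ast))|}{\cos^{\frac{2N+1}{3}}\varphi^\ast}\frac{b_N(\nu)}{2\pi}\quad\text{if }N\equiv2\bmod3.$$ (ii) Suppose $\frac{\pi}{4}<|\theta|\le\frac{\pi}{2}$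 and $N\ge4$. Then $$\left|R_N^{(Y)}(\nu)\right|\le\frac12\sqrt{\tfrac e3\left(2N+\tfrac{11}2\right)}\frac{b_N(\nu)}{2\pi}+\frac12\sqrt{\tfrac e3\left(2N+\tfrac{19}2\right)}\frac{b_{N+2}(\nu)}{2\pi}\quad\text{if }N\equiv0\bmod3;$$ $$\left|R_N^{(Y)}(\nu)\right|\le\frac12\sqrt{\tfrac e3\left(2N+\tfrac{15}2\right)}\frac{b_{N+1}(\nu)}{2\pi}\quad\text{if }N\equiv1\bmod3;$$ $$\left|R_N^{(Y)}(\nu)\right|\le\frac12\sqrt{\tfrac e3\left(2N+\tfrac{11}2\right)}\frac{b_N(\nu)}{2\pi}\quad\text{if }N\equiv2\bmod3.$$
   Context: $\nu\ne0$ is a complex number with $|\arg\nu|<\pi$, powers $\nu^{k/3}$ being principal. The remainder $R_N^{(Y)}(\nu)$ in the expansion of the Bessel function of the second kind with order equal to its argument is defined by $$Y_\nu(\nu)=-\frac{2}{3\pi}\sum_{n=0}^{N-1}6^{\frac{2n+1}{3}}B_{2n}(0)\sin^2\left(\frac{(2n+1)\pi}{3}\right)\frac{\Gamma\left(\frac{2n+1}{3}\right)}{\nu^{\frac{2n+1}{3}}}+R_N^{(Y)}(\nu),$$ where $B_n(0)=\frac{1}{n!}\left[\frac{d^n}{dt^n}\left(\frac16\frac{t^3}{\sinh t-t}\right)^{\frac{n+1}{3}}\right]_{t=0}$ (branch of the power equal to $1$ at $t=0$). Notation: $$b_n(\nu)=6^{\frac{2n+1}{3}}|B_{2n}(0)|\frac{\Gamma\left(\frac{2n+1}{3}\right)}{|\nu|^{\frac{2n+1}{3}}}.$$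 The interval $I_\theta$ is: $\left(-\frac{\pi}{2}+\theta,\frac{\pi}{2}\right)$ if $\frac{3\pi}{4}\le\theta<\pi$; $\left(-\frac{\pi}{2}+\theta,-\frac{\pi}{4}+\theta\right)$ if $\frac{\pi}{2}\le\theta<\frac{3\pi}{4}$; $\left(0,-\frac{\pi}{4}+\theta\right)$ if $\frac{\pi}{4}<\theta<\frac{\pi}{2}$; $\left(-\frac{\pi}{2},\frac{\pi}{2}+\theta\right)$ if $-\pi<\theta\le-\frac{3\pi}{4}$; $\left(\frac{\pi}{4}+\theta,\frac{\pi}{2}+\theta\right)$ if $-\frac{3\pi}{4}<\theta\le-\frac{\pi}{2}$; $\left(\frac{\pi}{4}+\theta,0\right)$ if $-\frac{\pi}{2}<\theta<-\frac{\pi}{4}$. *)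

theory Defs
  imports "HOL-Analysis.Analysis"
begin

text \<open>
  Bessel functions of complex order on the cut plane, with principal powers. The reciprocal
  Gamma function is entire, so the series needs no case distinction at the poles of Gamma.
\<close>

definition bessel_J :: "complex \<Rightarrow> complex \<Rightarrow> complex" where
  "bessel_J \<nu> z = (z / 2) powr \<nu> *
     (\<Sum>k. (-1) ^ k * rGamma (\<nu> + of_nat k + 1) / fact k * (z / 2) ^ (2 * k))"

definition bessel_Y :: "complex \<Rightarrow> complex \<Rightarrow> complex" where
  "bessel_Y \<nu> z =
     (let q = (\<lambda>\<mu>. (bessel_J \<mu> z * cos (\<mu> * of_real pi) - bessel_J (- \<mu>) z)
                    / sin (\<mu> * of_real pi))
      in if \<nu> \<in> \<int> then Lim (at \<nu>) q else q \<nu>)"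

text \<open>
  The quotient below has a removable singularity at 0 with value 1; near 0 it is close to 1, so
  its principal power is the branch that equals 1 at 0.
\<close>

definition sinh_quot :: "complex \<Rightarrow> complex" where
  "sinh_quot t = (if t = 0 then 1 else (1 / 6) * (t ^ 3 / (sinh t - t)))"

definition B0 :: "nat \<Rightarrow> complex" where
  "B0 n = 1 / fact n *
     (deriv ^^ n) (\<lambda>t. sinh_quot t powr of_real ((real n + 1) / 3)) 0"

definition R_Y :: "nat \<Rightarrow> complex \<Rightarrow> complex" where
  "R_Y N \<nu> = bessel_Y \<nu> \<nu> -
     (- of_real (2 / (3 * pi)) *
       (\<Sum>n<N. of_real (6 powr ((2 * real n + 1) / 3)) * B0 (2 * n)
               * of_real ((sin ((2 * real n + 1) * pi / 3))\<^sup>2)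
               * of_real (Gamma ((2 * real n + 1) / 3))
               / \<nu> powr of_real ((2 * real n + 1) / 3)))"

definition b_term :: "nat \<Rightarrow> complex \<Rightarrow> real" where
  "b_term n \<nu> = 6 powr ((2 * real n + 1) / 3) * cmod (B0 (2 * n))
     * (Gamma ((2 * real n + 1) / 3) / cmod \<nu> powr ((2 * real n + 1) / 3))"

definition csc :: "real \<Rightarrow> real" where
  "csc x = 1 / sin x"

definition I_theta :: "real \<Rightarrow> real set" where
  "I_theta \<theta> =
     (if 3 * pi / 4 \<le> \<theta> \<and> \<theta> < pi then {- pi / 2 + \<theta> <..< pi / 2}
      else if pi / 2 \<le> \<theta> \<and> \<theta> < 3 * pi / 4 then {- pi / 2 + \<theta> <..< - pi / 4 + \<theta>}
      else if pi / 4 < \<theta> \<and> \<theta> < pi / 2 then {0 <..< - pi / 4 + \<theta>}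
      else if - pi < \<theta> \<and> \<theta> \<le> - 3 * pi / 4 then {- pi / 2 <..< pi / 2 + \<theta>}
      else if - 3 * pi / 4 < \<theta> \<and> \<theta> \<le> - pi / 2 then {pi / 4 + \<theta> <..< pi / 2 + \<theta>}
      else if - pi / 2 < \<theta> \<and> \<theta> < - pi / 4 then {pi / 4 + \<theta> <..< 0}
      else {})"

end

theory Submission
  imports Defs "HOL-Complex_Analysis.Complex_Analysis"
begin

text \<open>
  A Schlaefli-type formula expresses \<open>J\<close> of orders \<open>\<nu>\<close> and \<open>- \<nu>\<close> at \<open>\<nu>\<close> through a primitive of
  \<open>exp (\<nu> (sinh t - t))\<close>. Substituting \<open>r\<^sup>3 = 6 (sinh t - t)\<close> turns \<open>Y\<close> into three integrals of
  \<open>exp (- \<nu> r\<^sup>3 / 6) G(r\<^sup>2)\<close> along rays, where \<open>G(r\<^sup>2) = dt/dr\<close>. Cauchy's theorem on the region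
  bounded by the curve \<open>Re (sinh t - t) = 0\<close> that starts at the critical point \<open>2 \<pi> i\<close> shows that \<open>G\<close> is a
  Stieltjes transform, \<open>G(z) = \<integral> d\<mu>(x) / (1 + z / x)\<close> with \<open>\<mu> \<ge> 0\<close> and \<open>x \<ge> 1\<close>; by Lagrange
  inversion its moments are \<open>|B\<^sub>2\<^sub>n(0)|\<close>. Expanding the geometric series under the integral gives the
  asymptotic expansion, and with \<open>\<zeta> = r\<^sup>2 / x\<close> the three rays leave the kernel \<open>3 (1 + \<zeta>\<^sup>2) / (1 + \<zeta>\<^sup>3)\<close>
  or \<open>3 (1 - \<zeta>) / (1 + \<zeta>\<^sup>3)\<close> in the remainder. On the ray \<open>arg r = - \<psi> / 3\<close>, \<open>\<psi> = \<theta> - \<phi>\<close>, both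
  \<open>1 / (1 + \<zeta>\<^sup>3)\<close> and \<open>(1 - \<zeta>) / (1 + \<zeta>\<^sup>3)\<close> are at most \<open>|csc (2 \<psi>)|\<close>, and the exponential
  contributes the power of \<open>cos \<phi>\<close>. The bounds hold for every admissible \<open>\<phi>\<close>; the equations for
  \<open>\<phi>\<close> say that the bound is stationary.
\<close>

section \<open>Bounds for the kernels\<close>

text \<open>Why N is taken modulo 3: two of the three rays enter with factors exp((2N+1) \<pi> i /
  3) and its conjugate. For N \<equiv> 1 the weights of the N-th term sum to zero, so the remainder
  equals the one of index N + 1 \<equiv> 2. For N \<equiv> 0 the numerator 1 + \<zeta>^2 is split:
  its parts belong to the moments N and N + 2, and each integral can be turned to a ray of its own,
  which is why two different angles appear in that case.

  Why the measure stays away from 0: the singularities of dt/dr nearest to 0 come from the critical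
  points 2 \<pi> i and - 2 \<pi> i, where |r|^3 = 12 \<pi>. The bound x >= 1 is a convenient
  weakening of this.

  Constraints on the ray: |\<theta> - \<psi>| < \<pi>/2 makes the exponential decay, and |\<psi>| <
  \<pi>/2 keeps all three rotated copies of r^2 off the cut. Together they allow every |\<theta>| <
  \<pi>. In the range of the theorem \<nu> is not real, hence not an integer, so
  \<open>bessel_Y\<close> is always given by its quotient.

  Part (ii) does not solve the stationarity equation. It uses the optimal angle for \<theta> =
  \<pi>/2, which is explicit, and shifts it for smaller \<theta>.\<close>

lemma norm_one_plus_ge_sin:
  fixes z :: complex assumes "z = of_real r * cis a" shows "\<bar>sin a\<bar> \<le> norm (1 + z)"
proof -
  \<comment> \<open>The distance from -1 to the line through 0 in direction a is |sin a|; the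
    dropped square vanishes at the nearest point r = - cos a.\<close>
  have "(sin a)\<^sup>2 \<le> (r + cos a)\<^sup>2 + (sin a)\<^sup>2" by simp
  also have "\<dots> = r\<^sup>2 + 2 * r * cos a + ((cos a)\<^sup>2 + (sin a)\<^sup>2)" by (simp add: power2_eq_square algebra_simps del: sin_cos_squared_add sin_cos_squared_add2)
  also have "\<dots> = (1 + r * cos a)\<^sup>2 + (r * sin a)\<^sup>2"
  proof -
    have "r\<^sup>2 + 2 * r * c + (c\<^sup>2 + s\<^sup>2) = (1 + r * c)\<^sup>2 + (r * s)\<^sup>2" if "c\<^sup>2 + s\<^sup>2 = 1" for c s :: real
      using that by algebra
    then show ?thesis by simp
  qed
  also have "\<dots> = (norm (1 + z))\<^sup>2" unfolding cmod_power2 by (simp add: assms)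
  finally show ?thesis using power2_le_iff_abs_le by (metis abs_norm_cancel abs_le_square_iff)
qed

text \<open>Here \<open>c = cos b\<close> and \<open>C = cos (3 b)\<close>. If \<open>r \<le> 2 c\<close>, the first factor is at most \<open>1\<close>; otherwise
  expand in powers of \<open>d = r - 2 c > 0\<close>.\<close>

lemma one_minus_kernel_real:
  fixes r c :: real
  assumes r: "r \<ge> 0" and c: "1 / 2 \<le> c" "c \<le> 1"
  defines "C \<equiv> 4 * c ^ 3 - 3 * c"
  shows "(1 - 2 * r * c + r\<^sup>2) * (1 - C\<^sup>2) \<le> 1 + 2 * r ^ 3 * C + r ^ 6"
proof -
  have S: "1 - C\<^sup>2 = (1 - c\<^sup>2) * (4 * c\<^sup>2 - 1)\<^sup>2" unfolding C_def by algebra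
  have c2: "1 \<le> 4 * c\<^sup>2" "c\<^sup>2 \<le> 1"
    using power_mono[of "1 / 2" c 2] power_le_one[of c 2] c by (auto simp: power2_eq_square)
  have S0: "0 \<le> 1 - C\<^sup>2" unfolding S using c2 by simp
  have E: "1 + 2 * r ^ 3 * C + r ^ 6 = (r ^ 3 + C)\<^sup>2 + (1 - C\<^sup>2)" by algebra
  have main: "(r\<^sup>2 - 2 * r * c) * (1 - C\<^sup>2) \<le> (r ^ 3 + C)\<^sup>2"
  proof (cases "r \<le> 2 * c")
    case True
    then have "r * (r - 2 * c) \<le> 0" using r by (intro mult_nonneg_nonpos) auto
    then have "(r\<^sup>2 - 2 * r * c) * (1 - C\<^sup>2) \<le> 0"
      using S0 by (intro mult_nonpos_nonneg) (auto simp: power2_eq_square algebra_simps)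
    then show ?thesis using zero_le_power2[of "r ^ 3 + C"] by linarith
  next
    case False
    define d where "d = r - 2 * c"
    have d: "d > 0" "r = 2 * c + d" using False by (auto simp: d_def)
    define m where "m = 4 * c\<^sup>2 - 1"
    have m: "0 \<le> m" "m \<le> 3" using c2 by (auto simp: m_def)
    have rhs: "r ^ 3 + C = 3 * c * m + 12 * c\<^sup>2 * d + (6 * c * d\<^sup>2 + d ^ 3)"
      unfolding d(2) C_def m_def by algebra
    have pos: "0 \<le> 3 * c * m + 12 * c\<^sup>2 * d" "0 \<le> 6 * c * d\<^sup>2 + d ^ 3" using c m d by auto
    have "(3 * c * m + 12 * c\<^sup>2 * d)\<^sup>2 \<le> (r ^ 3 + C)\<^sup>2"
      unfolding rhs using pos by (intro power_mono) auto
    moreover have "(r\<^sup>2 - 2 * r * c) * (1 - C\<^sup>2) \<le> (3 * c * m + 12 * c\<^sup>2 * d)\<^sup>2"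
    proof -
      have c4: "c\<^sup>2 * c\<^sup>2 \<ge> 1 / 16" using mult_mono[of "1/4" "c\<^sup>2" "1/4" "c\<^sup>2"] c2 by simp
      have q: "(1 - c\<^sup>2) * m \<le> 9 / 4"
      proof -
        have "(1 - c\<^sup>2) * m \<le> (3 / 4) * 3" using c2 m by (intro mult_mono) auto
        then show ?thesis by simp
      qed
      have q0: "0 \<le> (1 - c\<^sup>2) * m" using c2 m by simp
      have "(r\<^sup>2 - 2 * r * c) * (1 - C\<^sup>2) = ((1 - c\<^sup>2) * m) * (m * (2 * c * d)) + ((1 - c\<^sup>2) * m) * (m * d\<^sup>2)"
        unfolding S d(2) m_def by algebra
      also have "\<dots> \<le> (9 / 4) * (m * (2 * c * d)) + (9 / 4) * (3 * d\<^sup>2)"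
        using q q0 m c d by (intro add_mono mult_mono) auto
      also have "\<dots> \<le> 72 * c\<^sup>2 * (m * (c * d)) + 144 * (c\<^sup>2 * c\<^sup>2) * d\<^sup>2"
      proof (rule add_mono)
        have "9 / 2 * (m * (c * d)) \<le> 72 * c\<^sup>2 * (m * (c * d))" using c2 m c d by (intro mult_right_mono) auto
        then show "(9 / 4) * (m * (2 * c * d)) \<le> 72 * c\<^sup>2 * (m * (c * d))" by simp
        have "27 / 4 * d\<^sup>2 \<le> 144 * (c\<^sup>2 * c\<^sup>2) * d\<^sup>2" using c4 by (intro mult_right_mono) auto
        then show "(9 / 4) * (3 * d\<^sup>2) \<le> 144 * (c\<^sup>2 * c\<^sup>2) * d\<^sup>2" by simp
      qed
      also have "\<dots> \<le> 72 * c\<^sup>2 * (m * (c * d)) + 144 * (c\<^sup>2 * c\<^sup>2) * d\<^sup>2 + (3 * c * m)\<^sup>2" by simp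
      also have "\<dots> = (3 * c * m + 12 * c\<^sup>2 * d)\<^sup>2" by algebra
      finally show ?thesis .
    qed
    ultimately show ?thesis by linarith
  qed
  have "(1 - 2 * r * c + r\<^sup>2) * (1 - C\<^sup>2) = (r\<^sup>2 - 2 * r * c) * (1 - C\<^sup>2) + (1 - C\<^sup>2)" by algebra
  then show ?thesis using main unfolding E by linarith
qed

text \<open>The squared moduli are the polynomials of \<open>one_minus_kernel_real\<close> with c =
  cos b and C = cos (3 b), and |b| <= \<pi>/3 is the condition c >= 1/2 there. The application is b
  = - 2 \<psi> / 3.\<close>

lemma norm_one_minus_kernel:
  assumes r: "r \<ge> 0" and b: "\<bar>b\<bar> \<le> pi / 3" and z: "z = of_real r * cis b"
  shows "norm (1 - z) * \<bar>sin (3 * b)\<bar> \<le> norm (1 + z ^ 3)"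
proof -
  have c: "1 / 2 \<le> cos b" 
    using cos_monotone_0_pi_le[of "\<bar>b\<bar>" "pi / 3"] b by (simp add: cos_60)
  have c3: "cos (3 * b) = 4 * cos b ^ 3 - 3 * cos b" by (rule cos_treble_cos)
  have n1: "(norm (1 - z))\<^sup>2 = 1 - 2 * r * cos b + r\<^sup>2"
  proof -
    have "(1 - r * c)\<^sup>2 + (r * s)\<^sup>2 = 1 - 2 * r * c + r\<^sup>2" if "s\<^sup>2 + c\<^sup>2 = 1" for c s :: real using that by algebra
    then show ?thesis unfolding cmod_power2 by (simp add: z)
  qed
  have n2: "(norm (1 + z ^ 3))\<^sup>2 = 1 + 2 * r ^ 3 * cos (3 * b) + r ^ 6"
  proof -
    have "cis b ^ 3 = cis (3 * b)" using Complex.DeMoivre[of b 3] by simp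
    then have "z ^ 3 = of_real (r ^ 3) * cis (3 * b)" by (simp add: z power_mult_distrib)
    moreover have "(1 + q * c)\<^sup>2 + (q * s)\<^sup>2 = 1 + 2 * q * c + q\<^sup>2" if "s\<^sup>2 + c\<^sup>2 = 1" for q c s :: real using that by algebra
    ultimately show ?thesis unfolding cmod_power2 by (simp flip: power_mult)
  qed
  have s: "(sin (3 * b))\<^sup>2 = 1 - (cos (3 * b))\<^sup>2" using sin_squared_eq by blast
  have "(norm (1 - z) * \<bar>sin (3 * b)\<bar>)\<^sup>2 \<le> (norm (1 + z ^ 3))\<^sup>2"
    unfolding power_mult_distrib n1 n2 power2_abs s c3
    by (rule one_minus_kernel_real) (use r c in auto)
  then show ?thesis by (rule power2_le_imp_le) simp
qed

section \<open>The optimal rotation angle\<close>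

text \<open>Logarithmic derivative in \<phi> of csc (2 (\<theta> - \<phi>)) / cos \<phi> ^ p,
  multiplied by sin (2 (\<theta> - \<phi>)) cos \<phi>. Its zeros are the stationary points of the
  error bound.\<close>

definition opt_fun :: "real \<Rightarrow> real \<Rightarrow> real \<Rightarrow> real" where
  "opt_fun p \<theta> \<phi> = 2 * cos (2 * (\<theta> - \<phi>)) * cos \<phi> + p * (sin \<phi> * sin (2 * (\<theta> - \<phi>)))"

lemma opt_fun_eq:
  "2 * opt_fun p \<theta> \<phi> = (p + 2) * cos (3 * \<phi> - 2 * \<theta>) - (p - 2) * cos (\<phi> - 2 * \<theta>)"
proof -
  have "cos (3 * \<phi> - 2 * \<theta>) = cos (2 * (\<theta> - \<phi>) - \<phi>)" by (subst cos_minus[symmetric]) (simp add: algebra_simps)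
  moreover have "cos (\<phi> - 2 * \<theta>) = cos (2 * (\<theta> - \<phi>) + \<phi>)" by (subst cos_minus[symmetric]) (simp add: algebra_simps)
  ultimately show ?thesis unfolding opt_fun_def by (simp only: cos_add cos_diff) (simp add: algebra_simps)
qed

text \<open>The case distinction for positive \<theta> only unfolds two conditions, 0 < \<phi> <
  \<pi>/2 and \<pi>/4 < \<theta> - \<phi> < \<pi>/2. They make cos \<phi> and sin (2 (\<theta> -
  \<phi>)) positive.\<close>

lemma I_theta_pos:
  assumes "pi / 4 < \<theta>" "\<theta> < pi"
  shows "I_theta \<theta> = {\<phi>. max 0 (\<theta> - pi / 2) < \<phi> \<and> \<phi> < min (pi / 2) (\<theta> - pi / 4)}"
  using assms by (auto simp: I_theta_def max_def min_def)

lemma I_theta_minus: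
  assumes "pi / 4 < \<theta>" "\<theta> < pi"
  shows "I_theta (- \<theta>) = uminus ` I_theta \<theta>"
proof -
  have "I_theta (- \<theta>) = {\<phi>. - \<phi> \<in> I_theta \<theta>}"
    unfolding I_theta_pos[OF assms] using assms by (auto simp: I_theta_def max_def min_def)
  also have "\<dots> = uminus ` I_theta \<theta>" by (auto intro: image_eqI[where x = "- x" for x])
  finally show ?thesis .
qed

text \<open>Existence is a sign change between the ends of the interval. For uniqueness, dividing by
  the positive factor cos \<phi> sin (2 (\<theta> - \<phi>)) leaves 2 cot (2 (\<theta> - \<phi>)) +
  p tan \<phi>, a sum of two increasing functions.\<close>

lemma opt_fun_unique:
  assumes t: "pi / 4 < \<theta>" "\<theta> < pi" and p: "p > 0"
  shows "\<exists>\<phi>. {\<phi> \<in> I_theta \<theta>. opt_fun p \<theta> \<phi> = 0} = {\<phi>}"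
proof -
  define l u where "l = max 0 (\<theta> - pi / 2)" and "u = min (pi / 2) (\<theta> - pi / 4)"
  have lu: "l < u" "0 \<le> l" "u \<le> pi / 2" "\<theta> - u \<ge> pi / 4" "\<theta> - l \<le> pi / 2"
    using t by (auto simp: l_def u_def max_def min_def)
  have I: "I_theta \<theta> = {l<..<u}" unfolding I_theta_pos[OF t] by (auto simp: l_def u_def)
  have cont: "continuous_on {l..u} (opt_fun p \<theta>)" unfolding opt_fun_def[abs_def] by (intro continuous_intros)
  have fl: "opt_fun p \<theta> l < 0"
  proof (cases "\<theta> \<ge> pi / 2")
    case True
    then have "l = \<theta> - pi / 2" by (simp add: l_def)
    moreover have "cos (\<theta> - pi / 2) > 0" using t True by (intro cos_gt_zero_pi) auto
    moreover have "2 * (\<theta> - (\<theta> - pi / 2)) = pi" by simp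
    ultimately show ?thesis by (simp add: opt_fun_def)
  next
    case False
    then have "l = 0" by (simp add: l_def)
    moreover have "cos (2 * \<theta>) < cos (pi / 2)" using t False by (intro cos_monotone_0_pi) auto
    ultimately show ?thesis by (simp add: opt_fun_def)
  qed
  have fu: "opt_fun p \<theta> u > 0"
  proof (cases "\<theta> \<ge> 3 * pi / 4")
    case True
    then have u: "u = pi / 2" by (simp add: u_def)
    have "sin (2 * (\<theta> - pi / 2)) > 0" using t True by (intro sin_gt_zero) auto
    then have "0 < p * sin (2 * (\<theta> - pi / 2))" using p by (intro mult_pos_pos)
    then show ?thesis by (simp add: opt_fun_def u)
  next
    case False
    then have u: "u = \<theta> - pi / 4" by (simp add: u_def)
    have "sin (\<theta> - pi / 4) > 0" using t False by (intro sin_gt_zero) auto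
    moreover have "2 * (\<theta> - (\<theta> - pi / 4)) = pi / 2" by simp
    ultimately show ?thesis using p by (simp add: opt_fun_def u)
  qed
  obtain x where x: "l \<le> x" "x \<le> u" "opt_fun p \<theta> x = 0"
    using IVT'[of "opt_fun p \<theta>" l 0 u] fl fu lu cont by auto
  then have xI: "x \<in> I_theta \<theta>" using fl fu by (auto simp: I less_le)
  define g where "g \<phi> = 2 * cot (2 * (\<theta> - \<phi>)) + p * tan \<phi>" for \<phi>
  have angle: "0 < cos \<phi>" "0 < sin (2 * (\<theta> - \<phi>))" if "\<phi> \<in> {l<..<u}" for \<phi>
    using that lu by (auto intro!: cos_gt_zero_pi sin_gt_zero)
  have g_opt: "opt_fun p \<theta> \<phi> = 0 \<longleftrightarrow> g \<phi> = 0" if "\<phi> \<in> {l<..<u}" for \<phi>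
  proof -
    have "opt_fun p \<theta> \<phi> = g \<phi> * (cos \<phi> * sin (2 * (\<theta> - \<phi>)))"
      using angle[OF that] by (simp add: opt_fun_def g_def cot_def tan_def field_simps)
    then show ?thesis using angle[OF that] by auto
  qed
  have g_mono: "g a < g b" if ab: "a \<in> {l<..<u}" "b \<in> {l<..<u}" "a < b" for a b
  proof (rule DERIV_pos_imp_increasing[OF \<open>a < b\<close>])
    fix y assume "a \<le> y" "y \<le> b"
    then have y: "y \<in> {l<..<u}" using ab by auto
    note an = angle[OF y]
    have "((\<lambda>\<phi>. cot (2 * (\<theta> - \<phi>))) has_real_derivative - inverse ((sin (2 * (\<theta> - y)))\<^sup>2) * - 2) (at y)"
      by (rule DERIV_chain2[OF DERIV_cot]) (use an in \<open>auto intro!: derivative_eq_intros\<close>)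
    then have "(g has_real_derivative (4 * inverse ((sin (2 * (\<theta> - y)))\<^sup>2) + p * inverse ((cos y)\<^sup>2))) (at y)"
      unfolding g_def[abs_def] using an by (auto intro!: derivative_eq_intros)
    moreover have "0 < 4 * inverse ((sin (2 * (\<theta> - y)))\<^sup>2) + p * inverse ((cos y)\<^sup>2)"
      using an p by (intro add_pos_pos mult_pos_pos) auto
    ultimately show "\<exists>D. (g has_real_derivative D) (at y) \<and> 0 < D" by blast
  qed
  have "y = x" if "y \<in> I_theta \<theta>" "opt_fun p \<theta> y = 0" for y
    using that g_opt[of y] g_opt[of x] g_mono[of x y] g_mono[of y x] xI x(3) unfolding I
    by (cases x y rule: linorder_cases) auto
  with xI x(3) show ?thesis by blast
qed

text \<open>The exponent of the cosine is p = k / 3, and clearing denominators in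
  \<open>opt_fun_eq\<close> turns p + 2 and p - 2 into k + 6 and k - 6. Negative \<theta> follows
  from the symmetry (\<theta>, \<phi>) to (- \<theta>, - \<phi>).\<close>

lemma opt_angle_exists:
  assumes t: "pi / 4 < \<bar>\<theta>\<bar>" "\<bar>\<theta>\<bar> < pi" and k: "k > 0"
  shows "\<exists>\<phi>. {\<phi> \<in> I_theta \<theta>. (k + 6) * cos (3 * \<phi> - 2 * \<theta>) = (k - 6) * cos (\<phi> - 2 * \<theta>)} = {\<phi>}"
proof -
  have eq: "(k + 6) * cos (3 * \<phi> - 2 * \<tau>) = (k - 6) * cos (\<phi> - 2 * \<tau>) \<longleftrightarrow> opt_fun (k / 3) \<tau> \<phi> = 0" for \<phi> \<tau>
  proof -
    have "6 * opt_fun (k / 3) \<tau> \<phi> = (k + 6) * cos (3 * \<phi> - 2 * \<tau>) - (k - 6) * cos (\<phi> - 2 * \<tau>)"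
      using opt_fun_eq[of "k / 3" \<tau> \<phi>] by (simp add: algebra_simps)
    then show ?thesis by auto
  qed
  show ?thesis
  proof (cases "\<theta> > 0")
    case True
    then show ?thesis unfolding eq using opt_fun_unique[of \<theta> "k / 3"] t k by simp
  next
    case False
    then obtain \<phi> where \<phi>: "{\<phi> \<in> I_theta (- \<theta>). opt_fun (k / 3) (- \<theta>) \<phi> = 0} = {\<phi>}"
      using opt_fun_unique[of "- \<theta>" "k / 3"] t k by auto
    have "I_theta \<theta> = uminus ` I_theta (- \<theta>)" using I_theta_minus[of "- \<theta>"] t False by simp
    moreover have "opt_fun (k / 3) \<theta> (- x) = opt_fun (k / 3) (- \<theta>) x" for x
    proof -
      have "2 * (\<theta> - - x) = - (2 * (- \<theta> - x))" by simp
      then show ?thesis unfolding opt_fun_def by (simp only: cos_minus sin_minus)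
    qed
    ultimately have "{\<phi> \<in> I_theta \<theta>. opt_fun (k / 3) \<theta> \<phi> = 0} = uminus ` {\<phi> \<in> I_theta (- \<theta>). opt_fun (k / 3) (- \<theta>) \<phi> = 0}"
      by auto
    then show ?thesis unfolding eq \<phi> by auto
  qed
qed

section \<open>An explicit angle for |\<theta>| at most \<pi>/2\<close>

lemma one_plus_inverse_powr_bound:
  fixes k :: real assumes k: "k \<ge> 1"
  shows "k * ln (1 + 1 / k) \<le> 1 + ln ((k + 1 / 2) / (k + 1))"
proof -
  \<comment> \<open>With x = 1/k the claim is k D(x) >= 0. Here D' = \<open>D1\<close>, both
    functions vanish at 0, and D1' = x / ((2 + x)^2 (1 + x)) >= 0.\<close>
  define D where "D x = x + x * ln (1 + x / 2) - x * ln (1 + x) - ln (1 + x)" for x :: real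
  define D1 where "D1 x = ln (1 + x / 2) - ln (1 + x) + x / (2 + x)" for x :: real
  have D1: "0 \<le> D1 x" if "x \<ge> 0" for x
  proof -
    have "D1 0 \<le> D1 x"
    proof (rule DERIV_nonneg_imp_nondecreasing[OF that])
      fix y assume y: "0 \<le> y" "y \<le> x"
      then have "(D1 has_real_derivative 1 / 2 / (1 + y / 2) - 1 / (1 + y) + ((2 + y) - y) / ((2 + y) * (2 + y))) (at y)"
        unfolding D1_def[abs_def] by (auto intro!: derivative_eq_intros)
      moreover have "1 / 2 / (1 + y / 2) - 1 / (1 + y) + ((2 + y) - y) / ((2 + y) * (2 + y)) 
          = y / ((2 + y) * (2 + y) * (1 + y))"
      proof -
        have "1 / 2 / (1 + y / 2) = 1 / (2 + y)" using y by (simp add: divide_simps)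
        then show ?thesis using y by (simp add: divide_simps)
      qed
      ultimately show "\<exists>z. (D1 has_real_derivative z) (at y) \<and> 0 \<le> z" using y by auto
    qed
    then show ?thesis by (simp add: D1_def)
  qed
  have D: "0 \<le> D x" if "x \<ge> 0" for x
  proof -
    have "D 0 \<le> D x"
    proof (rule DERIV_nonneg_imp_nondecreasing[OF that])
      fix y assume y: "0 \<le> y" "y \<le> x"
      have "(D has_real_derivative D1 y) (at y)"
        unfolding D_def[abs_def] D1_def using y
        by (auto intro!: derivative_eq_intros simp: divide_simps) (simp add: algebra_simps)
      then show "\<exists>z. (D has_real_derivative z) (at y) \<and> 0 \<le> z" using D1[OF y(1)] by blast
    qed
    then show ?thesis by (simp add: D_def)
  qed
  have "(k + 1 / 2) / (k + 1) = (1 + (1 / k) / 2) / (1 + 1 / k)" using k by (simp add: divide_simps)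
  moreover have "0 < 1 + (1 / k) / 2" "0 < 1 + 1 / k" using k by (simp_all add: add_pos_nonneg)
  ultimately have "ln ((k + 1 / 2) / (k + 1)) = ln (1 + (1 / k) / 2) - ln (1 + 1 / k)"
    by (metis ln_div less_irrefl)
  moreover have "0 \<le> k * D (1 / k)" using D[of "1 / k"] k by simp
  moreover have "k * D (1 / k) = 1 + ln (1 + (1 / k) / 2) - ln (1 + 1 / k) - k * ln (1 + 1 / k)"
    using k by (simp add: D_def algebra_simps)
  ultimately show ?thesis by linarith
qed

text \<open>For \<theta> = \<pi>/2 the quantity is 1 / (2 sin \<phi> cos \<phi> ^ (p + 1)), which is
  least where tan \<phi> = 1 / sqrt (p + 1); this is \<open>\<phi>0\<close>. For smaller \<theta>
  the angle is lowered by \<pi>/2 - \<theta>, or replaced by 0 if that would make it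
  negative.\<close>

lemma csc_cos_bound:
  assumes t: "pi / 4 < \<theta>" "\<theta> \<le> pi / 2" and p: "p \<ge> 3"
  shows "\<exists>\<phi>. 0 \<le> \<phi> \<and> \<phi> < pi / 2 \<and> pi / 4 < \<theta> - \<phi> \<and> \<theta> - \<phi> < pi / 2 \<and>
     \<bar>csc (2 * (\<theta> - \<phi>))\<bar> / cos \<phi> powr p \<le> 1 / 2 * sqrt (exp 1 * (p + 3 / 2))"
proof -
  define \<phi>0 where "\<phi>0 = arctan (1 / sqrt (p + 1))"
  have sp: "sqrt (p + 1) > 1" using p by simp
  have \<phi>0: "0 < \<phi>0" "\<phi>0 < pi / 4"
    using sp arctan_less_iff[of "1 / sqrt (p + 1)" 1] by (auto simp: \<phi>0_def arctan_one)
  have c0: "cos \<phi>0 = 1 / sqrt (1 + 1 / (p + 1))" and s0: "sin \<phi>0 = (1 / sqrt (p + 1)) / sqrt (1 + 1 / (p + 1))"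
    unfolding \<phi>0_def cos_arctan sin_arctan using p by (auto simp: power_divide)
  have c0p: "cos \<phi>0 > 0" and s0p: "sin \<phi>0 > 0" using \<phi>0 by (auto intro!: cos_gt_zero_pi sin_gt_zero)
  have key: "1 / (sin (2 * \<phi>0) * cos \<phi>0 powr p) \<le> 1 / 2 * sqrt (exp 1 * (p + 3 / 2))"
  proof -
    \<comment> \<open>The value at \<open>\<phi>0\<close> is sqrt (k (1 + 1/k)^(k + 1)) / 2. The
      refined estimate (1 + 1/k)^k <= e (k + 1/2) / (k + 1) cancels the remaining factor k + 1 and
      leaves k + 1/2 = p + 3/2.\<close>
    define k where "k = p + 1"
    have k: "k \<ge> 4" using p by (simp add: k_def)
    have "ln (1 + 1 / k) * k \<le> 1 + ln ((k + 1 / 2) / (k + 1))"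
      using one_plus_inverse_powr_bound[of k] k by (simp add: mult.commute)
    then have "exp (ln (1 + 1 / k) * k) \<le> exp (1 + ln ((k + 1 / 2) / (k + 1)))" by simp
    then have 1: "(1 + 1 / k) powr k \<le> exp 1 * ((k + 1 / 2) / (k + 1))"
      using k by (simp add: exp_add powr_def mult.commute add_pos_nonneg)
    have 2: "sin \<phi>0 = 1 / sqrt k * cos \<phi>0" by (simp add: s0 c0 k_def)
    have 3: "cos \<phi>0 = (1 + 1 / k) powr (- 1 / 2)"
      using k by (simp add: c0 k_def powr_minus_divide powr_half_sqrt)
    have "sin (2 * \<phi>0) * cos \<phi>0 powr p = 2 * (1 / sqrt k) * (cos \<phi>0 powr 2 * cos \<phi>0 powr p)"
      unfolding sin_double 2 using c0p by (simp add: power2_eq_square)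
    also have "cos \<phi>0 powr 2 * cos \<phi>0 powr p = (1 + 1 / k) powr (- (k + 1) / 2)"
      proof -
      have "- 1 / 2 * 2 + - 1 / 2 * p = - (k + 1) / 2" by (simp add: k_def field_simps)
      then show ?thesis unfolding powr_add[symmetric] 3 powr_powr by (rule arg_cong)
    qed
    finally have e: "sin (2 * \<phi>0) * cos \<phi>0 powr p = 2 * (1 / sqrt k) * (1 + 1 / k) powr (- (k + 1) / 2)" .
    have m: "(1 + 1 / k) powr (- (k + 1) / 2) = 1 / (1 + 1 / k) powr ((k + 1) / 2)"
      by (simp only: minus_divide_left[symmetric] powr_minus_divide)
    have "1 / (2 * (1 / s) * (1 / Q)) = 1 / 2 * (s * Q)" for s Q :: real by simp
    then have "1 / (sin (2 * \<phi>0) * cos \<phi>0 powr p) = 1 / 2 * (sqrt k * (1 + 1 / k) powr ((k + 1) / 2))"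
      unfolding e m .
    also have "\<dots> = 1 / 2 * sqrt (k * ((1 + 1 / k) powr (k + 1)))"
      using k by (simp add: real_sqrt_mult powr_half_sqrt[symmetric] powr_powr)
    also have "(1 + 1 / k) powr (k + 1) = (1 + 1 / k) powr k * (1 + 1 / k)"
      using k by (simp add: powr_add add_nonneg_nonneg)
    also have "k * ((1 + 1 / k) powr k * (1 + 1 / k)) = (1 + 1 / k) powr k * (k + 1)" using k by (simp add: field_simps)
    also have "\<dots> \<le> exp 1 * ((k + 1 / 2) / (k + 1)) * (k + 1)" using 1 k by (intro mult_right_mono) auto
    also have "\<dots> = exp 1 * (p + 3 / 2)" using k by (simp add: k_def)
    finally show ?thesis by simp
  qed
  have s2: "sin (2 * \<phi>0) > 0" using \<phi>0 by (intro sin_gt_zero) auto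
  show ?thesis
  \<comment> \<open>Lowering \<phi> together with \<theta> keeps \<theta> - \<phi>, hence the
    cosecant, and only increases cos \<phi>. With \<phi> = 0 in the other case, \<pi>/2 - \<theta> >
    \<open>\<phi>0\<close> gives sin (2 \<theta>) >= sin (2 \<open>\<phi>0\<close>).\<close>
  proof (cases "\<phi>0 \<ge> pi / 2 - \<theta>")
    case True
    define \<phi> where "\<phi> = \<phi>0 - (pi / 2 - \<theta>)"
    have \<phi>: "0 \<le> \<phi>" "\<phi> \<le> \<phi>0" "\<theta> - \<phi> = pi / 2 - \<phi>0" using True t by (auto simp: \<phi>_def)
    have "sin (2 * (\<theta> - \<phi>)) = sin (2 * \<phi>0)" unfolding \<phi>(3) by (simp add: right_diff_distrib)
    moreover have "cos \<phi>0 \<le> cos \<phi>" using \<phi> \<phi>0 by (intro cos_monotone_0_pi_le) auto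
    then have "cos \<phi>0 powr p \<le> cos \<phi> powr p" using c0p p by (intro powr_mono2) auto
    then have "1 / (sin (2 * \<phi>0) * cos \<phi> powr p) \<le> 1 / (sin (2 * \<phi>0) * cos \<phi>0 powr p)"
      using s2 c0p by (intro divide_left_mono mult_left_mono mult_pos_pos) auto
    ultimately have "\<bar>csc (2 * (\<theta> - \<phi>))\<bar> / cos \<phi> powr p \<le> 1 / 2 * sqrt (exp 1 * (p + 3 / 2))"
      using key s2 by (simp add: csc_def)
    then show ?thesis using \<phi> \<phi>0 by (intro exI[of _ \<phi>]) auto
  next
    case False
    have "sin (2 * \<phi>0) \<le> sin (pi - 2 * \<theta>)"
      using False t \<phi>0 by (intro sin_monotone_2pi_le) auto
    then have s: "sin (2 * \<phi>0) \<le> sin (2 * \<theta>)" by (simp add: sin_diff)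
    have "cos \<phi>0 powr p \<le> 1" using c0p p by (intro powr_le1) auto
    then have "sin (2 * \<phi>0) * cos \<phi>0 powr p \<le> sin (2 * \<theta>) * 1" using s s2 by (intro mult_mono) auto
    then have "1 / sin (2 * \<theta>) \<le> 1 / (sin (2 * \<phi>0) * cos \<phi>0 powr p)"
      using s2 s c0p by (intro divide_left_mono mult_pos_pos) auto
    then have "\<bar>csc (2 * (\<theta> - 0))\<bar> / cos 0 powr p \<le> 1 / 2 * sqrt (exp 1 * (p + 3 / 2))"
      using key s s2 by (simp add: csc_def)
    then show ?thesis using False \<phi>0 t by (intro exI[of _ 0]) auto
  qed
qed

section \<open>The critical curve\<close>

lemma cosh_gt_1:
  fixes x :: real assumes "x > 0" shows "1 < cosh x"
  using cosh_real_strict_mono[of 0 x] assms by simp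

lemma sinh_gt_self:
  fixes x :: real assumes "x > 0" shows "x < sinh x"
proof -
  have "(\<lambda>x. sinh x - x) 0 < (\<lambda>x::real. sinh x - x) x"
    by (rule DERIV_pos_imp_increasing_open[OF assms])
       (auto intro!: derivative_eq_intros exI continuous_intros simp: cosh_gt_1)
  then show ?thesis by simp
qed

lemma sinh_less_mult_cosh:
  fixes x :: real assumes "x > 0" shows "sinh x < x * cosh x"
proof -
  have "(\<lambda>x. x * cosh x - sinh x) 0 < (\<lambda>x::real. x * cosh x - sinh x) x"
  proof (rule DERIV_pos_imp_increasing_open[OF assms])
    fix y :: real assume "0 < y"
    then show "\<exists>z. ((\<lambda>x. x * cosh x - sinh x) has_real_derivative z) (at y) \<and> 0 < z"
      by (intro exI[of _ "y * sinh y"]) (auto intro!: derivative_eq_intros)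
  qed (auto intro!: continuous_intros)
  then show ?thesis by simp
qed

lemma mult_cos_less_sin:
  fixes x :: real assumes "0 < x" "x < pi" shows "x * cos x < sin x"
proof -
  have "(\<lambda>x. sin x - x * cos x) 0 < (\<lambda>x::real. sin x - x * cos x) x"
  proof (rule DERIV_pos_imp_increasing_open[OF assms(1)])
    fix y :: real assume "0 < y" "y < x"
    then show "\<exists>z. ((\<lambda>x. sin x - x * cos x) has_real_derivative z) (at y) \<and> 0 < z"
      using assms by (intro exI[of _ "y * sin y"]) (auto intro!: derivative_eq_intros mult_pos_pos sin_gt_zero)
  qed (auto intro!: continuous_intros)
  then show ?thesis by simp
qed

lemma sinh_minus_self_strict_mono:
  fixes x y :: real assumes "x < y" shows "sinh x - x < sinh y - y"
proof -
  have 1: "sinh a - a < sinh b - b" if "0 \<le> a" "a < b" for a b :: real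
    using that(2)
  proof (rule DERIV_pos_imp_increasing_open)
    fix z assume "a < z" "z < b"
    with that(1) show "\<exists>y. ((\<lambda>x. sinh x - x) has_real_derivative y) (at z) \<and> 0 < y"
      by (intro exI[of _ "cosh z - 1"]) (auto intro!: derivative_eq_intros simp: cosh_gt_1)
  qed (auto intro!: continuous_intros)
  consider "0 \<le> x" | "y \<le> 0" | "x < 0" "0 < y" by linarith
  then show ?thesis
  proof cases
    case le: 1 then show ?thesis using assms 1 by blast
  next
    case 2 then show ?thesis using 1[of "-y" "-x"] assms by simp
  next
    case 3 then show ?thesis using 1[of 0 "-x"] 1[of 0 y] by simp
  qed
qed

text \<open>On the curve \<open>Im t = 2 \<pi> - crit_angle (Re t)\<close>, \<open>sinh t - t = - i crit_height (Re t)\<close>.\<close>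

definition crit_angle :: "real \<Rightarrow> real" where
  "crit_angle a = arccos (a / sinh a)"

definition crit_height :: "real \<Rightarrow> real" where
  "crit_height a = 2 * pi + cosh a * sin (crit_angle a) - crit_angle a"

lemma self_div_sinh_bounds:
  fixes a :: real assumes "a > 0" shows "0 < a / sinh a" "a / sinh a < 1"
  using assms sinh_gt_self[OF assms] by (auto simp: divide_simps)

lemma cos_crit_angle: "a > 0 \<Longrightarrow> cos (crit_angle a) = a / sinh a"
  unfolding crit_angle_def using self_div_sinh_bounds[of a] by (intro cos_arccos) linarith+

lemma crit_angle_bounds:
  assumes "a > 0" shows "0 < crit_angle a" "crit_angle a < pi / 2"
proof -
  show "0 < crit_angle a"
    unfolding crit_angle_def using self_div_sinh_bounds[OF assms] arccos_less_arccos[of "a / sinh a" 1] by simp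
  show "crit_angle a < pi / 2"
    unfolding crit_angle_def using self_div_sinh_bounds[OF assms] arccos_less_arccos[of 0 "a / sinh a"] by simp
qed

lemma crit_angle_deriv:
  assumes "a > 0"
  shows "(crit_angle has_real_derivative
           (a * cosh a - sinh a) / (sinh a)\<^sup>2 / sqrt (1 - (a / sinh a)\<^sup>2)) (at a)"
proof -
  define D where "D = - (a * cosh a - sinh a) / (sinh a)\<^sup>2"
  have "((\<lambda>a. a / sinh a) has_real_derivative D) (at a)"
    using assms by (auto intro!: derivative_eq_intros simp: D_def power2_eq_square)
  moreover have "(arccos has_real_derivative inverse (- sqrt (1 - (a / sinh a)\<^sup>2))) (at (a / sinh a))"
    using self_div_sinh_bounds[OF assms] by (intro DERIV_arccos) auto
  ultimately have "((\<lambda>a. arccos (a / sinh a)) has_real_derivative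
      inverse (- sqrt (1 - (a / sinh a)\<^sup>2)) * D) (at a)"
    by (rule DERIV_chain2[rotated])
  then show ?thesis unfolding crit_angle_def[abs_def] 
    by (rule DERIV_cong) (simp add: D_def divide_inverse mult.commute del: minus_diff_eq)
qed

lemma crit_angle_mono:
  assumes "0 < a" "a \<le> b" shows "crit_angle a \<le> crit_angle b"
proof (rule DERIV_nonneg_imp_nondecreasing[OF assms(2)])
  fix x assume "a \<le> x" "x \<le> b"
  then have "x > 0" using assms by simp
  then have "(x / sinh x)\<^sup>2 < 1" using self_div_sinh_bounds[of x] by (auto simp: abs_square_less_1)
  then have "0 \<le> (x * cosh x - sinh x) / (sinh x)\<^sup>2 / sqrt (1 - (x / sinh x)\<^sup>2)"
    using sinh_less_mult_cosh[OF \<open>x > 0\<close>] by (intro divide_nonneg_nonneg) auto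
  with crit_angle_deriv[OF \<open>x > 0\<close>]
  show "\<exists>y. (crit_angle has_real_derivative y) (at x) \<and> 0 \<le> y" by blast
qed

text \<open>With cos b = a / sinh a, the two inequalities sinh a < a cosh a and b cos b < sin b
  chain to b < cosh a * b cos b < cosh a * sin b.\<close>

lemma crit_height_gt: assumes "a > 0" shows "crit_height a > 2 * pi"
proof -
  define b where "b = crit_angle a"
  have b: "0 < b" "b < pi / 2" using crit_angle_bounds[OF assms] by (auto simp: b_def)
  have "cos b = a / sinh a" using cos_crit_angle[OF assms] by (simp add: b_def)
  have "b * cos b < sin b" using b by (intro mult_cos_less_sin) auto
  then have *: "cosh a * (b * cos b) < cosh a * sin b" by (intro mult_strict_left_mono) auto
  moreover have "b < cosh a * (b * cos b)"
    using sinh_less_mult_cosh[OF assms] b assms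
    by (simp add: \<open>cos b = _\<close> field_simps)
  ultimately have "b < cosh a * sin b" by linarith
  then show ?thesis by (simp add: crit_height_def b_def)
qed

section \<open>The phase function and its cube root\<close>

definition ph :: "complex \<Rightarrow> complex" where "ph t = sinh t - t"

lemma Re_ph: "Re (ph t) = sinh (Re t) * cos (Im t) - Re t"
  and Im_ph: "Im (ph t) = cosh (Re t) * sin (Im t) - Im t"
  by (simp_all add: ph_def sinh_conv_sin Re_sin Im_sin cosh_field_def sinh_field_def exp_minus field_simps)

lemma ph_of_real: "ph (of_real x) = of_real (sinh x - x)"
  by (simp add: complex_eq_iff Re_ph Im_ph)

lemma ph_deriv: "(ph has_field_derivative (cosh t - 1)) (at t within A)"
  unfolding ph_def[abs_def] by (auto intro!: derivative_eq_intros)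

lemma ph_holomorphic [holomorphic_intros]: "f holomorphic_on A \<Longrightarrow> (\<lambda>t. ph (f t)) holomorphic_on A"
  unfolding ph_def sinh_field_def by (intro holomorphic_intros) auto

lemma ph_continuous [continuous_intros]: "continuous_on A f \<Longrightarrow> continuous_on A (\<lambda>t. ph (f t))"
  unfolding ph_def sinh_field_def by (intro continuous_intros) auto

text \<open>The part of the closed first quadrant below the critical curve, without 0. The imaginary
  axis is a separate case because division by zero makes \<open>crit_angle 0\<close> equal to
  \<pi>/2, whereas the curve starts at 2 \<pi> i.\<close>

definition crit_region :: "complex set" where
  "crit_region = {t. Re t \<ge> 0 \<and> Im t \<ge> 0 \<and> t \<noteq> 0 \<and>
     (if Re t = 0 then Im t \<le> 2 * pi else Im t \<le> 2 * pi - crit_angle (Re t))}"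

lemma sin_div_decreasing:
  assumes "0 < y" "y < b" "b \<le> pi / 2" shows "sin b / b < sin y / y"
proof (rule DERIV_neg_imp_decreasing_open[OF assms(2)])
  fix x assume x: "y < x" "x < b"
  then have "x * cos x < sin x" using assms by (intro mult_cos_less_sin) auto
  then show "\<exists>z. ((\<lambda>x. sin x / x) has_real_derivative z) (at x) \<and> z < 0"
    using x assms by (intro exI[of _ "(x * cos x - sin x) / x\<^sup>2"] conjI)
      (auto intro!: derivative_eq_intros divide_neg_pos simp: power2_eq_square field_simps)
qed (use assms in \<open>auto intro!: continuous_intros\<close>)

text \<open>Nonnegative real part means cos y >= cos b, and y < 2 \<pi> - b then forces y <= b. On
  (0, b] the quotient sin y / y is decreasing, and already at b it exceeds 1 / cosh x by
  \<open>crit_height_gt\<close>.\<close>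

lemma ph_in_crit_region:
  assumes t: "Re t > 0" "Im t > 0" "Im t < 2 * pi - crit_angle (Re t)" and re: "Re (ph t) \<ge> 0"
  shows "Im (ph t) > 0"
proof -
  define x y b where "x = Re t" and "y = Im t" and "b = crit_angle (Re t)"
  have x: "x > 0" and y: "y > 0" "y < 2 * pi - b" using t by (auto simp: x_def y_def b_def)
  have b: "0 < b" "b < pi / 2" "cos b = x / sinh x"
    using crit_angle_bounds[OF x] cos_crit_angle[OF x] by (auto simp: b_def x_def)
  have "cos y \<ge> x / sinh x" using re x by (simp add: Re_ph x_def y_def divide_simps mult.commute)
  then have cy: "cos y \<ge> cos b" by (simp add: b)
  have yb: "y \<le> b"
  proof (rule ccontr)
    assume "\<not> y \<le> b"
    show False
    proof (cases "y \<le> pi")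
      case True
      then have "cos y < cos b" using b \<open>\<not> y \<le> b\<close> by (intro cos_monotone_0_pi) auto
      with cy show False by simp
    next
      case False
      have "cos (2 * pi - y) < cos b" using b y False by (intro cos_monotone_0_pi) auto
      with cy show False by (simp add: cos_diff)
    qed
  qed
  have "sin b / b \<le> sin y / y" using sin_div_decreasing[of y b] yb y b by (cases "y = b") auto
  then have "y * sin b \<le> b * sin y" using y b by (simp add: divide_simps mult.commute)
  then have le: "cosh x * (y * sin b) \<le> cosh x * (b * sin y)" by (intro mult_left_mono) auto
  have "cosh x * sin b > b" using crit_height_gt[OF x] by (simp add: crit_height_def b_def x_def)
  then have "y * b < y * (cosh x * sin b)" using y by simp
  also have "\<dots> = cosh x * (y * sin b)" by simp
  also note le
  finally have "b * y < b * (cosh x * sin y)" by (simp add: mult_ac)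
  then have "y < cosh x * sin y" using b by simp
  then show ?thesis by (simp add: Im_ph x_def y_def)
qed

lemma ph_crit_curve:
  assumes "a > 0"
  shows "ph (Complex a (2 * pi - crit_angle a)) = - \<i> * of_real (crit_height a)"
  using assms by (simp add: complex_eq_iff Re_ph Im_ph cos_diff sin_diff cos_crit_angle crit_height_def)

lemma ph_imag_axis: "ph (Complex 0 y) = \<i> * of_real (sin y - y)"
  by (simp add: complex_eq_iff Re_ph Im_ph)

lemma sin_less_self:
  fixes y :: real assumes "y > 0" shows "sin y < y"
proof (cases "y \<le> 1")
  case True
  have "(\<lambda>x. x - sin x) 0 < (\<lambda>x::real. x - sin x) y"
  proof (rule DERIV_pos_imp_increasing_open[OF assms])
    fix x :: real assume "0 < x" "x < y"
    then have "cos x < cos 0" using True pi_gt3 by (intro cos_monotone_0_pi) auto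
    then show "\<exists>z. ((\<lambda>x. x - sin x) has_real_derivative z) (at x) \<and> 0 < z"
      by (intro exI[of _ "1 - cos x"]) (auto intro!: derivative_eq_intros)
  qed (auto intro!: continuous_intros)
  then show ?thesis by simp
next
  case False
  then show ?thesis using sin_le_one[of y] by linarith
qed

text \<open>The values omit the open fourth quadrant, which leaves room for a cut of the cube root.
  The third claim makes the positive real axis the only place with positive real phase, as needed
  for injectivity.\<close>

lemma ph_crit_region_quadrants:
  assumes "t \<in> crit_region"
  shows "ph t \<noteq> 0" "Re (ph t) > 0 \<Longrightarrow> Im (ph t) \<ge> 0"
    and "Re (ph t) > 0 \<Longrightarrow> Im (ph t) = 0 \<Longrightarrow> Im t = 0"
proof -
  consider "Re t = 0" "0 < Im t" | "Re t > 0" "Im t = 0"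
    | "Re t > 0" "Im t > 0" "Im t < 2 * pi - crit_angle (Re t)"
    | "Re t > 0" "Im t = 2 * pi - crit_angle (Re t)"
    using assms by (auto simp: crit_region_def complex_eq_iff split: if_splits) (metis less_eq_real_def)+
  then have "ph t \<noteq> 0 \<and> (Re (ph t) > 0 \<longrightarrow> Im (ph t) \<ge> 0) \<and> (Re (ph t) > 0 \<longrightarrow> Im (ph t) = 0 \<longrightarrow> Im t = 0)"
  proof cases
    case 1
    then have "sin (Im t) < Im t" by (intro sin_less_self)
    then show ?thesis using 1 by (auto simp: complex_eq_iff Re_ph Im_ph)
  next
    case 2
    then show ?thesis using sinh_gt_self[of "Re t"] by (auto simp: complex_eq_iff Re_ph Im_ph)
  next
    case 3
    then show ?thesis using ph_in_crit_region[of t] by (force simp: complex_eq_iff)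
  next
    case 4
    then have "ph t = - \<i> * of_real (crit_height (Re t))"
      using ph_crit_curve[of "Re t"] by (metis complex_surj)
    then show ?thesis using crit_height_gt[OF 4(1)] pi_gt_zero by auto
  qed
  then show "ph t \<noteq> 0" "Re (ph t) > 0 \<Longrightarrow> Im (ph t) \<ge> 0" 
    "Re (ph t) > 0 \<Longrightarrow> Im (ph t) = 0 \<Longrightarrow> Im t = 0" by blast+
qed

text \<open>The cube root of \<open>6 (sinh t - t)\<close>, with the cut where the phase has argument \<open>- pi / 4\<close>,
  so that it is holomorphic around the whole critical region.\<close>

definition om :: "complex \<Rightarrow> complex" where
  "om t = exp ((Ln (6 * ph t * cis (- (3 * pi / 4))) + \<i> * of_real (3 * pi / 4)) / 3)"

definition om_dom :: "complex set" where
  "om_dom = {t. 6 * ph t * cis (- (3 * pi / 4)) \<notin> \<real>\<^sub>\<le>\<^sub>0}"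

text \<open>The factor cis (- 3 \<pi> / 4) carries the window (- \<pi>/4, 7 \<pi>/4) of arguments to
  (- \<pi>, \<pi>), where \<open>Ln\<close> inverts \<open>exp\<close>. All evaluations of
  \<open>om\<close> go through this window.\<close>

lemma om_eq_exp:
  assumes "6 * ph t = exp (3 * z)" "- pi / 4 < 3 * Im z" "3 * Im z < 7 * pi / 4"
  shows "om t = exp z" "t \<in> om_dom"
proof -
  define v where "v = 3 * z - \<i> * of_real (3 * pi / 4)"
  have v: "6 * ph t * cis (- (3 * pi / 4)) = exp v"
    unfolding assms(1) cis_conv_exp v_def mult_exp_exp by simp
  have im: "Im v = 3 * Im z - 3 * pi / 4" by (simp add: v_def)
  have im': "- pi < Im v" "Im v < pi" unfolding im using assms(2,3) by linarith+
  have "Ln (6 * ph t * cis (- (3 * pi / 4))) = v" unfolding v using im' by (intro Ln_exp) auto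
  then show "om t = exp z" by (simp add: om_def v_def)
  show "t \<in> om_dom"
  proof (rule ccontr)
    assume "t \<notin> om_dom"
    then have "exp v \<in> \<real>\<^sub>\<le>\<^sub>0" unfolding om_dom_def v[symmetric] by simp
    then have "Re (exp v) \<le> 0" "Im (exp v) = 0"
      by (simp_all add: complex_nonpos_Reals_iff)
    then have "cos (Im v) \<le> 0" "sin (Im v) = 0" by (auto simp: Re_exp Im_exp mult_le_0_iff)
    with im' show False using sin_eq_0_pi[of "Im v"] by simp
  qed
qed

lemma om_eq_polar:
  assumes "6 * ph t = of_real (r ^ 3) * cis (3 * \<alpha>)" "r > 0" "- pi / 4 < 3 * \<alpha>" "3 * \<alpha> < 7 * pi / 4"
  shows "om t = of_real r * cis \<alpha>"
proof -
  have "of_real r * cis \<alpha> = exp (Complex (ln r) \<alpha>)"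
    using assms(2) by (simp add: exp_eq_polar exp_of_real)
  moreover have "exp (3 * Complex (ln r) \<alpha>) = 6 * ph t"
  proof -
    have "exp (3 * ln r) = r ^ 3"
      using assms(2) by (metis exp_ln exp_of_nat_mult of_nat_numeral)
    then show ?thesis using assms(1) by (simp add: exp_eq_polar)
  qed
  ultimately show ?thesis using om_eq_exp[of t "Complex (ln r) \<alpha>"] assms by simp
qed

lemma open_om_dom: "open om_dom"
proof -
  have "open ((\<lambda>t. 6 * ph t * cis (- (3 * pi / 4))) -` (- \<real>\<^sub>\<le>\<^sub>0))"
    by (intro open_vimage continuous_intros) auto
  then show ?thesis by (simp add: om_dom_def vimage_def)
qed

lemma om_holomorphic: "om holomorphic_on om_dom"
  unfolding om_def[abs_def] by (intro holomorphic_intros) (auto simp: om_dom_def)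

lemma om_cube: assumes "ph t \<noteq> 0" shows "om t ^ 3 = 6 * ph t"
proof -
  have "om t ^ 3 = exp (Ln (6 * ph t * cis (- (3 * pi / 4))) + \<i> * of_real (3 * pi / 4))"
  proof -
    have "exp (v / 3) ^ 3 = exp v" for v :: complex
      using exp_of_nat_mult[of 3 "v / 3"] by simp
    then show ?thesis unfolding om_def .
  qed
  also have "\<dots> = 6 * ph t * (cis (- (3 * pi / 4)) * cis (3 * pi / 4))"
    using assms by (simp add: exp_add cis_conv_exp)
  finally show ?thesis by (simp add: cis_mult)
qed

lemma om_nonzero [simp]: "om t \<noteq> 0"
  by (simp add: om_def)

lemma norm_om_cube: "ph t \<noteq> 0 \<Longrightarrow> norm (om t) ^ 3 = 6 * norm (ph t)"
  using arg_cong[OF om_cube, of t norm] by (simp add: norm_power norm_mult)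

lemma om_dom_nonzero: "t \<in> om_dom \<Longrightarrow> ph t \<noteq> 0"
  by (auto simp: om_dom_def)

text \<open>Implicit differentiation of om^3 = 6 (sinh t - t).\<close>

lemma om_deriv:
  assumes "t \<in> om_dom"
  shows "(om has_field_derivative 2 * (cosh t - 1) / om t ^ 2) (at t)"
proof -
  obtain D where D: "(om has_field_derivative D) (at t)"
    using om_holomorphic assms open_om_dom holomorphic_on_imp_differentiable_at field_differentiable_def by blast
  have "((\<lambda>t. om t ^ 3) has_field_derivative 3 * om t ^ 2 * D) (at t)"
    by (auto intro!: derivative_eq_intros D)
  moreover have "((\<lambda>t. 6 * ph t) has_field_derivative 6 * (cosh t - 1)) (at t)"
    by (auto intro!: derivative_eq_intros ph_deriv)
  then have "((\<lambda>t. om t ^ 3) has_field_derivative 6 * (cosh t - 1)) (at t)"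
    by (rule has_field_derivative_transform_within_open[OF _ open_om_dom assms])
       (simp add: om_cube om_dom_nonzero)
  ultimately have "3 * om t ^ 2 * D = 6 * (cosh t - 1)" by (rule DERIV_unique)
  then have "3 * (D * om t ^ 2) = 3 * (2 * (cosh t - 1))" by (simp add: algebra_simps)
  then have "D * om t ^ 2 = 2 * (cosh t - 1)" by (metis mult_cancel_left zero_neq_numeral)
  then have "D = 2 * (cosh t - 1) / om t ^ 2" by (metis om_nonzero nonzero_eq_divide_eq power_not_zero)
  with D show ?thesis by simp
qed

text \<open>Since the phase avoids 0 and the open fourth quadrant, its argument lies in
  [0, 3 \<pi>/2], so the cube root stays in the closed first quadrant.\<close>

lemma om_crit_region:
  assumes "t \<in> crit_region"
  obtains z where "6 * ph t = exp (3 * z)" "0 \<le> Im z" "Im z \<le> pi / 2" "om t = exp z" "t \<in> om_dom"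
proof -
  define r \<beta> where "r = norm (ph t)" and "\<beta> = Arg2pi (ph t)"
  have p: "ph t = of_real r * cis \<beta>" "0 \<le> \<beta>" "\<beta> < 2 * pi" "r > 0"
    using Arg2pi[of "ph t"] ph_crit_region_quadrants(1)[OF assms] 
    by (auto simp: r_def \<beta>_def cis_conv_exp is_Arg_def)
  have "\<beta> \<le> 3 * pi / 2"
  proof (rule ccontr)
    assume b: "\<not> \<beta> \<le> 3 * pi / 2"
    have "cos \<beta> > 0" "sin \<beta> < 0"
      using b p cos_gt_zero[of "2 * pi - \<beta>"] sin_gt_zero[of "2 * pi - \<beta>"] by (auto simp: cos_diff sin_diff)
    then have "Re (ph t) > 0" "Im (ph t) < 0"
      using p(4) by (simp_all add: p(1) mult_pos_neg)
    then show False using ph_crit_region_quadrants(2)[OF assms] by simp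
  qed
  define z where "z = Complex (ln (6 * r) / 3) (\<beta> / 3)"
  have z: "6 * ph t = exp (3 * z)"
    using p(4) by (simp add: p(1) z_def exp_eq_polar)
  have im: "3 * Im z = \<beta>" by (simp add: z_def)
  then have im': "- pi / 4 < 3 * Im z" "3 * Im z < 7 * pi / 4"
    using p(2) \<open>\<beta> \<le> _\<close> pi_gt_zero by linarith+
  show ?thesis
    using im p(2) \<open>\<beta> \<le> _\<close> by (intro that[of z] z om_eq_exp[OF z im']) linarith+
qed

lemma crit_region_subset_om_dom: "crit_region \<subseteq> om_dom"
  using om_crit_region by blast

lemma om_of_real:
  assumes "x > 0" shows "om (of_real x) = of_real (root 3 (6 * (sinh x - x)))"
proof -
  have "(root 3 (6 * (sinh x - x))) ^ 3 = 6 * (sinh x - x)" by (simp add: odd_real_root_pow)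
  then show ?thesis
    using om_eq_polar[of "of_real x" "root 3 (6 * (sinh x - x))" 0] sinh_gt_self[OF assms] pi_gt_zero
    by (simp add: ph_of_real algebra_simps del: of_real_power)
qed

lemma cis_three_half_pi: "cis (3 * (pi / 2)) = - \<i>"
  using cos_3over2_pi sin_3over2_pi by (simp add: complex_eq_iff mult.commute)

lemma om_imag_axis:
  assumes "0 < y" shows "om (Complex 0 y) = \<i> * of_real (root 3 (6 * (y - sin y)))"
proof -
  have "(root 3 (6 * (y - sin y))) ^ 3 = 6 * (y - sin y)" by (simp add: odd_real_root_pow)
  then show ?thesis
    using om_eq_polar[of "Complex 0 y" "root 3 (6 * (y - sin y))" "pi / 2", unfolded cis_three_half_pi] 
      sin_less_self[OF assms(1)] pi_gt_zero
    by (simp add: ph_imag_axis algebra_simps del: of_real_power)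
qed

definition crit_rho :: "real \<Rightarrow> real" where "crit_rho a = root 3 (6 * crit_height a)"

lemma crit_rho_ge: "a > 0 \<Longrightarrow> crit_rho a \<ge> 1"
  using crit_height_gt[of a] pi_gt3 real_root_le_mono[of 3 1 "6 * crit_height a"] by (simp add: crit_rho_def)

text \<open>The phase has argument 3 \<pi>/2 here, as on the imaginary axis, so the cube root is on
  the positive imaginary axis. Its square is negative: the critical curve is what becomes the cut of
  the Stieltjes transform.\<close>

lemma om_crit_curve:
  assumes "a > 0" shows "om (Complex a (2 * pi - crit_angle a)) = \<i> * of_real (crit_rho a)"
proof -
  have "crit_rho a ^ 3 = 6 * crit_height a" by (simp add: crit_rho_def odd_real_root_pow)
  then show ?thesis
    using om_eq_polar[of "Complex a (2 * pi - crit_angle a)" "crit_rho a" "pi / 2", unfolded cis_three_half_pi] 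
      crit_rho_ge[OF assms] pi_gt_zero ph_crit_curve[OF assms]
    by (simp add: algebra_simps del: of_real_power)
qed

text \<open>The quotient 2 om / (om^2 - w^2) thus has its only pole at T. The sign - w is impossible
  because Re om >= 0; then the phase is positive real, so t is real, and sinh x - x is strictly
  increasing.\<close>

lemma om_square_eq_iff:
  assumes "T > 0" "t \<in> crit_region" and eq: "om t ^ 2 = om (of_real T) ^ 2"
  shows "t = of_real T"
proof -
  obtain z where z: "6 * ph t = exp (3 * z)" "0 \<le> Im z" "Im z \<le> pi / 2" "om t = exp z"
    using om_crit_region[OF assms(2)] by metis
  have p: "root 3 (6 * (sinh T - T)) > 0" using sinh_gt_self[OF assms(1)] by simp
  have "om t = om (of_real T) \<or> om t = - om (of_real T)" using eq by (simp add: power2_eq_iff)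
  moreover have "om t \<noteq> - om (of_real T)"
  proof
    assume "om t = - om (of_real T)"
    then have "Re (exp z) < 0" using z(4) p by (simp add: om_of_real[OF assms(1)])
    then show False using z(2,3) cos_ge_zero[of "Im z"] by (auto simp: Re_exp mult_less_0_iff)
  qed
  ultimately have "om t ^ 3 = om (of_real T) ^ 3" by simp
  moreover have "ph (of_real T) \<noteq> 0" using sinh_gt_self[OF assms(1)] by (simp add: ph_of_real)
  ultimately have ph: "ph t = of_real (sinh T - T)"
    using om_cube[of t] om_cube[of "of_real T"] ph_crit_region_quadrants(1)[OF assms(2)]
    by (metis mult_cancel_left zero_neq_numeral ph_of_real)
  then have "Im t = 0"
    using ph_crit_region_quadrants(3)[OF assms(2)] sinh_gt_self[OF assms(1)] by simp
  then have "t = of_real (Re t)" by (simp add: complex_eq_iff)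
  then have "sinh (Re t) - Re t = sinh T - T" using ph ph_of_real[of "Re t"] by (metis of_real_eq_iff)
  then have "Re t = T" using sinh_minus_self_strict_mono[of "Re t" T] sinh_minus_self_strict_mono[of T "Re t"]
    by (cases "Re t" T rule: linorder_cases) auto
  with \<open>t = of_real (Re t)\<close> show ?thesis by simp
qed

section \<open>The Stieltjes representation on the real axis\<close>

lemma Im_linepath_integral_bound:
  assumes "(f has_contour_integral i) (linepath a b)"
    and "\<And>t. t \<in> closed_segment a b \<Longrightarrow> \<bar>Im (f t * (b - a))\<bar> \<le> B"
  shows "\<bar>Im i\<bar> \<le> B"
proof -
  have "((\<lambda>x. f (linepath a b x) * (b - a)) has_integral i) {0..1}"
    using assms(1) by (simp add: has_contour_integral_linepath)
  from has_integral_linear[OF this bounded_linear_Im]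
  have "((\<lambda>x. Im (f (linepath a b x) * (b - a))) has_integral Im i) (cbox 0 1)" by (simp add: o_def)
  moreover have "B \<ge> 0" using assms(2)[of a] by (smt (verit) ends_in_segment(1))
  moreover have "\<bar>Im (f (linepath a b x) * (b - a))\<bar> \<le> B" if "x \<in> cbox 0 1" for x
    using that by (intro assms(2)) (auto simp: linepath_in_path)
  ultimately have "norm (Im i) \<le> B * measure lborel (cbox 0 (1::real))"
    by (intro has_integral_bound[of B]) auto
  then show ?thesis by simp
qed

definition crit_point :: "real \<Rightarrow> complex" where "crit_point a = Complex a (2 * pi - crit_angle a)"

definition crit_path :: "real \<Rightarrow> real \<Rightarrow> real \<Rightarrow> complex" where
  "crit_path d X s = crit_point (d + s * (X - d))"

definition crit_angle_d :: "real \<Rightarrow> real" where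
  "crit_angle_d a = (a * cosh a - sinh a) / (sinh a)\<^sup>2 / sqrt (1 - (a / sinh a)\<^sup>2)"

lemma crit_angle_d_continuous: "continuous_on {0<..} crit_angle_d"
proof -
  have "(x / sinh x)\<^sup>2 \<noteq> 1" if "x > 0" for x :: real
    using self_div_sinh_bounds[OF that] by (auto simp: power2_eq_1_iff)
  then show ?thesis unfolding crit_angle_d_def[abs_def] by (intro continuous_intros) auto
qed

lemma crit_point_deriv:
  assumes "a > 0" shows "(crit_point has_vector_derivative Complex 1 (- crit_angle_d a)) (at a)"
proof -
  have "(crit_angle has_real_derivative crit_angle_d a) (at a)"
    unfolding crit_angle_d_def by (rule crit_angle_deriv[OF assms])
  then have "((\<lambda>a. 2 * pi - crit_angle a) has_real_derivative - crit_angle_d a) (at a)"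
    by (auto intro!: derivative_eq_intros)
  then show ?thesis
    by (simp add: has_vector_derivative_complex_iff crit_point_def)
qed

lemma affine_mem_interval:
  fixes s d X :: real
  assumes "d < X" "s \<in> {0..1}" shows "d + s * (X - d) \<in> {d..X}"
proof -
  define v where "v = s * (X - d)"
  have "0 \<le> v" "v \<le> X - d"
    using assms by (auto simp: v_def intro: mult_left_le_one_le)
  then show ?thesis unfolding v_def[symmetric] by auto
qed

lemma crit_path_deriv:
  assumes "0 < d" "d < X" "s \<in> {0..1}"
  shows "(crit_path d X has_vector_derivative
          of_real (X - d) * Complex 1 (- crit_angle_d (d + s * (X - d)))) (at s)"
proof -
  have 1: "((\<lambda>s. d + s * (X - d)) has_vector_derivative (X - d)) (at s)"
    unfolding has_real_derivative_iff_has_vector_derivative[symmetric] by (auto intro!: derivative_eq_intros)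
  have "d + s * (X - d) > 0" using affine_mem_interval[OF assms(2,3)] assms(1) by simp
  from vector_diff_chain_at[OF 1 crit_point_deriv[OF this]]
  show ?thesis by (simp only: crit_path_def[abs_def] o_def scaleR_conv_of_real)
qed

lemma crit_path_valid:
  assumes "0 < d" "d < X" shows "valid_path (crit_path d X)"
proof -
  have pos: "d + s * (X - d) \<in> {0<..}" if "s \<in> {0..1}" for s 
    using affine_mem_interval[OF assms(2) that] assms(1) by simp
  have "continuous_on {0..1} (\<lambda>s. d + s * (X - d))" by (intro continuous_intros)
  then have cont: "continuous_on {0..1} (\<lambda>s. crit_angle_d (d + s * (X - d)))"
    by (rule continuous_on_compose2[OF crit_angle_d_continuous]) (use pos in blast)
  have "crit_path d X C1_differentiable_on {0..1}"
    unfolding C1_differentiable_on_def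
  proof (intro exI conjI ballI)
    show "continuous_on {0..1} (\<lambda>s. of_real (X - d) * Complex 1 (- crit_angle_d (d + s * (X - d))))"
      unfolding Complex_eq by (intro continuous_intros cont)
  qed (rule crit_path_deriv[OF assms])
  then show ?thesis by (simp add: valid_path_def C1_differentiable_imp_piecewise)
qed

lemma crit_path_ends [simp]:
  "pathstart (crit_path d X) = crit_point d" "pathfinish (crit_path d X) = crit_point X"
  by (simp_all add: pathstart_def pathfinish_def crit_path_def)

lemma crit_path_image:
  assumes "0 < d" "d < X" "t \<in> path_image (crit_path d X)"
  obtains a where "d \<le> a" "a \<le> X" "t = crit_point a"
proof -
  obtain s where s: "s \<in> {0..1}" "t = crit_path d X s" using assms(3) by (auto simp: path_image_def)
  have "d \<le> d + s * (X - d)" "d + s * (X - d) \<le> X"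
    using affine_mem_interval[OF assms(2) s(1)] by simp_all
  then show ?thesis using that s(2) unfolding crit_path_def by blast
qed

text \<open>Along the curve dt = (1 - i b'(a)) da. As f = i h is purely imaginary there, the
  imaginary part of f dt is h da, and the slope b' of the curve drops out.\<close>

lemma crit_path_integral:
  assumes "0 < d" "d < X" and f: "(f has_contour_integral i) (crit_path d X)"
    and h: "\<And>a. d \<le> a \<Longrightarrow> a \<le> X \<Longrightarrow> f (crit_point a) = \<i> * of_real (h a)" and "continuous_on {d..X} h"
  shows "Im i = integral {d..X} h"
proof -
  have le: "d + s * (X - d) \<in> {d..X}" if "s \<in> {0..1}" for s
    using affine_mem_interval[OF assms(2) that] .
  have "((\<lambda>s. f (crit_path d X s) * vector_derivative (crit_path d X) (at s)) has_integral i) {0..1}"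
    using f by (simp add: has_contour_integral)
  from has_integral_linear[OF this bounded_linear_Im]
  have 1: "((\<lambda>s. Im (f (crit_path d X s) * vector_derivative (crit_path d X) (at s))) has_integral Im i) {0..1}"
    by (simp add: o_def)
  have eq: "Im (f (crit_path d X s) * vector_derivative (crit_path d X) (at s)) = (X - d) *\<^sub>R h (d + s * (X - d))"
    if "s \<in> {0..1}" for s
    using vector_derivative_at[OF crit_path_deriv[OF assms(1,2) that]] h[of "d + s * (X - d)"] le[OF that]
    by (simp add: crit_path_def)
  have "((\<lambda>s. (X - d) *\<^sub>R h (d + s * (X - d))) has_integral Im i) {0..1}"
    by (rule has_integral_eq[OF _ 1]) (rule eq)
  moreover have "((\<lambda>s. (X - d) *\<^sub>R h (d + s * (X - d))) has_integral
      integral {d + 0 * (X - d)..d + 1 * (X - d)} h) {0..1}"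
    using assms le by (intro has_integral_substitution[where c = d and d = X])
      (auto intro!: derivative_eq_intros)
  ultimately show ?thesis by (auto dest: has_integral_unique)
qed

text \<open>The truncation by d avoids 0, where \<open>om\<close> is not continuous, and the start
  of the critical curve at a = 0, where the formula for its tangent degenerates. The maximum makes
  the upper boundary horizontal for Re t <= d.\<close>

definition crit_box :: "real \<Rightarrow> real \<Rightarrow> complex set" where
  "crit_box d X = {t. 0 \<le> Re t \<and> Re t \<le> X \<and> d \<le> Im t \<and> Im t \<le> 2 * pi - crit_angle (max (Re t) d)}"

lemma crit_box_subset:
  assumes "0 < d" shows "crit_box d X \<subseteq> crit_region"
proof
  fix t assume t: "t \<in> crit_box d X"
  show "t \<in> crit_region"
  proof (cases "Re t = 0")
    case True
    then show ?thesis using t assms crit_angle_bounds[OF assms]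
      by (auto simp: crit_box_def crit_region_def max_def)
  next
    case False
    then have "Re t > 0" using t by (auto simp: crit_box_def)
    then show ?thesis using t assms crit_angle_mono[of "Re t" "max (Re t) d"]
      by (auto simp: crit_box_def crit_region_def)
  qed
qed

text \<open>The upper boundary descends as Re t grows, because \<open>crit_angle\<close> increases,
  and a move towards the corner i d lowers both coordinates. So the box is starlike about that
  corner.\<close>

lemma crit_box_segment:
  assumes "0 < d" "t \<in> crit_box d X" shows "closed_segment (Complex 0 d) t \<subseteq> crit_box d X"
proof
  fix z assume "z \<in> closed_segment (Complex 0 d) t"
  then obtain u where u: "0 \<le> u" "u \<le> 1" "z = (1 - u) *\<^sub>R Complex 0 d + u *\<^sub>R t"
    by (auto simp: closed_segment_def)
  have t: "0 \<le> Re t" "Re t \<le> X" "d \<le> Im t" "Im t \<le> 2 * pi - crit_angle (max (Re t) d)"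
    using assms by (auto simp: crit_box_def)
  have re: "Re z = u * Re t" and im: "Im z = (1 - u) * d + u * Im t" by (simp_all add: u)
  have le: "u * Re t \<le> 1 * Re t" using u t by (intro mult_right_mono) auto
  have "Im z \<le> (1 - u) * Im t + u * Im t" "Im z \<ge> (1 - u) * d + u * d"
    unfolding im using u t by (intro add_mono mult_left_mono order.refl; simp)+
  then have "d \<le> Im z" "Im z \<le> Im t" by (simp_all add: algebra_simps)
  moreover have "crit_angle (max (Re z) d) \<le> crit_angle (max (Re t) d)"
    using assms(1) le by (intro crit_angle_mono) (auto simp: re)
  ultimately show "z \<in> crit_box d X"
    using t u le mult_nonneg_nonneg[OF u(1) t(1)] by (simp add: crit_box_def re)
qed

lemma crit_box_simply_connected:
  assumes "0 < d" "d < 1" "0 < X" shows "simply_connected (crit_box d X)"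
proof (rule starlike_imp_simply_connected)
  have "Complex 0 d \<in> crit_box d X" using assms crit_angle_bounds[OF assms(1)] pi_gt3 by (auto simp: crit_box_def)
  then show "starlike (crit_box d X)" unfolding starlike_def using crit_box_segment[OF assms(1)] by blast
qed

lemma crit_point_in_box: "0 < d \<Longrightarrow> d < 1 \<Longrightarrow> d \<le> a \<Longrightarrow> a \<le> X \<Longrightarrow> crit_point a \<in> crit_box d X"
  using crit_angle_bounds[of a] pi_gt3 by (auto simp: crit_point_def crit_box_def max_def)

text \<open>The contour runs along the bottom, up the right side, back along the critical curve down to
  abscissa \<open>d\<close>, horizontally to the imaginary axis, and down.\<close>

lemma crit_box_contour:
  assumes d: "0 < d" "d < 1" "d < X" and f: "f holomorphic_on S" "open S" "crit_box d X \<subseteq> S"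
    and h: "\<And>a. d \<le> a \<Longrightarrow> a \<le> X \<Longrightarrow> f (crit_point a) = - \<i> * of_real (h a)" "continuous_on {d..X} h"
    and axis: "\<And>y. d \<le> y \<Longrightarrow> y \<le> 2 * pi \<Longrightarrow> Re (f (Complex 0 y)) = 0"
    and right: "\<And>y. d \<le> y \<Longrightarrow> y \<le> 2 * pi - crit_angle X \<Longrightarrow> norm (f (Complex X y)) \<le> M"
    and flat: "\<And>x. 0 \<le> x \<Longrightarrow> x \<le> d \<Longrightarrow> norm (f (Complex x (2 * pi - crit_angle d))) \<le> K"
  shows "\<bar>integral {d..X} h + Im (contour_integral (linepath (Complex 0 d) (Complex X d)) f)\<bar> \<le> 2 * pi * M + d * K"
proof -
  define c where "c = 2 * pi - crit_angle d"
  have c: "d \<le> c" "c \<le> 2 * pi" using crit_angle_bounds[OF d(1)] d pi_gt3 by (auto simp: c_def)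
  have cX: "d \<le> 2 * pi - crit_angle X" using crit_angle_bounds[of X] d pi_gt3 by auto
  have sX: "closed_segment (Complex 0 d) (Complex X d) \<subseteq> crit_box d X"
    using d cX by (intro crit_box_segment) (auto simp: crit_box_def max_def)
  have s1: "t \<in> crit_box d X \<and> Re t = X \<and> d \<le> Im t \<and> Im t \<le> 2 * pi - crit_angle X" 
    if "t \<in> closed_segment (Complex X d) (crit_point X)" for t
    using that d cX by (auto simp: closed_segment_same_Re crit_point_def crit_box_def max_def closed_segment_eq_real_ivl)
  have s2: "t \<in> crit_box d X \<and> 0 \<le> Re t \<and> Re t \<le> d \<and> Im t = c" if "t \<in> closed_segment (crit_point d) (Complex 0 c)" for t
    using that d c by (auto simp: closed_segment_same_Im crit_point_def crit_box_def max_def closed_segment_eq_real_ivl c_def)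
  have s3: "t \<in> crit_box d X \<and> Re t = 0 \<and> d \<le> Im t \<and> Im t \<le> 2 * pi" if "t \<in> closed_segment (Complex 0 c) (Complex 0 d)" for t
    using that d c by (auto simp: closed_segment_same_Re crit_box_def max_def closed_segment_eq_real_ivl c_def split: if_splits)
  have sP: "path_image (crit_path d X) \<subseteq> crit_box d X"
    using crit_path_image[OF d(1,3)] crit_point_in_box[OF d(1,2)] by blast
  define L1 L2 L3 L4 L5 where "L1 = linepath (Complex 0 d) (Complex X d)"
    and "L2 = linepath (Complex X d) (crit_point X)" and "L3 = reversepath (crit_path d X)"
    and "L4 = linepath (crit_point d) (Complex 0 c)" and "L5 = linepath (Complex 0 c) (Complex 0 d)"
  note L = L1_def L2_def L3_def L4_def L5_def
  define \<gamma> where "\<gamma> = L1 +++ L2 +++ L3 +++ L4 +++ L5"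
  have vp: "valid_path L1" "valid_path L2" "valid_path L3" "valid_path L4" "valid_path L5"
    using crit_path_valid[OF d(1,3)] by (auto simp: L)
  have vg: "valid_path \<gamma>" unfolding \<gamma>_def by (intro valid_path_join vp) (simp_all add: L)
  have img: "path_image \<gamma> \<subseteq> crit_box d X"
    unfolding \<gamma>_def by (intro subset_path_image_join) (use sX s1 s2 s3 sP in \<open>auto simp: L\<close>)
  have loop: "pathfinish \<gamma> = pathstart \<gamma>" by (simp add: \<gamma>_def L)
  have zero: "(f has_contour_integral 0) \<gamma>"
  proof (rule Cauchy_theorem_global[OF f(2,1) vg loop])
    show "path_image \<gamma> \<subseteq> S" using img f by blast
    show "winding_number \<gamma> w = 0" if "w \<notin> S" for w
      using that f d by (intro simply_connected_imp_winding_number_zero[OF crit_box_simply_connected _ img loop])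
        (auto intro: valid_path_imp_path vg)
  qed
  have ci: "f contour_integrable_on L" if "valid_path L" "path_image L \<subseteq> crit_box d X" for L
    using that f by (meson contour_integrable_holomorphic_simple order_trans)
  have cis1: "f contour_integrable_on L1" using sX by (intro ci vp) (simp add: L)
  have cis2: "f contour_integrable_on L2" using s1 by (intro ci vp) (auto simp: L)
  have cis3: "f contour_integrable_on L3" using sP by (intro ci vp) (simp add: L)
  have cis4: "f contour_integrable_on L4" using s2 by (intro ci vp) (auto simp: L)
  have cis5: "f contour_integrable_on L5" using s3 by (intro ci vp) (auto simp: L)
  note hci = has_contour_integral_integral[OF cis1] has_contour_integral_integral[OF cis2]
    has_contour_integral_integral[OF cis3] has_contour_integral_integral[OF cis4]
    has_contour_integral_integral[OF cis5]
  have "(f has_contour_integral (contour_integral L1 f + (contour_integral L2 f + (contour_integral L3 f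
      + (contour_integral L4 f + contour_integral L5 f))))) \<gamma>"
    unfolding \<gamma>_def by (intro has_contour_integral_join hci vp valid_path_join) (simp_all add: L)
  with zero have sum0: "contour_integral L1 f + (contour_integral L2 f + (contour_integral L3 f
      + (contour_integral L4 f + contour_integral L5 f))) = 0"
    by (metis contour_integral_unique)
  have "(f has_contour_integral contour_integral (crit_path d X) f) (crit_path d X)"
    using ci[OF crit_path_valid[OF d(1,3)] sP] by (rule has_contour_integral_integral)
  from crit_path_integral[OF d(1,3) this, of "\<lambda>a. - h a"] h
  have "Im (contour_integral (crit_path d X) f) = integral {d..X} (\<lambda>a. - h a)"
    by (auto intro!: continuous_intros)
  moreover have "contour_integral L3 f = - contour_integral (crit_path d X) f"
    unfolding L using crit_path_valid[OF d(1,3)] by (rule contour_integral_reversepath)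
  ultimately have I3: "Im (contour_integral L3 f) = integral {d..X} h" by simp
  have I2: "\<bar>Im (contour_integral L2 f)\<bar> \<le> 2 * pi * M"
    unfolding L2_def
  proof (rule Im_linepath_integral_bound[OF has_contour_integral_integral[OF cis2[unfolded L2_def]]])
    fix t assume "t \<in> closed_segment (Complex X d) (crit_point X)"
    from s1[OF this] have "norm (f t) \<le> M" using right[of "Im t"] by (metis complex_surj)
    moreover have n: "norm (crit_point X - Complex X d) \<le> 2 * pi"
      using crit_angle_bounds[of X] d cX by (simp add: crit_point_def cmod_def)
    ultimately have "norm (f t * (crit_point X - Complex X d)) \<le> M * (2 * pi)"
      unfolding norm_mult using norm_ge_zero order_trans by (intro mult_mono) blast+
    then show "\<bar>Im (f t * (crit_point X - Complex X d))\<bar> \<le> 2 * pi * M"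
      using abs_Im_le_cmod order_trans by (metis mult.commute)
  qed
  have I4: "\<bar>Im (contour_integral L4 f)\<bar> \<le> d * K"
    unfolding L4_def
  proof (rule Im_linepath_integral_bound[OF has_contour_integral_integral[OF cis4[unfolded L4_def]]])
    fix t assume "t \<in> closed_segment (crit_point d) (Complex 0 c)"
    from s2[OF this] have "norm (f t) \<le> K" using flat[of "Re t"] unfolding c_def by (metis complex_surj)
    moreover have n: "norm (Complex 0 c - crit_point d) \<le> d"
      using d by (simp add: crit_point_def cmod_def c_def)
    ultimately have "norm (f t * (Complex 0 c - crit_point d)) \<le> K * d"
      unfolding norm_mult using norm_ge_zero order_trans by (intro mult_mono) blast+
    then show "\<bar>Im (f t * (Complex 0 c - crit_point d))\<bar> \<le> d * K"
      using abs_Im_le_cmod order_trans by (metis mult.commute)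
  qed
  \<comment> \<open>On the imaginary axis f and dt are both imaginary, so their product is
    real.\<close>
  have I5: "\<bar>Im (contour_integral L5 f)\<bar> \<le> 0"
    unfolding L5_def
  proof (rule Im_linepath_integral_bound[OF has_contour_integral_integral[OF cis5[unfolded L5_def]]])
    fix t assume "t \<in> closed_segment (Complex 0 c) (Complex 0 d)"
    from s3[OF this] have "Re (f t) = 0" using axis[of "Im t"] by (metis complex_surj)
    then show "\<bar>Im (f t * (Complex 0 d - Complex 0 c))\<bar> \<le> 0" by simp
  qed
  show ?thesis
    using arg_cong[OF sum0, of Im] I2 I3 I4 I5 unfolding plus_complex.simps L1_def zero_complex.simps by linarith
qed

lemma cosh_complex_of_real: "cosh (complex_of_real x) = of_real (cosh x)"
  by (simp add: cosh_field_def exp_of_real flip: of_real_minus)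

lemma pi_le_0_iff [simp]: "pi \<le> 0 \<longleftrightarrow> False"
  by (simp add: not_le)

lemma crit_region_Im_le: "t \<in> crit_region \<Longrightarrow> Im t \<le> 2 * pi"
  using crit_angle_bounds[of "Re t"] by (auto simp: crit_region_def split: if_splits)

text \<open>From |sinh t|^2 = sinh (Re t)^2 + sin (Im t)^2, the modulus of sinh t is at least sinh
  (Re t), while |t| <= Re t + 2 \<pi> in the region.\<close>

lemma norm_om_ge:
  assumes "t \<in> crit_region" shows "norm (om t) ^ 3 \<ge> 6 * (sinh (Re t) - Re t - 2 * pi)"
proof -
  have t: "Re t \<ge> 0" "0 \<le> Im t" using assms by (auto simp: crit_region_def)
  have n: "norm t \<le> Re t + 2 * pi" using cmod_le[of t] t crit_region_Im_le[OF assms] by simp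
  have "(norm (sinh t))\<^sup>2 = (sinh (Re t) * cos (Im t))\<^sup>2 + (cosh (Re t) * sin (Im t))\<^sup>2"
    using Re_ph[of t] Im_ph[of t] by (simp add: cmod_power2 ph_def)
  also have "\<dots> = (sinh (Re t))\<^sup>2 * ((cos (Im t))\<^sup>2 + (sin (Im t))\<^sup>2) + (sin (Im t))\<^sup>2"
  proof -
    have "(S * c)\<^sup>2 + (C * s)\<^sup>2 = S\<^sup>2 * (c\<^sup>2 + s\<^sup>2) + s\<^sup>2" if "C\<^sup>2 = S\<^sup>2 + 1" for S C c s :: real
      using that by algebra
    then show ?thesis using cosh_square_eq by blast
  qed
  also have "\<dots> \<ge> (sinh (Re t))\<^sup>2" by simp
  finally have "sinh (Re t) \<le> norm (sinh t)" by (rule power2_le_imp_le) simp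
  moreover have "norm (sinh t) \<le> norm (ph t) + norm t"
    using norm_triangle_ineq[of "ph t" t] by (simp add: ph_def)
  ultimately have "norm (ph t) \<ge> sinh (Re t) - Re t - 2 * pi" using n by linarith
  then show ?thesis using norm_om_cube[OF ph_crit_region_quadrants(1)[OF assms]] by simp
qed

lemma sinh_minus_at_top: "filterlim (\<lambda>x::real. sinh x - x) at_top at_top"
proof (rule filterlim_at_top_mono[OF filterlim_ident])
  show "\<forall>\<^sub>F x::real in at_top. x \<le> sinh x - x"
    using eventually_ge_at_top[of 6]
  proof eventually_elim
    case (elim x)
    then have "1 + x + x\<^sup>2 / 2 \<le> exp x" by (intro exp_lower_Taylor_quadratic) auto
    moreover have "exp (- x) \<le> 1" using elim by simp
    moreover have "x\<^sup>2 \<ge> 6 * x" using elim by (simp add: power2_eq_square)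
    ultimately have "4 * x \<le> exp x - exp (- x)" by linarith
    then show ?case by (simp add: sinh_field_def field_simps)
  qed
qed

lemma norm_om_at_top: 
  "\<forall>\<^sub>F X in at_top. \<forall>t\<in>crit_region. Re t = X \<longrightarrow> norm (om t) \<ge> B"
proof -
  define m where "m = max B 0"
  have m: "m \<ge> 0" "m \<ge> B" by (auto simp: m_def)
  have "\<forall>\<^sub>F X in at_top. sinh X - X \<ge> m ^ 3 + 2 * pi"
    using sinh_minus_at_top by (simp add: filterlim_at_top)
  then show ?thesis
  proof eventually_elim
    case (elim X)
    show ?case
    proof safe
      fix t assume t: "t \<in> crit_region" "X = Re t"
      have "m ^ 3 \<le> norm (om t) ^ 3" 
      proof -
        have "m ^ 3 \<le> sinh (Re t) - Re t - 2 * pi" using elim[unfolded t(2)] by linarith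
        moreover have "0 \<le> m ^ 3" using m by simp
        ultimately show ?thesis using norm_om_ge[OF t(1)] by argo
      qed
      then have "m \<le> norm (om t)" using m(1) by (metis norm_ge_zero not_le power_strict_mono zero_less_numeral)
      then show "B \<le> norm (om t)" using m by simp
    qed
  qed
qed

text \<open>The limit is taken through the modulus, |om|^3 = 6 |ph|, since \<open>om 0\<close>
  itself has a nonzero default value and the branch is cut near 0.\<close>

lemma om_tendsto_0:
  assumes "(g \<longlongrightarrow> 0) F" "\<forall>\<^sub>F x in F. ph (g x) \<noteq> 0" shows "((\<lambda>x. om (g x)) \<longlongrightarrow> 0) F"
proof -
  have "isCont ph 0" using ph_deriv[of 0 UNIV] DERIV_isCont by blast
  then have "((\<lambda>x. ph (g x)) \<longlongrightarrow> ph 0) F" using assms(1) by (rule isCont_tendsto_compose)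
  then have "((\<lambda>x. root 3 (6 * norm (ph (g x)))) \<longlongrightarrow> root 3 (6 * norm (0::complex))) F"
    by (intro tendsto_intros) (simp add: ph_def)
  moreover have "\<forall>\<^sub>F x in F. root 3 (6 * norm (ph (g x))) = norm (om (g x))"
    using assms(2)
  proof eventually_elim
    case (elim x)
    then show ?case using norm_om_cube[OF elim] by (metis norm_ge_zero real_root_power_cancel zero_less_numeral)
  qed
  ultimately have "((\<lambda>x. norm (om (g x))) \<longlongrightarrow> 0) F" by (simp add: tendsto_cong)
  then show ?thesis by (simp add: tendsto_norm_zero_iff)
qed

lemma crit_rho_continuous: "continuous_on {0<..} crit_rho"
proof -
  have "continuous_on {0<..} crit_angle"
    by (intro continuous_at_imp_continuous_on ballI) (auto intro: DERIV_isCont crit_angle_deriv)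
  then show ?thesis unfolding crit_rho_def[abs_def] crit_height_def[abs_def] by (intro continuous_intros)
qed

text \<open>This is i times the value of 2 om / (om^2 - w^2) at om = i
  \<open>crit_rho a\<close>.\<close>

definition crit_kernel :: "real \<Rightarrow> real \<Rightarrow> real" where
  "crit_kernel w a = 2 * crit_rho a / (crit_rho a ^ 2 + w ^ 2)"

lemma crit_kernel_continuous: "continuous_on {0<..} (crit_kernel w)"
  unfolding crit_kernel_def[abs_def]
proof (intro continuous_intros crit_rho_continuous ballI)
  fix a :: real assume "a \<in> {0<..}"
  then have "crit_rho a ^ 2 > 0" using crit_rho_ge[of a] by simp
  then show "crit_rho a ^ 2 + w ^ 2 \<noteq> 0" using zero_le_power2[of w] by linarith
qed

lemma crit_kernel_bounds: assumes "a > 0" shows "0 \<le> crit_kernel w a" "crit_kernel w a \<le> 2"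
proof -
  have r: "crit_rho a \<ge> 1" by (rule crit_rho_ge[OF assms])
  then have le: "crit_rho a \<le> crit_rho a ^ 2" by (rule self_le_power) simp
  then have "crit_rho a \<le> crit_rho a ^ 2 + w ^ 2" "crit_rho a ^ 2 + w ^ 2 > 0"
    using r zero_le_power2[of w] by linarith+
  then show "crit_kernel w a \<le> 2" "0 \<le> crit_kernel w a"
    using r unfolding crit_kernel_def by (simp_all add: divide_simps)
qed

text \<open>Integrate f = 2 om / (om^2 - w^2) around the box. On the real axis f is real except for
  the simple pole at T with residue c = 1 / om'(T), whose half residue contributes \<pi> c as the
  bottom side descends. The imaginary axis contributes nothing to the imaginary part, the right side
  vanishes as X grows, and the critical curve gives the integral of the kernel.\<close>

theorem stieltjes_real:
  assumes T: "T > 0"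
  defines "w \<equiv> root 3 (6 * (sinh T - T))"
  shows "has_bochner_integral lborel (\<lambda>a. indicator {0<..} a * crit_kernel w a)
           (pi * w ^ 2 / (2 * (cosh T - 1)))"
proof -
  define c where "c = w ^ 2 / (2 * (cosh T - 1))"
  define t0 where "t0 = complex_of_real T"
  have w: "w > 0" using sinh_gt_self[OF T] by (simp add: w_def)
  have omT: "om t0 = of_real w" unfolding t0_def w_def by (rule om_of_real[OF T])
  have t0: "t0 \<in> crit_region" using T crit_angle_bounds[OF T] by (auto simp: crit_region_def t0_def)
  then have t0d: "t0 \<in> om_dom" using crit_region_subset_om_dom by blast
  have coshT: "cosh t0 - 1 \<noteq> 0" 
    using cosh_gt_1[OF T] by (auto simp: t0_def cosh_complex_of_real)
  have ct: "cosh t0 = of_real (cosh T)" by (simp add: t0_def cosh_complex_of_real)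
  define h where "h t = om t ^ 2 - of_real w ^ 2" for t
  have h_hol: "h holomorphic_on om_dom" unfolding h_def[abs_def] by (intro holomorphic_intros om_holomorphic)
  have h_deriv: "deriv h t0 = 2 * om t0 * (2 * (cosh t0 - 1) / om t0 ^ 2)"
    unfolding h_def[abs_def] by (rule DERIV_imp_deriv) (auto intro!: derivative_eq_intros om_deriv[OF t0d])
  have h0: "h t0 = 0" by (simp add: h_def omT)
  \<comment> \<open>The quotient h / (t - T) with its removable singularity filled. It has no zero
    in \<open>crit_region\<close>, so f = \<open>Nn\<close> / (t - T) with \<open>Nn\<close>
    holomorphic on an open neighbourhood \<open>E\<close> of the region.\<close>
  define q where "q t = (if t = t0 then deriv h t0 else (h t - h t0) / (t - t0))" for t
  have q_hol: "q holomorphic_on om_dom" unfolding q_def[abs_def] by (rule pole_lemma_open[OF h_hol open_om_dom])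
  have q0: "q t0 \<noteq> 0" using w coshT by (simp add: q_def h_deriv omT)
  define E where "E = {t \<in> om_dom. q t \<noteq> 0}"
  have "open (om_dom \<inter> q -` (- {0}))"
    by (intro continuous_open_preimage holomorphic_on_imp_continuous_on[OF q_hol] open_om_dom) auto
  moreover have "om_dom \<inter> q -` (- {0}) = E" by (auto simp: E_def)
  ultimately have E_open: "open E" by simp
  have h_nz: "h t \<noteq> 0" if "t \<in> crit_region" "t \<noteq> t0" for t
    using om_square_eq_iff[OF T that(1)] that(2) omT by (auto simp: h_def t0_def)
  have crit_E: "crit_region \<subseteq> E"
    using crit_region_subset_om_dom h_nz h0 q0 by (auto simp: E_def q_def)
  define Nn where "Nn t = 2 * om t / q t" for t
  have N_hol: "Nn holomorphic_on E" unfolding Nn_def[abs_def]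
    by (intro holomorphic_intros holomorphic_on_subset[OF om_holomorphic] holomorphic_on_subset[OF q_hol])
       (auto simp: E_def)
  have N0: "Nn t0 = of_real c"
  proof -
    have "Nn t0 = 2 * of_real w / (2 * of_real w * (2 * (cosh t0 - 1) / of_real w ^ 2))"
      by (simp add: Nn_def q_def h_deriv omT)
    also have "\<dots> = of_real w ^ 2 / (2 * (cosh t0 - 1))" using w coshT by (simp add: divide_simps)
    finally show ?thesis by (simp add: c_def ct)
  qed
  define f where "f t = 2 * om t / h t" for t
  have f_N: "f t = Nn t / (t - t0)" if "t \<noteq> t0" for t
    using that by (simp add: f_def Nn_def q_def h0)
  \<comment> \<open>What remains of f when its principal part c / (t - T) is subtracted.\<close>
  define g where "g t = (if t = t0 then deriv Nn t0 else (Nn t - Nn t0) / (t - t0))" for t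
  have g_hol: "g holomorphic_on E" unfolding g_def[abs_def] by (rule pole_lemma_open[OF N_hol E_open])
  have f_g: "f t = g t + of_real c / (t - t0)" if "t \<noteq> t0" for t
    using that by (simp add: f_N g_def N0 diff_divide_distrib)
  have f_hol: "f holomorphic_on (E - {t0})"
  proof -
    have "(\<lambda>t. Nn t / (t - t0)) holomorphic_on (E - {t0})"
      by (intro holomorphic_intros holomorphic_on_subset[OF N_hol]) auto
    then show ?thesis by (rule holomorphic_transform) (auto simp: f_N)
  qed
  have box_sub: "crit_box d X \<subseteq> E - {t0}" if "d > 0" for d X
    using crit_box_subset[OF that, of X] crit_E that by (auto simp: crit_box_def t0_def)
  have f_curve: "f (crit_point a) = - \<i> * of_real (crit_kernel w a)" if "a > 0" for a
  proof -
    have om: "om (crit_point a) = \<i> * of_real (crit_rho a)" 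
      unfolding crit_point_def by (rule om_crit_curve[OF that])
    have "f (crit_point a) = \<i> * of_real (2 * crit_rho a / (- (crit_rho a ^ 2) - w ^ 2))"
      by (simp add: f_def h_def om power_mult_distrib)
    also have "2 * crit_rho a / (- (crit_rho a ^ 2) - w ^ 2) = - crit_kernel w a"
      unfolding crit_kernel_def by (metis minus_add_distrib add_uminus_conv_diff minus_divide_right)
    finally show ?thesis by simp
  qed
  have f_axis: "Re (f (Complex 0 y)) = 0" if "y > 0" for y
  proof -
    define r where "r = root 3 (6 * (y - sin y))"
    have om: "om (Complex 0 y) = \<i> * of_real r" unfolding r_def by (rule om_imag_axis[OF that])
    have "f (Complex 0 y) = \<i> * of_real (2 * r / (- (r ^ 2) - w ^ 2))"
      by (simp add: f_def h_def om power_mult_distrib)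
    then show ?thesis by simp
  qed
  have f_real: "Im (f (of_real x)) = 0" if "x > 0" for x
  proof -
    define r where "r = root 3 (6 * (sinh x - x))"
    have om: "om (of_real x) = of_real r" unfolding r_def by (rule om_of_real[OF that])
    have "f (of_real x) = of_real (2 * r / (r ^ 2 - w ^ 2))"
      by (simp add: f_def h_def om)
    then show ?thesis by (simp del: of_real_divide)
  qed
  have f_right: "\<forall>\<^sub>F X in at_top. \<forall>t\<in>crit_region. Re t = X \<longrightarrow> norm (f t) \<le> e" if "e > 0" for e
    using norm_om_at_top[of "max (4 / e) (2 * w)"]
  proof eventually_elim
    case (elim X)
    show ?case
    proof safe
      fix t assume t: "t \<in> crit_region" "X = Re t"
      define r where "r = norm (om t)"
      have r: "r \<ge> 4 / e" "r \<ge> 2 * w" using elim t by (auto simp: r_def)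
      then have "r > 0" using w by simp
      have "(2 * w) ^ 2 \<le> r ^ 2" using r w by (intro power_mono) auto
      then have "4 * w ^ 2 \<le> r ^ 2" by (simp add: power_mult_distrib)
      then have "2 * w ^ 2 \<le> r ^ 2" using zero_le_power2[of w] by linarith
      moreover have "norm (h t) \<ge> r ^ 2 - w ^ 2"
        using norm_triangle_ineq2[of "om t ^ 2" "of_real w ^ 2"] w by (simp add: h_def r_def norm_power)
      ultimately have "norm (h t) \<ge> r ^ 2 / 2" by simp
      then have "norm (f t) \<le> 2 * r / (r ^ 2 / 2)"
        unfolding f_def norm_divide norm_mult r_def[symmetric] using \<open>r > 0\<close> by (intro frac_le) auto
      also have "\<dots> = 4 / r" using \<open>r > 0\<close> by (simp add: power2_eq_square)
      also have "\<dots> \<le> e" using r(1) that \<open>r > 0\<close> by (simp add: field_simps)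
      finally show "norm (f t) \<le> e" .
    qed
  qed
  \<comment> \<open>One compact set containing the horizontal top sides for all 0 < d < 1. Hence f
    has a bound K on them independent of d, and their contribution is at most d K.\<close>
  define Kset where "Kset = {t. 0 \<le> Re t \<and> Re t \<le> 1 \<and> pi \<le> Im t \<and> Im t \<le> 2 * pi \<and> Re (ph t) \<le> 0}"
  have K_sub: "Kset \<subseteq> crit_region"
  proof
    fix t assume t: "t \<in> Kset"
    show "t \<in> crit_region"
    proof (cases "Re t = 0")
      case True
      then show ?thesis using t pi_gt_zero by (auto simp: Kset_def crit_region_def)
    next
      case False
      then have x: "Re t > 0" using t by (auto simp: Kset_def)
      have "Im t \<le> 2 * pi - crit_angle (Re t)"
      proof (rule ccontr)
        assume "\<not> ?thesis"
        then have "cos (crit_angle (Re t)) < cos (2 * pi - Im t)"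
          using t crit_angle_bounds[OF x] by (intro cos_monotone_0_pi) (auto simp: Kset_def)
        then have "Re t / sinh (Re t) < cos (Im t)" using x by (simp add: cos_crit_angle cos_diff)
        then have "Re (ph t) > 0" using x by (simp add: Re_ph divide_simps mult.commute)
        then show False using t by (simp add: Kset_def)
      qed
      then show ?thesis using t x pi_gt_zero by (auto simp: Kset_def crit_region_def)
    qed
  qed
  have "compact Kset"
  proof (rule compact_eq_bounded_closed[THEN iffD2, OF conjI])
    have "Kset \<subseteq> cbox (Complex 0 pi) (Complex 1 (2 * pi))" by (auto simp: Kset_def in_cbox_complex_iff)
    then show "bounded Kset" using bounded_cbox bounded_subset by blast
    show "closed Kset" unfolding Kset_def
      by (intro closed_Collect_conj closed_Collect_le continuous_intros) 
  qed
  moreover have "continuous_on Kset f"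
    by (rule continuous_on_subset[OF holomorphic_on_imp_continuous_on[OF f_hol]])
       (use K_sub crit_E pi_gt_zero in \<open>auto simp: Kset_def t0_def\<close>)
  ultimately have "bounded (f ` Kset)" by (intro compact_imp_bounded compact_continuous_image)
  then obtain K where K: "\<And>t. t \<in> Kset \<Longrightarrow> norm (f t) \<le> K" by (auto simp: bounded_iff)
  have f_flat: "norm (f (Complex x (2 * pi - crit_angle d))) \<le> K" if "0 \<le> x" "x \<le> d" "0 < d" "d < 1" for x d
  proof (rule K)
    have "cos (crit_angle d) * sinh x \<le> x"
    proof (cases "x = 0")
      case False
      then have "cos (crit_angle d) \<le> cos (crit_angle x)"
        using that crit_angle_mono[of x d] crit_angle_bounds[of x] crit_angle_bounds[of d]
        by (intro cos_monotone_0_pi_le) auto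
      then show ?thesis using False that by (simp add: cos_crit_angle[of x] divide_simps)
    qed simp
    then show "Complex x (2 * pi - crit_angle d) \<in> Kset"
      using that crit_angle_bounds[of d] by (auto simp: Kset_def Re_ph cos_diff mult.commute)
  qed

  \<comment> \<open>The kernel set to zero for a <= 0, to be integrated over the whole line.\<close>
  define k0 where "k0 a = indicator {0<..} a * crit_kernel w a" for a :: real
  define A where "A X = (\<integral>a. k0 a * indicator {..X} a \<partial>lborel)" for X
  have k0_meas [measurable]: "k0 \<in> borel_measurable borel"
    using borel_measurable_continuous_on_indicator[OF _ crit_kernel_continuous[of w]] by (simp add: k0_def[abs_def])
  have k0_b: "0 \<le> k0 a" "k0 a \<le> 2" for a using crit_kernel_bounds[of a w] by (auto simp: k0_def indicator_def)
  have k0_int: "integrable lborel (\<lambda>a. k0 a * indicator {u..v} a)" for u v :: real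
    by (rule integrableI_bounded_set[where A = "{u..v}" and B = 2]) (use k0_b in \<open>auto simp: indicator_def emeasure_lborel_Icc_eq\<close>)
  have k0_eq: "(\<lambda>a. k0 a * indicator {..X} a) = (\<lambda>a. k0 a * indicator {0..X} a)" for X
    by (auto simp: k0_def indicator_def)
  have A_diff: "\<bar>A X - integral {d..X} (crit_kernel w)\<bar> \<le> 2 * d" if "0 < d" "d < X" for d X
  proof -
    have "integral {d..X} (crit_kernel w) = (LINT a:{d..X}|lborel. crit_kernel w a)"
    proof (rule set_borel_integral_eq_integral(2)[symmetric])
      show "set_integrable lborel {d..X} (crit_kernel w)"
        by (intro borel_integrable_atLeastAtMost' continuous_on_subset[OF crit_kernel_continuous]) (use that in auto)
    qed
    also have "\<dots> = (\<integral>a. k0 a * indicator {d..X} a \<partial>lborel)"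
      unfolding set_lebesgue_integral_def using that
      by (intro Bochner_Integration.integral_cong) (auto simp: k0_def indicator_def)
    finally have 1: "integral {d..X} (crit_kernel w) = (\<integral>a. k0 a * indicator {d..X} a \<partial>lborel)" .
    have "A X = (\<integral>a. k0 a * indicator {0..X} a \<partial>lborel)" by (simp only: A_def k0_eq)
    with 1 have "A X - integral {d..X} (crit_kernel w) = (\<integral>a. k0 a * indicator {0..X} a - k0 a * indicator {d..X} a \<partial>lborel)"
      using k0_int by simp
    also have "norm \<dots> \<le> (\<integral>a. 2 * indicator {0..d} a \<partial>lborel)"
    proof (rule Bochner_Integration.integral_norm_bound_integral[OF Bochner_Integration.integrable_diff[OF k0_int k0_int]])
      show "integrable lborel (\<lambda>a. 2 * indicator {0..d} a :: real)"
        by (intro integrable_mult_right integrable_real_indicator) (auto simp: emeasure_lborel_Icc_eq)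
      show "norm (k0 a * indicator {0..X} a - k0 a * indicator {d..X} a) \<le> 2 * indicator {0..d} a" for a
        using k0_b[of a] that by (auto simp: indicator_def)
    qed
    also have "\<dots> = 2 * d" using that by simp
    finally show ?thesis by simp
  qed
  have A_bound: "\<bar>A X - pi * c\<bar> \<le> 2 * pi * M"
    if X: "X > T" and M: "\<And>t. t \<in> crit_region \<Longrightarrow> Re t = X \<Longrightarrow> norm (f t) \<le> M" for X M
  proof -
    have X0: "X > 0" using X T by simp
    define CI where "CI d = contour_integral (linepath (Complex 0 d) (Complex X d)) f" for d
    have ev: "\<forall>\<^sub>F d in at_right 0. 0 < d \<and> d < 1 \<and> d < X"
      by (rule eventually_mono[OF eventually_at_right_real[of 0 "min 1 X"]]) (use X0 in auto)
    have CI_bound: "\<bar>integral {d..X} (crit_kernel w) + Im (CI d)\<bar> \<le> 2 * pi * M + d * K" if "0 < d \<and> d < 1 \<and> d < X" for d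
      unfolding CI_def
    proof (rule crit_box_contour[OF _ _ _ f_hol _ box_sub])
      show "continuous_on {d..X} (crit_kernel w)" 
        by (rule continuous_on_subset[OF crit_kernel_continuous]) (use that in auto)
      show "norm (f (Complex X y)) \<le> M" if "d \<le> y" "y \<le> 2 * pi - crit_angle X" for y
        using that \<open>0 < d \<and> _\<close> X0 by (intro M) (auto simp: crit_region_def complex_eq_iff)
      show "open (E - {t0})" using E_open by (intro open_delete)
    qed (use that f_curve f_axis f_flat in auto)
    \<comment> \<open>Since om tends to 0, f tends to 0 at the origin, and g = f - c / (t - T) tends
      to c / T. With this value g becomes uniformly continuous on a closed rectangle along the real
      axis.\<close>
    define G where "G t = (if t = 0 then of_real (c / T) else g t)" for t
    define Rc where "Rc = cbox 0 (Complex X 1)"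
    have Rc_sub: "t \<in> crit_region" if "t \<in> Rc" "t \<noteq> 0" for t
      using that crit_angle_bounds[of "Re t"] pi_gt3 by (auto simp: Rc_def in_cbox_complex_iff crit_region_def)
    have G_cont: "continuous_on Rc G"
      unfolding continuous_on_def
    proof
      fix t assume t: "t \<in> Rc"
      show "(G \<longlongrightarrow> G t) (at t within Rc)"
      proof (cases "t = 0")
        case False
        then have "t \<in> E" using Rc_sub[OF t] crit_E by blast
        then have "isCont g t" 
          using g_hol E_open holomorphic_on_imp_continuous_on continuous_on_eq_continuous_at by blast
        then have "(g \<longlongrightarrow> g t) (at t within Rc)" using isContD tendsto_within_subset by blast
        moreover have "\<forall>\<^sub>F x in at t within Rc. g x = G x"
          using eventually_neq_at_within[of 0 t Rc] by eventually_elim (simp add: G_def)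
        ultimately have "(G \<longlongrightarrow> g t) (at t within Rc)" by (rule Lim_transform_eventually)
        then show ?thesis using False by (simp add: G_def[of t])
      next
        case True
        have nz: "\<forall>\<^sub>F x in at 0 within Rc. x \<in> Rc \<and> x \<noteq> 0" by (simp add: eventually_at_filter)
        have "((\<lambda>x. om x) \<longlongrightarrow> 0) (at 0 within Rc)"
          by (rule om_tendsto_0[OF tendsto_ident_at])
             (use nz in eventually_elim, use Rc_sub ph_crit_region_quadrants(1) in blast)
        then have "((\<lambda>x. 2 * om x / (om x ^ 2 - of_real w ^ 2) - of_real c / (x - t0)) \<longlongrightarrow> 
            2 * 0 / (0 ^ 2 - of_real w ^ 2) - of_real c / (0 - t0)) (at 0 within Rc)"
          using w T by (intro tendsto_intros) (auto simp: t0_def)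
        moreover have "\<forall>\<^sub>F x in at 0 within Rc. 2 * om x / (om x ^ 2 - of_real w ^ 2) - of_real c / (x - t0) = G x"
          using nz eventually_neq_at_within[of t0 0 Rc] 
        proof eventually_elim
          case (elim x)
          then show ?case using f_g[of x] by (simp add: G_def f_def h_def)
        qed
        ultimately have "(G \<longlongrightarrow> 2 * 0 / (0 ^ 2 - of_real w ^ 2) - of_real c / (0 - t0)) (at 0 within Rc)"
          by (rule Lim_transform_eventually)
        then show ?thesis unfolding True by (simp add: G_def[of 0] t0_def)
      qed
    qed
    have "compact Rc" by (simp add: Rc_def)
    with G_cont have unif: "uniformly_continuous_on Rc G" by (rule compact_uniformly_continuous)
    have g_re: "Im (g (of_real x)) = 0" if "x > 0" "x \<noteq> T" for x
    proof -
      have "g (of_real x) = f (of_real x) - of_real (c / (x - T))"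
        using f_g[of "of_real x"] that by (simp add: t0_def)
      then show ?thesis using f_real[OF that(1)] by (simp del: of_real_divide)
    qed
    have "isCont g t0" 
      using t0 crit_E g_hol E_open holomorphic_on_imp_continuous_on continuous_on_eq_continuous_at by blast
    then have "isCont (\<lambda>x. g (complex_of_real x)) T"
      unfolding t0_def by (rule isCont_o2[rotated]) simp
    then have "isCont (\<lambda>x. Im (g (complex_of_real x))) T" by (rule continuous_Im)
    then have "((\<lambda>x. Im (g (complex_of_real x))) \<longlongrightarrow> Im (g (of_real T))) (at T)" by (rule isContD)
    moreover have "\<forall>\<^sub>F x in at T. x \<in> {0<..}" using T by (intro eventually_at_in_open') auto
    then have "\<forall>\<^sub>F x in at T. Im (g (complex_of_real x)) = 0"
      using eventually_neq_at_within[of T T UNIV] by eventually_elim (auto intro: g_re)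
    ultimately have g_T: "Im (g (of_real T)) = 0"
      using tendsto_unique[of "at T"] tendsto_eventually by (metis at_neq_bot)
    have G_re: "Im (G (of_real x)) = 0" if "x \<ge> 0" for x
      using g_re[of x] g_T that by (cases "x = T"; cases "x = 0") (auto simp: G_def)
    define gI where "gI d = contour_integral (linepath (Complex 0 d) (Complex X d)) g" for d
    have seg: "t \<in> Rc \<and> Im t = d \<and> 0 \<le> Re t \<and> Re t \<le> X" 
      if "0 < d \<and> d < 1 \<and> d < X" "t \<in> closed_segment (Complex 0 d) (Complex X d)" for d t
      using that by (auto simp: closed_segment_same_Im closed_segment_eq_real_ivl Rc_def in_cbox_complex_iff)
    have seg_E: "closed_segment (Complex 0 d) (Complex X d) \<subseteq> E" if "0 < d \<and> d < 1 \<and> d < X" for d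
    proof
      fix t assume "t \<in> closed_segment (Complex 0 d) (Complex X d)"
      note t = seg[OF that this]
      then have "t \<noteq> 0" using that by auto
      with t show "t \<in> E" using Rc_sub[of t] crit_E by blast
    qed
    have g_ci: "(g has_contour_integral gI d) (linepath (Complex 0 d) (Complex X d))" if "0 < d \<and> d < 1 \<and> d < X" for d
      unfolding gI_def using g_hol E_open seg_E[OF that]
      by (intro has_contour_integral_integral contour_integrable_holomorphic_simple) auto
    \<comment> \<open>The regular part is real on the real axis, so by uniform continuity its
      imaginary part is uniformly small at height d.\<close>
    have gI_lim: "((\<lambda>d. Im (gI d)) \<longlongrightarrow> 0) (at_right 0)"
    proof (rule tendstoI)
      fix e :: real assume e: "e > 0"
      then have "e / (2 * X) > 0" using X0 by simp
      with unif obtain \<eta> where \<eta>: "\<eta> > 0" "\<And>x y. x \<in> Rc \<Longrightarrow> y \<in> Rc \<Longrightarrow> dist y x < \<eta> \<Longrightarrow> dist (G y) (G x) < e / (2 * X)"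
        unfolding uniformly_continuous_on_def by meson
      have "\<forall>\<^sub>F d in at_right 0. d < \<eta>" using \<eta>(1) by (auto simp: eventually_at_right_field)
      with ev show "\<forall>\<^sub>F d in at_right 0. dist (Im (gI d)) 0 < e"
      proof eventually_elim
        case (elim d)
        have "\<bar>Im (gI d)\<bar> \<le> e / 2"
        proof (rule Im_linepath_integral_bound[OF g_ci[OF elim(1)]])
          fix t assume "t \<in> closed_segment (Complex 0 d) (Complex X d)"
          note t = seg[OF elim(1) this]
          have "of_real (Re t) \<in> Rc" using t by (auto simp: Rc_def in_cbox_complex_iff)
          moreover have "dist t (of_real (Re t)) < \<eta>" using t elim by (simp add: dist_norm cmod_def)
          ultimately have "dist (G t) (G (of_real (Re t))) < e / (2 * X)" using t \<eta>(2) by blast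
          then have "\<bar>Im (G t) - Im (G (of_real (Re t)))\<bar> < e / (2 * X)"
            using abs_Im_le_cmod[of "G t - G (of_real (Re t))"] by (simp add: dist_norm)
          moreover have "G t = g t" using t elim by (auto simp: G_def)
          ultimately have "\<bar>Im (g t)\<bar> \<le> e / (2 * X)" 
            using G_re[of "Re t"] t by simp
          moreover have "Complex X d - Complex 0 d = of_real X" by (simp add: complex_eq_iff)
          ultimately show "\<bar>Im (g t * (Complex X d - Complex 0 d))\<bar> \<le> e / 2"
            using X0 by (simp add: abs_mult field_simps)
        qed
        then show ?case using e by simp
      qed
    qed
    \<comment> \<open>The principal part is integrated by a logarithm. As d tends to 0 its argument
      changes from \<pi> at the left end to 0 at the right end, which gives - \<pi> c.\<close>
    have CI_eq: "CI d = gI d + of_real c * (Ln (Complex X d - t0) - Ln (Complex 0 d - t0))" 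
      if d: "0 < d \<and> d < 1 \<and> d < X" for d
    proof -
      have "((\<lambda>t. of_real c / (t - t0)) has_contour_integral 
          (of_real c * Ln (Complex X d - t0) - of_real c * Ln (Complex 0 d - t0))) (linepath (Complex 0 d) (Complex X d))"
        using contour_integral_primitive[of "{t. Im t > 0}" "\<lambda>t. of_real c * Ln (t - t0)" "\<lambda>t. of_real c / (t - t0)"
            "linepath (Complex 0 d) (Complex X d)"] seg[OF d] d
        by (force intro!: derivative_eq_intros simp: t0_def complex_nonpos_Reals_iff divide_inverse)
      from has_contour_integral_add[OF g_ci[OF d] this]
      have "((\<lambda>t. g t + of_real c / (t - t0)) has_contour_integral 
          gI d + of_real c * (Ln (Complex X d - t0) - Ln (Complex 0 d - t0))) (linepath (Complex 0 d) (Complex X d))"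
        by (simp add: algebra_simps)
      then have "(f has_contour_integral 
          gI d + of_real c * (Ln (Complex X d - t0) - Ln (Complex 0 d - t0))) (linepath (Complex 0 d) (Complex X d))"
      proof (rule has_contour_integral_eq)
        fix t assume "t \<in> path_image (linepath (Complex 0 d) (Complex X d))"
        then have "t \<noteq> t0" using seg[OF d, of t] d by (auto simp: t0_def)
        then show "g t + of_real c / (t - t0) = f t" by (simp add: f_g)
      qed
      then show ?thesis unfolding CI_def by (rule contour_integral_unique)
    qed
    have cl: "((\<lambda>d. Complex u (s * d)) \<longlongrightarrow> Complex u 0) (at_right 0)" for u s :: real
      by (rule tendsto_eq_intros refl | simp)+
    have Ln0: "Im (Ln (Complex u 0)) = 0" if "u > 0" for u
      using that by (metis Ln_of_real complex_of_real_def Im_complex_of_real)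
    have L1: "((\<lambda>d. Im (Ln (Complex X d - t0))) \<longlongrightarrow> 0) (at_right 0)"
    proof -
      have "((\<lambda>d. Im (Ln (Complex (X - T) (1 * d)))) \<longlongrightarrow> Im (Ln (Complex (X - T) 0))) (at_right 0)"
        using X by (intro tendsto_intros cl) (auto simp: complex_nonpos_Reals_iff)
      moreover have "Complex X d - t0 = Complex (X - T) (1 * d)" for d by (simp add: t0_def complex_eq_iff)
      moreover have "Im (Ln (Complex (X - T) 0)) = 0" using X by (intro Ln0) simp
      ultimately show ?thesis by simp
    qed
    have L2: "((\<lambda>d. Im (Ln (Complex 0 d - t0))) \<longlongrightarrow> pi) (at_right 0)"
    proof -
      have "((\<lambda>d. Im (Ln (Complex T ((-1) * d))) + pi) \<longlongrightarrow> Im (Ln (Complex T 0)) + pi) (at_right 0)"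
        using T by (intro tendsto_intros cl) (auto simp: complex_nonpos_Reals_iff)
      moreover have "Im (Ln (Complex T 0)) = 0" using T by (rule Ln0)
      ultimately have "((\<lambda>d. Im (Ln (Complex T ((-1) * d))) + pi) \<longlongrightarrow> pi) (at_right 0)" by simp
      moreover have "\<forall>\<^sub>F d in at_right 0. Im (Ln (Complex T ((-1) * d))) + pi = Im (Ln (Complex 0 d - t0))"
        using ev
      proof eventually_elim
        case (elim d)
        have "Complex 0 d - t0 = - Complex T ((-1) * d)" by (simp add: t0_def complex_eq_iff)
        moreover have "Ln (- Complex T ((-1) * d)) = Ln (Complex T ((-1) * d)) + \<i> * pi"
          using elim T by (subst Ln_minus) (auto simp: complex_eq_iff)
        ultimately show ?case by simp
      qed
      ultimately show ?thesis by (rule Lim_transform_eventually)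
    qed
    have "((\<lambda>d. Im (gI d) + c * (Im (Ln (Complex X d - t0)) - Im (Ln (Complex 0 d - t0)))) \<longlongrightarrow> 0 + c * (0 - pi)) (at_right 0)"
      by (intro tendsto_intros gI_lim L1 L2)
    moreover have "\<forall>\<^sub>F d in at_right 0. Im (gI d) + c * (Im (Ln (Complex X d - t0)) - Im (Ln (Complex 0 d - t0))) = Im (CI d)"
      using ev by eventually_elim (simp add: CI_eq)
    ultimately have CI_lim: "((\<lambda>d. Im (CI d)) \<longlongrightarrow> - (pi * c)) (at_right 0)"
      by (simp add: Lim_transform_eventually mult.commute)
    have "((\<lambda>d. A X - integral {d..X} (crit_kernel w)) \<longlongrightarrow> 0) (at_right 0)"
    proof (rule Lim_null_comparison)
      show "\<forall>\<^sub>F d in at_right 0. norm (A X - integral {d..X} (crit_kernel w)) \<le> 2 * d"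
        using ev by eventually_elim (use A_diff in auto)
      show "((\<lambda>d. 2 * d) \<longlongrightarrow> 0) (at_right (0::real))" by (rule tendsto_eq_intros refl | simp)+
    qed
    from tendsto_diff[OF tendsto_const[of "A X"] this]
    have I_lim: "((\<lambda>d. integral {d..X} (crit_kernel w)) \<longlongrightarrow> A X) (at_right 0)" by simp
    have "((\<lambda>d. \<bar>integral {d..X} (crit_kernel w) + Im (CI d)\<bar>) \<longlongrightarrow> \<bar>A X + - (pi * c)\<bar>) (at_right 0)"
      by (intro tendsto_intros I_lim CI_lim)
    moreover have "((\<lambda>d. 2 * pi * M + d * K) \<longlongrightarrow> 2 * pi * M + 0 * K) (at_right 0)" by (intro tendsto_intros)
    ultimately have "\<bar>A X + - (pi * c)\<bar> \<le> 2 * pi * M + 0 * K"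
      by (intro tendsto_le[of "at_right 0" "\<lambda>d. 2 * pi * M + d * K"]) (use ev CI_bound in \<open>auto elim!: eventually_mono\<close>)
    then show ?thesis by simp
  qed
  have "(A \<longlongrightarrow> pi * c) at_top"
  proof (rule tendstoI)
    fix e :: real assume e: "e > 0"
    then have "e / (4 * pi) > 0" by simp
    from f_right[OF this] eventually_gt_at_top[of T]
    show "\<forall>\<^sub>F X in at_top. dist (A X) (pi * c) < e"
    proof eventually_elim
      case (elim X)
      then have "\<bar>A X - pi * c\<bar> \<le> 2 * pi * (e / (4 * pi))" by (intro A_bound) auto
      then show ?case using e by (simp add: dist_norm)
    qed
  qed
  then have "has_bochner_integral lborel k0 (pi * c)"
    unfolding A_def
  proof (intro has_bochner_integral_monotone_convergence_at_top)
    show "integrable lborel (\<lambda>a. k0 a * indicator {..y} a)" for y unfolding k0_eq by (rule k0_int)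
  qed (use k0_b in auto)
  then show ?thesis by (simp add: k0_def[abs_def] c_def)
qed

section \<open>Stieltjes transforms of finite measures\<close>

text \<open>For cos \<beta> < 0 the minimum over r is sin(\<beta>)^2 = (1 + cos \<beta>)(1 - cos
  \<beta>), and 1 - cos \<beta> >= 1/2. Unlike |sin \<beta>|, the bound does not degenerate at
  \<beta> = 0.\<close>

lemma norm_one_plus_cis_ge:
  fixes r \<beta> :: real assumes "r \<ge> 0"
  shows "(cos (\<beta> / 2))\<^sup>2 \<le> (norm (1 + of_real r * cis \<beta>))\<^sup>2"
proof -
  have n: "(norm (1 + of_real r * cis \<beta>))\<^sup>2 = 1 + 2 * r * cos \<beta> + r\<^sup>2"
  proof -
    have "(1 + r * c)\<^sup>2 + (r * s)\<^sup>2 = 1 + 2 * r * c + r\<^sup>2" if "s\<^sup>2 + c\<^sup>2 = 1" for c s :: real using that by algebra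
    then show ?thesis unfolding cmod_power2 by simp
  qed
  have "cos \<beta> = 2 * (cos (\<beta> / 2))\<^sup>2 - 1" using cos_double_cos[of "\<beta> / 2"] by simp
  then have h: "(cos (\<beta> / 2))\<^sup>2 = (1 + cos \<beta>) / 2" by simp
  have c: "- 1 \<le> cos \<beta>" "cos \<beta> \<le> 1" by simp_all
  show ?thesis
  proof (cases "cos \<beta> \<ge> 0")
    case True
    then have "0 \<le> 2 * r * cos \<beta>" using assms by simp
    have "(1 + c) / 2 \<le> 1 + p + q" if "0 \<le> p" "c \<le> 1" "0 \<le> q" for c p q :: real using that by simp
    from this[OF \<open>0 \<le> 2 * r * cos \<beta>\<close> c(2) zero_le_power2[of r]] show ?thesis unfolding n h .
  next
    case False
    have "0 \<le> (1 + cos \<beta>) * (1 / 2 - cos \<beta>)" by (intro mult_nonneg_nonneg) (use False c in linarith)+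
    moreover have "1 + 2 * r * cos \<beta> + r\<^sup>2 = (r + cos \<beta>)\<^sup>2 + (1 + cos \<beta>) * (1 / 2 - cos \<beta>) + (1 + cos \<beta>) / 2"
      by (simp add: power2_eq_square field_simps)
    ultimately show ?thesis unfolding n h by simp
  qed
qed

definition cut_plane :: "complex set" where "cut_plane = - (complex_of_real ` {..- 1})"

lemma open_cut_plane: "open cut_plane"
proof -
  have "complex_of_real ` {..- 1} = {z. Im z = 0 \<and> Re z \<le> - 1}"
    by (auto simp: image_iff complex_eq_iff)
  moreover have "closed {z. Im z = 0 \<and> Re z \<le> - 1}"
    by (intro closed_Collect_conj closed_Collect_eq closed_Collect_le continuous_intros)
  ultimately show ?thesis by (simp add: cut_plane_def open_Compl)
qed

text \<open>With y = 1/x the parameter runs through the compact interval [0, 1], on which 1 + z y is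
  continuous and has no zero.\<close>

lemma cut_plane_lower_bound:
  assumes "z \<in> cut_plane"
  obtains d where "d > 0" "\<And>x. x \<ge> 1 \<Longrightarrow> d \<le> norm (1 + z / of_real x)"
proof -
  define A where "A = (\<lambda>y. norm (1 + z * of_real y)) ` {0..1}"
  have "compact A" unfolding A_def by (intro compact_continuous_image continuous_intros) auto
  moreover have "A \<noteq> {}" by (auto simp: A_def)
  ultimately obtain d where d: "d \<in> A" "\<And>y. y \<in> A \<Longrightarrow> d \<le> y" using compact_attains_inf by metis
  then obtain y0 where y0: "d = norm (1 + z * of_real y0)" "0 \<le> y0" "y0 \<le> 1" by (auto simp: A_def)
  have "1 + z * of_real y0 \<noteq> 0"
  proof
    assume eq: "1 + z * of_real y0 = 0"
    then have "y0 \<noteq> 0" by auto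
    then have "z = of_real (- 1 / y0)" using eq by (simp add: field_simps add_eq_0_iff)
    have "- 1 / y0 \<le> - 1" using y0 \<open>y0 \<noteq> 0\<close> by (simp add: field_simps)
    then have "z \<in> complex_of_real ` {..- 1}" using \<open>z = _\<close> by (intro image_eqI[of _ _ "- 1 / y0"]) simp_all
    then show False using assms by (simp add: cut_plane_def)
  qed
  then have "d > 0" by (simp add: y0)
  moreover have "d \<le> norm (1 + z / of_real x)" if "x \<ge> 1" for x
    using that by (intro d(2)) (auto simp: A_def divide_inverse inverse_le_1_iff intro!: image_eqI[of _ _ "inverse x"])
  ultimately show ?thesis using that by blast
qed

locale stieltjes = finite_measure M for M :: "real measure" +
  fixes X :: "real \<Rightarrow> real"
  assumes X_meas [measurable]: "X \<in> borel_measurable M" and X_ge: "\<And>a. X a \<ge> 1"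
begin

definition wt :: "nat \<Rightarrow> real \<Rightarrow> real" where "wt m a = 1 / X a ^ m"

text \<open>The index m makes room for the tails of the geometric series: the remainder of
  \<open>St 0\<close> after m terms is (- z)^m times \<open>St m\<close>.\<close>

definition St :: "nat \<Rightarrow> complex \<Rightarrow> complex" where
  "St m z = (\<integral>a. of_real (wt m a) * (1 / (1 + z / of_real (X a))) \<partial>M)"

definition moment :: "nat \<Rightarrow> real" where "moment m = (\<integral>a. wt m a \<partial>M)"

lemma X_pos: "X a > 0" using X_ge[of a] by simp

lemma wt_pos: "0 < wt m a" and wt_le_1: "wt m a \<le> 1" and wt_Suc: "wt (Suc m) a = wt m a / X a"
  using X_ge[of a] X_pos[of a] by (auto simp: wt_def divide_simps one_le_power)

lemma wt_measurable [measurable]: "wt m \<in> borel_measurable M"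
  unfolding wt_def[abs_def] by measurable

lemma moment_integrable: "integrable M (wt m)"
  by (rule integrable_const_bound[of _ 1]) (auto simp: wt_le_1 less_imp_le[OF wt_pos] abs_of_pos[OF wt_pos])

lemma moment_nonneg: "moment m \<ge> 0"
  unfolding moment_def by (intro Bochner_Integration.integral_nonneg less_imp_le wt_pos)

lemma norm_weighted_le:
  assumes "norm z \<le> B" shows "norm (complex_of_real (wt m a) * z) \<le> B * wt m a"
  using mult_left_mono[OF assms, of "wt m a"] wt_pos[of m a] by (simp add: norm_mult mult.commute)

lemma weighted_integrable:
  fixes f :: "real \<Rightarrow> complex"
  assumes [measurable]: "f \<in> borel_measurable M" and B: "\<And>a. norm (f a) \<le> B"
  shows "integrable M (\<lambda>a. of_real (wt m a) * f a)"
proof (rule Bochner_Integration.integrable_bound[of M "\<lambda>a. B * wt m a"])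
  have "B \<ge> 0" using B[of 0] norm_ge_zero order_trans by blast
  then show "AE a in M. norm (of_real (wt m a) * f a) \<le> norm (B * wt m a)"
    using norm_weighted_le[OF B] wt_pos by (intro AE_I2) (simp add: abs_mult abs_of_pos)
qed (auto intro: integrable_mult_right moment_integrable)

lemma weighted_bound:
  fixes f :: "real \<Rightarrow> complex"
  assumes "f \<in> borel_measurable M" "\<And>a. norm (f a) \<le> B"
  shows "norm (\<integral>a. of_real (wt m a) * f a \<partial>M) \<le> B * moment m"
proof -
  have "norm (\<integral>a. of_real (wt m a) * f a \<partial>M) \<le> (\<integral>a. B * wt m a \<partial>M)"
    by (rule Bochner_Integration.integral_norm_bound_integral[OF weighted_integrable[OF assms]
        integrable_mult_right[OF moment_integrable]]) (rule norm_weighted_le[OF assms(2)])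
  then show ?thesis by (simp add: moment_def)
qed

lemma cut_plane_kernel:
  assumes "z \<in> cut_plane"
  obtains d where "d > 0" "\<And>a. d \<le> norm (1 + z / of_real (X a))" "\<And>a. norm (1 / (1 + z / of_real (X a))) \<le> 1 / d"
proof -
  obtain d where d: "d > 0" "\<And>x. x \<ge> 1 \<Longrightarrow> d \<le> norm (1 + z / of_real x)" by (rule cut_plane_lower_bound[OF assms], rule that)
  have le: "d \<le> norm (1 + z / of_real (X a))" for a using d(2)[OF X_ge] .
  then have "norm (1 / (1 + z / of_real (X a))) \<le> 1 / d" for a
    unfolding norm_divide norm_one using d(1) le[of a] by (intro frac_le) auto
  with d(1) le show ?thesis using that by blast
qed

lemma St_integrable:
  assumes "z \<in> cut_plane" shows "integrable M (\<lambda>a. of_real (wt m a) * (1 / (1 + z / of_real (X a))))"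
proof -
  obtain d where d: "d > 0" "\<And>a. d \<le> norm (1 + z / of_real (X a))" "\<And>a. norm (1 / (1 + z / of_real (X a))) \<le> 1 / d"
    by (rule cut_plane_kernel[OF assms], rule that)
  have "(\<lambda>a. 1 / (1 + z / complex_of_real (X a))) \<in> borel_measurable M" by measurable
  from weighted_integrable[OF this d(3)] show ?thesis .
qed

lemma St_bound:
  assumes "\<And>a. norm (1 / (1 + z / of_real (X a))) \<le> B" shows "norm (St m z) \<le> B * moment m"
proof -
  have "(\<lambda>a. 1 / (1 + z / complex_of_real (X a))) \<in> borel_measurable M" by measurable
  from weighted_bound[OF this assms, of m] show ?thesis unfolding St_def .
qed

text \<open>One step of the geometric series, 1 / (1 + y) = 1 - y / (1 + y) with y = z / X.\<close>

lemma St_Suc: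
  assumes "z \<in> cut_plane" shows "St m z = of_real (moment m) - z * St (Suc m) z"
proof -
  obtain d where d: "d > 0" "\<And>a. d \<le> norm (1 + z / of_real (X a))" "\<And>a. norm (1 / (1 + z / of_real (X a))) \<le> 1 / d"
    by (rule cut_plane_kernel[OF assms], rule that)
  have eq: "of_real (wt m a) * (1 / (1 + z / of_real (X a))) =
      of_real (wt m a) - z * (of_real (wt (Suc m) a) * (1 / (1 + z / of_real (X a))))" for a
  proof -
    have nz: "1 + z / of_real (X a) \<noteq> 0" using d(1) d(2)[of a] by auto
    have "c * (1 / (1 + z / x)) = c - z * (c / x * (1 / (1 + z / x)))" if "1 + z / x \<noteq> 0" for c x :: complex
    proof -
      define k where "k = 1 / (1 + z / x)"
      have "k * (1 + z / x) = 1" using that by (simp add: k_def)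
      then have "k = 1 - z / x * k" by (simp add: algebra_simps)
      then have "c * k = c * (1 - z / x * k)" by (rule arg_cong)
      also have "\<dots> = c - z * (c / x * k)" by (simp add: divide_inverse right_diff_distrib)
      finally show ?thesis unfolding k_def .
    qed
    from this[OF nz] show ?thesis unfolding wt_Suc of_real_divide .
  qed
  have "St m z = (\<integral>a. of_real (wt m a) \<partial>M) - (\<integral>a. z * (of_real (wt (Suc m) a) * (1 / (1 + z / of_real (X a)))) \<partial>M)"
    unfolding St_def eq
    by (intro Bochner_Integration.integral_diff integrable_mult_right St_integrable[OF assms] integrable_of_real moment_integrable)
  also have "\<dots> = of_real (moment m) - z * St (Suc m) z"
    unfolding St_def moment_def by (simp only: integral_mult_right_zero integral_complex_of_real)
  finally show ?thesis .
qed

lemma St_expand: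
  assumes "z \<in> cut_plane"
  shows "St 0 z = (\<Sum>n<N. (- z) ^ n * of_real (moment n)) + (- z) ^ N * St N z"
proof (induction N)
  case (Suc N)
  have "(- z) ^ N * St N z = (- z) ^ N * (of_real (moment N) - z * St (Suc N) z)"
    by (simp only: St_Suc[OF assms, of N])
  then show ?case unfolding Suc.IH by (simp add: right_diff_distrib)
qed simp

text \<open>Differentiation under the integral by an explicit second-order remainder: the error of
  the difference quotient is the integral of \<open>r\<close>, which is at most 2 |h| / d^3
  uniformly in a once |h| <= d/2.\<close>

lemma St_has_derivative:
  assumes z: "z \<in> cut_plane"
  shows "(St m has_field_derivative
           (- (\<integral>a. of_real (wt m a) * (1 / of_real (X a) / (1 + z / of_real (X a))\<^sup>2) \<partial>M))) (at z)"
proof -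
  obtain d where d: "d > 0" and lb: "\<And>a. d \<le> norm (1 + z / of_real (X a))" 
    and "\<And>a. norm (1 / (1 + z / of_real (X a))) \<le> 1 / d" by (rule cut_plane_kernel[OF z], rule that)
  define q where "q a = 1 / complex_of_real (X a) / (1 + z / of_real (X a))\<^sup>2" for a
  define D where "D = (\<integral>a. of_real (wt m a) * q a \<partial>M)"
  obtain e where e: "e > 0" "ball z e \<subseteq> cut_plane" using open_cut_plane z openE by blast
  have inv1: "norm (1 / complex_of_real (X a)) \<le> 1" for a using X_ge[of a] by (simp add: norm_divide)
  have lb2: "norm (1 + (z + h) / of_real (X a)) \<ge> d / 2" if "norm h \<le> d / 2" for a h
  proof -
    have "norm (h / of_real (X a)) \<le> norm h"
      using mult_left_mono[OF inv1[of a], of "norm h"] by (simp add: norm_divide)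
    moreover have "norm (1 + z / of_real (X a)) - norm (h / of_real (X a)) \<le> norm (1 + z / of_real (X a) + h / of_real (X a))"
      by (rule norm_diff_ineq)
    moreover have "1 + (z + h) / of_real (X a) = 1 + z / of_real (X a) + h / of_real (X a)" by (simp add: add_divide_distrib)
    moreover have "d / 2 \<le> N" if "p \<le> q" "n - p \<le> N" "d \<le> n" "q \<le> d / 2" for n N p q using that by linarith
    ultimately show ?thesis using lb[of a] that by metis
  qed
  have q_meas [measurable]: "q \<in> borel_measurable M" unfolding q_def[abs_def] by measurable
  have q_b: "norm (q a) \<le> 1 / d\<^sup>2" for a
    unfolding q_def norm_divide[of "1 / of_real (X a)"] norm_power
    using inv1[of a] lb[of a] d by (intro frac_le power_mono) auto
  define K where "K = 2 / d ^ 3 * moment m"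
  have bound: "norm ((St m (z + h) - St m z) / h + D) \<le> K * norm h" if h: "h \<noteq> 0" "norm h < min e (d / 2)" for h
  proof -
    have zh: "z + h \<in> cut_plane" using h e by (auto simp: dist_norm subset_iff)
    define r where "r a = h * (1 / of_real (X a) ^ 2 / ((1 + (z + h) / of_real (X a)) * (1 + z / of_real (X a))\<^sup>2))" for a
    have r_meas: "r \<in> borel_measurable M" unfolding r_def[abs_def] by measurable
    have r_b: "norm (r a) \<le> norm h * (2 / d ^ 3)" for a
    proof -
      have X2: "norm (1 / complex_of_real (X a) ^ 2) \<le> 1"
        using power_mono[OF inv1[of a], of 2] by (simp add: norm_divide norm_power power_divide)
      have "d / 2 * d\<^sup>2 \<le> norm (1 + (z + h) / of_real (X a)) * norm (1 + z / of_real (X a)) ^ 2"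
        using lb[of a] lb2[of h a] h d by (intro mult_mono power_mono) auto
      then have "norm (1 / of_real (X a) ^ 2 / ((1 + (z + h) / of_real (X a)) * (1 + z / of_real (X a))\<^sup>2)) \<le> 1 / (d / 2 * d\<^sup>2)"
        unfolding norm_divide[of "1 / of_real (X a) ^ 2"] norm_mult norm_power using X2 d by (intro frac_le) auto
      then have "norm (r a) \<le> norm h * (1 / (d / 2 * d\<^sup>2))" unfolding r_def norm_mult[of h] by (intro mult_left_mono) auto
      then show ?thesis by (simp add: power2_eq_square power3_eq_cube)
    qed
    have eq: "of_real (wt m a) * (1 / (1 + (z + h) / of_real (X a))) = of_real (wt m a) * (1 / (1 + z / of_real (X a)))
        - h * (of_real (wt m a) * q a) + h * (of_real (wt m a) * r a)" for a
    proof -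
      define x A B c where "x = complex_of_real (X a)" and "A = 1 + (z + h) / x" and "B = 1 + z / x" and "c = complex_of_real (wt m a)"
      have nz: "x \<noteq> 0" "A \<noteq> 0" "B \<noteq> 0" 
        using X_pos[of a] lb[of a] lb2[of h a] h d by (auto simp: x_def A_def B_def)
      have hAB: "h = (A - B) * x" using nz(1) by (simp add: A_def B_def add_divide_distrib)
      have "c * (1 / A) = c * (1 / B) - h * (c * (1 / x / B\<^sup>2)) + h * (c * (h * (1 / x ^ 2 / (A * B\<^sup>2))))"
        unfolding hAB using nz by (simp add: divide_simps) (simp add: algebra_simps power2_eq_square)
      then show ?thesis unfolding r_def q_def x_def A_def B_def c_def .
    qed
    have "St m (z + h) = St m z - h * D + h * (\<integral>a. of_real (wt m a) * r a \<partial>M)"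
    proof -
      have i1: "integrable M (\<lambda>a. of_real (wt m a) * (1 / (1 + z / of_real (X a))))" by (rule St_integrable[OF z])
      have i2: "integrable M (\<lambda>a. h * (of_real (wt m a) * q a))"
        by (intro integrable_mult_right weighted_integrable[OF q_meas q_b])
      have i3: "integrable M (\<lambda>a. h * (of_real (wt m a) * r a))"
        by (intro integrable_mult_right weighted_integrable[OF r_meas r_b])
      show ?thesis
        unfolding St_def[of m "z + h"] eq D_def
        unfolding Bochner_Integration.integral_add[OF Bochner_Integration.integrable_diff[OF i1 i2] i3]
          Bochner_Integration.integral_diff[OF i1 i2]
        by (simp only: integral_mult_right_zero St_def)
    qed
    then have "(St m (z + h) - St m z) / h + D = (\<integral>a. of_real (wt m a) * r a \<partial>M)"
      using h by (simp add: field_simps)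
    then show ?thesis using weighted_bound[OF r_meas r_b, of m] by (simp add: K_def mult_ac)
  qed
  have "((\<lambda>h. (St m (z + h) - St m z) / h - - D) \<longlongrightarrow> 0) (at 0)"
  proof (rule Lim_null_comparison)
    show "\<forall>\<^sub>F h in at 0. norm ((St m (z + h) - St m z) / h - - D) \<le> K * norm h"
      unfolding eventually_at using bound e d by (intro exI[of _ "min e (d / 2)"]) auto
    show "((\<lambda>h::complex. K * norm h) \<longlongrightarrow> 0) (at 0)"
      by (intro tendsto_mult_right_zero tendsto_norm_zero tendsto_ident_at)
  qed
  then have "((\<lambda>h. (St m (z + h) - St m z) / h) \<longlongrightarrow> - D) (at 0)" by (subst Lim_null)
  then show ?thesis unfolding DERIV_def D_def q_def .
qed

lemma St_holomorphic: "St m holomorphic_on cut_plane"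
  unfolding holomorphic_on_open[OF open_cut_plane] using St_has_derivative by blast

lemma St_cnj: "St m (cnj z) = cnj (St m z)"
proof -
  have "St m (cnj z) = (\<integral>a. cnj (of_real (wt m a) * (1 / (1 + z / of_real (X a)))) \<partial>M)"
    unfolding St_def by (intro Bochner_Integration.integral_cong) auto
  also have "\<dots> = cnj (St m z)" unfolding St_def by (rule Bochner_Integration.integral_cnj)
  finally show ?thesis .
qed

lemma St_of_real: "St m (of_real x) = of_real (\<integral>a. wt m a * (1 / (1 + x / X a)) \<partial>M)"
  unfolding St_def integral_complex_of_real[symmetric] by (intro Bochner_Integration.integral_cong) auto

end

section \<open>The measure of the critical curve\<close>

text \<open>The locale asks for values >= 1 at every a, hence the default 1 for a <= 0, where the
  density of the measure is zero.\<close>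

definition crit_x :: "real \<Rightarrow> real" where "crit_x a = (if a > 0 then crit_rho a ^ 2 else 1)"

text \<open>The density for which weight / (1 + w^2 / \<open>crit_x\<close>) is
  \<open>crit_kernel\<close> / \<pi>, with \<open>crit_x\<close> =
  \<open>crit_rho\<close>^2.\<close>

definition crit_weight :: "real \<Rightarrow> real" where
  "crit_weight a = indicator {0<..} a * (2 / (pi * crit_rho a))"

definition crit_measure :: "real measure" where
  "crit_measure = density lborel (\<lambda>a. ennreal (crit_weight a))"

lemma crit_weight_measurable [measurable]: 
  "crit_weight \<in> borel_measurable borel"
proof -
  have "continuous_on {0<..} (\<lambda>a. 2 / (pi * crit_rho a))"
    using crit_rho_ge by (intro continuous_intros crit_rho_continuous) force
  from borel_measurable_continuous_on_indicator[OF _ this] show ?thesis by (simp add: crit_weight_def[abs_def])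
qed

lemma crit_x_measurable [measurable]: "crit_x \<in> borel_measurable borel"
proof -
  have "(\<lambda>a. indicator {0<..} a *\<^sub>R crit_rho a ^ 2) \<in> borel_measurable borel"
    by (intro borel_measurable_continuous_on_indicator continuous_intros crit_rho_continuous) simp
  then have "(\<lambda>a. if a \<in> {0<..} then indicator {0<..} a *\<^sub>R crit_rho a ^ 2 else 1) \<in> borel_measurable borel"
    by (intro measurable_If_set) auto
  moreover have "(\<lambda>a. if a \<in> {0<..} then indicator {0<..} a *\<^sub>R crit_rho a ^ 2 else 1) = crit_x"
    by (auto simp: crit_x_def)
  ultimately show ?thesis by simp
qed

lemma crit_weight_nonneg: "0 \<le> crit_weight a"
  using crit_rho_ge[of a] by (auto simp: indicator_def crit_weight_def)

text \<open>Finiteness of the mass comes from \<open>stieltjes_real\<close> at the single point T =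
  1: since \<open>crit_rho\<close> >= 1, one has r^2 + w^2 <= (1 + w^2) r^2, so the weight is
  dominated by a multiple of the kernel.\<close>

lemma crit_weight_integrable: "integrable lborel crit_weight"
proof -
  define w where "w = root 3 (6 * (sinh 1 - 1 :: real))"
  have int: "integrable lborel (\<lambda>a. (1 + w ^ 2) / pi * (indicator {0<..} a * crit_kernel w a))"
    using stieltjes_real[of 1] by (intro integrable_mult_right) (auto simp: w_def has_bochner_integral_iff)
  show ?thesis
  proof (rule Bochner_Integration.integrable_bound[OF int])
    show "AE a in lborel. norm (crit_weight a)
       \<le> norm ((1 + w ^ 2) / pi * (indicator {0<..} a * crit_kernel w a))"
    proof (rule AE_I2)
      fix a :: real
      show "norm (crit_weight a) \<le> norm ((1 + w ^ 2) / pi * (indicator {0<..} a * crit_kernel w a))"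
      proof (cases "a > 0")
        case True
        define r where "r = crit_rho a"
        have r: "r \<ge> 1" using crit_rho_ge[OF True] by (simp add: r_def)
        have rw: "r\<^sup>2 + w\<^sup>2 > 0" using r by (simp add: add_pos_nonneg)
        have "w\<^sup>2 * 1 \<le> w\<^sup>2 * r\<^sup>2" using r by (intro mult_left_mono) auto
        then have le: "r\<^sup>2 + w\<^sup>2 \<le> (1 + w\<^sup>2) * r\<^sup>2" by (simp add: algebra_simps)
        have "2 / (pi * r) = 2 * r / pi * (1 / r\<^sup>2)" using r by (simp add: power2_eq_square)
        also have "1 / r\<^sup>2 \<le> (1 + w\<^sup>2) / (r\<^sup>2 + w\<^sup>2)" using le rw r by (simp add: pos_le_divide_eq pos_divide_le_eq)
        then have "2 * r / pi * (1 / r\<^sup>2) \<le> 2 * r / pi * ((1 + w\<^sup>2) / (r\<^sup>2 + w\<^sup>2))" using r by (intro mult_left_mono) auto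
        also have "\<dots> = (1 + w ^ 2) / pi * crit_kernel w a" by (simp add: crit_kernel_def r_def)
        finally have "crit_weight a \<le> (1 + w ^ 2) / pi * crit_kernel w a" using True by (simp add: crit_weight_def r_def)
        then show ?thesis using True crit_weight_nonneg[of a] crit_kernel_bounds(1)[OF True, of w] by (simp add: abs_mult)
      qed (simp add: crit_weight_def)
    qed
  qed measurable
qed

interpretation crit: stieltjes crit_measure crit_x
proof (intro stieltjes.intro finite_measureI stieltjes_axioms.intro)
  have "emeasure crit_measure (space crit_measure) = (\<integral>\<^sup>+a. ennreal (crit_weight a) \<partial>lborel)"
    unfolding crit_measure_def by (simp add: emeasure_density)
  also have "\<dots> = (\<integral>\<^sup>+a. ennreal (norm (crit_weight a)) \<partial>lborel)" using crit_weight_nonneg by simp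
  also have "\<dots> < \<infinity>" using crit_weight_integrable unfolding integrable_iff_bounded by blast
  finally show "emeasure crit_measure (space crit_measure) \<noteq> \<infinity>" by simp
  show "crit_x \<in> borel_measurable crit_measure" by (simp add: crit_measure_def)
  show "crit_x a \<ge> 1" for a using crit_rho_ge[of a] by (auto simp: crit_x_def)
qed

definition crit_transform :: "complex \<Rightarrow> complex" where "crit_transform = crit.St 0"

text \<open>So the transform at \<open>w\<^sup>2\<close> is \<open>dt/dw\<close>, where \<open>w\<^sup>3 = 6 (sinh t - t)\<close>.\<close>

theorem crit_transform_real:
  assumes "T > 0"
  defines "w \<equiv> root 3 (6 * (sinh T - T))"
  shows "crit_transform (of_real (w ^ 2)) = of_real (w ^ 2 / (2 * (cosh T - 1)))"
proof -
  have "(\<integral>a. crit.wt 0 a * (1 / (1 + w ^ 2 / crit_x a)) \<partial>crit_measure)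
      = (\<integral>a. crit_weight a * (1 / (1 + w ^ 2 / crit_x a)) \<partial>lborel)"
    unfolding crit_measure_def using crit_weight_nonneg by (subst integral_density) (auto simp: crit.wt_def)
  also have "\<dots> = (\<integral>a. 1 / pi * (indicator {0<..} a * crit_kernel w a) \<partial>lborel)"
  proof (rule Bochner_Integration.integral_cong[OF refl])
    fix a :: real
    show "crit_weight a * (1 / (1 + w ^ 2 / crit_x a)) = 1 / pi * (indicator {0<..} a * crit_kernel w a)"
    proof (cases "a > 0")
      case True
      define r where "r = crit_rho a"
      have r: "r \<ge> 1" using crit_rho_ge[OF True] by (simp add: r_def)
      have rw: "r\<^sup>2 + w\<^sup>2 > 0" using r by (simp add: add_pos_nonneg)
      have "1 + w\<^sup>2 / r\<^sup>2 = (r\<^sup>2 + w\<^sup>2) / r\<^sup>2" using r by (simp add: add_divide_distrib)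
      then have "2 / (pi * r) * (1 / (1 + w\<^sup>2 / r\<^sup>2)) = 2 / (pi * r) * (r\<^sup>2 / (r\<^sup>2 + w\<^sup>2))" by simp
      also have "\<dots> = 1 / pi * (2 * r / (r\<^sup>2 + w\<^sup>2))" using r by (simp add: power2_eq_square)
      finally show ?thesis using True by (simp add: crit_x_def crit_kernel_def crit_weight_def r_def)
    qed (simp add: crit_weight_def)
  qed
  also have "\<dots> = w ^ 2 / (2 * (cosh T - 1))"
    using stieltjes_real[OF assms(1)] by (simp add: has_bochner_integral_iff w_def)
  finally show ?thesis unfolding crit_transform_def by (subst crit.St_of_real) simp_all
qed

section \<open>The coefficients as moments\<close>

definition phase_quot :: "complex \<Rightarrow> complex" where "phase_quot t = (if t = 0 then 1 / 6 else (sinh t - t) / t ^ 3)"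

lemma phase_quot_holomorphic: "phase_quot holomorphic_on ball 0 r"
proof (rule power_series_holomorphic)
  define c :: "nat \<Rightarrow> complex" where "c n = (if even n then 0 else 1 / fact n)" for n
  fix t assume "t \<in> ball (0::complex) r"
  have "(\<lambda>n. if even n then 0 else t ^ n /\<^sub>R fact n) sums sinh t" by (rule sinh_converges)
  moreover have "(if even n then 0 else t ^ n /\<^sub>R fact n) = c n * t ^ n" for n
    by (simp add: c_def scaleR_conv_of_real divide_inverse)
  ultimately have "(\<lambda>n. c n * t ^ n) sums sinh t" by simp
  from sums_split_initial_segment[OF this, of 3]
  have s: "(\<lambda>n. c (n + 3) * t ^ (n + 3)) sums (sinh t - t)"
    by (simp add: c_def eval_nat_numeral)
  show "(\<lambda>n. c (n + 3) * (t - 0) ^ n) sums phase_quot t"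
  proof (cases "t = 0")
    case True
    then show ?thesis using powser_sums_zero[of "\<lambda>n. c (n + 3)"] by (simp add: phase_quot_def c_def fact_numeral)
  next
    case False
    then show ?thesis using sums_mult[OF s, of "1 / t ^ 3"] by (simp add: phase_quot_def power_add)
  qed
qed

text \<open>Near 0 a cube root of 6 (sinh t - t) is needed that is holomorphic on a full disc, which
  \<open>om\<close> is not. Factoring out t^3 leaves a function close to 1; on the positive axis the
  result agrees with \<open>om\<close>.\<close>

definition phi_p :: "complex \<Rightarrow> complex" where "phi_p t = exp (Ln (6 * phase_quot t) / 3)"
definition phi :: "complex \<Rightarrow> complex" where "phi t = t * phi_p t"

lemma phi_cube:
  assumes "phase_quot t \<noteq> 0" shows "phi t ^ 3 = 6 * (sinh t - t)"
proof -
  have "exp (v / 3) ^ 3 = exp v" for v :: complex using exp_of_nat_mult[of 3 "v / 3"] by simp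
  then have "phi t ^ 3 = t ^ 3 * (6 * phase_quot t)" using assms by (simp add: phi_def phi_p_def power_mult_distrib)
  then show ?thesis by (simp add: phase_quot_def)
qed

lemma phi_of_real:
  assumes "T > 0" shows "phi (of_real T) = of_real (root 3 (6 * (sinh T - T)))"
proof -
  define k where "k = (sinh T - T) / T ^ 3"
  have k: "k > 0" using sinh_gt_self[OF assms] assms by (simp add: k_def)
  have phase_quot: "phase_quot (of_real T) = of_real k" 
    using assms ph_of_real[of T] by (simp add: phase_quot_def k_def ph_def)
  have phi: "phi (of_real T) = of_real (T * exp (ln (6 * k) / 3))"
    using k Ln_of_real[of "6 * k"] by (simp add: phi_def phi_p_def phase_quot flip: exp_of_real)
  have "exp (v / 3) ^ 3 = exp v" for v :: real using exp_of_nat_mult[of 3 "v / 3"] by simp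
  then have "(T * exp (ln (6 * k) / 3)) ^ 3 = T ^ 3 * (6 * k)" using k by (simp add: power_mult_distrib)
  also have "\<dots> = 6 * (sinh T - T)" using assms by (simp add: k_def)
  finally have "root 3 (6 * (sinh T - T)) = root 3 ((T * exp (ln (6 * k) / 3)) ^ 3)" by simp
  also have "\<dots> = T * exp (ln (6 * k) / 3)" using assms by (intro real_root_power_cancel) auto
  finally show ?thesis by (simp add: phi)
qed

lemma phi_disc:
  obtains r where "0 < r" "r < 1" "\<And>t. t \<in> ball 0 r \<Longrightarrow> Re (6 * phase_quot t) > 0" 
    "phi_p holomorphic_on ball 0 r" "phi holomorphic_on ball 0 r" "\<And>t. t \<in> ball 0 r \<Longrightarrow> norm (phi t) < 1"
proof -
  define S where "S = ball 0 1 \<inter> phase_quot -` {z. Re z > 0}"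
  have S: "open S" unfolding S_def
    by (intro continuous_open_preimage holomorphic_on_imp_continuous_on[OF phase_quot_holomorphic] open_halfspace_Re_gt) auto
  have k_hol: "phase_quot holomorphic_on S" by (rule holomorphic_on_subset[OF phase_quot_holomorphic[of 1]]) (auto simp: S_def)
  have p_hol: "phi_p holomorphic_on S" unfolding phi_p_def[abs_def]
    by (intro holomorphic_intros k_hol) (auto simp: S_def complex_nonpos_Reals_iff)
  then have f_hol: "phi holomorphic_on S" unfolding phi_def[abs_def] by (intro holomorphic_intros)
  define S' where "S' = S \<inter> phi -` ball 0 1"
  have "open S'" unfolding S'_def
    by (intro continuous_open_preimage holomorphic_on_imp_continuous_on[OF f_hol] S) auto
  moreover have "0 \<in> S'" by (simp add: S'_def S_def phase_quot_def phi_def)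
  ultimately obtain e where e: "e > 0" "ball 0 e \<subseteq> S'" using openE by blast
  define r where "r = min e (1 / 2)"
  have sub: "ball 0 r \<subseteq> S'" using e by (auto simp: r_def)
  show ?thesis
  proof (rule that[of r])
    show "0 < r" "r < 1" using e by (auto simp: r_def)
    show "Re (6 * phase_quot t) > 0" "norm (phi t) < 1" if "t \<in> ball 0 r" for t using that sub by (auto simp: S'_def S_def)
    show "phi_p holomorphic_on ball 0 r" "phi holomorphic_on ball 0 r"
      using sub by (auto simp: S'_def intro: holomorphic_on_subset[OF p_hol] holomorphic_on_subset[OF f_hol])
  qed
qed

lemma small_in_cut_plane: "norm z < 1 \<Longrightarrow> z \<in> cut_plane"
  by (auto simp: cut_plane_def)

text \<open>For positive real t this is \<open>crit_transform_real\<close> combined with \<phi>^2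
  \<phi>' = 2 (cosh t - 1). Both sides are holomorphic on the disc, and the positive reals
  accumulate at 0.\<close>

lemma crit_transform_phi:
  assumes r: "0 < r" "r < 1" "\<And>t. t \<in> ball 0 r \<Longrightarrow> Re (6 * phase_quot t) > 0" "phi holomorphic_on ball 0 r"
    "\<And>t. t \<in> ball 0 r \<Longrightarrow> norm (phi t) < 1" and t: "t \<in> ball 0 r"
  shows "crit_transform (phi t ^ 2) * deriv phi t = 1"
proof -
  have sq: "phi t ^ 2 \<in> cut_plane" if "t \<in> ball 0 r" for t
    using r(5)[OF that] by (intro small_in_cut_plane) (simp add: norm_power power_less_one_iff)
  have hol: "(\<lambda>t. crit_transform (phi t ^ 2) * deriv phi t - 1) holomorphic_on ball 0 r"
  proof -
    have "(crit_transform \<circ> (\<lambda>t. phi t ^ 2)) holomorphic_on ball 0 r"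
      unfolding crit_transform_def
      by (rule holomorphic_on_compose_gen[OF _ crit.St_holomorphic]) (use sq in \<open>auto intro!: holomorphic_intros r(4)\<close>)
    then show ?thesis unfolding o_def by (intro holomorphic_intros holomorphic_deriv r(4)) auto
  qed
  have "crit_transform (phi t ^ 2) * deriv phi t - 1 = 0"
  proof (rule analytic_continuation[OF hol open_ball connected_ball, of "complex_of_real ` {0<..<r}" 0])
    show "0 islimpt complex_of_real ` {0<..<r}"
      unfolding islimpt_approachable
    proof (intro allI impI)
      fix e :: real assume "e > 0"
      then show "\<exists>x'\<in>complex_of_real ` {0<..<r}. x' \<noteq> 0 \<and> dist x' 0 < e"
        using r(1) by (intro bexI[of _ "of_real (min e r / 2)"] imageI) auto
    qed
    fix z assume "z \<in> complex_of_real ` {0<..<r}"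
    then obtain T where T: "0 < T" "T < r" "z = of_real T" by auto
    then have zb: "z \<in> ball 0 r" by simp
    define w where "w = root 3 (6 * (sinh T - T))"
    have w: "w > 0" using sinh_gt_self[OF T(1)] by (simp add: w_def)
    have ph: "phi z = of_real w" unfolding T w_def by (rule phi_of_real[OF T(1)])
    have nz: "phase_quot t \<noteq> 0" if "t \<in> ball 0 r" for t using r(3)[OF that] by auto
    have D: "(phi has_field_derivative deriv phi z) (at z)" using holomorphic_derivI[OF r(4) open_ball zb] .
    have "((\<lambda>t. phi t ^ 3) has_field_derivative 3 * phi z ^ 2 * deriv phi z) (at z)"
      by (auto intro!: derivative_eq_intros D)
    moreover have "((\<lambda>t. 6 * ph t) has_field_derivative 6 * (cosh z - 1)) (at z)"
      by (auto intro!: derivative_eq_intros ph_deriv)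
    then have "((\<lambda>t. phi t ^ 3) has_field_derivative 6 * (cosh z - 1)) (at z)"
      by (rule has_field_derivative_transform_within_open[OF _ open_ball zb]) (simp add: phi_cube nz ph_def)
    ultimately have e: "3 * phi z ^ 2 * deriv phi z = 6 * (cosh z - 1)" by (rule DERIV_unique)
    have d: "of_real (w ^ 2) * deriv phi z = of_real (2 * (cosh T - 1))"
    proof -
      have "of_real (w ^ 2) * deriv phi z = 3 * phi z ^ 2 * deriv phi z / 3" by (simp add: ph)
      also have "\<dots> = of_real (2 * (cosh T - 1))" unfolding e by (simp add: T(3) cosh_complex_of_real)
      finally show ?thesis .
    qed
    have "crit_transform (phi z ^ 2) = of_real (w ^ 2 / (2 * (cosh T - 1)))"
      using crit_transform_real[OF T(1)] by (simp add: ph w_def)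
    then have "crit_transform (phi z ^ 2) * deriv phi z = of_real (w ^ 2) * deriv phi z / of_real (2 * (cosh T - 1))" by simp
    also have "\<dots> = 1" unfolding d using cosh_gt_1[OF T(1)] T(1) by (simp del: of_real_mult of_real_diff)
    finally show "crit_transform (phi z ^ 2) * deriv phi z - 1 = 0" by simp
  qed (use t r in auto)
  then show ?thesis by simp
qed

text \<open>Lagrange inversion: integrate \<open>\<phi>\<^sup>-\<^sup>(\<^sup>2\<^sup>n\<^sup>+\<^sup>1\<^sup>) = G(\<phi>\<^sup>2) \<phi>' \<phi>\<^sup>-\<^sup>(\<^sup>2\<^sup>n\<^sup>+\<^sup>1\<^sup>)\<close> over a small circle.\<close>

theorem B0_even: "B0 (2 * n) = of_real ((- 1) ^ n * crit.moment n)"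
proof -
  obtain r where r: "0 < r" "r < 1" "\<And>t. t \<in> ball 0 r \<Longrightarrow> Re (6 * phase_quot t) > 0"
    "phi_p holomorphic_on ball 0 r" "phi holomorphic_on ball 0 r" "\<And>t. t \<in> ball 0 r \<Longrightarrow> norm (phi t) < 1"
    by (rule phi_disc, rule that)
  define C where "C = circlepath (0::complex) (r / 2)"
  have C: "valid_path C" "pathfinish C = pathstart C" "path_image C \<subseteq> ball 0 r - {0}" "path_image C \<subseteq> ball 0 r"
    using r by (auto simp: C_def dist_norm)
  have phi_nz: "phi t \<noteq> 0" if "t \<in> ball 0 r - {0}" for t using that by (simp add: phi_def phi_p_def)
  have D: "(phi has_field_derivative deriv phi t) (at t)" if "t \<in> ball 0 r" for t
    using holomorphic_derivI[OF r(5) open_ball that] .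
  have Dp: "(phi_p has_field_derivative deriv phi_p t) (at t)" if "t \<in> ball 0 r" for t
    using holomorphic_derivI[OF r(4) open_ball that] .
  \<comment> \<open>For exponent at least 2 the integrand is an exact derivative, of a multiple of
    \<phi> ^ (- (e + 1)).\<close>
  have I1: "((\<lambda>t. deriv phi t / phi t ^ Suc (Suc e)) has_contour_integral 0) C" for e
  proof -
    have "((\<lambda>t. - inverse (of_nat (Suc e)) * inverse (phi t ^ Suc e)) has_field_derivative deriv phi t / phi t ^ Suc (Suc e)) (at t within ball 0 r - {0})"
      if t: "t \<in> ball 0 r - {0}" for t
    proof (rule has_field_derivative_at_within)
      have "((\<lambda>t. - inverse (of_nat (Suc e)) * inverse (phi t ^ Suc e)) has_field_derivative
          - inverse (of_nat (Suc e)) * - (inverse (phi t ^ Suc e) * (of_nat (Suc e) * (deriv phi t * phi t ^ (Suc e - Suc 0))) * inverse (phi t ^ Suc e))) (at t)"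
        by (rule DERIV_cmult[OF DERIV_inverse'[OF DERIV_power[OF D]]]) (use t phi_nz[OF t] in auto)
      moreover have "- inverse E * - (inverse (P ^ Suc e) * (E * (d * P ^ (Suc e - Suc 0))) * inverse (P ^ Suc e)) = d / P ^ Suc (Suc e)"
        if "E \<noteq> 0" "P \<noteq> 0" for E P d :: complex using that by (simp add: divide_simps)
      from this[OF of_nat_neq_0 phi_nz[OF t]] have "- inverse (of_nat (Suc e)) * - (inverse (phi t ^ Suc e) * (of_nat (Suc e) * (deriv phi t * phi t ^ (Suc e - Suc 0))) * inverse (phi t ^ Suc e))
          = deriv phi t / phi t ^ Suc (Suc e)" .
      ultimately show "((\<lambda>t. - inverse (of_nat (Suc e)) * inverse (phi t ^ Suc e)) has_field_derivative deriv phi t / phi t ^ Suc (Suc e)) (at t)"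
        by (rule DERIV_cong)
    qed
    from contour_integral_primitive[OF this C(1,3)] show ?thesis using C(2) by simp
  qed
  \<comment> \<open>The zero of \<phi> at 0 is simple: \<phi>'/\<phi> = 1/t +
    \<open>phi_p\<close>'/\<open>phi_p\<close> with a zero-free factor \<open>phi_p\<close>, so the
    residue is 1.\<close>
  have I2: "((\<lambda>t. deriv phi t / phi t) has_contour_integral 2 * pi * \<i>) C"
  proof -
    have "(\<lambda>t. deriv phi_p t / phi_p t) holomorphic_on ball 0 r"
      by (intro holomorphic_intros holomorphic_deriv r(4)) (auto simp: phi_p_def)
    then have "((\<lambda>t. deriv phi_p t / phi_p t) has_contour_integral 0) C"
      by (rule Cauchy_theorem_disc_simple[OF _ C(1,4,2)])
    moreover have "((\<lambda>t. 1 / (t - 0)) has_contour_integral 2 * pi * \<i>) C"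
      unfolding C_def using r(1) Cauchy_integral_circlepath_simple[of "\<lambda>_. 1" 0 "r / 2" 0] by simp
    ultimately have "((\<lambda>t. 1 / (t - 0) + deriv phi_p t / phi_p t) has_contour_integral 2 * pi * \<i> + 0) C"
      by (rule has_contour_integral_add[rotated])
    then have "((\<lambda>t. deriv phi t / phi t) has_contour_integral 2 * pi * \<i> + 0) C"
    proof (rule has_contour_integral_eq)
      fix t assume "t \<in> path_image C"
      then have t: "t \<in> ball 0 r" "t \<noteq> 0" using C by auto
      have "(phi has_field_derivative (phi_p t + t * deriv phi_p t)) (at t)"
        unfolding phi_def[abs_def] using Dp[OF t(1)] by (auto intro!: derivative_eq_intros)
      then have "deriv phi t = phi_p t + t * deriv phi_p t" by (rule DERIV_imp_deriv)
      moreover have "phi_p t \<noteq> 0" by (simp add: phi_p_def)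
      ultimately show "1 / (t - 0) + deriv phi_p t / phi_p t = deriv phi t / phi t"
        using t(2) by (simp add: phi_def field_simps)
    qed
    then show ?thesis by simp
  qed
  have sq: "phi t ^ 2 \<in> cut_plane" if "t \<in> ball 0 r" for t
    using r(6)[OF that] by (intro small_in_cut_plane) (simp add: norm_power power_less_one_iff)
  have I3: "((\<lambda>t. phi t * crit.St (Suc n) (phi t ^ 2) * deriv phi t) has_contour_integral 0) C"
  proof -
    have "(crit.St (Suc n) \<circ> (\<lambda>t. phi t ^ 2)) holomorphic_on ball 0 r"
      by (rule holomorphic_on_compose_gen[OF _ crit.St_holomorphic]) (use sq in \<open>auto intro!: holomorphic_intros r(5)\<close>)
    then have "(\<lambda>t. phi t * crit.St (Suc n) (phi t ^ 2) * deriv phi t) holomorphic_on ball 0 r"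
      unfolding o_def by (intro holomorphic_intros holomorphic_deriv r(5)) auto
    then show ?thesis by (rule Cauchy_theorem_disc_simple[OF _ C(1,4,2)])
  qed
  define m where "m j = complex_of_real ((- 1) ^ j * crit.moment j)" for j
  \<comment> \<open>For j < n the exponent Suc (Suc (2 (n - j) - 1)) is 2 (n - j) + 1, left over
    from \<phi>^(2j) / \<phi>^(2n+1) and written in the form required by \<open>I1\<close>. Only j =
    n has a nonzero residue.\<close>
  have sum: "((\<lambda>t. (\<Sum>j<n. m j * (deriv phi t / phi t ^ Suc (Suc (2 * (n - j) - 1)))) + m n * (deriv phi t / phi t)
        + (- 1) ^ Suc n * (phi t * crit.St (Suc n) (phi t ^ 2) * deriv phi t)) 
      has_contour_integral (\<Sum>j<n. m j * 0) + m n * (2 * pi * \<i>) + (- 1) ^ Suc n * 0) C"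
    by (intro has_contour_integral_add has_contour_integral_sum has_contour_integral_lmul I1 I2 I3) auto
  \<comment> \<open>The function in the definition of \<open>B0 (2 * n)\<close>. On the disc it is
    \<open>phi_p\<close> to the power - (2n+1), so Q / t^(2n+1) = \<phi> ^ (- (2n+1)).\<close>
  define Q where "Q t = sinh_quot t powr of_real ((real (2 * n) + 1) / 3)" for t
  have Q: "Q t = inverse (phi_p t) ^ (2 * n + 1)" if t: "t \<in> ball 0 r" for t
  proof -
    have nz: "6 * phase_quot t \<notin> \<real>\<^sub>\<le>\<^sub>0" "phase_quot t \<noteq> 0" using r(3)[OF t] by (auto simp: complex_nonpos_Reals_iff)
    have "1 / 6 * (q / s) = inverse (6 * (s / q))" for s q :: complex
      by (cases "s = 0"; cases "q = 0") (simp_all add: field_simps)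
    then have sq: "sinh_quot t = inverse (6 * phase_quot t)" unfolding sinh_quot_def phase_quot_def by (cases "t = 0") simp_all
    have Ln: "Ln (sinh_quot t) = - Ln (6 * phase_quot t)" unfolding sq by (rule Ln_inverse[OF nz(1)])
    have c: "of_real ((real (2 * n) + 1) / 3) = complex_of_nat (2 * n + 1) / 3" by simp
    have "sinh_quot t \<noteq> 0" unfolding sq using nz by simp
    then have "Q t = exp (of_nat (2 * n + 1) / 3 * (- Ln (6 * phase_quot t)))" unfolding Q_def powr_def c Ln by simp
    also have "of_nat (2 * n + 1) / 3 * (- Ln (6 * phase_quot t)) = of_nat (2 * n + 1) * (- (Ln (6 * phase_quot t) / 3))" by simp
    also have "exp (of_nat (2 * n + 1) * (- (Ln (6 * phase_quot t) / 3))) = exp (- (Ln (6 * phase_quot t) / 3)) ^ (2 * n + 1)" by (rule exp_of_nat_mult)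
    finally show ?thesis by (simp only: phi_p_def exp_minus)
  qed
  have "(\<lambda>t. inverse (phi_p t) ^ (2 * n + 1)) holomorphic_on ball 0 r"
    by (intro holomorphic_intros r(4)) (simp add: phi_p_def)
  then have Q_hol: "Q holomorphic_on ball 0 r" by (rule holomorphic_transform) (simp add: Q)
  have "((\<lambda>u. Q u / (u - 0) ^ Suc (2 * n)) has_contour_integral ((2 * pi * \<i>) / fact (2 * n) * (deriv ^^ (2 * n)) Q 0)) C"
    unfolding C_def using r(1)
    by (intro Cauchy_has_contour_integral_higher_derivative_circlepath holomorphic_on_imp_continuous_on
        holomorphic_on_subset[OF Q_hol]) auto
  then have "((\<lambda>u. Q u / u ^ Suc (2 * n)) has_contour_integral 2 * pi * \<i> * B0 (2 * n)) C"
    by (simp add: B0_def Q_def[abs_def])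
  moreover have "((\<lambda>u. Q u / u ^ Suc (2 * n)) has_contour_integral
      (\<Sum>j<n. m j * 0) + m n * (2 * pi * \<i>) + (- 1) ^ Suc n * 0) C"
  proof (rule has_contour_integral_eq[OF sum])
    fix t assume "t \<in> path_image C"
    then have t: "t \<in> ball 0 r" "t \<noteq> 0" "t \<in> ball 0 r - {0}" using C by auto
    define f where "f = phi t"
    have f: "f \<noteq> 0" using phi_nz[OF t(3)] by (simp add: f_def)
    have "Q t / t ^ Suc (2 * n) = 1 / f ^ Suc (2 * n)"
      by (simp add: Q[OF t(1)] f_def phi_def power_mult_distrib divide_inverse power_inverse del: power_Suc)
    also have "\<dots> = crit_transform (f ^ 2) * deriv phi t / f ^ Suc (2 * n)"
      unfolding f_def by (subst crit_transform_phi[OF r(1-3,5,6) t(1)]) simp_all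
    also have "crit_transform (f ^ 2) = (\<Sum>j<n. m j * f ^ (2 * j)) + m n * f ^ (2 * n) + (- 1) ^ Suc n * f ^ (2 * Suc n) * crit.St (Suc n) (f ^ 2)"
    proof -
      have p: "(- (y ^ 2)) ^ j = (- 1) ^ j * y ^ (2 * j)" for y :: complex and j :: nat
        by (simp only: power_minus[of "y ^ 2"] power_mult)
      show ?thesis unfolding crit_transform_def f_def crit.St_expand[OF sq[OF t(1)], of "Suc n"] m_def
        by (simp only: p sum.lessThan_Suc of_real_mult of_real_power of_real_minus of_real_1 mult_ac)
    qed
    also have "(\<dots>) * deriv phi t / f ^ Suc (2 * n) = 
        (\<Sum>j<n. m j * f ^ (2 * j) * deriv phi t / f ^ Suc (2 * n)) + m n * f ^ (2 * n) * deriv phi t / f ^ Suc (2 * n)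
        + (- 1) ^ Suc n * f ^ (2 * Suc n) * crit.St (Suc n) (f ^ 2) * deriv phi t / f ^ Suc (2 * n)"
      by (simp only: distrib_right add_divide_distrib sum_distrib_right sum_divide_distrib)
    also have "(\<Sum>j<n. m j * f ^ (2 * j) * deriv phi t / f ^ Suc (2 * n)) = (\<Sum>j<n. m j * (deriv phi t / f ^ Suc (Suc (2 * (n - j) - 1))))"
    proof (rule sum.cong[OF refl])
      fix j assume "j \<in> {..<n}"
      then have "Suc (2 * n) = 2 * j + Suc (Suc (2 * (n - j) - 1))" by auto
      then have "f ^ Suc (2 * n) = f ^ (2 * j) * f ^ Suc (Suc (2 * (n - j) - 1))" by (metis power_add)
      then show "m j * f ^ (2 * j) * deriv phi t / f ^ Suc (2 * n) = m j * (deriv phi t / f ^ Suc (Suc (2 * (n - j) - 1)))"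
        using f by (simp del: power_Suc)
    qed
    also have "m n * f ^ (2 * n) * deriv phi t / f ^ Suc (2 * n) = m n * (deriv phi t / f)"
      using f by simp
    also have "(- 1) ^ Suc n * f ^ (2 * Suc n) * crit.St (Suc n) (f ^ 2) * deriv phi t / f ^ Suc (2 * n)
        = (- 1) ^ Suc n * (f * crit.St (Suc n) (f ^ 2) * deriv phi t)"
    proof -
      have "f ^ (2 * Suc n) = f ^ Suc (2 * n) * f" by simp
      then show ?thesis using f by (simp del: power_Suc mult_Suc_right)
    qed
    finally show "(\<Sum>j<n. m j * (deriv phi t / phi t ^ Suc (Suc (2 * (n - j) - 1)))) + m n * (deriv phi t / phi t)
        + (- 1) ^ Suc n * (phi t * crit.St (Suc n) (phi t ^ 2) * deriv phi t) = Q t / t ^ Suc (2 * n)"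
      unfolding f_def by (rule sym)
  qed
  ultimately have "2 * pi * \<i> * B0 (2 * n) = (\<Sum>j<n. m j * 0) + m n * (2 * pi * \<i>) + (- 1) ^ Suc n * 0"
    by (rule has_contour_integral_unique)
  then show ?thesis by (simp add: m_def)
qed

section \<open>A Schlaefli-type representation of the Bessel function\<close>

text \<open>\<open>x\<^bsup>\<sigma>\<^esup> gamma_series \<sigma> (- x)\<close> is the lower incomplete Gamma function, continued in \<open>\<sigma>\<close>.\<close>

definition gamma_series :: "complex \<Rightarrow> complex \<Rightarrow> complex" where
  "gamma_series \<sigma> y = (\<Sum>k. 1 / (fact k * (of_nat k + \<sigma>)) * y ^ k)"

definition nonpole :: "complex \<Rightarrow> bool" where "nonpole \<sigma> \<longleftrightarrow> (\<forall>k::nat. of_nat k + \<sigma> \<noteq> 0)"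

lemma nonpole_plus1: "nonpole \<sigma> \<Longrightarrow> nonpole (\<sigma> + 1)"
  unfolding nonpole_def by (metis (no_types) add.assoc add.commute of_nat_Suc)

text \<open>Only finitely many k matter, because |k + \<sigma>| >= k - |\<sigma>| exceeds 1
  eventually.\<close>

lemma nonpole_dist:
  assumes "nonpole \<sigma>" obtains d where "d > 0" "\<And>k::nat. d \<le> norm (of_nat k + \<sigma>)"
proof -
  obtain N :: nat where N: "real N > norm \<sigma> + 1" using reals_Archimedean2 by blast
  define d where "d = Min (insert 1 ((\<lambda>k. norm (of_nat k + \<sigma>)) ` {..N}))"
  have "d > 0" using assms unfolding d_def by (subst Min_gr_iff) (auto simp: nonpole_def)
  moreover have "d \<le> norm (of_nat k + \<sigma>)" for k :: nat
  proof (cases "k \<le> N")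
    case True
    then show ?thesis unfolding d_def by (intro Min_le) auto
  next
    case False
    have "d \<le> 1" unfolding d_def by (intro Min_le) auto
    also have "1 \<le> real k - norm \<sigma>" using False N by linarith
    also have "\<dots> \<le> norm (of_nat k + \<sigma>)" using norm_diff_ineq[of "of_nat k" \<sigma>] by simp
    finally show ?thesis .
  qed
  ultimately show ?thesis using that by blast
qed

lemma gamma_series_term_bound:
  fixes \<sigma> y :: complex
  assumes "d > 0" "\<And>k::nat. d \<le> norm (of_nat k + \<sigma>)"
  shows "norm (1 / (fact k * (of_nat k + \<sigma>)) * y ^ k) \<le> 1 / d * (norm y ^ k / fact k)"
proof -
  have "norm (1 / (fact k * (of_nat k + \<sigma>)) * y ^ k) = 1 / norm (of_nat k + \<sigma>) * (norm y ^ k / fact k)"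
    by (simp add: norm_mult norm_divide norm_power)
  also have "\<dots> \<le> 1 / d * (norm y ^ k / fact k)"
    using assms(1) assms(2)[of k] by (intro mult_right_mono frac_le) auto
  finally show ?thesis .
qed

lemma exp_norm_sums: "(\<lambda>k. x ^ k / fact k) sums exp (x::real)"
  using exp_converges[of x] by (simp add: divide_inverse mult.commute)

lemma gamma_series_summable: assumes "nonpole \<sigma>" shows "summable (\<lambda>k. 1 / (fact k * (of_nat k + \<sigma>)) * y ^ k)"
proof -
  obtain d where d: "d > 0" "\<And>k::nat. d \<le> norm (of_nat k + \<sigma>)" by (rule nonpole_dist[OF assms], rule that)
  have "summable (\<lambda>k. 1 / d * (norm y ^ k / fact k))" by (intro summable_mult sums_summable[OF exp_norm_sums])
  then show ?thesis by (rule summable_comparison_test'[where N = 0]) (rule gamma_series_term_bound[OF d])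
qed

lemma gamma_series_bound:
  assumes d: "d > 0" "\<And>k::nat. d \<le> norm (of_nat k + \<sigma>)" shows "norm (gamma_series \<sigma> y) \<le> 1 / d * exp (norm y)"
proof -
  have s: "summable (\<lambda>k. 1 / d * (norm y ^ k / fact k))" by (intro summable_mult sums_summable[OF exp_norm_sums])
  have "norm (gamma_series \<sigma> y) \<le> (\<Sum>k. 1 / d * (norm y ^ k / fact k))"
    unfolding gamma_series_def by (rule norm_suminf_le[OF gamma_series_term_bound[OF d] s])
  also have "\<dots> = 1 / d * exp (norm y)"
    using sums_unique[OF sums_mult[OF exp_norm_sums[of "norm y"], of "1 / d"]] by simp
  finally show ?thesis .
qed

lemma gamma_series_deriv:
  assumes "nonpole \<sigma>" shows "(gamma_series \<sigma> has_field_derivative gamma_series (\<sigma> + 1) y) (at y)"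
proof -
  define c where "c k = 1 / (fact k * (of_nat k + \<sigma>))" for k :: nat
  have "((\<lambda>x. \<Sum>n. c n * x^n) has_field_derivative (\<Sum>n. diffs c n * y^n)) (at y)"
    by (rule termdiffs_strong_converges_everywhere) (use gamma_series_summable[OF assms] in \<open>simp add: c_def\<close>)
  moreover have "diffs c n = 1 / (fact n * (of_nat n + (\<sigma> + 1)))" for n
  proof -
    have "of_nat (Suc n) + \<sigma> \<noteq> 0" using assms unfolding nonpole_def by blast
    have "diffs c n = of_nat (Suc n) / (of_nat (Suc n) * (fact n * (of_nat (Suc n) + \<sigma>)))"
      by (simp add: diffs_def c_def del: of_nat_Suc)
    also have "\<dots> = 1 / (fact n * (of_nat (Suc n) + \<sigma>))" by (simp del: of_nat_Suc)
    finally show ?thesis by (simp add: add_ac)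
  qed
  ultimately show ?thesis unfolding gamma_series_def[abs_def] c_def by simp
qed

text \<open>Coefficientwise: the left side has (\<sigma> + k) / (k! (k + \<sigma>)) = 1 / k! at
  y^k.\<close>

lemma gamma_series_functional:
  assumes "nonpole \<sigma>" shows "\<sigma> * gamma_series \<sigma> y + y * gamma_series (\<sigma> + 1) y = exp y"
proof -
  define c where "c k = 1 / (fact k * (of_nat k + \<sigma>)) * y ^ k" for k :: nat
  have c: "c sums gamma_series \<sigma> y" unfolding gamma_series_def c_def[symmetric] using gamma_series_summable[OF assms] by (simp add: c_def[abs_def] summable_sums)
  have "(\<lambda>k. 1 / (fact k * (of_nat k + (\<sigma> + 1))) * y ^ k) sums gamma_series (\<sigma> + 1) y"
    unfolding gamma_series_def using gamma_series_summable[OF nonpole_plus1[OF assms]] by (rule summable_sums)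
  then have "(\<lambda>k. y * (1 / (fact k * (of_nat k + (\<sigma> + 1))) * y ^ k)) sums (y * gamma_series (\<sigma> + 1) y)" by (rule sums_mult)
  moreover have "y * (1 / (fact k * (of_nat k + (\<sigma> + 1))) * y ^ k) = of_nat (Suc k) * c (Suc k)" for k
    by (simp add: c_def add_ac del: of_nat_Suc) (simp add: field_simps)
  ultimately have "(\<lambda>k. of_nat (Suc k) * c (Suc k)) sums (y * gamma_series (\<sigma> + 1) y)" by simp
  then have "(\<lambda>k. of_nat k * c k) sums (y * gamma_series (\<sigma> + 1) y)" by (subst (asm) sums_Suc_iff) simp
  from sums_add[OF sums_mult[OF c, of \<sigma>] this]
  have "(\<lambda>k. \<sigma> * c k + of_nat k * c k) sums (\<sigma> * gamma_series \<sigma> y + y * gamma_series (\<sigma> + 1) y)" .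
  moreover have "\<sigma> * c k + of_nat k * c k = y ^ k /\<^sub>R fact k" for k
  proof -
    have "of_nat k + \<sigma> \<noteq> 0" using assms unfolding nonpole_def by blast
    moreover have "\<sigma> * c k + of_nat k * c k = (of_nat k + \<sigma>) * c k" by (simp add: algebra_simps)
    ultimately show ?thesis by (simp add: c_def scaleR_conv_of_real divide_inverse)
  qed
  ultimately show ?thesis using exp_converges[of y] sums_unique2 by (metis (no_types, lifting) sums_cong)
qed

definition low_gamma :: "complex \<Rightarrow> real \<Rightarrow> complex" where
  "low_gamma \<sigma> x = of_real x powr \<sigma> * gamma_series \<sigma> (- of_real x)"

lemma low_gamma_deriv:
  assumes "nonpole \<sigma>" "x > 0"
  shows "(low_gamma \<sigma> has_vector_derivative (of_real (exp (- x)) * of_real x powr (\<sigma> - 1))) (at x)"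
proof -
  have x: "of_real x \<notin> \<real>\<^sub>\<le>\<^sub>0" "complex_of_real x \<noteq> 0" using assms by auto
  have "((\<lambda>z. z powr \<sigma> * gamma_series \<sigma> (- z)) has_field_derivative
      \<sigma> * of_real x powr (\<sigma> - 1) * gamma_series \<sigma> (- of_real x) + of_real x powr \<sigma> * (gamma_series (\<sigma> + 1) (- of_real x) * - 1)) (at (of_real x))"
  proof -
    have a: "((\<lambda>z. z powr \<sigma>) has_field_derivative \<sigma> * of_real x powr (\<sigma> - 1)) (at (of_real x))"
      using x(1) by (rule has_field_derivative_powr)
    have b: "((\<lambda>z. gamma_series \<sigma> (- z)) has_field_derivative gamma_series (\<sigma> + 1) (- of_real x) * - 1) (at (of_real x))"
      by (rule DERIV_chain2[OF gamma_series_deriv[OF assms(1)]]) (auto intro!: derivative_eq_intros)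
    show ?thesis by (rule DERIV_cong[OF DERIV_mult[OF a b]]) simp
  qed
  moreover have "\<sigma> * of_real x powr (\<sigma> - 1) * gamma_series \<sigma> (- of_real x) + of_real x powr \<sigma> * (gamma_series (\<sigma> + 1) (- of_real x) * - 1)
     = of_real x powr (\<sigma> - 1) * exp (- of_real x)"
  proof -
    have "of_real x powr \<sigma> = of_real x powr (\<sigma> - 1) * of_real x" using x by (simp add: powr_diff)
    then show ?thesis using gamma_series_functional[OF assms(1), of "- of_real x"] by (simp add: algebra_simps flip: gamma_series_functional[OF assms(1)])
  qed
  ultimately have "((\<lambda>z. z powr \<sigma> * gamma_series \<sigma> (- z)) has_field_derivative of_real (exp (- x)) * of_real x powr (\<sigma> - 1)) (at (of_real x))"
    by (simp add: exp_of_real mult.commute flip: of_real_minus)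
  from has_vector_derivative_real_field[OF this]
  show ?thesis unfolding low_gamma_def[abs_def] by simp
qed

lemma low_gamma_limit_pos:
  assumes "Re \<sigma> > 0" shows "(low_gamma \<sigma> \<longlongrightarrow> Gamma \<sigma>) at_top"
proof (rule tendsto_at_topI_sequentially)
  fix X :: "nat \<Rightarrow> real" assume X: "filterlim X at_top sequentially"
  have np: "nonpole \<sigma>" unfolding nonpole_def using assms by (auto simp: complex_eq_iff)
  define f where "f t = of_real t powr (\<sigma> - 1) / of_real (exp t)" for t :: real
  have f_abs: "f absolutely_integrable_on {0<..}" using absolutely_integrable_Gamma_integral'[OF assms] by (simp add: f_def[abs_def])
  have f_int: "(f has_integral Gamma \<sigma>) {0<..}" using Gamma_integral_complex'[OF assms] by (simp add: f_def[abs_def])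
  have gamma_series_cont: "continuous_on UNIV (gamma_series \<sigma>)"
    using gamma_series_deriv[OF np] DERIV_isCont continuous_at_imp_continuous_on by blast
  have lg: "(f has_integral low_gamma \<sigma> x) {0..x}" if "x \<ge> 0" for x
  proof -
    have "continuous_on {0..x} (\<lambda>t. complex_of_real t powr \<sigma>)"
      by (intro continuous_on_powr_complex continuous_intros) (use assms in auto)
    moreover have "continuous_on {0..x} (\<lambda>t. gamma_series \<sigma> (- complex_of_real t))"
      by (intro continuous_on_compose2[OF gamma_series_cont] continuous_intros) auto
    ultimately have "continuous_on {0..x} (low_gamma \<sigma>)" unfolding low_gamma_def[abs_def]
      by (intro continuous_on_mult)
    then have "(f has_integral (low_gamma \<sigma> x - low_gamma \<sigma> 0)) {0..x}"
      using low_gamma_deriv[OF np] that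
      by (intro fundamental_theorem_of_calculus_interior) (auto simp: f_def exp_minus divide_inverse mult.commute)
    then show ?thesis by (simp add: low_gamma_def)
  qed
  define g where "g n t = (if t \<in> {0..max 0 (X n)} then f t else 0)" for n t
  have g_int: "(g n has_integral low_gamma \<sigma> (max 0 (X n))) {0<..}" for n
  proof -
    have "(f has_integral low_gamma \<sigma> (max 0 (X n))) {0..max 0 (X n)}" by (rule lg) simp
    then have "(g n has_integral low_gamma \<sigma> (max 0 (X n))) UNIV"
      unfolding g_def[abs_def] by (subst has_integral_restrict_UNIV)
    moreover have "g n = (\<lambda>t. if t \<in> {0<..} then g n t else 0)" by (auto simp: g_def f_def)
    ultimately show ?thesis by (metis has_integral_restrict_UNIV)
  qed
  have "(\<lambda>n. integral {0<..} (g n)) \<longlonglongrightarrow> integral {0<..} f"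
  proof (rule dominated_convergence(2)[where h = "\<lambda>t. norm (f t)"])
    show "g n integrable_on {0<..}" for n using g_int by blast
    show "(\<lambda>t. norm (f t)) integrable_on {0<..}" using f_abs by (simp add: absolutely_integrable_on_def)
    show "norm (g n t) \<le> norm (f t)" for n t by (simp add: g_def)
    show "(\<lambda>n. g n t) \<longlonglongrightarrow> f t" if "t \<in> {0<..}" for t
    proof -
      have "\<forall>\<^sub>F n in sequentially. t \<le> X n" using X by (simp add: filterlim_at_top)
      then have "\<forall>\<^sub>F n in sequentially. g n t = f t" by eventually_elim (use that in \<open>auto simp: g_def\<close>)
      then show ?thesis by (rule tendsto_eventually)
    qed
  qed
  then have "(\<lambda>n. low_gamma \<sigma> (max 0 (X n))) \<longlonglongrightarrow> Gamma \<sigma>"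
    by (simp only: integral_unique[OF g_int] integral_unique[OF f_int])
  moreover have "\<forall>\<^sub>F n in sequentially. 0 \<le> X n" using X by (simp add: filterlim_at_top)
  then have "\<forall>\<^sub>F n in sequentially. low_gamma \<sigma> (max 0 (X n)) = low_gamma \<sigma> (X n)" by eventually_elim simp
  ultimately show "(\<lambda>n. low_gamma \<sigma> (X n)) \<longlonglongrightarrow> Gamma \<sigma>" by (rule Lim_transform_eventually)
qed

lemma powr_exp_tendsto_0: "((\<lambda>x. of_real x powr \<sigma> * exp (- complex_of_real x)) \<longlongrightarrow> 0) at_top"
proof (rule tendsto_norm_zero_cancel)
  have lim: "((\<lambda>x::real. x powr Re \<sigma> / exp x) \<longlongrightarrow> 0) at_top"
  proof -
    obtain n :: nat where n: "Re \<sigma> \<le> real n" using real_arch_simple by blast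
    show ?thesis
    proof (rule Lim_null_comparison[OF _ tendsto_power_div_exp_0[of n]])
      show "\<forall>\<^sub>F x::real in at_top. norm (x powr Re \<sigma> / exp x) \<le> x ^ n / exp x"
        using eventually_ge_at_top[of 1]
      proof eventually_elim
        case (elim x)
        then have "x powr Re \<sigma> \<le> x powr real n" using n by (intro powr_mono) auto
        then show ?case using elim by (simp add: powr_realpow divide_right_mono)
      qed
    qed
  qed
  show "((\<lambda>x. norm (of_real x powr \<sigma> * exp (- complex_of_real x))) \<longlongrightarrow> 0) at_top"
  proof (rule Lim_transform_eventually[OF lim])
    show "\<forall>\<^sub>F x in at_top. x powr Re \<sigma> / exp x = norm (of_real x powr \<sigma> * exp (- complex_of_real x))"
      using eventually_gt_at_top[of 0]
      by eventually_elim (simp add: norm_mult norm_powr_real_powr exp_minus norm_inverse divide_inverse)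
  qed
qed

text \<open>Extended one unit strip to the left at a time: low_gamma(\<sigma>) = (x^\<sigma> e^(-x)
  + low_gamma(\<sigma> + 1)) / \<sigma>, in which the exponential term vanishes at infinity and the
  rest matches \<Gamma>(\<sigma> + 1) = \<sigma> \<Gamma>(\<sigma>).\<close>

lemma low_gamma_limit:
  assumes "nonpole \<sigma>" shows "(low_gamma \<sigma> \<longlongrightarrow> Gamma \<sigma>) at_top"
proof -
  have "\<forall>\<sigma>. nonpole \<sigma> \<longrightarrow> - real n < Re \<sigma> \<longrightarrow> (low_gamma \<sigma> \<longlongrightarrow> Gamma \<sigma>) at_top" for n
  proof (induction n)
    case 0
    then show ?case using low_gamma_limit_pos by simp
  next
    case (Suc n)
    show ?case
    proof (intro allI impI)
      fix \<sigma> assume \<sigma>: "nonpole \<sigma>" "- real (Suc n) < Re \<sigma>"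
      have nz: "\<sigma> \<noteq> 0" using \<sigma>(1) unfolding nonpole_def by (metis add_0 of_nat_0)
      have "(low_gamma (\<sigma> + 1) \<longlongrightarrow> Gamma (\<sigma> + 1)) at_top" using Suc \<sigma> nonpole_plus1 by simp
      then have "((\<lambda>x. (of_real x powr \<sigma> * exp (- complex_of_real x) + low_gamma (\<sigma> + 1) x) / \<sigma>)
          \<longlongrightarrow> (0 + Gamma (\<sigma> + 1)) / \<sigma>) at_top"
        by (intro tendsto_intros powr_exp_tendsto_0 nz)
      moreover have "\<forall>\<^sub>F x in at_top. (of_real x powr \<sigma> * exp (- complex_of_real x) + low_gamma (\<sigma> + 1) x) / \<sigma> = low_gamma \<sigma> x"
        using eventually_gt_at_top[of 0]
      proof eventually_elim
        case (elim x)
        have "of_real x powr (\<sigma> + 1) = of_real x powr \<sigma> * complex_of_real x" using elim by (simp add: powr_add)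
        then show ?case using gamma_series_functional[OF \<sigma>(1), of "- of_real x"] nz
          by (simp add: low_gamma_def divide_simps flip: gamma_series_functional[OF \<sigma>(1)]) (simp add: algebra_simps)
      qed
      moreover have "(0 + Gamma (\<sigma> + 1)) / \<sigma> = Gamma \<sigma>"
      proof -
        have "\<sigma> \<notin> \<int>\<^sub>\<le>\<^sub>0" using \<sigma>(1) unfolding nonpole_def by (auto elim!: nonpos_Ints_cases')
        then show ?thesis using Gamma_plus1[of \<sigma>] nz by simp
      qed
      ultimately show "(low_gamma \<sigma> \<longlongrightarrow> Gamma \<sigma>) at_top" by (simp add: Lim_transform_eventually)
    qed
  qed
  moreover obtain n :: nat where "- Re \<sigma> < real n" using reals_Archimedean2 by blast
  ultimately show ?thesis using assms by (metis minus_less_iff)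
qed

text \<open>The bound depends on \<sigma> only through d and n. It therefore serves all orders -
  \<nu> - k simultaneously and provides the majorant for exchanging limit and sum.\<close>

lemma low_gamma_bound:
  assumes np: "nonpole \<sigma>" and d: "d > 0" "\<And>k::nat. d \<le> norm (of_nat k + \<sigma>)" 
    and a: "Re \<sigma> \<le> real n" "n > 0" and x: "x \<ge> 1"
  shows "norm (low_gamma \<sigma> x) \<le> exp 1 / d + Gamma (real n)"
proof -
  define f where "f t = of_real (exp (- t)) * of_real t powr (\<sigma> - 1)" for t :: real
  have "(f has_integral (low_gamma \<sigma> x - low_gamma \<sigma> 1)) {1..x}" unfolding f_def
    using low_gamma_deriv[OF np] x by (intro fundamental_theorem_of_calculus) (auto intro: has_vector_derivative_at_within)
  moreover have g: "((\<lambda>t. t powr (real n - 1) / exp t) has_integral Gamma (real n)) {0..}"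
    using a by (intro Gamma_integral_real) auto
  then have "(\<lambda>t. t powr (real n - 1) / exp t) integrable_on {1..x}"
    by (intro integrable_continuous_real continuous_intros) auto
  then obtain I where I: "((\<lambda>t. t powr (real n - 1) / exp t) has_integral I) {1..x}" by blast
  moreover have "norm (f t) \<le> t powr (real n - 1) / exp t" if "t \<in> {1..x}" for t
  proof -
    have "norm (f t) = exp (- t) * t powr (Re \<sigma> - 1)" using that by (simp add: f_def norm_mult norm_powr_real_powr)
    also have "\<dots> \<le> exp (- t) * t powr (real n - 1)" using that a by (intro mult_left_mono powr_mono) auto
    finally show ?thesis by (simp add: exp_minus divide_inverse mult.commute)
  qed
  ultimately have "norm (low_gamma \<sigma> x - low_gamma \<sigma> 1) \<le> I"
    using Henstock_Kurzweil_Integration.integral_norm_bound_integral[of f "{1..x}" "\<lambda>t. t powr (real n - 1) / exp t"]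
    by (auto simp: has_integral_iff)
  also have "I \<le> Gamma (real n)" by (rule has_integral_subset_le[OF _ I g]) auto
  finally have "norm (low_gamma \<sigma> x - low_gamma \<sigma> 1) \<le> Gamma (real n)" .
  moreover have "norm (low_gamma \<sigma> 1) \<le> exp 1 / d" using gamma_series_bound[OF d, of "- 1"] by (simp add: low_gamma_def)
  moreover have "norm (low_gamma \<sigma> x) \<le> norm (low_gamma \<sigma> x - low_gamma \<sigma> 1) + norm (low_gamma \<sigma> 1)"
    using norm_triangle_ineq[of "low_gamma \<sigma> x - low_gamma \<sigma> 1" "low_gamma \<sigma> 1"] by simp
  ultimately show ?thesis by linarith
qed

definition gamma_prim :: "complex \<Rightarrow> complex \<Rightarrow> complex" where "gamma_prim \<sigma> \<zeta> = exp (\<sigma> * \<zeta>) * gamma_series \<sigma> (exp \<zeta>)"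

lemma gamma_prim_deriv:
  assumes "nonpole \<sigma>" shows "(gamma_prim \<sigma> has_field_derivative exp (\<sigma> * \<zeta> + exp \<zeta>)) (at \<zeta>)"
proof -
  have "((\<lambda>\<zeta>. gamma_series \<sigma> (exp \<zeta>)) has_field_derivative gamma_series (\<sigma> + 1) (exp \<zeta>) * exp \<zeta>) (at \<zeta>)"
    by (rule DERIV_chain2[OF gamma_series_deriv[OF assms]]) (rule DERIV_exp)
  then have "(gamma_prim \<sigma> has_field_derivative \<sigma> * exp (\<sigma> * \<zeta>) * gamma_series \<sigma> (exp \<zeta>) + (gamma_series (\<sigma> + 1) (exp \<zeta>) * exp \<zeta>) * exp (\<sigma> * \<zeta>)) (at \<zeta>)"
    unfolding gamma_prim_def[abs_def] by (auto intro!: derivative_eq_intros)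
  moreover have "\<sigma> * exp (\<sigma> * \<zeta>) * gamma_series \<sigma> (exp \<zeta>) + (gamma_series (\<sigma> + 1) (exp \<zeta>) * exp \<zeta>) * exp (\<sigma> * \<zeta>)
      = exp (\<sigma> * \<zeta>) * (\<sigma> * gamma_series \<sigma> (exp \<zeta>) + exp \<zeta> * gamma_series (\<sigma> + 1) (exp \<zeta>))" by (simp add: algebra_simps)
  ultimately show ?thesis by (simp add: gamma_series_functional[OF assms] exp_add)
qed

text \<open>At \<xi> + i \<pi> and \<xi> - i \<pi> the exponential takes the same value - exp \<xi>,
  so only the prefactor exp (\<sigma> \<zeta>) differs. This replaces a Hankel loop around the
  negative axis.\<close>

lemma gamma_prim_jump:
  fixes \<xi> :: real
  shows "gamma_prim \<sigma> (of_real \<xi> + \<i> * of_real pi) - gamma_prim \<sigma> (of_real \<xi> - \<i> * of_real pi)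
    = 2 * \<i> * sin (of_real pi * \<sigma>) * low_gamma \<sigma> (exp \<xi>)"
proof -
  have e: "exp (of_real \<xi> + \<i> * of_real pi) = - complex_of_real (exp \<xi>)" "exp (of_real \<xi> - \<i> * of_real pi) = - complex_of_real (exp \<xi>)"
    by (simp_all add: exp_add exp_diff exp_of_real)
  have p: "of_real (exp \<xi>) powr \<sigma> = exp (\<sigma> * of_real \<xi>)" by (simp add: powr_def Ln_of_real)
  have s: "2 * \<i> * sin (of_real pi * \<sigma>) = exp (\<sigma> * (\<i> * of_real pi)) - exp (- (\<sigma> * (\<i> * of_real pi)))"
    by (simp add: sin_exp_eq mult_ac)
  show ?thesis unfolding gamma_prim_def e low_gamma_def p s
    by (simp add: distrib_left right_diff_distrib exp_add exp_diff exp_minus divide_inverse algebra_simps)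
qed

text \<open>Put \<zeta> = t + Ln (z/2) and expand exp (- (z/2) e^(-t)) in powers. Each term is a
  multiple of exp (\<sigma> \<zeta> + e^\<zeta>) with \<sigma> = - \<nu> - k; its primitive jumps by
  an incomplete Gamma function, which tends to \<Gamma>(- \<nu> - k). The shift by Arg z in the
  endpoints places \<zeta> at heights \<pi> and - \<pi>.\<close>

theorem schlaefli:
  assumes \<nu>: "\<nu> \<notin> \<int>" and z: "z \<noteq> 0"
    and F: "\<And>t. (F has_field_derivative exp (z * sinh t - \<nu> * t)) (at t)"
  shows "((\<lambda>X. F (of_real X + \<i> * of_real (pi - Arg z)) - F (of_real X - \<i> * of_real (pi + Arg z)))
           \<longlongrightarrow> 2 * pi * \<i> * bessel_J \<nu> z) at_top"
proof -
  define L where "L = Ln (z / 2)"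
  define l where "l = ln (norm z / 2)"
  have L: "L = of_real l + \<i> * of_real (Arg z)"
  proof -
    have "L = Ln z - of_real (ln 2)" using Ln_divide_of_real[of 2 z] z by (simp add: L_def)
    also have "Ln z = of_real (ln (norm z)) + \<i> * of_real (Arg z)"
      using z Arg_eq_Im_Ln[OF z] Re_Ln[OF z] by (simp add: complex_eq_iff)
    finally show ?thesis using z by (simp add: l_def ln_div)
  qed
  have expL: "exp L = z / 2" using z by (simp add: L_def)
  define \<sigma> where "\<sigma> k = - \<nu> - of_nat k" for k :: nat
  have np: "nonpole (\<sigma> k)" for k
    unfolding nonpole_def
  proof (intro allI notI)
    fix j :: nat assume "of_nat j + \<sigma> k = 0"
    moreover have "\<nu> = of_nat j - of_nat k - (of_nat j + \<sigma> k)" by (simp add: \<sigma>_def)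
    ultimately have "\<nu> = of_nat j - of_nat k" by simp
    then show False using \<nu> by simp
  qed
  define c where "c k = (z / 2) powr \<nu> * ((- ((z / 2) ^ 2)) ^ k / fact k)" for k :: nat
  have F_sums: "(\<lambda>k. c k * (gamma_prim (\<sigma> k) (b + L) - gamma_prim (\<sigma> k) (a + L))) sums (F b - F a)" for a b
  proof -
    \<comment> \<open>The integrand is h exp(y) with y = - (z/2) e^(-t). Both factors are bounded on
      a segment, so the exponential series in y may be integrated term by term.\<close>
    define h where "h t = exp (\<nu> * L) * exp (exp (t + L) - \<nu> * (t + L))" for t
    define y where "y t = - ((z / 2) ^ 2) * exp (- (t + L))" for t
    have fh: "exp (z * sinh t - \<nu> * t) = h t * exp (y t)" for t
    proof -
      have 1: "exp (t + L) = z / 2 * exp t" by (simp add: exp_add expL mult.commute)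
      have 2: "exp (- (t + L)) = exp (- t) / (z / 2)"
        by (simp only: minus_add_distrib exp_add exp_minus[of L] expL divide_inverse)
      have w: "- (w ^ 2) * (E / w) = - (w * E)" if "w \<noteq> 0" for w E :: complex using that by (simp add: power2_eq_square)
      have "z / 2 \<noteq> 0" using z by simp
      from w[OF this] have y: "y t = - (z / 2 * exp (- t))" unfolding y_def 2 .
      have "h t * exp (y t) = exp (\<nu> * L + (z / 2 * exp t - \<nu> * (t + L)) - z / 2 * exp (- t))"
        unfolding h_def 1 y by (simp only: mult_exp_exp diff_conv_add_uminus)
      also have "\<nu> * L + (z / 2 * exp t - \<nu> * (t + L)) - z / 2 * exp (- t) = z * sinh t - \<nu> * t"
        by (simp add: sinh_field_def algebra_simps diff_divide_distrib)
      finally show ?thesis by (rule sym)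
    qed
    have trm: "c k * exp (\<sigma> k * (t + L) + exp (t + L)) = h t * (y t ^ k / fact k)" for k t
    proof -
      have "(z / 2) powr \<nu> = exp (\<nu> * L)" using z by (simp add: powr_def L_def)
      moreover have "y t ^ k = (- ((z / 2) ^ 2)) ^ k * exp (- (of_nat k * (t + L)))"
      proof -
        have "exp (- (t + L)) ^ k = exp (- (of_nat k * (t + L)))" by (simp only: exp_of_nat_mult[symmetric] mult_minus_right)
        then show ?thesis unfolding y_def power_mult_distrib by (rule arg_cong)
      qed
      moreover have "exp (\<sigma> k * (t + L) + exp (t + L)) = exp (exp (t + L) - \<nu> * (t + L)) * exp (- (of_nat k * (t + L)))"
        unfolding mult_exp_exp \<sigma>_def by (simp add: algebra_simps)
      ultimately show ?thesis unfolding c_def h_def by simp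
    qed
    have hc: "continuous_on UNIV h" "continuous_on UNIV y"
      unfolding h_def[abs_def] y_def[abs_def] by (intro continuous_intros)+
    obtain Hb where Hb: "\<And>t. t \<in> closed_segment a b \<Longrightarrow> norm (h t) \<le> Hb"
    proof -
      have "bounded (h ` closed_segment a b)"
        by (intro compact_imp_bounded compact_continuous_image continuous_on_subset[OF hc(1)] compact_segment) simp
      then obtain B where "\<forall>x\<in>h ` closed_segment a b. norm x \<le> B" unfolding bounded_iff by blast
      then show ?thesis by (intro that[of B]) simp
    qed
    obtain Yb where Yb: "\<And>t. t \<in> closed_segment a b \<Longrightarrow> norm (y t) \<le> Yb"
    proof -
      have "bounded (y ` closed_segment a b)"
        by (intro compact_imp_bounded compact_continuous_image continuous_on_subset[OF hc(2)] compact_segment) simp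
      then obtain B where "\<forall>x\<in>y ` closed_segment a b. norm x \<le> B" unfolding bounded_iff by blast
      then show ?thesis by (intro that[of B]) simp
    qed
    have Y0: "0 \<le> Yb" "0 \<le> Hb" using Yb[of a] Hb[of a] norm_ge_zero order_trans by blast+
    have ci: "((\<lambda>t. exp (z * sinh t - \<nu> * t) - (\<Sum>k\<le>n. c k * exp (\<sigma> k * (t + L) + exp (t + L)))) has_contour_integral
        (F b - F a) - (\<Sum>k\<le>n. c k * (gamma_prim (\<sigma> k) (b + L) - gamma_prim (\<sigma> k) (a + L)))) (linepath a b)" for n
    proof (intro has_contour_integral_diff has_contour_integral_sum has_contour_integral_lmul)
      show "((\<lambda>t. exp (z * sinh t - \<nu> * t)) has_contour_integral F b - F a) (linepath a b)"
        using contour_integral_primitive[of UNIV F "\<lambda>t. exp (z * sinh t - \<nu> * t)" "linepath a b"] F by simp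
      show "((\<lambda>t. exp (\<sigma> k * (t + L) + exp (t + L))) has_contour_integral gamma_prim (\<sigma> k) (b + L) - gamma_prim (\<sigma> k) (a + L)) (linepath a b)" for k
      proof -
        have "((\<lambda>t. gamma_prim (\<sigma> k) (t + L)) has_field_derivative exp (\<sigma> k * (t + L) + exp (t + L)) * 1) (at t)" for t
          by (rule DERIV_chain2[OF gamma_prim_deriv[OF np[of k]]]) (auto intro!: derivative_eq_intros)
        then show ?thesis
          using contour_integral_primitive[of UNIV "\<lambda>t. gamma_prim (\<sigma> k) (t + L)" "\<lambda>t. exp (\<sigma> k * (t + L) + exp (t + L))" "linepath a b"] by simp
      qed
    qed simp
    have bound: "norm ((F b - F a) - (\<Sum>k\<le>n. c k * (gamma_prim (\<sigma> k) (b + L) - gamma_prim (\<sigma> k) (a + L)))) 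
        \<le> Hb * (exp Yb * (Yb ^ Suc n / fact n)) * norm (b - a)" for n
    proof (rule has_contour_integral_bound_linepath[OF ci])
      show "0 \<le> Hb * (exp Yb * (Yb ^ Suc n / fact n))" using Y0 by simp
      fix t assume t: "t \<in> closed_segment a b"
      have "exp (z * sinh t - \<nu> * t) - (\<Sum>k\<le>n. c k * exp (\<sigma> k * (t + L) + exp (t + L))) 
          = h t * (exp (y t) - (\<Sum>k\<le>n. y t ^ k / fact k))"
        unfolding fh trm by (simp add: right_diff_distrib sum_distrib_left)
      also have "norm \<dots> \<le> Hb * (exp (norm (y t)) * norm (y t) ^ Suc n / fact n)"
        unfolding norm_mult using Hb[OF t] Y0 Taylor_exp_field[of "y t" n] by (intro mult_mono) auto
      also have "\<dots> \<le> Hb * (exp Yb * Yb ^ Suc n / fact n)"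
        using Y0 Yb[OF t] by (intro mult_left_mono divide_right_mono mult_mono power_mono) auto
      finally show "norm (exp (z * sinh t - \<nu> * t) - (\<Sum>k\<le>n. c k * exp (\<sigma> k * (t + L) + exp (t + L)))) 
          \<le> Hb * (exp Yb * (Yb ^ Suc n / fact n))" by simp
    qed
    have "(\<lambda>n. Yb ^ n / fact n) \<longlonglongrightarrow> 0" using sums_summable[OF exp_norm_sums] by (rule summable_LIMSEQ_zero)
    then have "(\<lambda>n. Hb * (exp Yb * (Yb * (Yb ^ n / fact n))) * norm (b - a)) \<longlonglongrightarrow> Hb * (exp Yb * (Yb * 0)) * norm (b - a)"
      by (intro tendsto_intros)
    then have lim: "(\<lambda>n. Hb * (exp Yb * (Yb ^ Suc n / fact n)) * norm (b - a)) \<longlonglongrightarrow> 0" by simp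
    have "(\<lambda>n. (F b - F a) - (\<Sum>k\<le>n. c k * (gamma_prim (\<sigma> k) (b + L) - gamma_prim (\<sigma> k) (a + L)))) \<longlonglongrightarrow> 0"
      by (rule Lim_null_comparison[OF always_eventually lim]) (use bound in auto)
    then have "(\<lambda>n. \<Sum>k\<le>n. c k * (gamma_prim (\<sigma> k) (b + L) - gamma_prim (\<sigma> k) (a + L))) \<longlonglongrightarrow> F b - F a"
      using tendsto_diff[OF tendsto_const[of "F b - F a"], of _ 0 sequentially] by fastforce
    then show ?thesis by (simp add: sums_def_le)
  qed
  define d where "d k = c k * (2 * \<i> * sin (of_real pi * \<sigma> k))" for k
  define x where "x X = exp (X + l)" for X
  have D_sums: "(\<lambda>k. d k * low_gamma (\<sigma> k) (x X)) sums 
      (F (of_real X + \<i> * of_real (pi - Arg z)) - F (of_real X - \<i> * of_real (pi + Arg z)))" for X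
  proof -
    have e: "of_real X + \<i> * of_real (pi - Arg z) + L = of_real (X + l) + \<i> * of_real pi"
      "of_real X - \<i> * of_real (pi + Arg z) + L = of_real (X + l) - \<i> * of_real pi"
      by (simp_all add: L algebra_simps)
    show ?thesis
      using F_sums[of "of_real X + \<i> * of_real (pi - Arg z)" "of_real X - \<i> * of_real (pi + Arg z)", unfolded e gamma_prim_jump]
      by (simp only: d_def x_def mult.assoc)
  qed
  \<comment> \<open>Each j + \<open>\<sigma> k\<close> is an integer minus \<nu>, so one distance
    from \<nu> to the integers works for all j and k.\<close>
  obtain \<delta> where \<delta>: "\<delta> > 0" "\<And>j k. \<delta> \<le> norm (of_nat j + \<sigma> k)"
  proof -
    obtain d1 where d1: "d1 > 0" "\<And>k::nat. d1 \<le> norm (of_nat k + (- \<nu>))" 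
      by (rule nonpole_dist[OF np[of 0, unfolded \<sigma>_def of_nat_0 diff_0_right]], rule that)
    have np': "nonpole \<nu>" unfolding nonpole_def
    proof (intro allI notI)
      fix j :: nat assume "of_nat j + \<nu> = 0"
      then have "\<nu> = - of_nat j" by (simp add: add_eq_0_iff)
      then show False using \<nu> by simp
    qed
    obtain d2 where d2: "d2 > 0" "\<And>k::nat. d2 \<le> norm (of_nat k + \<nu>)" by (rule nonpole_dist[OF np'], rule that)
    have "min d1 d2 \<le> norm (of_nat j + \<sigma> k)" for j k
    proof (cases "k \<le> j")
      case True
      then have "of_nat j + \<sigma> k = of_nat (j - k) + (- \<nu>)" by (simp add: \<sigma>_def of_nat_diff)
      then show ?thesis using d1(2)[of "j - k"] by simp
    next
      case False
      then have "of_nat j + \<sigma> k = - (of_nat (k - j) + \<nu>)" by (simp add: \<sigma>_def of_nat_diff)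
      then show ?thesis using d2(2)[of "k - j"] by (simp add: norm_minus_commute del: minus_add_distrib)
    qed
    then show ?thesis using that[of "min d1 d2"] d1 d2 by simp
  qed
  obtain n :: nat where n: "Re (- \<nu>) \<le> real n" "n > 0"
  proof -
    obtain n :: nat where "max 1 (Re (- \<nu>)) \<le> real n" using real_arch_simple by blast
    then have "Re (- \<nu>) \<le> real n" "n > 0" by auto
    then show ?thesis by (rule that)
  qed
  define B where "B = exp 1 / \<delta> + Gamma (real n)"
  have lg_b: "norm (low_gamma (\<sigma> k) y) \<le> B" if "y \<ge> 1" for k y
    unfolding B_def using n that \<delta> by (intro low_gamma_bound[OF np]) (auto simp: \<sigma>_def)
  have sin: "norm (sin (of_real pi * \<sigma> k)) = norm (sin (of_real pi * \<nu>))" for k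
  proof -
    have "of_real pi * \<sigma> k = - (of_real pi * \<nu>) - of_real (real k * pi)" by (simp add: \<sigma>_def algebra_simps)
    then show ?thesis by (simp add: sin_diff norm_mult norm_power sin_of_real cos_of_real)
  qed
  have d_b: "norm (d k) = norm ((z / 2) powr \<nu>) * 2 * norm (sin (of_real pi * \<nu>)) * ((norm (z / 2) ^ 2) ^ k / fact k)" for k
    by (simp add: d_def c_def norm_mult norm_divide norm_power sin)
  have tannery: "eventually (\<lambda>X. summable (\<lambda>k. norm (d k * low_gamma (\<sigma> k) (x X)))) at_top \<and>
      summable (\<lambda>k. norm (d k * Gamma (\<sigma> k))) \<and>
      ((\<lambda>X. \<Sum>k. d k * low_gamma (\<sigma> k) (x X)) \<longlongrightarrow> (\<Sum>k. d k * Gamma (\<sigma> k))) at_top"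
  proof (rule tannerys_theorem[where M = "\<lambda>k. norm (d k) * B"])
    show "((\<lambda>X. d k * low_gamma (\<sigma> k) (x X)) \<longlongrightarrow> d k * Gamma (\<sigma> k)) at_top" for k
    proof (intro tendsto_intros)
      have "filterlim (\<lambda>X. exp (l + X)) at_top at_top"
        by (rule filterlim_compose[OF exp_at_top filterlim_tendsto_add_at_top[OF tendsto_const filterlim_ident]])
      then have "filterlim x at_top at_top" by (simp add: x_def[abs_def] add.commute)
      then show "((\<lambda>X. low_gamma (\<sigma> k) (x X)) \<longlongrightarrow> Gamma (\<sigma> k)) at_top"
        by (rule filterlim_compose[OF low_gamma_limit[OF np]])
    qed
    show "\<forall>\<^sub>F (k, X) in sequentially \<times>\<^sub>F at_top. norm (d k * low_gamma (\<sigma> k) (x X)) \<le> norm (d k) * B"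
    proof -
      have "\<forall>\<^sub>F X in at_top. \<forall>k. norm (d k * low_gamma (\<sigma> k) (x X)) \<le> norm (d k) * B"
        using eventually_ge_at_top[of "- l"]
        by eventually_elim (auto simp: norm_mult x_def intro!: mult_left_mono lg_b)
      then show ?thesis unfolding eventually_prod_filter
        by (intro exI[of _ "\<lambda>_. True"] exI[of _ "\<lambda>X. \<forall>k. norm (d k * low_gamma (\<sigma> k) (x X)) \<le> norm (d k) * B"]) simp
    qed
    show "summable (\<lambda>k. norm (d k) * B)"
      unfolding d_b by (intro summable_mult2 summable_mult sums_summable[OF exp_norm_sums])
  qed simp
  then have "((\<lambda>X. \<Sum>k. d k * low_gamma (\<sigma> k) (x X)) \<longlongrightarrow> (\<Sum>k. d k * Gamma (\<sigma> k))) at_top" by (elim conjE)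
  moreover have "(\<Sum>k. d k * low_gamma (\<sigma> k) (x X)) = F (of_real X + \<i> * of_real (pi - Arg z)) - F (of_real X - \<i> * of_real (pi + Arg z))" for X
    using sums_unique[OF D_sums] by simp
  moreover have "(\<Sum>k. d k * Gamma (\<sigma> k)) = 2 * pi * \<i> * bessel_J \<nu> z"
  proof -
    define t where "t k = (- 1) ^ k * rGamma (\<nu> + of_nat k + 1) / fact k * (z / 2) ^ (2 * k)" for k
    define C where "C = 2 * pi * \<i> * (z / 2) powr \<nu>"
    have dt: "d k * Gamma (\<sigma> k) = C * t k" for k
    proof -
      have a: "rGamma (\<sigma> k) * rGamma (1 - \<sigma> k) = sin (of_real pi * \<sigma> k) / of_real pi" by (rule rGamma_reflection_complex)
      have b: "Gamma (\<sigma> k) * rGamma (\<sigma> k) = 1"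
      proof -
        have "\<sigma> k \<notin> \<int>\<^sub>\<le>\<^sub>0" using np[of k] unfolding nonpole_def by (auto elim!: nonpos_Ints_cases')
        then show ?thesis by (simp add: Gamma_def rGamma_eq_zero_iff)
      qed
      \<comment> \<open>The reflection formula turns \<Gamma>(- \<nu> - k) sin (\<pi> \<sigma>) into
        \<pi> / \<Gamma>(\<nu> + k + 1), the coefficient in the Bessel series.\<close>
      have "sin (of_real pi * \<sigma> k) * Gamma (\<sigma> k) = of_real pi * rGamma (1 - \<sigma> k)"
        proof -
          have "sin (of_real pi * \<sigma> k) = of_real pi * (rGamma (\<sigma> k) * rGamma (1 - \<sigma> k))" unfolding a by simp
          then have "sin (of_real pi * \<sigma> k) * Gamma (\<sigma> k) = of_real pi * rGamma (1 - \<sigma> k) * (Gamma (\<sigma> k) * rGamma (\<sigma> k))"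
            by (simp only: mult_ac)
          then show ?thesis unfolding b by simp
        qed
      note sg = this
      have ar: "1 - \<sigma> k = \<nu> + of_nat k + 1" by (simp add: \<sigma>_def)
      have pw: "(- ((z / 2) ^ 2)) ^ k = (- 1) ^ k * (z / 2) ^ (2 * k)" by (simp only: power_minus[of "(z / 2) ^ 2"] power_mult)
      have "d k * Gamma (\<sigma> k) = (2 * \<i> * (z / 2) powr \<nu> * ((- 1) ^ k * (z / 2) ^ (2 * k) / fact k)) * (sin (of_real pi * \<sigma> k) * Gamma (\<sigma> k))"
        unfolding d_def c_def pw by (simp only: mult_ac)
      also have "\<dots> = C * t k" unfolding sg ar C_def t_def by (simp only: divide_inverse mult_ac of_real_mult of_real_numeral)
      finally show ?thesis .
    qed
    have "C \<noteq> 0" using z by (simp add: C_def)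
    have "summable (\<lambda>k. norm (d k * Gamma (\<sigma> k)))" using tannery by (elim conjE)
    then have "summable (\<lambda>k. d k * Gamma (\<sigma> k))" by (rule summable_norm_cancel)
    then have "summable (\<lambda>k. C * t k)" unfolding dt .
    then have "summable t" by (rule summable_mult_D[OF _ \<open>C \<noteq> 0\<close>])
    then have "(\<Sum>k. d k * Gamma (\<sigma> k)) = C * (\<Sum>k. t k)" unfolding dt by (rule suminf_mult)
    then show ?thesis by (simp add: bessel_J_def C_def t_def[abs_def])
  qed
  ultimately show ?thesis by simp
qed

section \<open>Integrals along rays\<close>

lemma has_integral_open_half_line:
  fixes f :: "real \<Rightarrow> real"
  shows "(f has_integral y) {0<..} \<longleftrightarrow> (f has_integral y) {0..}"
proof (rule has_integral_spike_set_eq)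
  show "negligible {x \<in> {0<..} - {0..}. f x \<noteq> 0}" by (rule negligible_subset[of "{0}"]) auto
  show "negligible {x \<in> {0..} - {0<..}. f x \<noteq> 0}" by (rule negligible_subset[of "{0}"]) auto
qed

text \<open>The Gamma integral under the substitution t = c \<rho>^3.\<close>

lemma cubic_exp_integral:
  fixes c :: real and M :: nat
  assumes c: "c > 0"
  shows "((\<lambda>\<rho>. \<rho> ^ M * exp (- c * \<rho> ^ 3)) has_integral
           (Gamma ((real M + 1) / 3) / (3 * c powr ((real M + 1) / 3)))) {0..}"
proof -
  define p where "p = (real M + 1) / 3"
  have p: "p > 0" by (simp add: p_def)
  define f where "f t = t powr (p - 1) / exp t" for t :: real
  define g where "g \<rho> = c * \<rho> ^ 3" for \<rho> :: real
  have img: "g ` {0<..} = {0<..}"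
  proof (intro equalityI subsetI)
    fix y :: real assume y: "y \<in> {0<..}"
    have "g (root 3 (y / c)) = y" using c by (simp add: g_def odd_real_root_pow)
    moreover have "root 3 (y / c) > 0" using y c by simp
    ultimately show "y \<in> g ` {0<..}" by (metis greaterThan_iff image_eqI)
  qed (use c in \<open>auto simp: g_def\<close>)
  have inj: "inj_on g {0<..}"
    by (rule inj_onI) (use c in \<open>auto simp: g_def power_eq_iff_eq_base\<close>)
  have f: "(f has_integral Gamma p) {0<..}"
    unfolding has_integral_open_half_line f_def using p by (rule Gamma_integral_real)
  then have "f absolutely_integrable_on {0<..}"
    by (intro nonnegative_absolutely_integrable_1 has_integral_integrable[OF f]) (simp add: f_def)
  moreover have "integral {0<..} f = Gamma p" using f by (rule integral_unique)
  moreover have "(g has_field_derivative 3 * c * \<rho> ^ 2) (at \<rho> within {0<..})" for \<rho>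
    unfolding g_def[abs_def] by (auto intro!: derivative_eq_intros)
  ultimately have h: "(\<lambda>\<rho>. \<bar>3 * c * \<rho> ^ 2\<bar> * f (g \<rho>)) absolutely_integrable_on {0<..}"
    "integral {0<..} (\<lambda>\<rho>. \<bar>3 * c * \<rho> ^ 2\<bar> * f (g \<rho>)) = Gamma p"
    using has_absolute_integral_change_of_variables_1'[of "{0<..}" g "\<lambda>\<rho>. 3 * c * \<rho> ^ 2" f "Gamma p"] inj img by auto
  then have "((\<lambda>\<rho>. \<bar>3 * c * \<rho> ^ 2\<bar> * f (g \<rho>)) has_integral Gamma p) {0<..}"
    by (metis absolutely_integrable_on_def integrable_integral)
  then have "((\<lambda>\<rho>. \<rho> ^ M * exp (- c * \<rho> ^ 3) * (3 * c powr p)) has_integral Gamma p) {0<..}"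
  proof (rule has_integral_eq[rotated])
    fix \<rho> :: real assume "\<rho> \<in> {0<..}"
    then have \<rho>: "\<rho> > 0" by simp
    have "(\<rho> ^ 3) powr (p - 1) = \<rho> powr (3 * (p - 1))" using \<rho> by (simp add: powr_powr flip: powr_numeral)
    also have "3 * (p - 1) = real M - 2" by (simp add: p_def field_simps)
    finally have 1: "\<rho> ^ 2 * (\<rho> ^ 3) powr (p - 1) = \<rho> ^ M"
      using \<rho> by (simp add: powr_diff powr_realpow)
    have 2: "c * c powr (p - 1) = c powr p" using c by (simp add: powr_diff)
    have "\<bar>3 * c * \<rho> ^ 2\<bar> * f (g \<rho>) = 3 * (c * c powr (p - 1)) * (\<rho> ^ 2 * (\<rho> ^ 3) powr (p - 1)) * exp (- c * \<rho> ^ 3)"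
      using \<rho> c by (simp add: f_def g_def powr_mult exp_minus divide_inverse mult_ac)
    then show "\<bar>3 * c * \<rho> ^ 2\<bar> * f (g \<rho>) = \<rho> ^ M * exp (- c * \<rho> ^ 3) * (3 * c powr p)"
      unfolding 1 2 by (simp add: mult_ac)
  qed
  then have "((\<lambda>\<rho>. \<rho> ^ M * exp (- c * \<rho> ^ 3) * (3 * c powr p)) has_integral Gamma p) {0..}"
    unfolding has_integral_open_half_line .
  from has_integral_mult_left[OF this, of "1 / (3 * c powr p)"]
  show ?thesis using c by (simp add: p_def)
qed

lemma improper_integral_primitive:
  fixes f :: "real \<Rightarrow> complex"
  assumes deriv: "\<And>t. t \<ge> 0 \<Longrightarrow> (\<Psi> has_vector_derivative f t) (at t within {0..})"
    and g: "g integrable_on {0..}" and le: "\<And>t. t \<ge> 0 \<Longrightarrow> norm (f t) \<le> g t"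
  shows "f integrable_on {0..}" "(\<Psi> \<longlongrightarrow> \<Psi> 0 + integral {0..} f) at_top"
proof -
  have ftc: "(f has_integral (\<Psi> x - \<Psi> 0)) {0..x}" if "x \<ge> 0" for x
    using that by (intro fundamental_theorem_of_calculus)
      (auto intro: has_vector_derivative_within_subset[OF deriv])
  define h where "h x t = (if t \<in> {0..x} then f t else 0)" for x t
  have h_int: "(h x has_integral (\<Psi> x - \<Psi> 0)) {0..}" if "x \<ge> 0" for x
  proof -
    have "(h x has_integral (\<Psi> x - \<Psi> 0)) UNIV"
      unfolding h_def[abs_def] has_integral_restrict_UNIV by (rule ftc[OF that])
    moreover have "h x = (\<lambda>t. if t \<in> {0..} then h x t else 0)" by (auto simp: h_def)
    ultimately show ?thesis by (metis has_integral_restrict_UNIV)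
  qed
  have main: "f integrable_on {0..} \<and> (\<lambda>n. \<Psi> (X n)) \<longlonglongrightarrow> \<Psi> 0 + integral {0..} f"
    if X: "filterlim X at_top sequentially" for X :: "nat \<Rightarrow> real"
  proof -
    define Y where "Y n = max 0 (X n)" for n
    have Y: "filterlim Y at_top sequentially"
      by (rule filterlim_at_top_mono[OF X]) (simp add: Y_def)
    have lim: "(\<lambda>n. h (Y n) t) \<longlonglongrightarrow> f t" if "t \<in> {0..}" for t
    proof -
      have "\<forall>\<^sub>F n in sequentially. t \<le> Y n" using Y by (simp add: filterlim_at_top)
      then have "\<forall>\<^sub>F n in sequentially. h (Y n) t = f t" by eventually_elim (use that in \<open>auto simp: h_def\<close>)
      then show ?thesis by (rule tendsto_eventually)
    qed
    have hb: "norm (h (Y n) t) \<le> g t" if "t \<in> {0..}" for n t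
      using le[of t] that order_trans[OF norm_ge_zero le[of t]] by (auto simp: h_def)
    have hi: "h (Y n) integrable_on {0..}" for n using h_int[of "Y n"] by (auto simp: Y_def)
    have "(\<lambda>n. integral {0..} (h (Y n))) \<longlonglongrightarrow> integral {0..} f"
      by (rule dominated_convergence(2)[OF hi g hb lim])
    moreover have "integral {0..} (h (Y n)) = \<Psi> (Y n) - \<Psi> 0" for n
      by (rule integral_unique[OF h_int]) (simp add: Y_def)
    ultimately have "(\<lambda>n. \<Psi> (Y n) - \<Psi> 0) \<longlonglongrightarrow> integral {0..} f" by simp
    from tendsto_add[OF tendsto_const[of "\<Psi> 0"] this]
    have "(\<lambda>n. \<Psi> (Y n)) \<longlonglongrightarrow> \<Psi> 0 + integral {0..} f" by simp
    moreover have "\<forall>\<^sub>F n in sequentially. 0 \<le> X n" using X by (simp add: filterlim_at_top)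
    then have "\<forall>\<^sub>F n in sequentially. \<Psi> (Y n) = \<Psi> (X n)" by eventually_elim (simp add: Y_def)
    ultimately have "(\<lambda>n. \<Psi> (X n)) \<longlonglongrightarrow> \<Psi> 0 + integral {0..} f" by (rule Lim_transform_eventually)
    then show ?thesis using dominated_convergence(1)[OF hi g hb lim] by simp
  qed
  show "f integrable_on {0..}" using main[OF filterlim_real_sequentially] by simp
  show "(\<Psi> \<longlongrightarrow> \<Psi> 0 + integral {0..} f) at_top"
    by (rule tendsto_at_topI_sequentially) (use main in blast)
qed

lemma ray_limit:
  fixes f \<Phi> :: "complex \<Rightarrow> complex"
  assumes \<Phi>: "\<And>r. r \<in> S \<Longrightarrow> (\<Phi> has_field_derivative f r) (at r)"
    and S: "\<And>\<rho>. \<rho> \<ge> 0 \<Longrightarrow> of_real \<rho> * cis a \<in> S" and c: "c > 0"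
    and le: "\<And>\<rho>. \<rho> \<ge> 0 \<Longrightarrow> norm (f (of_real \<rho> * cis a)) \<le> C * \<rho> ^ M * exp (- c * \<rho> ^ 3)"
  shows "(\<lambda>\<rho>. f (of_real \<rho> * cis a) * cis a) integrable_on {0..}"
    "((\<lambda>\<rho>. \<Phi> (of_real \<rho> * cis a)) \<longlongrightarrow> \<Phi> 0 + integral {0..} (\<lambda>\<rho>. f (of_real \<rho> * cis a) * cis a)) at_top"
proof -
  have D: "((\<lambda>\<rho>. \<Phi> (of_real \<rho> * cis a)) has_vector_derivative f (of_real \<rho> * cis a) * cis a) (at \<rho> within {0..})" if "\<rho> \<ge> 0" for \<rho>
  proof -
    have "((\<lambda>z. \<Phi> (z * cis a)) has_field_derivative f (of_real \<rho> * cis a) * cis a) (at (of_real \<rho>))"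
      by (rule DERIV_chain2[where f = \<Phi> and g = "\<lambda>z. z * cis a" and x = "of_real \<rho>", OF \<Phi>[OF S[OF that]]]) (auto intro!: derivative_eq_intros)
    from has_vector_derivative_real_field[OF this] show ?thesis by (rule has_vector_derivative_at_within)
  qed
  have "(\<lambda>\<rho>. C * \<rho> ^ M * exp (- c * \<rho> ^ 3)) integrable_on {0..}"
    using integrable_on_cmult_left[of "\<lambda>\<rho>. \<rho> ^ M * exp (- c * \<rho> ^ 3)" "{0..}" C] cubic_exp_integral[OF c, of M]
    by (auto simp: mult.assoc has_integral_integrable)
  moreover have "norm (f (of_real \<rho> * cis a) * cis a) \<le> C * \<rho> ^ M * exp (- c * \<rho> ^ 3)" if "\<rho> \<ge> 0" for \<rho>
    using le[OF that] by (simp add: norm_mult)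
  ultimately show "(\<lambda>\<rho>. f (of_real \<rho> * cis a) * cis a) integrable_on {0..}"
    "((\<lambda>\<rho>. \<Phi> (of_real \<rho> * cis a)) \<longlongrightarrow> \<Phi> 0 + integral {0..} (\<lambda>\<rho>. f (of_real \<rho> * cis a) * cis a)) at_top"
    using improper_integral_primitive[OF D] by auto
qed

lemma arc_bound:
  fixes f \<Phi> :: "complex \<Rightarrow> complex"
  assumes \<Phi>: "\<And>r. r \<in> S \<Longrightarrow> (\<Phi> has_field_derivative f r) (at r)"
    and S: "\<And>\<alpha>. \<alpha> \<in> closed_segment a b \<Longrightarrow> of_real \<rho> * cis \<alpha> \<in> S"
    and le: "\<And>\<alpha>. \<alpha> \<in> closed_segment a b \<Longrightarrow> norm (f (of_real \<rho> * cis \<alpha>)) \<le> B" and \<rho>: "\<rho> \<ge> 0"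
  shows "norm (\<Phi> (of_real \<rho> * cis b) - \<Phi> (of_real \<rho> * cis a)) \<le> B * \<rho> * \<bar>b - a\<bar>"
proof -
  have D: "((\<lambda>\<alpha>. \<Phi> (of_real \<rho> * cis \<alpha>)) has_vector_derivative f (of_real \<rho> * cis \<alpha>) * (of_real \<rho> * (\<i> * cis \<alpha>))) (at \<alpha>)"
    if "\<alpha> \<in> closed_segment a b" for \<alpha>
  proof -
    have "((\<lambda>z. \<Phi> (of_real \<rho> * exp (\<i> * z))) has_field_derivative 
        f (of_real \<rho> * exp (\<i> * of_real \<alpha>)) * (of_real \<rho> * (exp (\<i> * of_real \<alpha>) * \<i>))) (at (of_real \<alpha>))"
      using \<Phi>[OF S[OF that]] unfolding cis_conv_exp
      by (rule DERIV_chain2) (auto intro!: derivative_eq_intros)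
    from has_vector_derivative_real_field[OF this] show ?thesis by (simp add: cis_conv_exp mult_ac)
  qed
  have "norm (\<Phi> (of_real \<rho> * cis b) - \<Phi> (of_real \<rho> * cis a)) \<le> norm (b - a) * (B * \<rho>)"
  proof (rule differentiable_bound[where f' = "\<lambda>\<alpha> h. h *\<^sub>R (f (of_real \<rho> * cis \<alpha>) * (of_real \<rho> * (\<i> * cis \<alpha>)))" and S = "closed_segment a b", 
        THEN order_trans])
    show "((\<lambda>\<alpha>. \<Phi> (of_real \<rho> * cis \<alpha>)) has_derivative (\<lambda>h. h *\<^sub>R (f (of_real \<rho> * cis \<alpha>) * (of_real \<rho> * (\<i> * cis \<alpha>))))) (at \<alpha> within closed_segment a b)"
      if "\<alpha> \<in> closed_segment a b" for \<alpha>
      using D[OF that] unfolding has_vector_derivative_def by (rule has_derivative_at_withinI)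
    show "onorm (\<lambda>h. h *\<^sub>R (f (of_real \<rho> * cis \<alpha>) * (of_real \<rho> * (\<i> * cis \<alpha>)))) \<le> B * \<rho>"
      if "\<alpha> \<in> closed_segment a b" for \<alpha>
    proof (rule onorm_bound)
      have "0 \<le> B" using le[OF that] norm_ge_zero order_trans by blast
      then show "0 \<le> B * \<rho>" using \<rho> by simp
      show "norm (h *\<^sub>R (f (of_real \<rho> * cis \<alpha>) * (of_real \<rho> * (\<i> * cis \<alpha>)))) \<le> B * \<rho> * norm h" for h :: real
        using mult_left_mono[OF le[OF that], of "\<rho> * \<bar>h\<bar>"] \<rho> by (simp add: norm_mult mult_ac)
    qed
  qed auto
  then show ?thesis by (simp add: mult_ac)
qed

lemma power_exp_cube_tendsto_0:
  fixes c :: real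
  assumes "c > 0" shows "((\<lambda>\<rho>. \<rho> ^ M * exp (- c * \<rho> ^ 3)) \<longlongrightarrow> 0) at_top"
proof (rule Lim_null_comparison)
  have lim: "((\<lambda>x::real. x ^ M / exp x) \<longlongrightarrow> 0) at_top" by (rule tendsto_power_div_exp_0)
  have "filterlim (\<lambda>\<rho>. c * \<rho>) at_top at_top"
    by (rule filterlim_tendsto_pos_mult_at_top[OF tendsto_const[of c] assms]) (rule filterlim_ident)
  from filterlim_compose[OF lim this]
  have "((\<lambda>\<rho>. (c * \<rho>) ^ M / exp (c * \<rho>)) \<longlongrightarrow> 0) at_top" .
  from tendsto_mult_right[OF this, of "1 / c ^ M"]
  show "((\<lambda>\<rho>. (c * \<rho>) ^ M / exp (c * \<rho>) * (1 / c ^ M)) \<longlongrightarrow> 0) at_top" by simp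
  show "\<forall>\<^sub>F \<rho> in at_top. norm (\<rho> ^ M * exp (- c * \<rho> ^ 3)) \<le> (c * \<rho>) ^ M / exp (c * \<rho>) * (1 / c ^ M)"
    using eventually_ge_at_top[of 1]
  proof eventually_elim
    case (elim \<rho>)
    have "\<rho> \<le> \<rho> ^ 3" using elim by (intro self_le_power) auto
    then have "exp (- c * \<rho> ^ 3) \<le> exp (- (c * \<rho>))" using assms by simp
    then have "\<rho> ^ M * exp (- c * \<rho> ^ 3) \<le> \<rho> ^ M * exp (- (c * \<rho>))" using elim by (intro mult_left_mono) auto
    moreover have "(c * \<rho>) ^ M / exp (c * \<rho>) * (1 / c ^ M) = \<rho> ^ M * exp (- (c * \<rho>))"
      using assms by (simp add: power_mult_distrib exp_minus field_simps)
    moreover have "norm (\<rho> ^ M * exp (- c * \<rho> ^ 3)) = \<rho> ^ M * exp (- c * \<rho> ^ 3)"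
      using elim by (simp add: abs_mult)
    ultimately show ?case by (simp only:)
  qed
qed

text \<open>The shape of domain used for all ray integrals: such a set carries primitives and
  contains the segment from 0 to each of its points, although the sector around the rays may be all
  that is of interest.\<close>

definition star_at_0 :: "complex set \<Rightarrow> bool" where
  "star_at_0 S \<longleftrightarrow> open S \<and> 0 \<in> S \<and> (\<forall>r\<in>S. \<forall>l\<in>{0..1}. of_real l * r \<in> S)"

lemma star_primitive:
  assumes "star_at_0 S" "f holomorphic_on S"
  obtains \<Phi> where "\<And>r. r \<in> S \<Longrightarrow> (\<Phi> has_field_derivative f r) (at r)" "\<Phi> 0 = 0"
proof -
  have "starlike S"
    unfolding starlike_def
  proof (intro bexI ballI subsetI)
    fix x z assume "x \<in> S" "z \<in> closed_segment 0 x"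
    then show "z \<in> S" using assms(1) by (auto simp: star_at_0_def in_segment scaleR_conv_of_real)
  qed (use assms(1) in \<open>simp add: star_at_0_def\<close>)
  moreover have "open S" using assms(1) by (simp add: star_at_0_def)
  ultimately obtain g where g: "\<And>x. x \<in> S \<Longrightarrow> (g has_field_derivative f x) (at x)"
    using holomorphic_starlike_primitive[of S f "{}"] holomorphic_on_imp_continuous_on[OF assms(2)]
      holomorphic_on_imp_differentiable_at[OF assms(2)] by auto
  have "((\<lambda>r. g r - g 0) has_field_derivative f r) (at r)" if "r \<in> S" for r
    using g[OF that] by (auto intro!: derivative_eq_intros)
  then show ?thesis using that[of "\<lambda>r. g r - g 0"] by simp
qed

lemma cos_bound_between:
  fixes a b A :: real
  assumes "\<alpha> \<in> closed_segment a b" "\<bar>a\<bar> \<le> A" "\<bar>b\<bar> \<le> A" shows "\<bar>\<alpha>\<bar> \<le> A"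
  using assms by (auto simp: closed_segment_eq_real_ivl split: if_splits)

text \<open>A primitive has limits along both rays. They agree because the arc joining the rays at
  radius \<rho> contributes at most a power of \<rho> times exp (- c \<rho>^3).\<close>

lemma ray_rotation:
  assumes S: "star_at_0 S" and k: "k holomorphic_on S"
    and sec: "\<And>\<rho> \<alpha>. \<rho> \<ge> 0 \<Longrightarrow> \<alpha> \<in> closed_segment a b \<Longrightarrow> of_real \<rho> * cis \<alpha> \<in> S"
    and kb: "\<And>\<rho> \<alpha>. \<rho> \<ge> 0 \<Longrightarrow> \<alpha> \<in> closed_segment a b \<Longrightarrow> norm (k (of_real \<rho> * cis \<alpha>)) \<le> C * \<rho> ^ M"
    and m: "m > 0" and ang: "\<bar>\<tau> + 3 * a\<bar> < pi / 2" "\<bar>\<tau> + 3 * b\<bar> < pi / 2"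
  defines "f \<equiv> \<lambda>r. exp (- (of_real m * cis \<tau>) * r ^ 3 / 6) * k r"
  shows "(\<lambda>\<rho>. f (of_real \<rho> * cis a) * cis a) integrable_on {0..}"
    and "integral {0..} (\<lambda>\<rho>. f (of_real \<rho> * cis a) * cis a) = integral {0..} (\<lambda>\<rho>. f (of_real \<rho> * cis b) * cis b)"
proof -
  have fhol: "f holomorphic_on S" unfolding f_def by (intro holomorphic_intros k) auto
  obtain \<Phi> where \<Phi>: "\<And>r. r \<in> S \<Longrightarrow> (\<Phi> has_field_derivative f r) (at r)" "\<Phi> 0 = 0"
    by (rule star_primitive[OF S fhol], rule that)
  define A where "A = max \<bar>\<tau> + 3 * a\<bar> \<bar>\<tau> + 3 * b\<bar>"
  have A: "0 \<le> A" "A < pi / 2" using ang by (auto simp: A_def)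
  \<comment> \<open>Between the two rays |\<tau> + 3 \<alpha>| <= A < \<pi>/2, so the real part of
    \<mu> r^3 / 6 is at least c \<rho>^3 throughout the sector.\<close>
  define c where "c = m * cos A / 6"
  have c: "c > 0" using m A by (simp add: c_def cos_gt_zero_pi)
  have fb: "norm (f (of_real \<rho> * cis \<alpha>)) \<le> C * \<rho> ^ M * exp (- c * \<rho> ^ 3)"
    if "\<rho> \<ge> 0" "\<alpha> \<in> closed_segment a b" for \<rho> \<alpha>
  proof -
    have "\<tau> + 3 * \<alpha> \<in> closed_segment (\<tau> + 3 * a) (\<tau> + 3 * b)"
      using that(2) by (auto simp: closed_segment_eq_real_ivl split: if_splits)
    then have "\<bar>\<tau> + 3 * \<alpha>\<bar> \<le> A" by (rule cos_bound_between) (auto simp: A_def)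
    then have "cos A \<le> cos \<bar>\<tau> + 3 * \<alpha>\<bar>" using A by (intro cos_monotone_0_pi_le) auto
    then have co: "cos A \<le> cos (\<tau> + 3 * \<alpha>)" by simp
    have c3: "cis \<alpha> ^ 3 = cis (3 * \<alpha>)" using Complex.DeMoivre[of \<alpha> 3] by simp
    have "of_real m * cis \<tau> * (of_real \<rho> * cis \<alpha>) ^ 3 = of_real (m * \<rho> ^ 3) * cis (\<tau> + 3 * \<alpha>)"
      by (simp add: power_mult_distrib c3 cis_mult[symmetric] mult_ac)
    then have "Re (- (of_real m * cis \<tau>) * (of_real \<rho> * cis \<alpha>) ^ 3 / 6) = - (m * cos (\<tau> + 3 * \<alpha>) / 6) * \<rho> ^ 3"
      by (simp del: of_real_mult of_real_power)
    also have "\<dots> \<le> - c * \<rho> ^ 3"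
      unfolding c_def using co m that by (intro mult_right_mono) auto
    finally have "norm (exp (- (of_real m * cis \<tau>) * (of_real \<rho> * cis \<alpha>) ^ 3 / 6)) \<le> exp (- c * \<rho> ^ 3)"
      unfolding norm_exp_eq_Re by (rule exp_le_cancel_iff[THEN iffD2])
    then have "norm (f (of_real \<rho> * cis \<alpha>)) \<le> exp (- c * \<rho> ^ 3) * (C * \<rho> ^ M)"
      unfolding f_def norm_mult using kb[OF that] by (intro mult_mono) auto
    then show ?thesis by (simp add: mult_ac)
  qed
  have ea: "a \<in> closed_segment a b" "b \<in> closed_segment a b" by auto
  note lim_a = ray_limit[OF \<Phi>(1) sec[OF _ ea(1)] c fb[OF _ ea(1)]]
  note lim_b = ray_limit[OF \<Phi>(1) sec[OF _ ea(2)] c fb[OF _ ea(2)]]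
  show "(\<lambda>\<rho>. f (of_real \<rho> * cis a) * cis a) integrable_on {0..}" by (rule lim_a(1))
  have "((\<lambda>\<rho>. \<Phi> (of_real \<rho> * cis b) - \<Phi> (of_real \<rho> * cis a)) \<longlongrightarrow> 0) at_top"
  proof (rule Lim_null_comparison)
    show "\<forall>\<^sub>F \<rho> in at_top. norm (\<Phi> (of_real \<rho> * cis b) - \<Phi> (of_real \<rho> * cis a)) \<le> C * \<bar>b - a\<bar> * (\<rho> ^ Suc M * exp (- c * \<rho> ^ 3))"
      using eventually_ge_at_top[of 0]
    proof eventually_elim
      case (elim \<rho>)
      from arc_bound[OF \<Phi>(1) sec[OF elim] fb[OF elim] elim, of a b]
      show ?case by (simp add: mult_ac)
    qed
    from tendsto_mult_right[OF power_exp_cube_tendsto_0[OF c, of "Suc M"], of "C * \<bar>b - a\<bar>"]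
    show "((\<lambda>\<rho>. C * \<bar>b - a\<bar> * (\<rho> ^ Suc M * exp (- c * \<rho> ^ 3))) \<longlongrightarrow> 0) at_top" by (simp add: mult.commute)
  qed
  moreover have "((\<lambda>\<rho>. \<Phi> (of_real \<rho> * cis b) - \<Phi> (of_real \<rho> * cis a)) \<longlongrightarrow>
     (\<Phi> 0 + integral {0..} (\<lambda>\<rho>. f (of_real \<rho> * cis b) * cis b)) - (\<Phi> 0 + integral {0..} (\<lambda>\<rho>. f (of_real \<rho> * cis a) * cis a))) at_top"
    by (intro tendsto_diff lim_a(2) lim_b(2))
  ultimately have "(\<Phi> 0 + integral {0..} (\<lambda>\<rho>. f (of_real \<rho> * cis b) * cis b)) - (\<Phi> 0 + integral {0..} (\<lambda>\<rho>. f (of_real \<rho> * cis a) * cis a)) = 0"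
    by (intro tendsto_unique[OF trivial_limit_at_top_linorder])
  then show "integral {0..} (\<lambda>\<rho>. f (of_real \<rho> * cis a) * cis a) = integral {0..} (\<lambda>\<rho>. f (of_real \<rho> * cis b) * cis b)" by simp
qed

section \<open>From the phase plane to the Borel plane\<close>

text \<open>Because \<open>crit_angle\<close> < \<pi>/2, points below height 3 \<pi>/2 lie strictly
  under the critical curve. Their phase is not on the negative imaginary axis, so arg om < \<pi>/2
  and om^2 is not negative real.\<close>

lemma om_square_cut_plane:
  assumes "Re t > 0" "Im t > 0" "Im t < 3 * pi / 2"
  shows "t \<in> crit_region" "om t ^ 2 \<in> cut_plane"
proof -
  have b: "crit_angle (Re t) < pi / 2" using crit_angle_bounds[OF assms(1)] by simp
  then show r: "t \<in> crit_region" using assms by (auto simp: crit_region_def complex_eq_iff)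
  obtain z where z: "6 * ph t = exp (3 * z)" "0 \<le> Im z" "Im z \<le> pi / 2" "om t = exp z"
    using om_crit_region[OF r] by metis
  have "Im z \<noteq> pi / 2"
  proof
    assume im: "Im z = pi / 2"
    have "Re (6 * ph t) = 0" "Im (6 * ph t) < 0"
      unfolding z(1) using sin_3over2_pi cos_3over2_pi by (simp_all add: Re_exp Im_exp im mult.commute)
    then show False using ph_in_crit_region[of t] assms b by simp
  qed
  then have im: "0 \<le> Im z" "Im z < pi / 2" using z by auto
  have sq: "om t ^ 2 = exp (2 * z)" unfolding z(4) by (simp flip: exp_of_nat_mult)
  show "om t ^ 2 \<in> cut_plane"
  proof (rule ccontr)
    assume "om t ^ 2 \<notin> cut_plane"
    then obtain x where x: "exp (2 * z) = of_real x" "x \<le> - 1" by (auto simp: cut_plane_def sq)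
    then have "Im (exp (2 * z)) = 0" "Re (exp (2 * z)) < 0" by auto
    then have "sin (2 * Im z) = 0" "cos (2 * Im z) < 0" by (auto simp: Re_exp Im_exp mult_less_0_iff)
    moreover have "sin (2 * Im z) > 0 \<or> Im z = 0" using im sin_gt_zero[of "2 * Im z"] by linarith
    ultimately show False by auto
  qed
qed

definition strip :: "complex set" where "strip = {t. Re t > 0 \<and> Im t > 0 \<and> Im t < 3 * pi / 2}"

lemma strip_convex: "convex strip" and strip_open: "open strip"
proof -
  have eq: "strip = {t. Re t > 0} \<inter> {t. Im t > 0} \<inter> {t. Im t < 3 * pi / 2}" by (auto simp: strip_def)
  show "convex strip" unfolding eq
    by (intro convex_Int convex_halfspace_Re_gt convex_halfspace_Im_gt convex_halfspace_Im_lt)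
  show "open strip" unfolding eq
    by (intro open_Int open_halfspace_Re_gt open_halfspace_Im_gt open_halfspace_Im_lt)
qed

text \<open>The identity is known on the positive real axis, which bounds the strip without lying in
  it. A ball around 1 carries it across the axis, and connectedness of the strip does the
  rest.\<close>

lemma crit_transform_om_strip:
  assumes "t \<in> strip" shows "crit_transform (om t ^ 2) * (2 * (cosh t - 1) / om t ^ 2) = 1"
proof -
  define S where "S = om_dom \<inter> (\<lambda>t. om t ^ 2) -` cut_plane"
  have om_cont: "continuous_on om_dom (\<lambda>t. om t ^ 2)"
    by (intro continuous_intros holomorphic_on_imp_continuous_on om_holomorphic)
  have S: "open S" unfolding S_def by (intro continuous_open_preimage om_cont open_om_dom open_cut_plane)
  define A where "A t = crit_transform (om t ^ 2) * (2 * (cosh t - 1) / om t ^ 2) - 1" for t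
  have A: "A holomorphic_on S"
  proof -
    have h1: "(crit_transform \<circ> (\<lambda>t. om t ^ 2)) holomorphic_on S" unfolding crit_transform_def
      by (rule holomorphic_on_compose_gen[OF _ crit.St_holomorphic])
         (auto simp: S_def intro!: holomorphic_intros holomorphic_on_subset[OF om_holomorphic])
    have h2: "(\<lambda>t. 2 * (cosh t - 1) / om t ^ 2) holomorphic_on S" unfolding cosh_field_def
      by (intro holomorphic_intros holomorphic_on_subset[OF om_holomorphic]) (auto simp: S_def)
    show ?thesis unfolding A_def[abs_def]
      by (intro holomorphic_on_diff holomorphic_on_mult holomorphic_on_const h1[unfolded o_def] h2)
  qed
  have A_real: "A (of_real T) = 0" if "T > 0" for T
  proof -
    define w where "w = root 3 (6 * (sinh T - T))"
    have w: "w > 0" using sinh_gt_self[OF that] by (simp add: w_def)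
    have om: "om (of_real T) = of_real w" unfolding w_def by (rule om_of_real[OF that])
    have G: "crit_transform (of_real w ^ 2) = of_real (w ^ 2 / (2 * (cosh T - 1)))"
      using crit_transform_real[OF that] by (simp only: w_def of_real_power)
    have ch: "cosh (complex_of_real T) - 1 = of_real (cosh T - 1)" by (simp add: cosh_complex_of_real)
    have "cosh T - 1 \<noteq> 0" using cosh_gt_1[OF that] that by linarith
    then have nz: "2 * complex_of_real (cosh T - 1) \<noteq> 0" "complex_of_real w ^ 2 \<noteq> 0" using w by (simp_all del: of_real_diff)
    have "p / q * (q / p) - 1 = 0" if "q \<noteq> 0" "p \<noteq> 0" for p q :: complex using that by simp
    from this[OF nz] show ?thesis
      unfolding A_def om G ch by (simp only: of_real_divide of_real_mult of_real_power of_real_numeral)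
  qed
  have real_S: "of_real T \<in> S" if "T > 0" for T
  proof -
    have "of_real T \<in> crit_region" using that crit_angle_bounds[OF that] by (auto simp: crit_region_def)
    moreover have "om (of_real T) ^ 2 = of_real ((root 3 (6 * (sinh T - T))) ^ 2)" by (simp add: om_of_real[OF that])
    moreover have "complex_of_real (x ^ 2) \<in> cut_plane" for x
    proof -
      have "\<not> x ^ 2 \<le> - 1" using zero_le_power2[of x] by linarith
      then show ?thesis by (auto simp: cut_plane_def simp del: of_real_power)
    qed
    ultimately show ?thesis using crit_region_subset_om_dom by (auto simp: S_def)
  qed
  obtain e where e: "e > 0" "ball 1 e \<subseteq> S" using S real_S[of 1] openE[of S 1] by auto
  have ball: "A z = 0" if "z \<in> ball 1 e" for z
  proof (rule analytic_continuation[OF holomorphic_on_subset[OF A e(2)] open_ball connected_ball, of "complex_of_real ` {1<..<1+e}" 1])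
    show "1 islimpt complex_of_real ` {1<..<1+e}"
      unfolding islimpt_approachable
    proof (intro allI impI)
      fix d :: real assume "d > 0"
      then show "\<exists>x'\<in>complex_of_real ` {1<..<1+e}. x' \<noteq> 1 \<and> dist x' 1 < d"
        using e(1) by (intro bexI[of _ "of_real (1 + min d e / 2)"] imageI) (auto simp: dist_norm)
    qed
    show "complex_of_real ` {1<..<1 + e} \<subseteq> ball 1 e"
    proof clarify
      fix x :: real assume "x \<in> {1<..<1 + e}"
      then show "complex_of_real x \<in> ball 1 e"
        using dist_of_real[of 1 x, where 'a = complex] by (simp add: dist_real_def)
    qed
  qed (use e that A_real in auto)
  define \<xi> where "\<xi> = Complex 1 (min e 1 / 2)"
  have \<xi>: "\<xi> \<in> strip" "\<xi> \<in> ball 1 e" using e pi_gt3 by (auto simp: \<xi>_def strip_def dist_norm cmod_def)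
  have sub: "strip \<subseteq> S"
    using om_square_cut_plane crit_region_subset_om_dom by (auto simp: strip_def S_def)
  have "A t = 0"
  proof (rule analytic_continuation[OF holomorphic_on_subset[OF A sub] strip_open convex_connected[OF strip_convex], of "strip \<inter> ball 1 e" \<xi>])
    show "\<xi> islimpt strip \<inter> ball 1 e"
      by (rule interior_limit_point) (use \<xi> in \<open>auto simp: interior_open open_Int strip_open\<close>)
  qed (use \<xi> ball assms in auto)
  then show ?thesis by (simp add: A_def)
qed

section \<open>Horizontal lines in the phase plane and rays in the Borel plane\<close>

definition phase_prim :: "complex \<Rightarrow> complex \<Rightarrow> complex" where
  "phase_prim \<mu> = (SOME F. F 0 = 0 \<and> (\<forall>t. (F has_field_derivative exp (- \<mu> * ph t)) (at t)))"

lemma phase_prim: "phase_prim \<mu> 0 = 0" "(phase_prim \<mu> has_field_derivative exp (- \<mu> * ph t)) (at t)"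
proof -
  have "(\<lambda>t. exp (- \<mu> * ph t)) holomorphic_on UNIV" by (intro holomorphic_intros)
  then obtain g where g: "\<And>x. (g has_field_derivative exp (- \<mu> * ph x)) (at x)"
    using holomorphic_convex_primitive'[of UNIV "\<lambda>t. exp (- \<mu> * ph t)"] by auto
  have "\<exists>F. F 0 = 0 \<and> (\<forall>t. (F has_field_derivative exp (- \<mu> * ph t)) (at t))"
    by (intro exI[of _ "\<lambda>t. g t - g 0"]) (auto intro!: derivative_eq_intros g)
  from someI_ex[OF this] show "phase_prim \<mu> 0 = 0" "(phase_prim \<mu> has_field_derivative exp (- \<mu> * ph t)) (at t)"
    by (auto simp: phase_prim_def)
qed

text \<open>Two entire primitives differ by a constant, so the symmetries of the phase under t to -
  t, conjugation and translation by 2 \<pi> i pass to differences of the primitive.\<close>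

lemma phase_prim_unique:
  assumes "\<And>t. (F has_field_derivative exp (- \<mu> * ph t)) (at t)" shows "F a - F b = phase_prim \<mu> a - phase_prim \<mu> b"
proof -
  have "((\<lambda>t. F t - phase_prim \<mu> t) has_field_derivative 0) (at t)" for t
    using DERIV_diff[OF assms phase_prim(2)[of \<mu> t]] by simp
  then obtain c where "\<And>t. F t - phase_prim \<mu> t = c" using has_field_derivative_zero_constant[of UNIV "\<lambda>t. F t - phase_prim \<mu> t"] by auto
  then show ?thesis by (metis (no_types) diff_add_cancel diff_diff_eq2 add_diff_cancel_left)
qed

lemma ph_minus: "ph (- t) = - ph t" and ph_cnj: "ph (cnj t) = cnj (ph t)"
  by (simp_all add: ph_def complex_eq_iff Re_ph[unfolded ph_def, simplified] Im_ph[unfolded ph_def, simplified])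

lemma phase_prim_minus: "phase_prim (- \<mu>) (- t) = - phase_prim \<mu> t"
proof -
  have "((\<lambda>t. - phase_prim \<mu> (- t)) has_field_derivative exp (- (- \<mu>) * ph t)) (at t)" for t
  proof -
    have "((\<lambda>t. phase_prim \<mu> (- t)) has_field_derivative exp (- \<mu> * ph (- t)) * - 1) (at t)"
      by (rule DERIV_chain2[OF phase_prim(2)]) (auto intro!: derivative_eq_intros)
    from DERIV_minus[OF this] show ?thesis by (simp add: ph_minus)
  qed
  from phase_prim_unique[OF this, of "- t" 0] show ?thesis by (simp add: phase_prim(1))
qed

lemma phase_prim_cnj: "phase_prim \<mu> (cnj t) = cnj (phase_prim (cnj \<mu>) t)"
proof -
  have "((cnj \<circ> phase_prim (cnj \<mu>) \<circ> cnj) has_field_derivative cnj (exp (- cnj \<mu> * ph (cnj t)))) (at t)" for t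
    using has_field_derivative_cnj_cnj[OF phase_prim(2)[of "cnj \<mu>" "cnj t"]] by simp
  then have "((cnj \<circ> phase_prim (cnj \<mu>) \<circ> cnj) has_field_derivative exp (- \<mu> * ph t)) (at t)" for t
    by (simp add: exp_cnj ph_cnj)
  from phase_prim_unique[OF this, of "cnj t" 0] show ?thesis by (simp add: phase_prim(1))
qed

definition ray_dom :: "complex set" where "ray_dom = {r. r ^ 2 \<in> cut_plane}"

lemma cut_plane_scale: "z \<in> cut_plane \<Longrightarrow> 0 \<le> l \<Longrightarrow> l \<le> 1 \<Longrightarrow> of_real l * z \<in> cut_plane"
proof (rule ccontr)
  assume z: "z \<in> cut_plane" "0 \<le> l" "l \<le> 1" "of_real l * z \<notin> cut_plane"
  then obtain x where x: "of_real l * z = of_real x" "x \<le> - 1" by (auto simp: cut_plane_def)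
  then have "l \<noteq> 0" by auto
  then have "z = of_real (x / l)" using x by (simp add: field_simps)
  moreover have "x / l \<le> - 1" using x z \<open>l \<noteq> 0\<close> by (simp add: field_simps)
  ultimately have "z \<in> complex_of_real ` {..- 1}" by (intro image_eqI[of _ _ "x / l"]) simp_all
  then show False using z(1) by (simp add: cut_plane_def)
qed

lemma star_scaled_square:
  shows "star_at_0 {r. w * r ^ 2 \<in> cut_plane}"
proof -
  have "open ((\<lambda>r. w * r ^ 2) -` cut_plane)" by (intro open_vimage open_cut_plane continuous_intros)
  moreover have "w * (of_real l * r) ^ 2 \<in> cut_plane" if "w * r ^ 2 \<in> cut_plane" "0 \<le> l" "l \<le> 1" for r and l :: real
    using cut_plane_scale[OF that(1), of "l ^ 2"] that by (simp add: power_mult_distrib power_le_one mult_ac)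
  ultimately show ?thesis by (auto simp: star_at_0_def vimage_def small_in_cut_plane)
qed

lemma ray_dom_star: "star_at_0 ray_dom"
  using star_scaled_square[of 1] by (simp add: ray_dom_def)

lemma crit_transform_ray_holomorphic: "(\<lambda>r. crit_transform (r ^ 2)) holomorphic_on ray_dom"
proof -
  have "(crit_transform \<circ> (\<lambda>r. r ^ 2)) holomorphic_on ray_dom" unfolding crit_transform_def
    by (rule holomorphic_on_compose_gen[OF _ crit.St_holomorphic]) (auto simp: ray_dom_def intro!: holomorphic_intros)
  then show ?thesis by (simp add: o_def)
qed

lemma polar_cut_plane: "cos (\<beta> / 2) > 0 \<Longrightarrow> \<rho> \<ge> 0 \<Longrightarrow> of_real \<rho> * cis \<beta> \<in> cut_plane"
proof (rule ccontr)
  assume b: "cos (\<beta> / 2) > 0" "\<rho> \<ge> 0" "of_real \<rho> * cis \<beta> \<notin> cut_plane"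
  then obtain x where x: "of_real \<rho> * cis \<beta> = of_real x" "x \<le> - 1" by (auto simp: cut_plane_def)
  define l where "l = - 1 / x"
  have l: "0 \<le> l" "l * x = - 1" using x by (auto simp: l_def field_simps)
  have "0 < (cos (\<beta> / 2))\<^sup>2" using b by simp
  also have "\<dots> \<le> (norm (1 + of_real (l * \<rho>) * cis \<beta>))\<^sup>2" using l b by (intro norm_one_plus_cis_ge) simp
  also have "1 + of_real (l * \<rho>) * cis \<beta> = 1 + of_real (l * x)" using x(1) by (simp add: mult.assoc)
  finally show False by (simp add: l)
qed

lemma norm_inv_one_plus_cis:
  assumes "cos (\<beta> / 2) \<ge> c" "c > 0" "\<rho> \<ge> 0" shows "norm (1 / (1 + of_real \<rho> * cis \<beta>)) \<le> 1 / c"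
proof -
  have "c ^ 2 \<le> (cos (\<beta> / 2))\<^sup>2" using assms by (intro power_mono) auto
  also have "\<dots> \<le> (norm (1 + of_real \<rho> * cis \<beta>))\<^sup>2" by (rule norm_one_plus_cis_ge[OF assms(3)])
  finally have "c \<le> norm (1 + of_real \<rho> * cis \<beta>)" by (rule power2_le_imp_le) simp
  then show ?thesis unfolding norm_divide norm_one using assms by (intro frac_le) auto
qed

lemma crit_transform_polar_bound:
  assumes "cos \<alpha> \<ge> c" "c > 0" "\<rho> \<ge> 0" shows "norm (crit_transform ((of_real \<rho> * cis \<alpha>) ^ 2)) \<le> 1 / c * crit.moment 0"
  unfolding crit_transform_def
proof (rule crit.St_bound)
  fix a
  have "cis \<alpha> ^ 2 = cis (2 * \<alpha>)" using Complex.DeMoivre[of \<alpha> 2] by simp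
  then have e: "(of_real \<rho> * cis \<alpha>) ^ 2 / of_real (crit_x a) = of_real (\<rho> ^ 2 / crit_x a) * cis (2 * \<alpha>)"
    by (simp add: power_mult_distrib)
  have "\<rho> ^ 2 / crit_x a \<ge> 0" using crit.X_pos[of a] by simp
  then show "norm (1 / (1 + (of_real \<rho> * cis \<alpha>) ^ 2 / of_real (crit_x a))) \<le> 1 / c"
    unfolding e by (intro norm_inv_one_plus_cis) (use assms in simp_all)
qed

text \<open>On the line Im t = \<beta> the phase behaves like e^X cis \<beta> / 2, so the argument
  of its cube root tends to \<beta>/3.\<close>

lemma om_line_limit:
  assumes \<beta>: "0 < \<beta>" "\<beta> < 3 * pi / 2" and e: "e > 0"
  shows "\<forall>\<^sub>F X in at_top. \<exists>\<rho> \<alpha>. om (Complex X \<beta>) = of_real \<rho> * cis \<alpha> \<and> \<rho> > 0 \<and> \<bar>\<alpha> - \<beta> / 3\<bar> < e \<and> 0 \<le> \<alpha> \<and> \<alpha> \<le> pi / 2"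
proof -
  define \<epsilon> where "\<epsilon> = min (3 * e) (pi / 4)"
  have "\<epsilon> \<le> pi / 4" by (simp add: \<epsilon>_def)
  then have "\<epsilon> < pi / 2" using pi_gt_zero by linarith
  then have \<epsilon>: "0 < \<epsilon>" "\<epsilon> < pi / 2" "\<epsilon> \<le> 3 * e" using e by (simp_all add: \<epsilon>_def)
  \<comment> \<open>The ratio of the phase to its leading term e^X cis \<beta> / 2; it tends to
    1.\<close>
  define u where "u X = 1 - exp (- of_real (2 * X)) * cis (- 2 * \<beta>) - 2 * (of_real (X * exp (- X)) + \<i> * of_real (\<beta> * exp (- X))) * cis (- \<beta>)" for X :: real
  have u_eq: "2 * ph (Complex X \<beta>) = of_real (exp X) * cis \<beta> * u X" for X
  proof -
    have t: "Complex X \<beta> = of_real X + \<i> * of_real \<beta>" by (simp add: complex_eq_iff)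
    have e1: "exp (Complex X \<beta>) = of_real (exp X) * cis \<beta>" by (simp add: exp_eq_polar)
    have e2: "exp (- Complex X \<beta>) = of_real (exp (- X)) * cis (- \<beta>)" by (simp add: exp_eq_polar)
    have e3: "cis \<beta> * cis (- \<beta>) = 1" "cis \<beta> * cis (- 2 * \<beta>) = cis (- \<beta>)" by (simp_all add: cis_mult)
    have r: "exp X * exp (- X) = 1" "exp X * exp (- (2 * X)) = exp (- X)" by (simp_all flip: exp_add)
    have "of_real (exp X) * cis \<beta> * u X = of_real (exp X) * cis \<beta> - of_real (exp X * exp (- (2 * X))) * (cis \<beta> * cis (- 2 * \<beta>))
        - 2 * (of_real (X * (exp X * exp (- X))) + \<i> * of_real (\<beta> * (exp X * exp (- X)))) * (cis \<beta> * cis (- \<beta>))"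
      unfolding u_def by (simp add: algebra_simps exp_of_real[symmetric])
    also have "\<dots> = exp (Complex X \<beta>) - exp (- Complex X \<beta>) - 2 * Complex X \<beta>"
      unfolding e3 r e1 e2 by (simp add: t algebra_simps)
    also have "\<dots> = 2 * ph (Complex X \<beta>)" by (simp add: ph_def sinh_field_def)
    finally show ?thesis by simp
  qed
  have l1: "((\<lambda>X::real. exp (- (2 * X))) \<longlongrightarrow> 0) at_top" "((\<lambda>X::real. exp (- X)) \<longlongrightarrow> 0) at_top"
    "((\<lambda>X::real. X * exp (- X)) \<longlongrightarrow> 0) at_top"
  proof -
    show 2: "((\<lambda>X::real. exp (- X)) \<longlongrightarrow> 0) at_top"
      by (rule filterlim_compose[OF exp_at_bot filterlim_uminus_at_bot_at_top])
    from tendsto_mult[OF 2 2] show "((\<lambda>X::real. exp (- (2 * X))) \<longlongrightarrow> 0) at_top" by (simp flip: exp_add)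
    show "((\<lambda>X::real. X * exp (- X)) \<longlongrightarrow> 0) at_top"
      using tendsto_power_div_exp_0[of 1] by (simp add: exp_minus divide_inverse)
  qed
  have "(u \<longlongrightarrow> 1 - of_real 0 * cis (- 2 * \<beta>) - 2 * (of_real 0 + \<i> * of_real (\<beta> * 0)) * cis (- \<beta>)) at_top"
    unfolding u_def[abs_def] exp_of_real of_real_minus[symmetric] by (intro tendsto_intros l1)
  then have u_lim: "(u \<longlongrightarrow> 1) at_top" by simp
  then have "((\<lambda>X. Re (u X) / norm (u X)) \<longlongrightarrow> Re 1 / norm (1::complex)) at_top" by (intro tendsto_intros) simp_all
  moreover have "cos \<epsilon> < Re 1 / norm (1::complex)" using cos_monotone_0_pi[of 0 \<epsilon>] \<epsilon> by simp
  ultimately have ev: "\<forall>\<^sub>F X in at_top. cos \<epsilon> < Re (u X) / norm (u X)" by (rule order_tendstoD(1))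
  have "\<forall>\<^sub>F X::real in at_top. X > 0" by (rule eventually_gt_at_top)
  with ev show ?thesis
  proof eventually_elim
    case (elim X)
    have reg: "Complex X \<beta> \<in> crit_region" by (rule om_square_cut_plane) (use elim \<beta> in auto)
    obtain z where z: "6 * ph (Complex X \<beta>) = exp (3 * z)" "0 \<le> Im z" "Im z \<le> pi / 2" "om (Complex X \<beta>) = exp z"
      using om_crit_region[OF reg] by metis
    \<comment> \<open>An argument of \<open>u X\<close>. The a priori bound |\<delta>| < 3 \<pi>/2
      excludes other multiples of 2 \<pi>, so that cos \<delta> > cos \<epsilon> > 0 forces
      |\<delta>| < \<epsilon>.\<close>
    define \<delta> where "\<delta> = 3 * Im z - \<beta>"
    have \<delta>: "\<bar>\<delta>\<bar> < 3 * pi / 2" unfolding \<delta>_def abs_less_iff using z(2,3) \<beta> by (intro conjI) linarith+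
    have u: "u X = of_real (exp (3 * Re z) / (3 * exp X)) * cis \<delta>"
    proof -
      have "exp (3 * z) = of_real (exp (3 * Re z)) * cis (3 * Im z)" by (simp add: exp_eq_polar)
      moreover have "3 * (of_real (exp X) * cis \<beta> * u X) = exp (3 * z)"
        unfolding z(1)[symmetric] u_eq[symmetric] by simp
      ultimately have "3 * (of_real (exp X) * cis \<beta> * u X) = of_real (exp (3 * Re z)) * cis (3 * Im z)" by (rule trans[rotated])
      then have "3 * of_real (exp X) * (cis (- \<beta>) * cis \<beta>) * u X = of_real (exp (3 * Re z)) * (cis (3 * Im z) * cis (- \<beta>))"
        by (simp add: mult_ac)
      then have "3 * of_real (exp X) * u X = of_real (exp (3 * Re z)) * cis \<delta>" by (simp add: cis_mult \<delta>_def)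
      then show ?thesis by (simp add: field_simps)
    qed
    define q where "q = exp (3 * Re z) / (3 * exp X)"
    have q: "q > 0" by (simp add: q_def)
    have "Re (u X) / norm (u X) = cos \<delta>" unfolding u q_def[symmetric] using q by (simp add: norm_mult)
    then have cd: "cos \<epsilon> < cos \<bar>\<delta>\<bar>" using elim by simp
    have "\<bar>\<delta>\<bar> < \<epsilon>"
    proof (rule ccontr)
      assume n: "\<not> \<bar>\<delta>\<bar> < \<epsilon>"
      show False
      proof (cases "\<bar>\<delta>\<bar> \<le> pi")
        case True
        then have "cos \<bar>\<delta>\<bar> \<le> cos \<epsilon>" using n \<epsilon> by (intro cos_monotone_0_pi_le) auto
        then show False using cd by simp
      next
        case False
        have "cos (\<bar>\<delta>\<bar> - pi) \<ge> 0" using False \<delta> by (intro cos_ge_zero) auto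
        then have "cos \<bar>\<delta>\<bar> \<le> 0" by (simp add: cos_diff)
        moreover have "cos \<epsilon> > 0" using \<epsilon> by (intro cos_gt_zero_pi) auto
        ultimately show False using cd by simp
      qed
    qed
    then have "\<bar>Im z - \<beta> / 3\<bar> < e" using \<epsilon>(3) by (simp add: \<delta>_def abs_less_iff)
    moreover have "om (Complex X \<beta>) = of_real (exp (Re z)) * cis (Im z)" unfolding z(4) by (simp add: exp_eq_polar)
    ultimately show ?case using z by (intro exI[of _ "exp (Re z)"] exI[of _ "Im z"]) auto
  qed
qed

definition ray_fun :: "complex \<Rightarrow> complex \<Rightarrow> complex" where
  "ray_fun \<mu> r = exp (- \<mu> * r ^ 3 / 6) * crit_transform (r ^ 2)"

text \<open>By \<open>crit_transform_om_strip\<close> the substitution r = om t carries exp (- \<mu>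
  ph t) dt to \<open>ray_fun\<close> dr, so the primitive equals \<Phi>(om t) on the strip. The
  image of the line approaches the ray of angle \<beta>/3 in argument, and short arcs between the
  two are negligible.\<close>

theorem phase_prim_line_limit_pos:
  assumes \<beta>: "0 < \<beta>" "\<beta> < 3 * pi / 2" and m: "m > 0" "\<mu> = of_real m * cis \<tau>" and ang: "\<bar>\<tau> + \<beta>\<bar> < pi / 2"
  shows "(\<lambda>\<rho>. ray_fun \<mu> (of_real \<rho> * cis (\<beta> / 3)) * cis (\<beta> / 3)) integrable_on {0..}"
    and "((\<lambda>X. phase_prim \<mu> (Complex X \<beta>)) \<longlongrightarrow>
       integral {0..} (\<lambda>\<rho>. ray_fun \<mu> (of_real \<rho> * cis (\<beta> / 3)) * cis (\<beta> / 3))) at_top"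
proof -
  have hol: "ray_fun \<mu> holomorphic_on ray_dom"
    unfolding ray_fun_def[abs_def] by (intro holomorphic_intros crit_transform_ray_holomorphic) auto
  obtain \<Phi> where \<Phi>: "\<And>r. r \<in> ray_dom \<Longrightarrow> (\<Phi> has_field_derivative ray_fun \<mu> r) (at r)" "\<Phi> 0 = 0"
    by (rule star_primitive[OF ray_dom_star hol], rule that)
  \<comment> \<open>An angular margin: within e of the ray the exponential still decays uniformly
    and r^2 stays off the cut.\<close>
  define e where "e = min (pi / 2 - \<bar>\<tau> + \<beta>\<bar>) (min \<beta> (3 * pi / 2 - \<beta>)) / 6"
  have e: "e > 0" "\<bar>\<tau> + \<beta>\<bar> + 3 * e < pi / 2" "\<bar>\<beta> / 3\<bar> + e < pi / 2"
  proof -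
    show e0: "e > 0" using \<beta> ang by (simp add: e_def)
    have le: "e \<le> (pi / 2 - \<bar>\<tau> + \<beta>\<bar>) / 6" "e \<le> (3 * pi / 2 - \<beta>) / 6" by (auto simp: e_def)
    show "\<bar>\<tau> + \<beta>\<bar> + 3 * e < pi / 2" 
    proof -
      have "a + 3 * e < p" if "e \<le> (p - a) / 6" "a < p" for a p :: real using that by (auto simp: field_simps)
      from this[OF le(1) ang] show ?thesis .
    qed
    show "\<bar>\<beta> / 3\<bar> + e < pi / 2" 
    proof -
      have "b / 3 + e < p / 2" if "e \<le> (3 * p / 2 - b) / 6" "b < 3 * p / 2" for b p :: real using that by (auto simp: field_simps)
      from this[OF le(2) \<beta>(2)] show ?thesis using \<beta>(1) by simp
    qed
  qed
  define c where "c = m * cos (\<bar>\<tau> + \<beta>\<bar> + 3 * e) / 6"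
  define g where "g = cos (\<bar>\<beta> / 3\<bar> + e)"
  have c: "c > 0" and g: "g > 0" 
  proof -
    have "0 < cos (\<bar>\<tau> + \<beta>\<bar> + 3 * e)" using e abs_ge_zero[of "\<tau> + \<beta>"] pi_gt_zero by (intro cos_gt_zero_pi) linarith+
    then show "c > 0" using m by (simp add: c_def)
    show "g > 0" unfolding g_def using e abs_ge_zero[of "\<beta> / 3"] pi_gt_zero by (intro cos_gt_zero_pi) linarith+
  qed
  have near: "of_real \<rho> * cis \<alpha> \<in> ray_dom \<and> norm (ray_fun \<mu> (of_real \<rho> * cis \<alpha>)) \<le> (1 / g * crit.moment 0) * \<rho> ^ 0 * exp (- c * \<rho> ^ 3)"
    if \<rho>: "\<rho> \<ge> 0" and al: "\<bar>\<alpha> - \<beta> / 3\<bar> \<le> e" for \<rho> \<alpha>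
  proof
    have "\<bar>\<alpha>\<bar> \<le> \<bar>\<beta> / 3\<bar> + e" using al by linarith
    then have "g \<le> cos \<bar>\<alpha>\<bar>" unfolding g_def using e by (intro cos_monotone_0_pi_le) auto
    then have ga: "g \<le> cos \<alpha>" by simp
    have "cis \<alpha> ^ 2 = cis (2 * \<alpha>)" using Complex.DeMoivre[of \<alpha> 2] by simp
    then have "(of_real \<rho> * cis \<alpha>) ^ 2 = of_real (\<rho> ^ 2) * cis (2 * \<alpha>)" by (simp add: power_mult_distrib)
    then show "of_real \<rho> * cis \<alpha> \<in> ray_dom"
      using polar_cut_plane[of "2 * \<alpha>" "\<rho> ^ 2"] ga g by (simp add: ray_dom_def)
    have "\<bar>\<tau> + 3 * \<alpha>\<bar> \<le> \<bar>\<tau> + \<beta>\<bar> + 3 * e" using al by linarith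
    then have "cos (\<bar>\<tau> + \<beta>\<bar> + 3 * e) \<le> cos \<bar>\<tau> + 3 * \<alpha>\<bar>" using e(2) pi_gt_zero by (intro cos_monotone_0_pi_le) linarith+
    then have co: "cos (\<bar>\<tau> + \<beta>\<bar> + 3 * e) \<le> cos (\<tau> + 3 * \<alpha>)" by simp
    have c3: "cis \<alpha> ^ 3 = cis (3 * \<alpha>)" using Complex.DeMoivre[of \<alpha> 3] by simp
    have "\<mu> * (of_real \<rho> * cis \<alpha>) ^ 3 = of_real (m * \<rho> ^ 3) * cis (\<tau> + 3 * \<alpha>)"
      unfolding m(2) by (simp add: power_mult_distrib c3 cis_mult[symmetric] mult_ac)
    then have "Re (- \<mu> * (of_real \<rho> * cis \<alpha>) ^ 3 / 6) = - (m * cos (\<tau> + 3 * \<alpha>) / 6) * \<rho> ^ 3"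
      by (simp del: of_real_mult of_real_power)
    also have "\<dots> \<le> - c * \<rho> ^ 3" unfolding c_def using co m \<rho> by (intro mult_right_mono) auto
    finally have "norm (exp (- \<mu> * (of_real \<rho> * cis \<alpha>) ^ 3 / 6)) \<le> exp (- c * \<rho> ^ 3)"
      unfolding norm_exp_eq_Re by (rule exp_le_cancel_iff[THEN iffD2])
    then have "norm (ray_fun \<mu> (of_real \<rho> * cis \<alpha>)) \<le> exp (- c * \<rho> ^ 3) * (1 / g * crit.moment 0)"
      unfolding ray_fun_def norm_mult using crit_transform_polar_bound[OF ga g \<rho>] by (intro mult_mono) auto
    then show "norm (ray_fun \<mu> (of_real \<rho> * cis \<alpha>)) \<le> (1 / g * crit.moment 0) * \<rho> ^ 0 * exp (- c * \<rho> ^ 3)"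
      by (simp add: mult_ac)
  qed
  have near0: "\<bar>\<beta> / 3 - \<beta> / 3\<bar> \<le> e" using e by simp
  note lim = ray_limit[OF \<Phi>(1) near[OF _ near0, THEN conjunct1] c near[OF _ near0, THEN conjunct2]]
  show "(\<lambda>\<rho>. ray_fun \<mu> (of_real \<rho> * cis (\<beta> / 3)) * cis (\<beta> / 3)) integrable_on {0..}" by (rule lim(1))
  define I where "I = integral {0..} (\<lambda>\<rho>. ray_fun \<mu> (of_real \<rho> * cis (\<beta> / 3)) * cis (\<beta> / 3))"
  have lim2: "((\<lambda>\<rho>. \<Phi> (of_real \<rho> * cis (\<beta> / 3))) \<longlongrightarrow> I) at_top" using lim(2) by (simp add: \<Phi>(2) I_def)
  have om_ray: "om t \<in> ray_dom" if "t \<in> strip" for t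
    using om_square_cut_plane[of t] that by (auto simp: strip_def ray_dom_def)
  have F_eq: "phase_prim \<mu> t = \<Phi> (om t)" if t: "t \<in> strip" for t
  proof -
    have D: "((\<lambda>t. phase_prim \<mu> t - \<Phi> (om t)) has_field_derivative 0) (at t within strip)" if "t \<in> strip" for t
    proof -
      have tr: "t \<in> crit_region" using that om_square_cut_plane(1)[of t] by (auto simp: strip_def)
      then have td: "t \<in> om_dom" using crit_region_subset_om_dom by blast
      have "((\<lambda>t. \<Phi> (om t)) has_field_derivative ray_fun \<mu> (om t) * (2 * (cosh t - 1) / om t ^ 2)) (at t)"
        by (rule DERIV_chain2[OF \<Phi>(1)[OF om_ray[OF that]] om_deriv[OF td]])
      moreover have "ray_fun \<mu> (om t) * (2 * (cosh t - 1) / om t ^ 2) = exp (- \<mu> * ph t)"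
        using crit_transform_om_strip[OF that] om_cube[OF ph_crit_region_quadrants(1)[OF tr]] by (simp add: ray_fun_def mult.assoc)
      ultimately have "((\<lambda>t. \<Phi> (om t)) has_field_derivative exp (- \<mu> * ph t)) (at t)" by simp
      from DERIV_diff[OF phase_prim(2)[of \<mu> t] this] show ?thesis by (simp add: has_field_derivative_at_within)
    qed
    obtain k where k: "\<And>t. t \<in> strip \<Longrightarrow> phase_prim \<mu> t - \<Phi> (om t) = k"
      using has_field_derivative_zero_constant[OF strip_convex D] by blast
    \<comment> \<open>The origin is only a boundary point of the strip. Approaching it along the
      diagonal shows that the constant difference of the two primitives is 0.\<close>
    define p where "p s = of_real s * Complex 1 1" for s :: real
    have p_lim: "(p \<longlongrightarrow> 0) (at_right 0)" unfolding p_def[abs_def] by (rule tendsto_eq_intros refl | simp)+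
    have ev: "\<forall>\<^sub>F s in at_right 0. p s \<in> strip"
      by (rule eventually_mono[OF eventually_at_right_real[of 0 1]]) (use pi_gt3 in \<open>auto simp: p_def strip_def\<close>)
    have "((\<lambda>s. om (p s)) \<longlongrightarrow> 0) (at_right 0)"
      by (rule om_tendsto_0[OF p_lim]) (rule eventually_mono[OF ev], 
        use om_square_cut_plane(1) ph_crit_region_quadrants(1) in \<open>auto simp: strip_def\<close>)
    moreover have "isCont \<Phi> 0" using \<Phi>(1)[of 0] ray_dom_star DERIV_isCont by (auto simp: star_at_0_def)
    ultimately have "((\<lambda>s. \<Phi> (om (p s))) \<longlongrightarrow> 0) (at_right 0)"
      using isCont_tendsto_compose[of 0 \<Phi>] \<Phi>(2) by fastforce
    moreover have "isCont (phase_prim \<mu>) 0" using phase_prim(2) DERIV_isCont by blast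
    then have "((\<lambda>s. phase_prim \<mu> (p s)) \<longlongrightarrow> 0) (at_right 0)"
      using isCont_tendsto_compose[OF _ p_lim, of "phase_prim \<mu>"] phase_prim(1)[of \<mu>] by simp
    ultimately have "((\<lambda>s. phase_prim \<mu> (p s) - \<Phi> (om (p s))) \<longlongrightarrow> 0 - 0) (at_right 0)" by (rule tendsto_diff[rotated])
    moreover have "((\<lambda>s. phase_prim \<mu> (p s) - \<Phi> (om (p s))) \<longlongrightarrow> k) (at_right 0)"
      by (rule tendsto_eventually) (rule eventually_mono[OF ev], rule k)
    ultimately have "k = 0 - 0" by (intro tendsto_unique[OF trivial_limit_at_right_real])
    then show ?thesis using k[OF t] by simp
  qed
  define R where "R X = norm (om (Complex X \<beta>))" for X
  have strip_ev: "\<forall>\<^sub>F X in at_top. Complex X \<beta> \<in> strip"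
    by (rule eventually_mono[OF eventually_gt_at_top[of 0]]) (use \<beta> in \<open>auto simp: strip_def\<close>)
  have R_lim: "filterlim R at_top at_top"
    unfolding filterlim_at_top
  proof
    fix B :: real
    show "\<forall>\<^sub>F X in at_top. B \<le> R X"
      using norm_om_at_top[of B] strip_ev
      by eventually_elim (use om_square_cut_plane(1) in \<open>auto simp: R_def strip_def\<close>)
  qed
  have diff: "((\<lambda>X. \<Phi> (of_real (R X) * cis (\<beta> / 3)) - phase_prim \<mu> (Complex X \<beta>)) \<longlongrightarrow> 0) at_top"
  proof (rule Lim_null_comparison)
    show "\<forall>\<^sub>F X in at_top. norm (\<Phi> (of_real (R X) * cis (\<beta> / 3)) - phase_prim \<mu> (Complex X \<beta>)) 
        \<le> (1 / g * crit.moment 0) * e * (R X ^ 1 * exp (- c * R X ^ 3))"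
      using om_line_limit[OF \<beta> e(1)] strip_ev
    proof eventually_elim
      case (elim X)
      then obtain \<rho> \<alpha> where om: "om (Complex X \<beta>) = of_real \<rho> * cis \<alpha>" "\<rho> > 0" "\<bar>\<alpha> - \<beta> / 3\<bar> < e" by blast
      have R: "R X = \<rho>" using om by (simp add: R_def norm_mult)
      have seg: "\<bar>x - \<beta> / 3\<bar> \<le> e" if "x \<in> closed_segment \<alpha> (\<beta> / 3)" for x
        using that om(3) by (auto simp: closed_segment_eq_real_ivl split: if_splits)
      have "norm (\<Phi> (of_real \<rho> * cis (\<beta> / 3)) - \<Phi> (of_real \<rho> * cis \<alpha>)) 
          \<le> ((1 / g * crit.moment 0) * \<rho> ^ 0 * exp (- c * \<rho> ^ 3)) * \<rho> * \<bar>\<beta> / 3 - \<alpha>\<bar>"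
        using om(2) near seg by (intro arc_bound[where S = ray_dom and f = "ray_fun \<mu>"] \<Phi>(1)) auto
      also have "\<dots> \<le> ((1 / g * crit.moment 0) * \<rho> ^ 0 * exp (- c * \<rho> ^ 3)) * \<rho> * e"
        using om g crit.moment_nonneg[of 0] by (intro mult_left_mono) auto
      finally show ?case unfolding F_eq[OF elim(2)] om(1)[symmetric] R by (simp add: om(1) mult_ac)
    qed
    have "((\<lambda>X. R X ^ 1 * exp (- c * R X ^ 3)) \<longlongrightarrow> 0) at_top"
      by (rule filterlim_compose[OF power_exp_cube_tendsto_0[OF c] R_lim])
    from tendsto_mult_right[OF this, of "(1 / g * crit.moment 0) * e"]
    show "((\<lambda>X. (1 / g * crit.moment 0) * e * (R X ^ 1 * exp (- c * R X ^ 3))) \<longlongrightarrow> 0) at_top" by (simp add: mult.commute)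
  qed
  have "((\<lambda>X. \<Phi> (of_real (R X) * cis (\<beta> / 3))) \<longlongrightarrow> I) at_top" by (rule filterlim_compose[OF lim2 R_lim])
  from tendsto_diff[OF this diff] show "((\<lambda>X. phase_prim \<mu> (Complex X \<beta>)) \<longlongrightarrow> I) at_top" by simp
qed

definition ray_int :: "complex \<Rightarrow> real \<Rightarrow> complex" where
  "ray_int \<mu> \<beta> = integral {0..} (\<lambda>\<rho>. ray_fun \<mu> (of_real \<rho> * cis (\<beta> / 3)) * cis (\<beta> / 3))"

text \<open>Negative heights come from positive ones by complex conjugation, as the transform is
  real on the real axis.\<close>

lemma phase_prim_line_limit:
  assumes \<beta>: "\<beta> \<noteq> 0" "\<bar>\<beta>\<bar> < 3 * pi / 2" and m: "m > 0" "\<mu> = of_real m * cis \<tau>" and ang: "\<bar>\<tau> + \<beta>\<bar> < pi / 2"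
  shows "(\<lambda>\<rho>. ray_fun \<mu> (of_real \<rho> * cis (\<beta> / 3)) * cis (\<beta> / 3)) integrable_on {0..}"
    and "((\<lambda>X. phase_prim \<mu> (Complex X \<beta>)) \<longlongrightarrow> ray_int \<mu> \<beta>) at_top"
proof -
  have "(\<lambda>\<rho>. ray_fun \<mu> (of_real \<rho> * cis (\<beta> / 3)) * cis (\<beta> / 3)) integrable_on {0..} \<and>
     ((\<lambda>X. phase_prim \<mu> (Complex X \<beta>)) \<longlongrightarrow> ray_int \<mu> \<beta>) at_top"
  proof (cases "\<beta> > 0")
    case True
    then show ?thesis using phase_prim_line_limit_pos[OF True _ m ang] \<beta> by (simp add: ray_int_def)
  next
    case False
    define h where "h \<rho> = ray_fun (cnj \<mu>) (of_real \<rho> * cis (- \<beta> / 3)) * cis (- \<beta> / 3)" for \<rho> :: real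
    have m': "cnj \<mu> = of_real m * cis (- \<tau>)" by (simp add: m(2) cis_cnj)
    have lim: "h integrable_on {0..}" "((\<lambda>X. phase_prim (cnj \<mu>) (Complex X (- \<beta>))) \<longlongrightarrow> integral {0..} h) at_top"
    proof -
      have b': "0 < - \<beta>" "- \<beta> < 3 * pi / 2" and a': "\<bar>- \<tau> + - \<beta>\<bar> < pi / 2" using False \<beta> ang by linarith+
      show "h integrable_on {0..}" "((\<lambda>X. phase_prim (cnj \<mu>) (Complex X (- \<beta>))) \<longlongrightarrow> integral {0..} h) at_top"
        unfolding h_def[abs_def] by (rule phase_prim_line_limit_pos[OF b' m(1) m' a'])+
    qed
    have crit_transform_cnj: "crit_transform (cnj z) = cnj (crit_transform z)" for z by (simp add: crit_transform_def crit.St_cnj)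
    have h: "cnj (h \<rho>) = ray_fun \<mu> (of_real \<rho> * cis (\<beta> / 3)) * cis (\<beta> / 3)" for \<rho>
      by (simp add: h_def ray_fun_def crit_transform_cnj[symmetric] cis_cnj exp_cnj)
    have "(cnj \<circ> h) integrable_on {0..}" by (rule integrable_linear[OF lim(1) bounded_linear_cnj])
    moreover have "integral {0..} (cnj \<circ> h) = cnj (integral {0..} h)" by (rule integral_linear[OF lim(1) bounded_linear_cnj])
    moreover have "((\<lambda>X. cnj (phase_prim (cnj \<mu>) (Complex X (- \<beta>)))) \<longlongrightarrow> cnj (integral {0..} h)) at_top"
      by (intro tendsto_cnj lim(2))
    moreover have "cnj (phase_prim (cnj \<mu>) (Complex X (- \<beta>))) = phase_prim \<mu> (Complex X \<beta>)" for X
      by (simp add: phase_prim_cnj[symmetric] complex_cnj)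
    ultimately show ?thesis by (simp add: ray_int_def o_def h)
  qed
  then show "(\<lambda>\<rho>. ray_fun \<mu> (of_real \<rho> * cis (\<beta> / 3)) * cis (\<beta> / 3)) integrable_on {0..}"
    "((\<lambda>X. phase_prim \<mu> (Complex X \<beta>)) \<longlongrightarrow> ray_int \<mu> \<beta>) at_top" by blast+
qed

text \<open>The vertical segment between the heights contributes a doubly exponentially small
  integral as long as |\<tau> + y| < \<pi>/2 on it. This lets the heights prescribed by Arg \<nu> be
  exchanged for those belonging to \<psi>.\<close>

lemma phase_prim_line_shift:
  assumes m: "m > 0" "\<mu> = of_real m * cis \<tau>" and ang: "\<bar>\<tau> + a\<bar> < pi / 2" "\<bar>\<tau> + b\<bar> < pi / 2"
  shows "((\<lambda>X. phase_prim \<mu> (Complex X a) - phase_prim \<mu> (Complex X b)) \<longlongrightarrow> 0) at_top"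
proof -
  define A where "A = max \<bar>\<tau> + a\<bar> \<bar>\<tau> + b\<bar>"
  have A: "0 \<le> A" "A < pi / 2" using ang by (auto simp: A_def)
  define Y where "Y = max \<bar>a\<bar> \<bar>b\<bar>"
  define c where "c = cos A / 2"
  have c: "c > 0" using A by (simp add: c_def cos_gt_zero_pi)
  \<comment> \<open>Lower bound for Re (cis \<tau> * ph t): the term e^t / 2 gives at least c e^X,
    while e^(-t) / 2 and t cost at most 1 and X + Y.\<close>
  define E where "E X = exp X * c - 1 - X - Y" for X :: real
  have E_lim: "filterlim E at_top at_top"
  proof -
    have "((\<lambda>X::real. X / exp X) \<longlongrightarrow> 0) at_top" using tendsto_power_div_exp_0[of 1] by simp
    moreover have "((\<lambda>X::real. 1 / exp X) \<longlongrightarrow> 0) at_top" using tendsto_power_div_exp_0[of 0] by simp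
    ultimately have "((\<lambda>X::real. c - (1 + Y) * (1 / exp X) - X / exp X) \<longlongrightarrow> c - (1 + Y) * 0 - 0) at_top"
      by (intro tendsto_intros)
    then have "filterlim (\<lambda>X. (c - (1 + Y) * (1 / exp X) - X / exp X) * exp X) at_top at_top"
      by (intro filterlim_tendsto_pos_mult_at_top[OF _ _ exp_at_top]) (use c in auto)
    moreover have "(c - (1 + Y) * (1 / exp X) - X / exp X) * exp X = E X" for X
      by (simp add: E_def field_simps)
    ultimately show ?thesis by simp
  qed
  have bound: "norm (phase_prim \<mu> (Complex X a) - phase_prim \<mu> (Complex X b)) \<le> exp (- (m * E X)) * \<bar>a - b\<bar>" if X: "X \<ge> 0" for X
  proof -
    have "((\<lambda>t. exp (- \<mu> * ph t)) has_contour_integral phase_prim \<mu> (Complex X a) - phase_prim \<mu> (Complex X b)) (linepath (Complex X b) (Complex X a))"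
      using contour_integral_primitive[of UNIV "phase_prim \<mu>" "\<lambda>t. exp (- \<mu> * ph t)" "linepath (Complex X b) (Complex X a)"] phase_prim(2) by simp
    then have "norm (phase_prim \<mu> (Complex X a) - phase_prim \<mu> (Complex X b)) \<le> exp (- (m * E X)) * norm (Complex X a - Complex X b)"
    proof (rule has_contour_integral_bound_linepath)
      fix t assume "t \<in> closed_segment (Complex X b) (Complex X a)"
      then have t: "Re t = X" "Im t \<in> closed_segment b a" by (auto simp: closed_segment_same_Re)
      define y where "y = Im t"
      have tt: "t = Complex X y" using t by (simp add: y_def complex_eq_iff)
      have y: "y \<in> closed_segment b a" using t by (simp add: y_def)
      then have yY: "\<bar>y\<bar> \<le> Y" by (rule cos_bound_between) (auto simp: Y_def)
      have "\<tau> + y \<in> closed_segment (\<tau> + b) (\<tau> + a)"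
        using y by (auto simp: closed_segment_eq_real_ivl split: if_splits)
      then have "\<bar>\<tau> + y\<bar> \<le> A" by (rule cos_bound_between) (auto simp: A_def)
      then have "cos A \<le> cos \<bar>\<tau> + y\<bar>" using A by (intro cos_monotone_0_pi_le) auto
      then have co: "2 * c \<le> cos (\<tau> + y)" by (simp add: c_def)
      have "2 * (cis \<tau> * ph t) = cis \<tau> * exp t - cis \<tau> * exp (- t) - 2 * (cis \<tau> * t)"
      proof -
        have sh: "2 * sinh t = exp t - exp (- t)" by (simp add: sinh_field_def)
        have "2 * (cis \<tau> * ph t) = cis \<tau> * (2 * sinh t) - 2 * (cis \<tau> * t)" by (simp add: ph_def right_diff_distrib)
        then show ?thesis unfolding sh by (simp add: right_diff_distrib)
      qed
      moreover have "cis \<tau> * exp t = of_real (exp X) * cis (\<tau> + y)" unfolding tt by (simp add: exp_eq_polar cis_mult[symmetric])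
      ultimately have eq: "2 * (cis \<tau> * ph t) = of_real (exp X) * cis (\<tau> + y) - cis \<tau> * exp (- t) - 2 * (cis \<tau> * t)" by simp
      have n1: "Re (cis \<tau> * exp (- t)) \<le> 1"
        by (rule order_trans[OF complex_Re_le_cmod]) (use X t in \<open>simp add: norm_mult\<close>)
      have n2: "Re (cis \<tau> * t) \<le> X + Y"
        by (rule order_trans[OF complex_Re_le_cmod]) (use cmod_le[of t] t X yY in \<open>simp add: norm_mult y_def\<close>)
      have "2 * Re (cis \<tau> * ph t) = exp X * cos (\<tau> + y) - Re (cis \<tau> * exp (- t)) - 2 * Re (cis \<tau> * t)"
        using arg_cong[OF eq, of Re] by simp
      moreover have "exp X * (2 * c) \<le> exp X * cos (\<tau> + y)" using co by (intro mult_left_mono) auto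
      ultimately have "Re (cis \<tau> * ph t) \<ge> E X" unfolding E_def using n1 n2 by argo
      then have "m * E X \<le> m * Re (cis \<tau> * ph t)" using m by (intro mult_left_mono) auto
      then show "norm (exp (- \<mu> * ph t)) \<le> exp (- (m * E X))" unfolding m(2) norm_exp_eq_Re by (simp add: mult.assoc)
    qed simp
    moreover have "norm (Complex X a - Complex X b) = \<bar>a - b\<bar>" by (simp add: cmod_def)
    ultimately show ?thesis by simp
  qed
  show ?thesis
  proof (rule Lim_null_comparison)
    show "\<forall>\<^sub>F X in at_top. norm (phase_prim \<mu> (Complex X a) - phase_prim \<mu> (Complex X b)) \<le> exp (- (m * E X)) * \<bar>a - b\<bar>"
      by (rule eventually_mono[OF eventually_ge_at_top[of 0]]) (rule bound)
    have "filterlim (\<lambda>X. m * E X) at_top at_top"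
      using m by (intro filterlim_tendsto_pos_mult_at_top[OF tendsto_const _ E_lim])
    then have "((\<lambda>X. exp (- (m * E X))) \<longlongrightarrow> 0) at_top"
      by (intro filterlim_compose[OF exp_at_bot] filterlim_uminus_at_top[THEN iffD1]) 
    from tendsto_mult_left_zero[OF this] show "((\<lambda>X. exp (- (m * E X)) * \<bar>a - b\<bar>) \<longlongrightarrow> 0) at_top" by simp
  qed
qed

text \<open>Both Bessel functions come from the same primitive H, the one of order - \<nu> through t
  to i \<pi> - t. With q = exp (i \<pi> \<nu>) the numerator of the quotient for Y becomes (q - 1/q)
  / 2 times - (U + V - 2 W), and the first factor is i sin (\<pi> \<nu>), which cancels the
  denominator.\<close>

theorem bessel_Y_rays:
  assumes \<nu>: "\<nu> \<notin> \<int>" and m: "m > 0" "\<nu> = of_real m * cis \<theta>" and \<theta>: "\<theta> = Arg \<nu>"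
    and \<psi>: "\<psi> \<noteq> 0" "\<bar>\<psi>\<bar> < pi / 2" "\<bar>\<theta> - \<psi>\<bar> < pi / 2"
  shows "bessel_Y \<nu> \<nu> = - (1 / (2 * pi)) * (ray_int (- \<nu>) (pi - \<psi>) + ray_int (- \<nu>) (- pi - \<psi>) + 2 * ray_int \<nu> (- \<psi>))"
proof -
  have nz: "\<nu> \<noteq> 0" using m by auto
  define H where "H = phase_prim (- \<nu>)"
  have H: "(H has_field_derivative exp (\<nu> * ph t)) (at t)" for t using phase_prim(2)[of "- \<nu>" t] by (simp add: H_def)
  define U V W where "U X = H (Complex X (pi - \<theta>))" and "V X = H (Complex X (- pi - \<theta>))" and "W X = H (Complex (- X) \<theta>)" for X
  have "((\<lambda>X. H (of_real X + \<i> * of_real (pi - Arg \<nu>)) - H (of_real X - \<i> * of_real (pi + Arg \<nu>))) \<longlongrightarrow> 2 * pi * \<i> * bessel_J \<nu> \<nu>) at_top"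
    by (rule schlaefli[OF \<nu> nz]) (use H in \<open>simp add: ph_def right_diff_distrib\<close>)
  moreover have "of_real X + \<i> * of_real (pi - Arg \<nu>) = Complex X (pi - \<theta>)" 
    "of_real X - \<i> * of_real (pi + Arg \<nu>) = Complex X (- pi - \<theta>)" for X by (simp_all add: \<theta> complex_eq_iff)
  ultimately have A_lim: "((\<lambda>X. U X - V X) \<longlongrightarrow> 2 * pi * \<i> * bessel_J \<nu> \<nu>) at_top" by (simp add: U_def V_def)
  define q where "q = exp (\<i> * of_real pi * \<nu>)"
  have q: "q \<noteq> 0" by (simp add: q_def)
  \<comment> \<open>The phase decreases by 2 \<pi> i under translation by 2 \<pi> i, so the
    integrand is multiplied by q^(-2).\<close>
  have per: "H (t + 2 * of_real pi * \<i>) - H (s + 2 * of_real pi * \<i>) = (H t - H s) / q ^ 2" for t s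
  proof -
    have q2: "q ^ 2 = exp (\<nu> * (2 * of_real pi * \<i>))" by (simp add: q_def mult_ac flip: exp_of_nat_mult)
    have "((\<lambda>t. q ^ 2 * H (t + 2 * of_real pi * \<i>)) has_field_derivative exp (- (- \<nu>) * ph t)) (at t)" for t
    proof -
      have "((\<lambda>t. q ^ 2 * H (t + 2 * of_real pi * \<i>)) has_field_derivative q ^ 2 * (exp (\<nu> * ph (t + 2 * of_real pi * \<i>)) * 1)) (at t)"
        by (rule DERIV_cmult[OF DERIV_chain2[OF H]]) (auto intro!: derivative_eq_intros)
      moreover have "ph (t + 2 * of_real pi * \<i>) = ph t - 2 * of_real pi * \<i>"
        by (simp add: ph_def sinh_field_def exp_add exp_diff exp_minus)
      ultimately show ?thesis unfolding q2 by (simp add: right_diff_distrib exp_diff)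
    qed
    from phase_prim_unique[OF this, of t s] show ?thesis using q by (simp add: H_def field_simps)
  qed
  \<comment> \<open>Under t to i \<pi> - t the phase becomes sinh t + t - i \<pi>, which is the
    exponent of order - \<nu> up to a constant. The factor - q compensates the constant and the
    reversed direction.\<close>
  have S: "((\<lambda>X. (- q * H (\<i> * of_real pi - (of_real X + \<i> * of_real (pi - Arg \<nu>)))) - (- q * H (\<i> * of_real pi - (of_real X - \<i> * of_real (pi + Arg \<nu>)))))
      \<longlongrightarrow> 2 * pi * \<i> * bessel_J (- \<nu>) \<nu>) at_top"
  proof (rule schlaefli[where F = "\<lambda>t. - q * H (\<i> * of_real pi - t)"])
    fix t
    have "((\<lambda>t. - q * H (\<i> * of_real pi - t)) has_field_derivative - q * (exp (\<nu> * ph (\<i> * of_real pi - t)) * - 1)) (at t)"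
      by (rule DERIV_cmult[OF DERIV_chain2[OF H]]) (auto intro!: derivative_eq_intros)
    moreover have "ph (\<i> * of_real pi - t) = sinh t + t - \<i> * of_real pi"
      by (simp add: ph_def sinh_field_def exp_add exp_diff exp_minus field_simps)
    ultimately show "((\<lambda>t. - q * H (\<i> * of_real pi - t)) has_field_derivative exp (\<nu> * sinh t - - \<nu> * t)) (at t)"
      unfolding q_def by (simp add: mult_exp_exp algebra_simps)
  qed (use \<nu> nz in \<open>simp_all add: minus_in_Ints_iff\<close>)
  have e1: "\<i> * of_real pi - (of_real X + \<i> * of_real (pi - Arg \<nu>)) = Complex (- X) \<theta>"
    "\<i> * of_real pi - (of_real X - \<i> * of_real (pi + Arg \<nu>)) = Complex (- X) \<theta> + 2 * of_real pi * \<i>" for X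
    by (simp_all add: \<theta> complex_eq_iff)
  have e2: "H (Complex (- X) \<theta> + 2 * of_real pi * \<i>) = U X + (W X - V X) / q ^ 2" for X
  proof -
    have "Complex X (- pi - \<theta>) + 2 * of_real pi * \<i> = Complex X (pi - \<theta>)" by (simp add: complex_eq_iff)
    then show ?thesis using per[of "Complex (- X) \<theta>" "Complex X (- pi - \<theta>)"] by (simp add: U_def V_def W_def algebra_simps)
  qed
  have B_lim: "((\<lambda>X. q * (U X - W X) + (W X - V X) / q) \<longlongrightarrow> 2 * pi * \<i> * bessel_J (- \<nu>) \<nu>) at_top"
  proof -
    have alg: "- q * w - - q * (u + (w - v) / q ^ 2) = q * (u - w) + (w - v) / q" for u v w
      using q by (simp add: field_simps power2_eq_square)
    show ?thesis using S unfolding e1 e2 W_def[symmetric] alg .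
  qed
  have qe: "exp (\<i> * (\<nu> * of_real pi)) = q" "exp (- (\<i> * (\<nu> * of_real pi))) = 1 / q"
    by (simp_all add: q_def mult_ac exp_minus inverse_eq_divide)
  have cs: "cos (\<nu> * of_real pi) = (q + 1 / q) / 2" "sin (\<nu> * of_real pi) = (q - 1 / q) / (2 * \<i>)"
    unfolding cos_exp_eq sin_exp_eq qe by (rule refl)+
  have "sin (\<nu> * of_real pi) \<noteq> 0"
    using \<nu> unfolding sin_eq_0 by (auto simp: Ints_def)
  have D_lim: "((\<lambda>X. (q - 1 / q) / 2 * (- (U X + V X - 2 * W X))) \<longlongrightarrow>
      2 * pi * \<i> * bessel_J \<nu> \<nu> * ((q + 1 / q) / 2) - 2 * pi * \<i> * bessel_J (- \<nu>) \<nu>) at_top"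
  proof -
    have alg: "(U X - V X) * ((q + 1 / q) / 2) - (q * (U X - W X) + (W X - V X) / q) = (q - 1 / q) / 2 * (- (U X + V X - 2 * W X))" for X
      using q by (simp add: field_simps)
    show ?thesis using tendsto_diff[OF tendsto_mult_right[OF A_lim, of "(q + 1 / q) / 2"] B_lim] unfolding alg .
  qed
  \<comment> \<open>Two polar forms of - \<nu>: \<theta> - \<pi> suits the line near height \<pi>,
    and \<theta> + \<pi> the line near - \<pi>.\<close>
  have m1: "- \<nu> = of_real m * cis (\<theta> - pi)" "- \<nu> = of_real m * cis (\<theta> + pi)"
    by (simp_all add: m(2) cis.ctr complex_eq_iff cos_diff sin_diff)
  have U_lim: "(U \<longlongrightarrow> ray_int (- \<nu>) (pi - \<psi>)) at_top"
  proof -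
    have "((\<lambda>X. phase_prim (- \<nu>) (Complex X (pi - \<theta>)) - phase_prim (- \<nu>) (Complex X (pi - \<psi>))) \<longlongrightarrow> 0) at_top"
      by (rule phase_prim_line_shift[OF m(1) m1(1)]) (use \<psi> in auto)
    moreover have "((\<lambda>X. phase_prim (- \<nu>) (Complex X (pi - \<psi>))) \<longlongrightarrow> ray_int (- \<nu>) (pi - \<psi>)) at_top"
      by (rule phase_prim_line_limit(2)[OF _ _ m(1) m1(1)]) (use \<psi> in auto)
    ultimately show ?thesis using tendsto_add by (fastforce simp: U_def[abs_def] H_def)
  qed
  have V_lim: "(V \<longlongrightarrow> ray_int (- \<nu>) (- pi - \<psi>)) at_top"
  proof -
    have "((\<lambda>X. phase_prim (- \<nu>) (Complex X (- pi - \<theta>)) - phase_prim (- \<nu>) (Complex X (- pi - \<psi>))) \<longlongrightarrow> 0) at_top"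
      by (rule phase_prim_line_shift[OF m(1) m1(2)]) (use \<psi> in auto)
    moreover have "((\<lambda>X. phase_prim (- \<nu>) (Complex X (- pi - \<psi>))) \<longlongrightarrow> ray_int (- \<nu>) (- pi - \<psi>)) at_top"
      by (rule phase_prim_line_limit(2)[OF _ _ m(1) m1(2)]) (use \<psi> in auto)
    ultimately show ?thesis using tendsto_add by (fastforce simp: V_def[abs_def] H_def)
  qed
  have W_lim: "(W \<longlongrightarrow> - ray_int \<nu> (- \<psi>)) at_top"
  proof -
    have W: "W X = - phase_prim \<nu> (Complex X (- \<theta>))" for X
    proof -
      have "Complex (- X) \<theta> = - Complex X (- \<theta>)" by (simp add: complex_eq_iff)
      then show ?thesis unfolding W_def H_def by (simp only: phase_prim_minus)
    qed
    have "((\<lambda>X. phase_prim \<nu> (Complex X (- \<theta>)) - phase_prim \<nu> (Complex X (- \<psi>))) \<longlongrightarrow> 0) at_top"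
      by (rule phase_prim_line_shift[OF m]) (use \<psi> in auto)
    moreover have "((\<lambda>X. phase_prim \<nu> (Complex X (- \<psi>))) \<longlongrightarrow> ray_int \<nu> (- \<psi>)) at_top"
      by (rule phase_prim_line_limit(2)[OF _ _ m]) (use \<psi> in auto)
    ultimately have "((\<lambda>X. phase_prim \<nu> (Complex X (- \<theta>))) \<longlongrightarrow> ray_int \<nu> (- \<psi>)) at_top" using tendsto_add by fastforce
    then show ?thesis unfolding W[abs_def] by (rule tendsto_minus)
  qed
  define R where "R = ray_int (- \<nu>) (pi - \<psi>) + ray_int (- \<nu>) (- pi - \<psi>) + 2 * ray_int \<nu> (- \<psi>)"
  have "((\<lambda>X. (q - 1 / q) / 2 * (- (U X + V X - 2 * W X))) \<longlongrightarrow> (q - 1 / q) / 2 * (- (ray_int (- \<nu>) (pi - \<psi>) + ray_int (- \<nu>) (- pi - \<psi>) - 2 * (- ray_int \<nu> (- \<psi>))))) at_top"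
    by (intro tendsto_intros U_lim V_lim W_lim)
  then have E: "2 * pi * \<i> * bessel_J \<nu> \<nu> * ((q + 1 / q) / 2) - 2 * pi * \<i> * bessel_J (- \<nu>) \<nu> = (q - 1 / q) / 2 * (- R)"
    using tendsto_unique[OF trivial_limit_at_top_linorder D_lim] by (simp add: R_def)
  have E2: "2 * pi * \<i> * (bessel_J \<nu> \<nu> * cos (\<nu> * of_real pi) - bessel_J (- \<nu>) \<nu>) = \<i> * sin (\<nu> * of_real pi) * (- R)"
  proof -
    have "\<i> * (y / (2 * \<i>)) = y / 2" for y :: complex by simp
    then have i2: "\<i> * ((q - 1 / q) / (2 * \<i>)) = (q - 1 / q) / 2" .
    show ?thesis using E unfolding cs i2 by (simp only: right_diff_distrib mult.assoc)
  qed
  have "2 * pi * (bessel_J \<nu> \<nu> * cos (\<nu> * of_real pi) - bessel_J (- \<nu>) \<nu>) = sin (\<nu> * of_real pi) * (- R)"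
  proof -
    have "\<i> * (2 * pi * (bessel_J \<nu> \<nu> * cos (\<nu> * of_real pi) - bessel_J (- \<nu>) \<nu>)) = \<i> * (sin (\<nu> * of_real pi) * (- R))"
      using E2 by (simp only: mult_ac)
    then show ?thesis by (metis complex_i_not_zero mult_left_cancel)
  qed
  then have "(bessel_J \<nu> \<nu> * cos (\<nu> * of_real pi) - bessel_J (- \<nu>) \<nu>) / sin (\<nu> * of_real pi) = - (1 / (2 * pi)) * R"
    using \<open>sin _ \<noteq> 0\<close> by (simp add: field_simps)
  then show ?thesis using \<nu> by (simp add: bessel_Y_def R_def)
qed

section \<open>The remainder as an integral along a ray\<close>

definition root6 :: complex where "root6 = cis (pi / 3)"
definition root6' :: complex where "root6' = cis (- (pi / 3))"

lemma root6_square: "root6 ^ 2 = root6 - 1" and root6'_eq: "root6' = 1 - root6"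
  by (simp_all add: root6_def root6'_def complex_eq_iff cos_60 sin_60 power2_eq_square)

lemma root6'_square: "root6' ^ 2 = - root6"
  unfolding root6'_eq using root6_square by algebra

lemma root6_cube: "root6 ^ 3 = - 1" and root6'_cube: "root6' ^ 3 = - 1"
  using root6_square root6'_eq by algebra+

lemma root6_square_cis: "root6 ^ 2 = cis (2 * pi / 3)" and root6'_square_cis: "root6' ^ 2 = cis (- (2 * pi / 3))"
  using Complex.DeMoivre[of "pi / 3" 2] Complex.DeMoivre[of "- (pi / 3)" 2] by (simp_all add: root6_def root6'_def)

lemma root6_power_mod0: "N mod 3 = 0 \<Longrightarrow> root6 ^ (2 * N + 1) = root6 \<and> root6' ^ (2 * N + 1) = root6'"
proof -
  assume "N mod 3 = 0"
  then obtain j where j: "N = 3 * j" by auto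
  have e: "2 * N + 1 = 3 * (2 * j) + 1" by (simp add: j)
  show ?thesis unfolding e power_add power_mult root6_cube root6'_cube by simp
qed

lemma root6_power_mod2: "N mod 3 = 2 \<Longrightarrow> root6 ^ (2 * N + 1) = root6' \<and> root6' ^ (2 * N + 1) = root6"
proof -
  assume "N mod 3 = 2"
  then have "2 * N + 1 = 3 * (2 * (N div 3) + 1) + 2" by presburger
  then obtain j where j: "2 * N + 1 = 3 * (2 * j + 1) + 2" by blast
  have g: "u ^ (3 * (2 * j + 1) + 2) = (u ^ 3) ^ (2 * j + 1) * u ^ 2" for u :: complex
    by (simp only: power_add[of u "3 * (2 * j + 1)"] power_mult[of u 3])
  show ?thesis unfolding j g root6_cube root6'_cube root6_square root6'_square by (simp add: root6'_eq)
qed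

text \<open>With x = (2n+1) \<pi>/3 one has cos (3 x) = -1, so cos x is -1 or 1/2, and for both
  values 2 + 2 cos x = 4 (sin x)^2.\<close>

lemma root6_sin_square: "2 + root6 ^ (2 * n + 1) + root6' ^ (2 * n + 1) = of_real (4 * (sin ((2 * real n + 1) * pi / 3))\<^sup>2)"
proof -
  define x where "x = (2 * real n + 1) * pi / 3"
  have e: "root6 ^ (2 * n + 1) = cis x" "root6' ^ (2 * n + 1) = cis (- x)"
    unfolding root6_def root6'_def Complex.DeMoivre by (simp_all add: x_def field_simps)
  have "cos (3 * x) = - 1"
  proof -
    have "3 * x = 2 * real n * pi + pi" by (simp add: x_def field_simps)
    then show ?thesis using cos_periodic_pi[of "2 * real n * pi"] cos_2npi[of n] by (simp add: mult_ac)
  qed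
  then have "4 * cos x ^ 3 - 3 * cos x = - 1" using cos_treble_cos[of x] by simp
  then have "(cos x + 1) * (2 * cos x - 1) ^ 2 = 0" by algebra
  then have "(cos x + 1) * (2 * cos x - 1) = 0" by auto
  then have "2 + 2 * cos x = 4 * (1 - (cos x)\<^sup>2)" by algebra
  then have "2 + 2 * cos x = 4 * (sin x)\<^sup>2" by (simp only: sin_squared_eq)
  moreover have "2 + cis x + cis (- x) = of_real (2 + 2 * cos x)" by (simp add: complex_eq_iff)
  ultimately show ?thesis unfolding e x_def[symmetric] by simp
qed

text \<open>For N = 0 this combines the three rays after the two outer ones are written as r times a
  sixth root of unity. For general N it is the N-th remainder of that combination, divided by (-
  z)^N.\<close>

definition borel_kernel :: "nat \<Rightarrow> complex \<Rightarrow> complex" where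
  "borel_kernel N z = 2 * crit.St N z + root6 ^ (2 * N + 1) * crit.St N (root6 ^ 2 * z) + root6' ^ (2 * N + 1) * crit.St N (root6' ^ 2 * z)"

text \<open>The transform with kernel 1 / (1 + \<zeta>^3), since averaging 1 / (1 + \<zeta>) over
  the cube roots of unity gives that kernel.\<close>

definition cubic_mean :: "nat \<Rightarrow> complex \<Rightarrow> complex" where
  "cubic_mean m z = 1 / 3 * crit.St m z + 1 / 3 * crit.St m (root6 ^ 2 * z) + 1 / 3 * crit.St m (root6' ^ 2 * z)"

definition tri_cut :: "complex set" where
  "tri_cut = {z. z \<in> cut_plane \<and> root6 ^ 2 * z \<in> cut_plane \<and> root6' ^ 2 * z \<in> cut_plane}"

lemma borel_kernel_expand:
  assumes "z \<in> tri_cut"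
  shows "borel_kernel 0 z = (\<Sum>n<N. (- z) ^ n * of_real (crit.moment n) * of_real (4 * (sin ((2 * real n + 1) * pi / 3))\<^sup>2)) + (- z) ^ N * borel_kernel N z"
proof -
  have z: "z \<in> cut_plane" "root6 ^ 2 * z \<in> cut_plane" "root6' ^ 2 * z \<in> cut_plane" using assms by (auto simp: tri_cut_def)
  have p: "root6 * (- (root6 ^ 2 * z)) ^ n = (- z) ^ n * root6 ^ (2 * n + 1)" "root6' * (- (root6' ^ 2 * z)) ^ n = (- z) ^ n * root6' ^ (2 * n + 1)" for n
  proof -
    have "u * (- (u ^ 2 * z)) ^ n = (- z) ^ n * u ^ (2 * n + 1)" for u :: complex
    proof -
      have "- (u ^ 2 * z) = u ^ 2 * (- z)" by simp
      then show ?thesis by (simp only: power_mult_distrib power_mult[symmetric] power_add power_one_right mult_ac)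
    qed
    then show "root6 * (- (root6 ^ 2 * z)) ^ n = (- z) ^ n * root6 ^ (2 * n + 1)" "root6' * (- (root6' ^ 2 * z)) ^ n = (- z) ^ n * root6' ^ (2 * n + 1)"
      by blast+
  qed
  have s: "u * crit.St 0 y = (\<Sum>n<N. u * (- y) ^ n * of_real (crit.moment n)) + u * (- y) ^ N * crit.St N y"
    if "y \<in> cut_plane" for u y
    using crit.St_expand[OF that, of N] by (simp add: distrib_left sum_distrib_left mult.assoc)
  have "borel_kernel 0 z = (\<Sum>n<N. 2 * (- z) ^ n * of_real (crit.moment n)) + 2 * (- z) ^ N * crit.St N z
     + ((\<Sum>n<N. (- z) ^ n * root6 ^ (2 * n + 1) * of_real (crit.moment n)) + (- z) ^ N * root6 ^ (2 * N + 1) * crit.St N (root6 ^ 2 * z))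
     + ((\<Sum>n<N. (- z) ^ n * root6' ^ (2 * n + 1) * of_real (crit.moment n)) + (- z) ^ N * root6' ^ (2 * N + 1) * crit.St N (root6' ^ 2 * z))"
    using s[OF z(1), of 2] s[OF z(2), of root6, unfolded p(1)] s[OF z(3), of root6', unfolded p(2)] by (simp add: borel_kernel_def)
  also have "\<dots> = ((\<Sum>n<N. 2 * (- z) ^ n * of_real (crit.moment n)) + (\<Sum>n<N. (- z) ^ n * root6 ^ (2 * n + 1) * of_real (crit.moment n))
       + (\<Sum>n<N. (- z) ^ n * root6' ^ (2 * n + 1) * of_real (crit.moment n))) + (- z) ^ N * borel_kernel N z"
    unfolding borel_kernel_def by (simp only: distrib_left mult_ac add_ac)
  also have "(\<Sum>n<N. 2 * (- z) ^ n * of_real (crit.moment n)) + (\<Sum>n<N. (- z) ^ n * root6 ^ (2 * n + 1) * of_real (crit.moment n))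
       + (\<Sum>n<N. (- z) ^ n * root6' ^ (2 * n + 1) * of_real (crit.moment n))
     = (\<Sum>n<N. (- z) ^ n * of_real (crit.moment n) * (2 + root6 ^ (2 * n + 1) + root6' ^ (2 * n + 1)))"
    unfolding sum.distrib[symmetric] by (intro sum.cong refl) (simp only: distrib_left mult_ac)
  finally show ?thesis unfolding root6_sin_square .
qed

text \<open>In terms of kernels this is 3 (1 + \<zeta>^2) / (1 + \<zeta>^3), where \<zeta>^2 trades
  z^2 for two more powers of 1/x. Expanding every \<open>St N\<close> by two steps reduces it to
  polynomial relations of the sixth roots.\<close>

lemma borel_kernel_mod0:
  assumes z: "z \<in> tri_cut" and N: "N mod 3 = 0" shows "borel_kernel N z = 3 * cubic_mean N z + 3 * z ^ 2 * cubic_mean (N + 2) z"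
proof -
  have c: "z \<in> cut_plane" "root6 ^ 2 * z \<in> cut_plane" "root6' ^ 2 * z \<in> cut_plane" using z by (auto simp: tri_cut_def)
  define a b where "a = complex_of_real (crit.moment N)" and "b = complex_of_real (crit.moment (Suc N))"
  have s: "crit.St N y = a - y * (b - y * crit.St (N + 2) y)" if "y \<in> cut_plane" for y
    using crit.St_Suc[OF that, of N] crit.St_Suc[OF that, of "Suc N"] by (simp add: a_def b_def)
  define A B C where "A = crit.St (N + 2) z" and "B = crit.St (N + 2) (root6 ^ 2 * z)" and "C = crit.St (N + 2) (root6' ^ 2 * z)"
  have w: "root6 ^ (2 * N + 1) = root6" "root6' ^ (2 * N + 1) = root6'" using root6_power_mod0[OF N] by auto
  have "2 * (a - z * (b - z * A)) + root6 * (a - root6 ^ 2 * z * (b - root6 ^ 2 * z * B)) + root6' * (a - root6' ^ 2 * z * (b - root6' ^ 2 * z * C))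
    = (a - z * (b - z * A)) + (a - root6 ^ 2 * z * (b - root6 ^ 2 * z * B)) + (a - root6' ^ 2 * z * (b - root6' ^ 2 * z * C)) + z ^ 2 * (A + B + C)"
    using root6_square root6'_eq by algebra
  moreover have "3 * cubic_mean m z = crit.St m z + crit.St m (root6 ^ 2 * z) + crit.St m (root6' ^ 2 * z)" for m
    by (simp add: cubic_mean_def distrib_left)
  moreover have "3 * z ^ 2 * cubic_mean (N + 2) z = z ^ 2 * (3 * cubic_mean (N + 2) z)" by simp
  ultimately show ?thesis
    by (simp only: borel_kernel_def w s[OF c(1)] s[OF c(2)] s[OF c(3)] A_def B_def C_def)
qed

text \<open>Partial fractions: the three denominators multiply to 1 + \<zeta>^3.\<close>

lemma cubic_kernels:
  assumes "1 + \<zeta> ^ 3 \<noteq> 0"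
  shows "1 / 3 * (1 / (1 + \<zeta>)) + 1 / 3 * (1 / (1 + root6 ^ 2 * \<zeta>)) + 1 / 3 * (1 / (1 + root6' ^ 2 * \<zeta>)) = 1 / (1 + \<zeta> ^ 3)"
    and "2 * (1 / (1 + \<zeta>)) + root6' * (1 / (1 + root6 ^ 2 * \<zeta>)) + root6 * (1 / (1 + root6' ^ 2 * \<zeta>)) = 3 * ((1 - \<zeta>) / (1 + \<zeta> ^ 3))"
proof -
  define A B C where "A = 1 + \<zeta>" and "B = 1 + root6 ^ 2 * \<zeta>" and "C = 1 + root6' ^ 2 * \<zeta>"
  have ABC: "A * B * C = 1 + \<zeta> ^ 3" unfolding A_def B_def C_def using root6_square root6'_eq by algebra
  then have nz: "A \<noteq> 0" "B \<noteq> 0" "C \<noteq> 0" using assms by auto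
  have i: "1 / A = B * C / (A * B * C)" "1 / B = A * C / (A * B * C)" "1 / C = A * B / (A * B * C)"
    using nz by simp_all
  have p: "B * C + A * C + A * B = 3" "2 * (B * C) + root6' * (A * C) + root6 * (A * B) = 3 * (1 - \<zeta>)"
    unfolding A_def B_def C_def using root6_square root6'_eq by algebra+
  have "1 / A + 1 / B + 1 / C = (B * C + A * C + A * B) / (A * B * C)" unfolding i by (simp only: add_divide_distrib)
  then have "1 / 3 * (1 / A) + 1 / 3 * (1 / B) + 1 / 3 * (1 / C) = 1 / 3 * (3 / (1 + \<zeta> ^ 3))"
    unfolding p ABC by (simp only: distrib_left[symmetric])
  then show "1 / 3 * (1 / (1 + \<zeta>)) + 1 / 3 * (1 / (1 + root6 ^ 2 * \<zeta>)) + 1 / 3 * (1 / (1 + root6' ^ 2 * \<zeta>)) = 1 / (1 + \<zeta> ^ 3)"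
    unfolding A_def B_def C_def by simp
  have "2 * (1 / A) + root6' * (1 / B) + root6 * (1 / C) = (2 * (B * C) + root6' * (A * C) + root6 * (A * B)) / (A * B * C)"
    unfolding i by (simp only: add_divide_distrib times_divide_eq_right)
  then show "2 * (1 / (1 + \<zeta>)) + root6' * (1 / (1 + root6 ^ 2 * \<zeta>)) + root6 * (1 / (1 + root6' ^ 2 * \<zeta>)) = 3 * ((1 - \<zeta>) / (1 + \<zeta> ^ 3))"
    unfolding p ABC by (simp add: A_def B_def C_def)
qed

text \<open>The three transforms are recombined under the integral before taking absolute values, so
  the cancellation between the kernels is kept.\<close>

lemma crit_combination_bound:
  fixes c0 c1 c2 :: complex
  assumes "z0 \<in> cut_plane" "z1 \<in> cut_plane" "z2 \<in> cut_plane"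
    and B: "\<And>a. norm (c0 * (1 / (1 + z0 / of_real (crit_x a))) + c1 * (1 / (1 + z1 / of_real (crit_x a))) + c2 * (1 / (1 + z2 / of_real (crit_x a)))) \<le> B"
  shows "norm (c0 * crit.St m z0 + c1 * crit.St m z1 + c2 * crit.St m z2) \<le> B * crit.moment m"
proof -
  define k where "k z a = 1 / (1 + z / complex_of_real (crit_x a))" for z a
  have i: "integrable crit_measure (\<lambda>a. of_real (crit.wt m a) * k z a)" if "z \<in> cut_plane" for z
    unfolding k_def by (rule crit.St_integrable[OF that])
  have km: "k z \<in> borel_measurable crit_measure" for z unfolding k_def[abs_def] by measurable
  define h where "h a = c0 * k z0 a + c1 * k z1 a + c2 * k z2 a" for a
  have hm: "h \<in> borel_measurable crit_measure" unfolding h_def[abs_def]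
    by (intro borel_measurable_add borel_measurable_times borel_measurable_const km)
  have hb: "norm (h a) \<le> B" for a using B[of a] by (simp add: h_def k_def)
  have "(\<integral>a. of_real (crit.wt m a) * h a \<partial>crit_measure)
    = (\<integral>a. c0 * (of_real (crit.wt m a) * k z0 a) + c1 * (of_real (crit.wt m a) * k z1 a) + c2 * (of_real (crit.wt m a) * k z2 a) \<partial>crit_measure)"
    by (rule Bochner_Integration.integral_cong[OF refl]) (simp only: h_def distrib_left mult_ac)
  also have "\<dots> = c0 * crit.St m z0 + c1 * crit.St m z1 + c2 * crit.St m z2"
    unfolding crit.St_def k_def[symmetric]
    by (subst Bochner_Integration.integral_add, intro Bochner_Integration.integrable_add integrable_mult_right i assms,
        intro integrable_mult_right i assms, subst Bochner_Integration.integral_add, intro integrable_mult_right i assms,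
        intro integrable_mult_right i assms, simp only: integral_mult_right_zero)
  finally show ?thesis using crit.weighted_bound[OF hm hb, of m] by simp
qed

text \<open>Half the argument of u r^2 is \<alpha> shifted by 0, \<pi>/3 or - \<pi>/3. Thus A <
  \<pi>/6 keeps it below \<pi>/2 for all three rotations.\<close>

lemma tri_polar:
  assumes "\<bar>\<alpha>\<bar> \<le> A" "A < pi / 6" and u: "u = 1 \<or> u = root6 ^ 2 \<or> u = root6' ^ 2"
  obtains \<beta> where "\<And>\<rho>. u * (of_real \<rho> * cis \<alpha>) ^ 2 = of_real (\<rho> ^ 2) * cis \<beta>" "cos (pi / 3 + A) \<le> cos (\<beta> / 2)"
proof -
  have c: "cis \<alpha> ^ 2 = cis (2 * \<alpha>)" using Complex.DeMoivre[of \<alpha> 2] by simp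
  obtain \<delta> where \<delta>: "\<bar>\<delta>\<bar> \<le> pi / 3" "u = cis (2 * \<delta>)"
  proof -
    have "u = cis (2 * 0) \<or> u = cis (2 * (pi / 3)) \<or> u = cis (2 * (- (pi / 3)))"
      using u by (simp add: root6_square_cis root6'_square_cis)
    then show ?thesis using that[of 0] that[of "pi / 3"] that[of "- (pi / 3)"] by fastforce
  qed
  have "u * (of_real \<rho> * cis \<alpha>) ^ 2 = of_real (\<rho> ^ 2) * cis (2 * \<delta> + 2 * \<alpha>)" for \<rho>
    unfolding power_mult_distrib c \<delta>(2) by (simp add: cis_mult[symmetric] mult_ac)
  moreover have "cos (pi / 3 + A) \<le> cos \<bar>\<delta> + \<alpha>\<bar>"
    using assms(1,2) \<delta>(1) by (intro cos_monotone_0_pi_le) linarith+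
  then have "cos (pi / 3 + A) \<le> cos ((2 * \<delta> + 2 * \<alpha>) / 2)" by (simp add: add_divide_distrib)
  ultimately show ?thesis by (rule that)
qed

lemma cos_third_pos: "0 \<le> A \<Longrightarrow> A < pi / 6 \<Longrightarrow> 0 < cos (pi / 3 + A)"
  by (intro cos_gt_zero_pi) auto

lemma tri_cut_polar:
  assumes "\<bar>\<alpha>\<bar> < pi / 6" shows "(of_real \<rho> * cis \<alpha>) ^ 2 \<in> tri_cut"
proof -
  have "u * (of_real \<rho> * cis \<alpha>) ^ 2 \<in> cut_plane" if u: "u = 1 \<or> u = root6 ^ 2 \<or> u = root6' ^ 2" for u
  proof -
    obtain \<beta> where \<beta>: "\<And>\<rho>. u * (of_real \<rho> * cis \<alpha>) ^ 2 = of_real (\<rho> ^ 2) * cis \<beta>" "cos (pi / 3 + \<bar>\<alpha>\<bar>) \<le> cos (\<beta> / 2)"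
      by (rule tri_polar[OF order_refl assms u], rule that)
    have "cos (\<beta> / 2) > 0" using \<beta>(2) cos_third_pos[OF abs_ge_zero assms] by linarith
    then show ?thesis unfolding \<beta>(1) by (rule polar_cut_plane) simp
  qed
  from this[of 1] this[of "root6 ^ 2"] this[of "root6' ^ 2"] show ?thesis by (simp add: tri_cut_def)
qed

lemma St_polar_bound:
  assumes "\<bar>\<alpha>\<bar> \<le> A" "A < pi / 6" and u: "u = 1 \<or> u = root6 ^ 2 \<or> u = root6' ^ 2"
  shows "norm (crit.St m (u * (of_real \<rho> * cis \<alpha>) ^ 2)) \<le> 1 / cos (pi / 3 + A) * crit.moment m"
proof (rule crit.St_bound)
  fix a
  obtain \<beta> where \<beta>: "\<And>\<rho>. u * (of_real \<rho> * cis \<alpha>) ^ 2 = of_real (\<rho> ^ 2) * cis \<beta>" "cos (pi / 3 + A) \<le> cos (\<beta> / 2)"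
    by (rule tri_polar[OF assms], rule that)
  have "0 \<le> A" using assms(1) by linarith
  have e: "u * (of_real \<rho> * cis \<alpha>) ^ 2 / of_real (crit_x a) = of_real (\<rho> ^ 2 / crit_x a) * cis \<beta>" by (simp add: \<beta>(1))
  have "\<rho> ^ 2 / crit_x a \<ge> 0" using crit.X_pos[of a] by simp
  then show "norm (1 / (1 + u * (of_real \<rho> * cis \<alpha>) ^ 2 / of_real (crit_x a))) \<le> 1 / cos (pi / 3 + A)"
    unfolding e by (rule norm_inv_one_plus_cis[OF \<beta>(2) cos_third_pos[OF \<open>0 \<le> A\<close> assms(2)]])
qed

text \<open>A crude bound, uniform on a sector, that serves to rotate the ray. The sharp cosecant
  bound is applied once the final ray is fixed.\<close>

lemma cubic_mean_polar_bound:
  assumes "\<bar>\<alpha>\<bar> \<le> A" "A < pi / 6"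
  shows "norm (cubic_mean m ((of_real \<rho> * cis \<alpha>) ^ 2)) \<le> 1 / cos (pi / 3 + A) * crit.moment m"
proof -
  define z where "z = (complex_of_real \<rho> * cis \<alpha>) ^ 2"
  define b where "b = 1 / cos (pi / 3 + A) * crit.moment m"
  have "norm (crit.St m (1 * z)) \<le> b" "norm (crit.St m (root6 ^ 2 * z)) \<le> b" "norm (crit.St m (root6' ^ 2 * z)) \<le> b"
    unfolding z_def b_def by (rule St_polar_bound[OF assms], simp)+
  then have b: "norm (1 / 3 * crit.St m z) \<le> b / 3" "norm (1 / 3 * crit.St m (root6 ^ 2 * z)) \<le> b / 3" "norm (1 / 3 * crit.St m (root6' ^ 2 * z)) \<le> b / 3"
    by (simp_all add: norm_mult norm_divide)
  have "norm (cubic_mean m z) \<le> b / 3 + b / 3 + b / 3" unfolding cubic_mean_def by (intro norm_triangle_mono b)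
  then show ?thesis by (simp add: z_def b_def)
qed

text \<open>On this ray arg \<zeta> = - 2 \<psi> / 3 and arg \<zeta>^3 = - 2 \<psi>. The first bound
  is the distance from -1 to the line through \<zeta>^3; the second is
  \<open>norm_one_minus_kernel\<close>, whose condition |2 \<psi> / 3| <= \<pi>/3 is |\<psi>| <=
  \<pi>/2.\<close>

lemma ray_kernel:
  assumes \<psi>: "\<psi> \<noteq> 0" "\<bar>\<psi>\<bar> < pi / 2" and x: "x > 0" and \<zeta>: "\<zeta> = (of_real \<rho> * cis (- \<psi> / 3)) ^ 2 / of_real x"
  shows "1 + \<zeta> ^ 3 \<noteq> 0" "norm (1 / (1 + \<zeta> ^ 3)) \<le> \<bar>csc (2 * \<psi>)\<bar>" "norm ((1 - \<zeta>) / (1 + \<zeta> ^ 3)) \<le> \<bar>csc (2 * \<psi>)\<bar>"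
proof -
  define q where "q = \<rho> ^ 2 / x"
  have q: "q \<ge> 0" using x by (simp add: q_def)
  have "cis (- \<psi> / 3) ^ 2 = cis (- (2 * \<psi> / 3))" using Complex.DeMoivre[of "- \<psi> / 3" 2] by simp
  then have z: "\<zeta> = of_real q * cis (- (2 * \<psi> / 3))" unfolding \<zeta> q_def by (simp add: power_mult_distrib)
  have "cis (- (2 * \<psi> / 3)) ^ 3 = cis (- (2 * \<psi>))" using Complex.DeMoivre[of "- (2 * \<psi> / 3)" 3] by simp
  then have z3: "\<zeta> ^ 3 = of_real (q ^ 3) * cis (- (2 * \<psi>))" unfolding z by (simp add: power_mult_distrib)
  have s: "sin (2 * \<psi>) \<noteq> 0"
  proof (cases "\<psi> > 0")
    case True
    then have "sin (2 * \<psi>) > 0" using \<psi> by (intro sin_gt_zero) auto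
    then show ?thesis by simp
  next
    case False
    then have "sin (2 * (- \<psi>)) > 0" using \<psi> by (intro sin_gt_zero) auto
    then show ?thesis by simp
  qed
  have l1: "\<bar>sin (2 * \<psi>)\<bar> \<le> norm (1 + \<zeta> ^ 3)" using norm_one_plus_ge_sin[OF z3] by simp
  have l2: "norm (1 - \<zeta>) * \<bar>sin (2 * \<psi>)\<bar> \<le> norm (1 + \<zeta> ^ 3)"
    using norm_one_minus_kernel[OF q _ z] \<psi> by simp
  have p: "0 < norm (1 + \<zeta> ^ 3)" using l1 s by (meson less_le_trans zero_less_abs_iff)
  then show "1 + \<zeta> ^ 3 \<noteq> 0" by simp
  have s0: "0 < \<bar>sin (2 * \<psi>)\<bar>" using s by simp
  have cs: "\<bar>csc (2 * \<psi>)\<bar> = 1 / \<bar>sin (2 * \<psi>)\<bar>" by (simp add: csc_def)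
  show "norm (1 / (1 + \<zeta> ^ 3)) \<le> \<bar>csc (2 * \<psi>)\<bar>"
    unfolding cs norm_divide norm_one by (rule divide_left_mono[OF l1]) (use p s0 in simp_all)
  have "a / b \<le> 1 / c" if "a * c \<le> b" "0 < b" "0 < c" for a b c :: real using that by (simp add: field_simps)
  from this[OF l2 p s0] show "norm ((1 - \<zeta>) / (1 + \<zeta> ^ 3)) \<le> \<bar>csc (2 * \<psi>)\<bar>"
    unfolding cs norm_divide .
qed

lemma
  assumes \<psi>: "\<psi> \<noteq> 0" "\<bar>\<psi>\<bar> < pi / 2"
  shows cubic_mean_ray_bound: "norm (cubic_mean m ((of_real \<rho> * cis (- \<psi> / 3)) ^ 2)) \<le> \<bar>csc (2 * \<psi>)\<bar> * crit.moment m"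
    and borel_kernel_ray_bound: "N mod 3 = 2 \<Longrightarrow> norm (borel_kernel N ((of_real \<rho> * cis (- \<psi> / 3)) ^ 2)) \<le> 3 * \<bar>csc (2 * \<psi>)\<bar> * crit.moment N"
proof -
  define z where "z = (complex_of_real \<rho> * cis (- \<psi> / 3)) ^ 2"
  have "z \<in> tri_cut" unfolding z_def by (rule tri_cut_polar) (use \<psi> in simp)
  then have c: "z \<in> cut_plane" "root6 ^ 2 * z \<in> cut_plane" "root6' ^ 2 * z \<in> cut_plane" by (auto simp: tri_cut_def)
  note rk = ray_kernel[where \<rho> = \<rho> and x = "crit_x a" and \<zeta> = "z / of_real (crit_x a)" for a, OF \<psi> crit.X_pos, unfolded z_def, OF refl, folded z_def]
  have "norm (cubic_mean m z) \<le> \<bar>csc (2 * \<psi>)\<bar> * crit.moment m"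
    unfolding cubic_mean_def
  proof (rule crit_combination_bound[OF c])
    show "norm (1 / 3 * (1 / (1 + z / of_real (crit_x a))) + 1 / 3 * (1 / (1 + root6 ^ 2 * z / of_real (crit_x a))) + 1 / 3 * (1 / (1 + root6' ^ 2 * z / of_real (crit_x a)))) \<le> \<bar>csc (2 * \<psi>)\<bar>" for a
      using rk(2)[of a] unfolding times_divide_eq_right[of _ z, symmetric] cubic_kernels(1)[OF rk(1)[of a]] .
  qed
  then show "norm (cubic_mean m ((of_real \<rho> * cis (- \<psi> / 3)) ^ 2)) \<le> \<bar>csc (2 * \<psi>)\<bar> * crit.moment m" by (simp add: z_def)
  assume "N mod 3 = 2"
  then have w: "root6 ^ (2 * N + 1) = root6'" "root6' ^ (2 * N + 1) = root6" using root6_power_mod2 by auto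
  have "norm (borel_kernel N z) \<le> 3 * \<bar>csc (2 * \<psi>)\<bar> * crit.moment N"
    unfolding borel_kernel_def w
  proof (rule crit_combination_bound[OF c])
    show "norm (2 * (1 / (1 + z / of_real (crit_x a))) + root6' * (1 / (1 + root6 ^ 2 * z / of_real (crit_x a))) + root6 * (1 / (1 + root6' ^ 2 * z / of_real (crit_x a)))) \<le> 3 * \<bar>csc (2 * \<psi>)\<bar>" for a
    proof -
      have "norm (3 * y) \<le> 3 * c" if "norm y \<le> c" for y :: complex and c using that by (simp add: norm_mult)
      from this[OF rk(3)[of a]] show ?thesis
        unfolding times_divide_eq_right[of _ z, symmetric] cubic_kernels(2)[OF rk(1)[of a]] .
    qed
  qed
  then show "norm (borel_kernel N ((of_real \<rho> * cis (- \<psi> / 3)) ^ 2)) \<le> 3 * \<bar>csc (2 * \<psi>)\<bar> * crit.moment N" by (simp add: z_def)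
qed

section \<open>Weighted integrals along a single ray\<close>

definition ray_exp :: "complex \<Rightarrow> real \<Rightarrow> (complex \<Rightarrow> complex) \<Rightarrow> real \<Rightarrow> complex" where
  "ray_exp \<nu> \<psi> k \<rho> = exp (- \<nu> * (of_real \<rho> * cis (- \<psi> / 3)) ^ 3 / 6) * k (of_real \<rho> * cis (- \<psi> / 3)) * cis (- \<psi> / 3)"

lemma ray_exp_norm:
  assumes "\<nu> = of_real m * cis \<theta>"
  shows "norm (ray_exp \<nu> \<psi> k \<rho>) = exp (- (m * cos (\<theta> - \<psi>) / 6) * \<rho> ^ 3) * norm (k (of_real \<rho> * cis (- \<psi> / 3)))"
proof -
  have c3: "cis (- \<psi> / 3) ^ 3 = cis (- \<psi>)" using Complex.DeMoivre[of "- \<psi> / 3" 3] by simp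
  have "cis \<theta> * cis (- \<psi>) = cis (\<theta> - \<psi>)" by (simp add: cis_mult)
  then have "\<nu> * (of_real \<rho> * cis (- \<psi> / 3)) ^ 3 = of_real (m * \<rho> ^ 3) * cis (\<theta> - \<psi>)"
    unfolding assms power_mult_distrib c3 by (metis (no_types) mult.assoc mult.left_commute of_real_mult of_real_power)
  then have "Re (- \<nu> * (of_real \<rho> * cis (- \<psi> / 3)) ^ 3 / 6) = - (m * cos (\<theta> - \<psi>) / 6) * \<rho> ^ 3"
    by (simp del: of_real_mult of_real_power)
  then show ?thesis unfolding ray_exp_def norm_mult norm_exp_eq_Re by simp
qed

lemma ray_exp_bound:
  assumes m: "m > 0" "\<nu> = of_real m * cis \<theta>" and ang: "\<bar>\<theta> - \<psi>\<bar> < pi / 2"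
    and k: "\<And>\<rho>. \<rho> \<ge> 0 \<Longrightarrow> norm (k (of_real \<rho> * cis (- \<psi> / 3))) \<le> K * \<rho> ^ M"
    and I: "(ray_exp \<nu> \<psi> k has_integral I) {0..}"
  shows "norm I \<le> K * (Gamma ((real M + 1) / 3) / (3 * (m * cos (\<theta> - \<psi>) / 6) powr ((real M + 1) / 3)))"
proof -
  define c where "c = m * cos (\<theta> - \<psi>) / 6"
  have "cos (\<theta> - \<psi>) > 0" using ang by (intro cos_gt_zero_pi) linarith+
  then have c: "c > 0" using m by (simp add: c_def)
  note gi = has_integral_mult_right[OF cubic_exp_integral[OF c, of M], of K]
  have "norm (integral {0..} (ray_exp \<nu> \<psi> k)) \<le> integral {0..} (\<lambda>\<rho>. K * (\<rho> ^ M * exp (- c * \<rho> ^ 3)))"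
  proof (rule Henstock_Kurzweil_Integration.integral_norm_bound_integral[OF has_integral_integrable[OF I] has_integral_integrable[OF gi]])
    fix \<rho> :: real assume "\<rho> \<in> {0..}"
    then have "\<rho> \<ge> 0" by simp
    from mult_left_mono[OF k[OF this], of "exp (- c * \<rho> ^ 3)"]
    show "norm (ray_exp \<nu> \<psi> k \<rho>) \<le> K * (\<rho> ^ M * exp (- c * \<rho> ^ 3))"
      unfolding ray_exp_norm[OF m(2)] c_def[symmetric] by (simp add: mult_ac)
  qed
  then show ?thesis unfolding integral_unique[OF I] integral_unique[OF gi] by (simp add: c_def)
qed

lemma ray_exp_rotate:
  assumes S: "star_at_0 S" and k: "k holomorphic_on S"
    and sec: "\<And>\<rho> \<alpha>. \<rho> \<ge> 0 \<Longrightarrow> \<bar>\<alpha>\<bar> \<le> A \<Longrightarrow> of_real \<rho> * cis \<alpha> \<in> S"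
    and kb: "\<And>\<rho> \<alpha>. \<rho> \<ge> 0 \<Longrightarrow> \<bar>\<alpha>\<bar> \<le> A \<Longrightarrow> norm (k (of_real \<rho> * cis \<alpha>)) \<le> C * \<rho> ^ M"
    and m: "m > 0" "\<nu> = of_real m * cis \<theta>" and ang: "\<bar>\<theta> - \<psi>\<bar> < pi / 2" "\<bar>\<theta> - \<psi>'\<bar> < pi / 2"
    and A: "\<bar>- \<psi> / 3\<bar> \<le> A" "\<bar>- \<psi>' / 3\<bar> \<le> A"
  obtains I where "(ray_exp \<nu> \<psi> k has_integral I) {0..}" "(ray_exp \<nu> \<psi>' k has_integral I) {0..}"
proof -
  have seg: "\<bar>\<alpha>\<bar> \<le> A" if "\<alpha> \<in> closed_segment (- \<psi> / 3) (- \<psi>' / 3)" for \<alpha> by (rule cos_bound_between[OF that A])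
  have seg': "\<bar>\<alpha>\<bar> \<le> A" if "\<alpha> \<in> closed_segment (- \<psi>' / 3) (- \<psi> / 3)" for \<alpha> by (rule cos_bound_between[OF that A(2,1)])
  have ang': "\<bar>\<theta> + 3 * (- \<psi> / 3)\<bar> < pi / 2" "\<bar>\<theta> + 3 * (- \<psi>' / 3)\<bar> < pi / 2" using ang by simp_all
  note r1 = ray_rotation[OF S k sec[OF _ seg] kb[OF _ seg] m(1) ang', folded m(2)]
  note r2 = ray_rotation[OF S k sec[OF _ seg'] kb[OF _ seg'] m(1) ang'(2,1), folded m(2)]
  have i: "ray_exp \<nu> \<psi> k integrable_on {0..}" "ray_exp \<nu> \<psi>' k integrable_on {0..}"
    using r1(1) r2(1) unfolding ray_exp_def[abs_def] by blast+
  have "integral {0..} (ray_exp \<nu> \<psi> k) = integral {0..} (ray_exp \<nu> \<psi>' k)"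
    using r1(2) unfolding ray_exp_def[abs_def] .
  with integrable_integral[OF i(1)] integrable_integral[OF i(2)] show ?thesis by (intro that) simp_all
qed

text \<open>Rotating to \<psi> = \<theta> makes \<nu> r^3 real and leaves a Gamma integral. The
  collected phase and the modulus combine to the principal power because \<theta> = Arg
  \<nu>.\<close>

lemma ray_exp_monomial:
  assumes m: "m > 0" "\<nu> = of_real m * cis \<theta>" "\<theta> = Arg \<nu>" and ang: "\<bar>\<theta> - \<psi>\<bar> < pi / 2"
  shows "(ray_exp \<nu> \<psi> (\<lambda>r. r ^ M) has_integral
    of_real (1 / 3 * 6 powr ((real M + 1) / 3) * Gamma ((real M + 1) / 3)) / \<nu> powr of_real ((real M + 1) / 3)) {0..}"
proof -
  define p where "p = (real M + 1) / 3"
  obtain I where I: "(ray_exp \<nu> \<psi> (\<lambda>r. r ^ M) has_integral I) {0..}" "(ray_exp \<nu> \<theta> (\<lambda>r. r ^ M) has_integral I) {0..}"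
  proof (rule ray_exp_rotate[where S = UNIV and k = "\<lambda>r. r ^ M" and C = 1 and M = M and A = "max \<bar>- \<psi> / 3\<bar> \<bar>- \<theta> / 3\<bar>" and \<psi> = \<psi> and \<psi>' = \<theta>, OF _ _ _ _ m(1,2) ang])
  qed (auto simp: star_at_0_def norm_mult norm_power intro!: holomorphic_intros)
  have c: "m / 6 > 0" using m by simp
  have e: "ray_exp \<nu> \<theta> (\<lambda>r. r ^ M) \<rho> = cis (- p * \<theta>) * of_real (\<rho> ^ M * exp (- (m / 6) * \<rho> ^ 3))" for \<rho>
  proof -
    have c3: "cis (- \<theta> / 3) ^ 3 = cis (- \<theta>)" using Complex.DeMoivre[of "- \<theta> / 3" 3] by simp
    have "cis \<theta> * cis (- \<theta>) = 1" by (simp add: cis_mult)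
    then have "\<nu> * (of_real \<rho> * cis (- \<theta> / 3)) ^ 3 = of_real (m * \<rho> ^ 3)"
      unfolding m(2) power_mult_distrib c3 by (metis (no_types) mult.assoc mult.left_commute mult.right_neutral of_real_mult of_real_power)
    then have E1: "- \<nu> * (of_real \<rho> * cis (- \<theta> / 3)) ^ 3 / 6 = of_real (- (m / 6) * \<rho> ^ 3)" by simp
    have E2: "cis (- \<theta> / 3) ^ M * cis (- \<theta> / 3) = cis (- p * \<theta>)"
    proof -
      have "real M * (- (3 * t) / 3) + - (3 * t) / 3 = - ((real M + 1) / 3) * (3 * t)" for t by (simp add: algebra_simps)
      from this[of "\<theta> / 3"] have "real M * (- \<theta> / 3) + - \<theta> / 3 = - p * \<theta>" by (simp add: p_def)
      then show ?thesis unfolding Complex.DeMoivre cis_mult by (rule arg_cong)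
    qed
    show ?thesis unfolding ray_exp_def E1
      unfolding power_mult_distrib E2[symmetric] exp_of_real of_real_mult[of "\<rho> ^ M"] of_real_power by (simp only: mult_ac)
  qed
  have "((\<lambda>\<rho>. complex_of_real (\<rho> ^ M * exp (- (m / 6) * \<rho> ^ 3))) has_integral of_real (Gamma p / (3 * (m / 6) powr p))) {0..}"
    unfolding p_def by (rule has_integral_of_real[OF cubic_exp_integral[OF c]])
  then have "(ray_exp \<nu> \<theta> (\<lambda>r. r ^ M) has_integral cis (- p * \<theta>) * of_real (Gamma p / (3 * (m / 6) powr p))) {0..}"
    unfolding e[abs_def] by (rule has_integral_mult_right)
  then have "I = cis (- p * \<theta>) * of_real (Gamma p / (3 * (m / 6) powr p))" using I(2) has_integral_unique by blast
  also have "\<dots> = of_real (1 / 3 * 6 powr p * Gamma p) / \<nu> powr of_real p"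
  proof -
    have nz: "\<nu> \<noteq> 0" "norm \<nu> = m" using m(1) unfolding m(2) by (auto simp: norm_mult)
    have "\<nu> powr of_real p = exp (of_real p * (of_real (ln m) + \<i> * of_real \<theta>))"
    proof -
      have "Ln \<nu> = of_real (ln m) + \<i> * of_real \<theta>"
        by (rule complex_eqI) (use nz Arg_eq_Im_Ln[OF nz(1)] Re_Ln[OF nz(1)] m(3) in simp_all)
      then show ?thesis using nz(1) by (simp add: powr_def)
    qed
    also have "\<dots> = of_real (m powr p) * cis (p * \<theta>)"
      using m(1) by (simp add: exp_eq_polar powr_def)
    finally have v: "\<nu> powr of_real p = of_real (m powr p) * cis (p * \<theta>)" .
    have c: "cis (- p * \<theta>) = 1 / cis (p * \<theta>)" by (rule eq_divide_imp[OF cis_neq_zero]) (simp add: cis_mult)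
    have "(m / 6) powr p = m powr p / 6 powr p" using m(1) by (simp add: powr_divide)
    then have "Gamma p / (3 * (m / 6) powr p) = (1 / 3 * 6 powr p * Gamma p) / m powr p" by simp
    then have g: "complex_of_real (Gamma p / (3 * (m / 6) powr p)) = of_real (1 / 3 * 6 powr p * Gamma p) / of_real (m powr p)"
      by (simp only: of_real_divide)
    have "1 / c * (x / y) = x / (y * c)" for c x y :: complex by simp
    then show ?thesis unfolding v c g .
  qed
  finally show ?thesis using I(1) by (simp add: p_def)
qed

text \<open>Puts \<nu> in the case where \<open>bessel_Y\<close> is defined by the quotient instead
  of a limit in the order.\<close>

lemma nu_not_Ints:
  assumes "\<nu> \<noteq> 0" "Arg \<nu> \<noteq> 0" "\<bar>Arg \<nu>\<bar> < pi" shows "\<nu> \<notin> \<int>"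
proof
  assume "\<nu> \<in> \<int>"
  then have "\<nu> \<in> \<real>" by (auto elim!: Ints_cases)
  then have "Arg \<nu> = 0 \<or> Arg \<nu> = pi" using Arg_eq_0_pi by blast
  then show False using assms by auto
qed

text \<open>The outer rays are the ray of angle - \<psi>/3 times u with u^3 = -1. This sign turns
  the exponential for - \<nu> into the one for \<nu>, so all three integrals share the same
  exponential factor.\<close>

lemma bessel_Y_kernel:
  assumes m: "m > 0" "\<nu> = of_real m * cis \<theta>" and \<theta>: "\<theta> = Arg \<nu>" and \<nu>: "\<nu> \<notin> \<int>"
    and \<psi>: "\<psi> \<noteq> 0" "\<bar>\<psi>\<bar> < pi / 2" "\<bar>\<theta> - \<psi>\<bar> < pi / 2"
  shows "(ray_exp \<nu> \<psi> (\<lambda>r. borel_kernel 0 (r ^ 2)) has_integral (- 2 * of_real pi * bessel_Y \<nu> \<nu>)) {0..}"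
proof -
  have rot: "ray_fun (- \<nu>) (of_real \<rho> * cis (b / 3)) * cis (b / 3) 
      = ray_exp \<nu> \<psi> (\<lambda>r. u * crit_transform (u ^ 2 * r ^ 2)) \<rho>" if "cis (b / 3) = u * cis (- \<psi> / 3)" "u ^ 3 = - 1" for b u \<rho>
  proof -
    define r where "r = of_real \<rho> * cis (- \<psi> / 3)"
    have e1: "of_real \<rho> * cis (b / 3) = u * r" unfolding that(1) r_def by simp
    have e2: "ray_fun (- \<nu>) (u * r) = exp (- \<nu> * r ^ 3 / 6) * crit_transform (u ^ 2 * r ^ 2)"
      unfolding ray_fun_def power_mult_distrib that(2) by simp
    show ?thesis unfolding ray_exp_def r_def[symmetric] unfolding e1 unfolding e2 that(1) by (simp only: mult_ac)
  qed
  have m1: "- \<nu> = of_real m * cis (\<theta> - pi)" "- \<nu> = of_real m * cis (\<theta> + pi)"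
    by (simp_all add: m(2) complex_eq_iff cos_diff sin_diff)
  have b1: "cis ((pi - \<psi>) / 3) = root6 * cis (- \<psi> / 3)" and b2: "cis ((- pi - \<psi>) / 3) = root6' * cis (- \<psi> / 3)"
    unfolding root6_def root6'_def cis_mult by (simp_all add: diff_divide_distrib)
  have i1: "(ray_exp \<nu> \<psi> (\<lambda>r. root6 * crit_transform (root6 ^ 2 * r ^ 2)) has_integral ray_int (- \<nu>) (pi - \<psi>)) {0..}"
  proof -
    have "(\<lambda>\<rho>. ray_fun (- \<nu>) (of_real \<rho> * cis ((pi - \<psi>) / 3)) * cis ((pi - \<psi>) / 3)) integrable_on {0..}"
      by (rule phase_prim_line_limit(1)[OF _ _ m(1) m1(1)]) (use \<psi> in auto)
    from integrable_integral[OF this] show ?thesis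
      unfolding ray_int_def[symmetric] unfolding rot[OF b1 root6_cube] .
  qed
  have i2: "(ray_exp \<nu> \<psi> (\<lambda>r. root6' * crit_transform (root6' ^ 2 * r ^ 2)) has_integral ray_int (- \<nu>) (- pi - \<psi>)) {0..}"
  proof -
    have "(\<lambda>\<rho>. ray_fun (- \<nu>) (of_real \<rho> * cis ((- pi - \<psi>) / 3)) * cis ((- pi - \<psi>) / 3)) integrable_on {0..}"
      by (rule phase_prim_line_limit(1)[OF _ _ m(1) m1(2)]) (use \<psi> in auto)
    from integrable_integral[OF this] show ?thesis
      unfolding ray_int_def[symmetric] unfolding rot[OF b2 root6'_cube] .
  qed
  have i3: "(ray_exp \<nu> \<psi> (\<lambda>r. crit_transform (r ^ 2)) has_integral ray_int \<nu> (- \<psi>)) {0..}"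
  proof -
    have "(\<lambda>\<rho>. ray_fun \<nu> (of_real \<rho> * cis (- \<psi> / 3)) * cis (- \<psi> / 3)) integrable_on {0..}"
      by (rule phase_prim_line_limit(1)[OF _ _ m(1,2)]) (use \<psi> in auto)
    from integrable_integral[OF this] show ?thesis
      unfolding ray_int_def[symmetric] by (simp add: ray_fun_def ray_exp_def[abs_def])
  qed
  have "(\<lambda>\<rho>. ray_exp \<nu> \<psi> (\<lambda>r. root6 * crit_transform (root6 ^ 2 * r ^ 2)) \<rho> + ray_exp \<nu> \<psi> (\<lambda>r. root6' * crit_transform (root6' ^ 2 * r ^ 2)) \<rho>
     + 2 * ray_exp \<nu> \<psi> (\<lambda>r. crit_transform (r ^ 2)) \<rho>) = ray_exp \<nu> \<psi> (\<lambda>r. borel_kernel 0 (r ^ 2))"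
    unfolding ray_exp_def borel_kernel_def crit_transform_def by (simp add: algebra_simps)
  moreover have "ray_int (- \<nu>) (pi - \<psi>) + ray_int (- \<nu>) (- pi - \<psi>) + 2 * ray_int \<nu> (- \<psi>) = - 2 * of_real pi * bessel_Y \<nu> \<nu>"
    unfolding bessel_Y_rays[OF \<nu> m \<theta> \<psi>] by (simp add: field_simps)
  ultimately show ?thesis
    using has_integral_add[OF has_integral_add[OF i1 i2] has_integral_mult_right[OF i3, of 2]] by simp
qed

text \<open>The first N terms of the kernel integrate to Gamma values. The prefactors match as 4
  \<cdot> 1/3 = (- 2 \<pi>) \<cdot> (- 2 / (3 \<pi>)), and the sign (-1)^n of the geometric series
  is that of \<open>B0 (2 * n)\<close>.\<close>

lemma R_Y_kernel:
  assumes m: "m > 0" "\<nu> = of_real m * cis \<theta>" and \<theta>: "\<theta> = Arg \<nu>" and \<nu>: "\<nu> \<notin> \<int>"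
    and \<psi>: "\<psi> \<noteq> 0" "\<bar>\<psi>\<bar> < pi / 2" "\<bar>\<theta> - \<psi>\<bar> < pi / 2"
  shows "(ray_exp \<nu> \<psi> (\<lambda>r. (- (r ^ 2)) ^ N * borel_kernel N (r ^ 2)) has_integral (- 2 * of_real pi * R_Y N \<nu>)) {0..}"
proof -
  define s where "s n = 4 * (sin ((2 * real n + 1) * pi / 3))\<^sup>2" for n
  define p where "p n = (2 * real n + 1) / 3" for n
  define t where "t n = of_real (1 / 3 * 6 powr p n * Gamma (p n)) / \<nu> powr of_real (p n)" for n
  define k where "k n = (- 1) ^ n * complex_of_real (crit.moment n) * of_real (s n)" for n
  have mono: "(ray_exp \<nu> \<psi> (\<lambda>r. r ^ (2 * n)) has_integral t n) {0..}" for n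
    using ray_exp_monomial[OF m \<theta> \<psi>(3), of "2 * n"] by (simp add: t_def p_def)
  have "((\<lambda>\<rho>. ray_exp \<nu> \<psi> (\<lambda>r. borel_kernel 0 (r ^ 2)) \<rho> - (\<Sum>n<N. k n * ray_exp \<nu> \<psi> (\<lambda>r. r ^ (2 * n)) \<rho>))
      has_integral (- 2 * of_real pi * bessel_Y \<nu> \<nu> - (\<Sum>n<N. k n * t n))) {0..}"
    by (intro has_integral_diff has_integral_sum has_integral_mult_right mono bessel_Y_kernel[OF m \<theta> \<nu> \<psi>] finite_lessThan)
  moreover have "ray_exp \<nu> \<psi> (\<lambda>r. borel_kernel 0 (r ^ 2)) \<rho> - (\<Sum>n<N. k n * ray_exp \<nu> \<psi> (\<lambda>r. r ^ (2 * n)) \<rho>)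
      = ray_exp \<nu> \<psi> (\<lambda>r. (- (r ^ 2)) ^ N * borel_kernel N (r ^ 2)) \<rho>" for \<rho>
  proof -
    define r where "r = of_real \<rho> * cis (- \<psi> / 3)"
    have "r ^ 2 \<in> tri_cut" unfolding r_def by (rule tri_cut_polar) (use \<psi> in simp)
    note ex = borel_kernel_expand[OF this, of N]
    have "borel_kernel 0 (r ^ 2) = (\<Sum>n<N. k n * r ^ (2 * n)) + (- (r ^ 2)) ^ N * borel_kernel N (r ^ 2)"
    proof -
      have p: "(- (r ^ 2)) ^ j = (- 1) ^ j * r ^ (2 * j)" for j :: nat by (simp only: power_minus[of "r ^ 2"] power_mult)
      show ?thesis using ex by (simp only: k_def s_def p mult_ac)
    qed
    then have "borel_kernel 0 (r ^ 2) - (\<Sum>n<N. k n * r ^ (2 * n)) = (- (r ^ 2)) ^ N * borel_kernel N (r ^ 2)" by simp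
    moreover have "ray_exp \<nu> \<psi> (\<lambda>r. borel_kernel 0 (r ^ 2)) \<rho> - (\<Sum>n<N. k n * ray_exp \<nu> \<psi> (\<lambda>r. r ^ (2 * n)) \<rho>)
       = exp (- \<nu> * r ^ 3 / 6) * (borel_kernel 0 (r ^ 2) - (\<Sum>n<N. k n * r ^ (2 * n))) * cis (- \<psi> / 3)"
      unfolding ray_exp_def r_def[symmetric] by (simp add: left_diff_distrib right_diff_distrib sum_distrib_left sum_distrib_right mult_ac)
    ultimately show ?thesis unfolding ray_exp_def r_def[symmetric] by simp
  qed
  moreover have "- 2 * of_real pi * bessel_Y \<nu> \<nu> - (\<Sum>n<N. k n * t n) = - 2 * of_real pi * R_Y N \<nu>"
  proof -
    have "k n * t n = of_real (4 / 3) * (of_real (6 powr p n) * B0 (2 * n) * of_real ((sin ((2 * real n + 1) * pi / 3))\<^sup>2) * of_real (Gamma (p n)) / \<nu> powr of_real (p n))" for n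
      unfolding B0_even k_def t_def s_def by (simp add: mult_ac)
    then have "(\<Sum>n<N. k n * t n) = of_real (4 / 3) * (\<Sum>n<N. of_real (6 powr p n) * B0 (2 * n) * of_real ((sin ((2 * real n + 1) * pi / 3))\<^sup>2) * of_real (Gamma (p n)) / \<nu> powr of_real (p n))"
      by (simp only: sum_distrib_left)
    then show ?thesis unfolding R_Y_def p_def by (simp add: field_simps)
  qed
  ultimately show ?thesis by simp
qed

section \<open>The error bounds\<close>

text \<open>The 6^p in \<open>b_term\<close> comes from the division by 6 in the exponent - \<nu>
  r^3 / 6, and |B| is the moment.\<close>

lemma bound_convert:
  assumes m: "m > 0" "norm \<nu> = m" and c: "c > 0"
  shows "3 * (q * crit.moment n * (Gamma ((real (2 * n) + 1) / 3) / (3 * (m * c / 6) powr ((real (2 * n) + 1) / 3))))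
    = 2 * pi * (q / c powr ((2 * real n + 1) / 3) * (b_term n \<nu> / (2 * pi)))"
proof -
  define p where "p = (2 * real n + 1) / 3"
  have B: "norm (B0 (2 * n)) = crit.moment n"
    unfolding B0_even using crit.moment_nonneg[of n] by (simp add: norm_mult norm_power)
  have pw: "(m * c / 6) powr p = m powr p * c powr p / 6 powr p"
    using m c by (simp add: powr_divide powr_mult)
  have e: "real (2 * n) = 2 * real n" by simp
  show ?thesis unfolding b_term_def m(2) e p_def[symmetric] B pw by (simp add: mult_ac)
qed

text \<open>Precisely the conditions under which \<psi> = \<theta> - \<phi> is an allowed ray in
  \<open>R_Y_kernel\<close>; |\<phi>| < \<pi>/2 is the decay condition.\<close>

definition admissible :: "real \<Rightarrow> real \<Rightarrow> bool" where
  "admissible \<theta> \<phi> \<longleftrightarrow> \<bar>\<phi>\<bar> < pi / 2 \<and> \<theta> \<noteq> \<phi> \<and> \<bar>\<theta> - \<phi>\<bar> < pi / 2"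

lemma bound_mod2:
  assumes \<nu>: "\<nu> \<noteq> 0" and \<theta>: "\<theta> = Arg \<nu>" "\<theta> \<noteq> 0" "\<bar>\<theta>\<bar> < pi" and \<phi>: "admissible \<theta> \<phi>" and N: "N mod 3 = 2"
  shows "norm (R_Y N \<nu>) \<le> \<bar>csc (2 * (\<theta> - \<phi>))\<bar> / cos \<phi> powr ((2 * real N + 1) / 3) * (b_term N \<nu> / (2 * pi))"
proof -
  define m where "m = norm \<nu>"
  have m: "m > 0" "\<nu> = of_real m * cis \<theta>" using \<nu> by (simp_all add: m_def \<theta>(1) cis_Arg_unique rcis_cmod_Arg[unfolded rcis_def])
  define \<psi> where "\<psi> = \<theta> - \<phi>"
  have \<psi>: "\<psi> \<noteq> 0" "\<bar>\<psi>\<bar> < pi / 2" "\<bar>\<theta> - \<psi>\<bar> < pi / 2" "\<theta> - \<psi> = \<phi>" using \<phi> by (auto simp: admissible_def \<psi>_def)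
  have nI: "\<nu> \<notin> \<int>" by (rule nu_not_Ints) (use \<nu> \<theta> in auto)
  have cp: "cos \<phi> > 0" using \<phi> by (intro cos_gt_zero_pi) (auto simp: admissible_def)
  have "norm (- 2 * of_real pi * R_Y N \<nu>) \<le> 3 * \<bar>csc (2 * \<psi>)\<bar> * crit.moment N *
     (Gamma ((real (2 * N) + 1) / 3) / (3 * (m * cos (\<theta> - \<psi>) / 6) powr ((real (2 * N) + 1) / 3)))"
  proof (rule ray_exp_bound[OF m \<psi>(3) _ R_Y_kernel[OF m \<theta>(1) nI \<psi>(1-3)]])
    fix \<rho> :: real assume \<rho>: "\<rho> \<ge> 0"
    have "norm ((- ((of_real \<rho> * cis (- \<psi> / 3)) ^ 2)) ^ N) = \<rho> ^ (2 * N)"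
      using \<rho> by (simp add: norm_power norm_mult power_mult)
    then show "norm ((- ((of_real \<rho> * cis (- \<psi> / 3)) ^ 2)) ^ N * borel_kernel N ((of_real \<rho> * cis (- \<psi> / 3)) ^ 2)) \<le> 3 * \<bar>csc (2 * \<psi>)\<bar> * crit.moment N * \<rho> ^ (2 * N)"
      using mult_left_mono[OF borel_kernel_ray_bound[OF \<psi>(1,2) N, of \<rho>], of "\<rho> ^ (2 * N)"] \<rho> by (simp only: norm_mult) (simp add: mult_ac)
  qed
  also have "\<dots> = 2 * pi * (\<bar>csc (2 * \<psi>)\<bar> / cos \<phi> powr ((2 * real N + 1) / 3) * (b_term N \<nu> / (2 * pi)))"
    unfolding \<psi>(4) bound_convert[OF m(1) m_def[symmetric] cp, symmetric] by (simp only: mult.assoc)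
  finally have "2 * pi * norm (R_Y N \<nu>) \<le> 2 * pi * (\<bar>csc (2 * \<psi>)\<bar> / cos \<phi> powr ((2 * real N + 1) / 3) * (b_term N \<nu> / (2 * pi)))"
    by (simp only: norm_mult) simp
  then have "norm (R_Y N \<nu>) \<le> \<bar>csc (2 * \<psi>)\<bar> / cos \<phi> powr ((2 * real N + 1) / 3) * (b_term N \<nu> / (2 * pi))"
    by (rule mult_left_le_imp_le) simp
  then show ?thesis by (simp only: \<psi>_def)
qed

text \<open>Here 2N + 1 is a multiple of 3, so the sine in the N-th term vanishes.\<close>

lemma R_Y_mod1:
  assumes "N mod 3 = 1" shows "R_Y (N + 1) \<nu> = R_Y N \<nu>"
proof -
  obtain j where j: "N = 3 * j + 1" using assms by (metis mult_div_mod_eq)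
  have "(2 * real N + 1) * pi / 3 = real (2 * j + 1) * pi" by (simp add: j field_simps)
  then have "sin ((2 * real N + 1) * pi / 3) = 0" by (simp only: sin_npi)
  then show ?thesis by (simp add: R_Y_def)
qed

lemma tri_star: "star_at_0 {r. r ^ 2 \<in> tri_cut}"
proof -
  have eq: "{r. r ^ 2 \<in> tri_cut} = {r. 1 * r ^ 2 \<in> cut_plane} \<inter> ({r. root6 ^ 2 * r ^ 2 \<in> cut_plane} \<inter> {r. root6' ^ 2 * r ^ 2 \<in> cut_plane})"
    by (auto simp: tri_cut_def)
  have int: "star_at_0 (S \<inter> T)" if "star_at_0 S" "star_at_0 T" for S T using that by (auto simp: star_at_0_def)
  show ?thesis unfolding eq by (intro int star_scaled_square)
qed

lemma cubic_mean_holomorphic: "(\<lambda>r. cubic_mean m (r ^ 2)) holomorphic_on {r. r ^ 2 \<in> tri_cut}"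
proof -
  have "(crit.St m \<circ> (\<lambda>r. u * r ^ 2)) holomorphic_on {r. r ^ 2 \<in> tri_cut}" if "u = 1 \<or> u = root6 ^ 2 \<or> u = root6' ^ 2" for u
    by (rule holomorphic_on_compose_gen[OF _ crit.St_holomorphic]) (use that in \<open>auto simp: tri_cut_def intro!: holomorphic_intros\<close>)
  from this[of 1] this[of "root6 ^ 2"] this[of "root6' ^ 2"] show ?thesis
    unfolding cubic_mean_def[abs_def] o_def by (intro holomorphic_intros) simp_all
qed

text \<open>The integral is needed along \<psi>, where it is part of the remainder, but is estimated
  along \<psi>'. This lets the two summands for N \<equiv> 0 use different angles.\<close>

lemma cubic_mean_ray:
  assumes m: "m > 0" "\<nu> = of_real m * cis \<theta>" 
    and \<psi>: "\<psi> \<noteq> 0" "\<bar>\<psi>\<bar> < pi / 2" "\<bar>\<theta> - \<psi>\<bar> < pi / 2" and \<psi>': "\<psi>' \<noteq> 0" "\<bar>\<psi>'\<bar> < pi / 2" "\<bar>\<theta> - \<psi>'\<bar> < pi / 2"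
  obtains I where "(ray_exp \<nu> \<psi> (\<lambda>r. (- (r ^ 2)) ^ n * cubic_mean n (r ^ 2)) has_integral I) {0..}"
    "norm I \<le> \<bar>csc (2 * \<psi>')\<bar> * crit.moment n * (Gamma ((real (2 * n) + 1) / 3) / (3 * (m * cos (\<theta> - \<psi>') / 6) powr ((real (2 * n) + 1) / 3)))"
proof -
  define A where "A = max \<bar>- \<psi> / 3\<bar> \<bar>- \<psi>' / 3\<bar>"
  have A: "A < pi / 6" using \<psi> \<psi>' by (auto simp: A_def)
  have nrm: "norm ((- ((of_real \<rho> * cis \<alpha>) ^ 2)) ^ n) = \<rho> ^ (2 * n)" if "\<rho> \<ge> 0" for \<rho> \<alpha>
    using that by (simp add: norm_power norm_mult power_mult)
  obtain I where I: "(ray_exp \<nu> \<psi> (\<lambda>r. (- (r ^ 2)) ^ n * cubic_mean n (r ^ 2)) has_integral I) {0..}"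
    "(ray_exp \<nu> \<psi>' (\<lambda>r. (- (r ^ 2)) ^ n * cubic_mean n (r ^ 2)) has_integral I) {0..}"
  proof (rule ray_exp_rotate[OF tri_star, where k = "\<lambda>r. (- (r ^ 2)) ^ n * cubic_mean n (r ^ 2)" and A = A and M = "2 * n"
        and C = "1 / cos (pi / 3 + A) * crit.moment n", OF _ _ _ m \<psi>(3) \<psi>'(3)])
    show "(\<lambda>r. (- (r ^ 2)) ^ n * cubic_mean n (r ^ 2)) holomorphic_on {r. r ^ 2 \<in> tri_cut}"
      by (intro holomorphic_intros cubic_mean_holomorphic)
    fix \<rho> \<alpha> :: real assume h: "\<rho> \<ge> 0" "\<bar>\<alpha>\<bar> \<le> A"
    show "of_real \<rho> * cis \<alpha> \<in> {r. r ^ 2 \<in> tri_cut}" using tri_cut_polar[of \<alpha> \<rho>] h A by simp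
    show "norm ((- ((of_real \<rho> * cis \<alpha>) ^ 2)) ^ n * cubic_mean n ((of_real \<rho> * cis \<alpha>) ^ 2)) \<le> 1 / cos (pi / 3 + A) * crit.moment n * \<rho> ^ (2 * n)"
      using mult_left_mono[OF cubic_mean_polar_bound[OF h(2) A, of n \<rho>], of "\<rho> ^ (2 * n)"] h
      unfolding norm_mult[of "(- ((of_real \<rho> * cis \<alpha>) ^ 2)) ^ n"] nrm[OF h(1)] by (simp add: mult_ac)
  qed (auto simp: A_def)
  have "norm I \<le> \<bar>csc (2 * \<psi>')\<bar> * crit.moment n * (Gamma ((real (2 * n) + 1) / 3) / (3 * (m * cos (\<theta> - \<psi>') / 6) powr ((real (2 * n) + 1) / 3)))"
  proof (rule ray_exp_bound[OF m \<psi>'(3) _ I(2)])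
    fix \<rho> :: real assume \<rho>: "\<rho> \<ge> 0"
    show "norm ((- ((of_real \<rho> * cis (- \<psi>' / 3)) ^ 2)) ^ n * cubic_mean n ((of_real \<rho> * cis (- \<psi>' / 3)) ^ 2)) \<le> \<bar>csc (2 * \<psi>')\<bar> * crit.moment n * \<rho> ^ (2 * n)"
      using mult_left_mono[OF cubic_mean_ray_bound[OF \<psi>'(1,2), of n \<rho>], of "\<rho> ^ (2 * n)"] \<rho>
      unfolding norm_mult[of "(- ((of_real \<rho> * cis (- \<psi>' / 3)) ^ 2)) ^ n"] nrm[OF \<rho>] by (simp add: mult_ac)
  qed
  with I(1) show ?thesis by (rule that)
qed

lemma bound_mod0:
  assumes \<nu>: "\<nu> \<noteq> 0" and \<theta>: "\<theta> = Arg \<nu>" "\<theta> \<noteq> 0" "\<bar>\<theta>\<bar> < pi" and \<phi>: "admissible \<theta> \<phi>" "admissible \<theta> \<phi>'" and N: "N mod 3 = 0"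
  shows "norm (R_Y N \<nu>) \<le> \<bar>csc (2 * (\<theta> - \<phi>))\<bar> / cos \<phi> powr ((2 * real N + 1) / 3) * (b_term N \<nu> / (2 * pi))
    + \<bar>csc (2 * (\<theta> - \<phi>'))\<bar> / cos \<phi>' powr ((2 * real (N + 2) + 1) / 3) * (b_term (N + 2) \<nu> / (2 * pi))"
proof -
  define m where "m = norm \<nu>"
  have m: "m > 0" "\<nu> = of_real m * cis \<theta>" using \<nu> by (simp_all add: m_def \<theta>(1) cis_Arg_unique rcis_cmod_Arg[unfolded rcis_def])
  define \<psi> \<psi>' where "\<psi> = \<theta> - \<phi>" and "\<psi>' = \<theta> - \<phi>'"
  have \<psi>: "\<psi> \<noteq> 0" "\<bar>\<psi>\<bar> < pi / 2" "\<bar>\<theta> - \<psi>\<bar> < pi / 2" "\<theta> - \<psi> = \<phi>" using \<phi>(1) by (auto simp: admissible_def \<psi>_def)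
  have \<psi>': "\<psi>' \<noteq> 0" "\<bar>\<psi>'\<bar> < pi / 2" "\<bar>\<theta> - \<psi>'\<bar> < pi / 2" "\<theta> - \<psi>' = \<phi>'" using \<phi>(2) by (auto simp: admissible_def \<psi>'_def)
  have nI: "\<nu> \<notin> \<int>" by (rule nu_not_Ints) (use \<nu> \<theta> in auto)
  have cp: "cos \<phi> > 0" "cos \<phi>' > 0" using \<phi> by (auto simp: admissible_def intro!: cos_gt_zero_pi)
  obtain I where I: "(ray_exp \<nu> \<psi> (\<lambda>r. (- (r ^ 2)) ^ N * cubic_mean N (r ^ 2)) has_integral I) {0..}"
    "norm I \<le> \<bar>csc (2 * \<psi>)\<bar> * crit.moment N * (Gamma ((real (2 * N) + 1) / 3) / (3 * (m * cos (\<theta> - \<psi>) / 6) powr ((real (2 * N) + 1) / 3)))"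
    by (rule cubic_mean_ray[OF m \<psi>(1-3) \<psi>(1-3)], rule that)
  obtain I' where I': "(ray_exp \<nu> \<psi> (\<lambda>r. (- (r ^ 2)) ^ (N + 2) * cubic_mean (N + 2) (r ^ 2)) has_integral I') {0..}"
    "norm I' \<le> \<bar>csc (2 * \<psi>')\<bar> * crit.moment (N + 2) * (Gamma ((real (2 * (N + 2)) + 1) / 3) / (3 * (m * cos (\<theta> - \<psi>') / 6) powr ((real (2 * (N + 2)) + 1) / 3)))"
    by (rule cubic_mean_ray[OF m \<psi>(1-3) \<psi>'(1-3)], rule that)
  have "((\<lambda>\<rho>. 3 * ray_exp \<nu> \<psi> (\<lambda>r. (- (r ^ 2)) ^ N * cubic_mean N (r ^ 2)) \<rho> + 3 * ray_exp \<nu> \<psi> (\<lambda>r. (- (r ^ 2)) ^ (N + 2) * cubic_mean (N + 2) (r ^ 2)) \<rho>)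
     has_integral 3 * I + 3 * I') {0..}"
    by (intro has_integral_add has_integral_mult_right I(1) I'(1))
  moreover have "3 * ray_exp \<nu> \<psi> (\<lambda>r. (- (r ^ 2)) ^ N * cubic_mean N (r ^ 2)) \<rho> + 3 * ray_exp \<nu> \<psi> (\<lambda>r. (- (r ^ 2)) ^ (N + 2) * cubic_mean (N + 2) (r ^ 2)) \<rho>
      = ray_exp \<nu> \<psi> (\<lambda>r. (- (r ^ 2)) ^ N * borel_kernel N (r ^ 2)) \<rho>" for \<rho>
  proof -
    define r where "r = of_real \<rho> * cis (- \<psi> / 3)"
    have "r ^ 2 \<in> tri_cut" unfolding r_def by (rule tri_cut_polar) (use \<psi> in simp)
    from borel_kernel_mod0[OF this N]
    have "(- (r ^ 2)) ^ N * borel_kernel N (r ^ 2) = 3 * ((- (r ^ 2)) ^ N * cubic_mean N (r ^ 2)) + 3 * ((- (r ^ 2)) ^ (N + 2) * cubic_mean (N + 2) (r ^ 2))"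
      by (simp add: power_add algebra_simps)
    then show ?thesis unfolding ray_exp_def r_def[symmetric] by (simp add: algebra_simps)
  qed
  ultimately have "(ray_exp \<nu> \<psi> (\<lambda>r. (- (r ^ 2)) ^ N * borel_kernel N (r ^ 2)) has_integral 3 * I + 3 * I') {0..}"
    by (simp only:)
  from has_integral_unique[OF R_Y_kernel[OF m \<theta>(1) nI \<psi>(1-3)] this]
  have "- 2 * of_real pi * R_Y N \<nu> = 3 * I + 3 * I'" .
  then have "norm (- 2 * of_real pi * R_Y N \<nu>) \<le> 3 * norm I + 3 * norm I'"
    using norm_triangle_ineq[of "3 * I" "3 * I'"] by (simp add: norm_mult)
  also have "\<dots> \<le> 2 * pi * (\<bar>csc (2 * \<psi>)\<bar> / cos \<phi> powr ((2 * real N + 1) / 3) * (b_term N \<nu> / (2 * pi)))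
    + 2 * pi * (\<bar>csc (2 * \<psi>')\<bar> / cos \<phi>' powr ((2 * real (N + 2) + 1) / 3) * (b_term (N + 2) \<nu> / (2 * pi)))"
    unfolding bound_convert[OF m(1) m_def[symmetric] cp(1), symmetric] bound_convert[OF m(1) m_def[symmetric] cp(2), symmetric]
    using I(2) I'(2) unfolding \<psi>(4) \<psi>'(4) by (intro add_mono mult_left_mono) auto
  finally have "2 * pi * norm (R_Y N \<nu>) \<le> 2 * pi * (\<bar>csc (2 * \<psi>)\<bar> / cos \<phi> powr ((2 * real N + 1) / 3) * (b_term N \<nu> / (2 * pi))
    + \<bar>csc (2 * \<psi>')\<bar> / cos \<phi>' powr ((2 * real (N + 2) + 1) / 3) * (b_term (N + 2) \<nu> / (2 * pi)))"
    unfolding distrib_left[of "2 * pi"] by (simp only: norm_mult) simp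
  then have "norm (R_Y N \<nu>) \<le> \<bar>csc (2 * \<psi>)\<bar> / cos \<phi> powr ((2 * real N + 1) / 3) * (b_term N \<nu> / (2 * pi))
    + \<bar>csc (2 * \<psi>')\<bar> / cos \<phi>' powr ((2 * real (N + 2) + 1) / 3) * (b_term (N + 2) \<nu> / (2 * pi))"
    by (rule mult_left_le_imp_le) simp
  then show ?thesis by (simp only: \<psi>_def \<psi>'_def)
qed

lemma I_theta_admissible:
  assumes "pi / 4 < \<bar>\<theta>\<bar>" "\<bar>\<theta>\<bar> < pi" "\<phi> \<in> I_theta \<theta>" shows "admissible \<theta> \<phi>"
proof (cases "\<theta> > 0")
  case True
  then show ?thesis using assms I_theta_pos[of \<theta>] by (auto simp: admissible_def)
next
  case False
  then have t: "pi / 4 < - \<theta>" "- \<theta> < pi" using assms by auto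
  then have "- \<phi> \<in> I_theta (- \<theta>)" using assms(3) I_theta_minus[OF t] by auto
  then show ?thesis using t I_theta_pos[OF t] by (auto simp: admissible_def)
qed

lemma simple_bound_angle:
  assumes "pi / 4 < \<bar>\<theta>\<bar>" "\<bar>\<theta>\<bar> \<le> pi / 2" and p: "p \<ge> 3"
  obtains \<phi> where "admissible \<theta> \<phi>" "\<bar>csc (2 * (\<theta> - \<phi>))\<bar> / cos \<phi> powr p \<le> 1 / 2 * sqrt (exp 1 * (p + 3 / 2))"
proof -
  obtain \<phi> where \<phi>: "0 \<le> \<phi>" "\<phi> < pi / 2" "pi / 4 < \<bar>\<theta>\<bar> - \<phi>" "\<bar>\<theta>\<bar> - \<phi> < pi / 2"
     "\<bar>csc (2 * (\<bar>\<theta>\<bar> - \<phi>))\<bar> / cos \<phi> powr p \<le> 1 / 2 * sqrt (exp 1 * (p + 3 / 2))"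
    using csc_cos_bound[OF assms] by blast
  show ?thesis
  proof (cases "\<theta> > 0")
    case True
    show ?thesis by (rule that[of \<phi>]) (use \<phi> True in \<open>auto simp: admissible_def\<close>)
  next
    case False
    have "csc (2 * (\<theta> - - \<phi>)) = - csc (2 * (\<bar>\<theta>\<bar> - \<phi>))"
    proof -
      have e: "2 * (\<theta> - - \<phi>) = - (2 * (\<bar>\<theta>\<bar> - \<phi>))" using False by simp
      show ?thesis unfolding csc_def e sin_minus by simp
    qed
    then show ?thesis using \<phi> False by (intro that[of "- \<phi>"]) (auto simp: admissible_def)
  qed
qed

theorem mainTheorem10:
  fixes \<nu> :: complex and N :: nat and \<theta> :: real
  assumes "\<nu> \<noteq> 0" and "\<theta> = Arg \<nu>" and "\<bar>\<theta>\<bar> < pi"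
  shows
    "(pi / 4 < \<bar>\<theta>\<bar> \<longrightarrow>
       (\<exists>\<phi>1 \<phi>2 \<phi>3.
          {\<phi> \<in> I_theta \<theta>. (2 * real N + 7) * cos (3 * \<phi> - 2 * \<theta>)
                           = (2 * real N - 5) * cos (\<phi> - 2 * \<theta>)} = {\<phi>1} \<and>
          {\<phi> \<in> I_theta \<theta>. (2 * real N + 9) * cos (3 * \<phi> - 2 * \<theta>)
                           = (2 * real N - 3) * cos (\<phi> - 2 * \<theta>)} = {\<phi>2} \<and>
          {\<phi> \<in> I_theta \<theta>. (2 * real N + 11) * cos (3 * \<phi> - 2 * \<theta>)
                           = (2 * real N - 1) * cos (\<phi> - 2 * \<theta>)} = {\<phi>3} \<and>
          (N mod 3 = 0 \<longrightarrow>
             cmod (R_Y N \<nu>) \<le>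
               \<bar>csc (2 * (\<theta> - \<phi>1))\<bar> / cos \<phi>1 powr ((2 * real N + 1) / 3)
                 * (b_term N \<nu> / (2 * pi))
             + \<bar>csc (2 * (\<theta> - \<phi>3))\<bar> / cos \<phi>3 powr ((2 * real N + 5) / 3)
                 * (b_term (N + 2) \<nu> / (2 * pi))) \<and>
          (N mod 3 = 1 \<longrightarrow>
             cmod (R_Y N \<nu>) \<le>
               \<bar>csc (2 * (\<theta> - \<phi>2))\<bar> / cos \<phi>2 powr ((2 * real N + 3) / 3)
                 * (b_term (N + 1) \<nu> / (2 * pi))) \<and>
          (N mod 3 = 2 \<longrightarrow>
             cmod (R_Y N \<nu>) \<le>
               \<bar>csc (2 * (\<theta> - \<phi>1))\<bar> / cos \<phi>1 powr ((2 * real N + 1) / 3)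
                 * (b_term N \<nu> / (2 * pi)))))
     \<and>
     (pi / 4 < \<bar>\<theta>\<bar> \<and> \<bar>\<theta>\<bar> \<le> pi / 2 \<and> 4 \<le> N \<longrightarrow>
       (N mod 3 = 0 \<longrightarrow>
          cmod (R_Y N \<nu>) \<le>
            1 / 2 * sqrt (exp 1 / 3 * (2 * real N + 11 / 2)) * (b_term N \<nu> / (2 * pi))
          + 1 / 2 * sqrt (exp 1 / 3 * (2 * real N + 19 / 2)) * (b_term (N + 2) \<nu> / (2 * pi))) \<and>
       (N mod 3 = 1 \<longrightarrow>
          cmod (R_Y N \<nu>) \<le>
            1 / 2 * sqrt (exp 1 / 3 * (2 * real N + 15 / 2)) * (b_term (N + 1) \<nu> / (2 * pi))) \<and>
       (N mod 3 = 2 \<longrightarrow>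
          cmod (R_Y N \<nu>) \<le>
            1 / 2 * sqrt (exp 1 / 3 * (2 * real N + 11 / 2)) * (b_term N \<nu> / (2 * pi))))"
proof -
  have e3: "(2 * real (N + 1) + 1) / 3 = (2 * real N + 3) / 3" and e5: "(2 * real (N + 2) + 1) / 3 = (2 * real N + 5) / 3"
    by simp_all
  have M0: "cmod (R_Y N \<nu>) \<le> \<bar>csc (2 * (\<theta> - \<phi>))\<bar> / cos \<phi> powr ((2 * real N + 1) / 3) * (b_term N \<nu> / (2 * pi))
       + \<bar>csc (2 * (\<theta> - \<phi>'))\<bar> / cos \<phi>' powr ((2 * real N + 5) / 3) * (b_term (N + 2) \<nu> / (2 * pi))"
    if "N mod 3 = 0" "admissible \<theta> \<phi>" "admissible \<theta> \<phi>'" "\<theta> \<noteq> 0" for \<phi> \<phi>'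
    using bound_mod0[OF assms(1,2) that(4) assms(3) that(2,3,1)] unfolding e5 .
  have M1: "cmod (R_Y N \<nu>) \<le> \<bar>csc (2 * (\<theta> - \<phi>))\<bar> / cos \<phi> powr ((2 * real N + 3) / 3) * (b_term (N + 1) \<nu> / (2 * pi))"
    if "N mod 3 = 1" "admissible \<theta> \<phi>" "\<theta> \<noteq> 0" for \<phi>
  proof -
    have "(N + 1) mod 3 = 2" using that(1) by presburger
    from bound_mod2[OF assms(1,2) that(3) assms(3) that(2) this] show ?thesis unfolding e3 R_Y_mod1[OF that(1)] .
  qed
  have M2: "cmod (R_Y N \<nu>) \<le> \<bar>csc (2 * (\<theta> - \<phi>))\<bar> / cos \<phi> powr ((2 * real N + 1) / 3) * (b_term N \<nu> / (2 * pi))"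
    if "N mod 3 = 2" "admissible \<theta> \<phi>" "\<theta> \<noteq> 0" for \<phi>
    by (rule bound_mod2[OF assms(1,2) that(3) assms(3) that(2,1)])
  show ?thesis
  proof ((rule conjI; rule impI), goal_cases)
    case 1
    then have t0: "\<theta> \<noteq> 0" by auto
    obtain \<phi>1 where \<phi>1: "{\<phi> \<in> I_theta \<theta>. (2 * real N + 7) * cos (3 * \<phi> - 2 * \<theta>) = (2 * real N - 5) * cos (\<phi> - 2 * \<theta>)} = {\<phi>1}"
      \<comment> \<open>The numerator k of the exponent of the cosine is 2N + 1 here, then 2N + 3
        and 2N + 5, and k + 6, k - 6 are the coefficients of the equation.\<close>
      using opt_angle_exists[OF 1 assms(3), of "2 * real N + 1"] by (auto simp: algebra_simps)
    obtain \<phi>2 where \<phi>2: "{\<phi> \<in> I_theta \<theta>. (2 * real N + 9) * cos (3 * \<phi> - 2 * \<theta>) = (2 * real N - 3) * cos (\<phi> - 2 * \<theta>)} = {\<phi>2}"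
      using opt_angle_exists[OF 1 assms(3), of "2 * real N + 3"] by (auto simp: algebra_simps)
    obtain \<phi>3 where \<phi>3: "{\<phi> \<in> I_theta \<theta>. (2 * real N + 11) * cos (3 * \<phi> - 2 * \<theta>) = (2 * real N - 1) * cos (\<phi> - 2 * \<theta>)} = {\<phi>3}"
      using opt_angle_exists[OF 1 assms(3), of "2 * real N + 5"] by (auto simp: algebra_simps)
    have "\<phi>1 \<in> I_theta \<theta>" "\<phi>2 \<in> I_theta \<theta>" "\<phi>3 \<in> I_theta \<theta>" using \<phi>1 \<phi>2 \<phi>3 by blast+
    then have ad: "admissible \<theta> \<phi>1" "admissible \<theta> \<phi>2" "admissible \<theta> \<phi>3"
      using I_theta_admissible[OF 1 assms(3)] by blast+
    show ?case
      by (intro exI[of _ \<phi>1] exI[of _ \<phi>2] exI[of _ \<phi>3] conjI impI \<phi>1 \<phi>2 \<phi>3 M0 M1 M2 ad t0)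
  next
    case 2
    then have t: "pi / 4 < \<bar>\<theta>\<bar>" "\<bar>\<theta>\<bar> \<le> pi / 2" "4 \<le> N" and t0: "\<theta> \<noteq> 0" by auto
    have bp: "0 \<le> b_term n \<nu> / (2 * pi)" for n
      unfolding b_term_def by (intro divide_nonneg_nonneg mult_nonneg_nonneg Gamma_real_nonneg) auto
    \<comment> \<open>For k = 1, 3, 5 the shift k + 9/2 is 11/2, 15/2 and 19/2.\<close>
    have s: "exp 1 * ((2 * real N + k) / 3 + 3 / 2) = exp 1 / 3 * (2 * real N + (k + 9 / 2))" for k :: real
    proof -
      have "(2 * real N + k) / 3 + 3 / 2 = (2 * real N + (k + 9 / 2)) / 3" by (simp add: field_simps)
      then show ?thesis by (simp only: times_divide_eq_right times_divide_eq_left)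
    qed
    show ?case
    proof (intro conjI impI)
      assume N: "N mod 3 = 0"
      \<comment> \<open>The angle estimate asks for exponents >= 3. With N >= 4 this holds for N
        \<equiv> 1 directly, while the residues 0 and 2 first raise N to at least 6 and 5.\<close>
      then have "6 \<le> N" using t(3) by presburger
      then have p: "(2 * real N + 1) / 3 \<ge> 3" "(2 * real N + 5) / 3 \<ge> 3" by simp_all
      obtain \<phi> where \<phi>: "admissible \<theta> \<phi>" "\<bar>csc (2 * (\<theta> - \<phi>))\<bar> / cos \<phi> powr ((2 * real N + 1) / 3) \<le> 1 / 2 * sqrt (exp 1 * ((2 * real N + 1) / 3 + 3 / 2))"
        by (rule simple_bound_angle[OF t(1,2) p(1)], rule that)
      obtain \<phi>' where \<phi>': "admissible \<theta> \<phi>'" "\<bar>csc (2 * (\<theta> - \<phi>'))\<bar> / cos \<phi>' powr ((2 * real N + 5) / 3) \<le> 1 / 2 * sqrt (exp 1 * ((2 * real N + 5) / 3 + 3 / 2))"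
        by (rule simple_bound_angle[OF t(1,2) p(2)], rule that)
      have "cmod (R_Y N \<nu>) \<le> 1 / 2 * sqrt (exp 1 * ((2 * real N + 1) / 3 + 3 / 2)) * (b_term N \<nu> / (2 * pi))
          + 1 / 2 * sqrt (exp 1 * ((2 * real N + 5) / 3 + 3 / 2)) * (b_term (N + 2) \<nu> / (2 * pi))"
        by (rule order_trans[OF M0[OF N \<phi>(1) \<phi>'(1) t0] add_mono[OF mult_right_mono[OF \<phi>(2) bp] mult_right_mono[OF \<phi>'(2) bp]]])
      then show "cmod (R_Y N \<nu>) \<le> 1 / 2 * sqrt (exp 1 / 3 * (2 * real N + 11 / 2)) * (b_term N \<nu> / (2 * pi))
          + 1 / 2 * sqrt (exp 1 / 3 * (2 * real N + 19 / 2)) * (b_term (N + 2) \<nu> / (2 * pi))"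
        unfolding s by simp
    next
      assume N: "N mod 3 = 1"
      have p: "(2 * real N + 3) / 3 \<ge> 3" using t(3) by simp
      obtain \<phi> where \<phi>: "admissible \<theta> \<phi>" "\<bar>csc (2 * (\<theta> - \<phi>))\<bar> / cos \<phi> powr ((2 * real N + 3) / 3) \<le> 1 / 2 * sqrt (exp 1 * ((2 * real N + 3) / 3 + 3 / 2))"
        by (rule simple_bound_angle[OF t(1,2) p], rule that)
      have "cmod (R_Y N \<nu>) \<le> 1 / 2 * sqrt (exp 1 * ((2 * real N + 3) / 3 + 3 / 2)) * (b_term (N + 1) \<nu> / (2 * pi))"
        by (rule order_trans[OF M1[OF N \<phi>(1) t0] mult_right_mono[OF \<phi>(2) bp]])
      then show "cmod (R_Y N \<nu>) \<le> 1 / 2 * sqrt (exp 1 / 3 * (2 * real N + 15 / 2)) * (b_term (N + 1) \<nu> / (2 * pi))"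
        unfolding s by simp
    next
      assume N: "N mod 3 = 2"
      then have "5 \<le> N" using t(3) by presburger
      then have p: "(2 * real N + 1) / 3 \<ge> 3" by simp
      obtain \<phi> where \<phi>: "admissible \<theta> \<phi>" "\<bar>csc (2 * (\<theta> - \<phi>))\<bar> / cos \<phi> powr ((2 * real N + 1) / 3) \<le> 1 / 2 * sqrt (exp 1 * ((2 * real N + 1) / 3 + 3 / 2))"
        by (rule simple_bound_angle[OF t(1,2) p], rule that)
      have "cmod (R_Y N \<nu>) \<le> 1 / 2 * sqrt (exp 1 * ((2 * real N + 1) / 3 + 3 / 2)) * (b_term N \<nu> / (2 * pi))"
        by (rule order_trans[OF M2[OF N \<phi>(1) t0] mult_right_mono[OF \<phi>(2) bp]])
      then show "cmod (R_Y N \<nu>) \<le> 1 / 2 * sqrt (exp 1 / 3 * (2 * real N + 11 / 2)) * (b_term N \<nu> / (2 * pi))"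
        unfolding s by simp
    qed
  qed
qed

end
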